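(* Let $\Omega\subset\mathbb{R}^2$ be a polygonal domain, let $\gamma_1,\dots,\gamma_N$ be (disjoint or intersecting) straight line segments strictly contained in $\Omega$, let $g_l\in H^{\beta_l}(\gamma_l)$ with $\beta_l\ge0$, and let $u\in H^1_0(\Omega)$ be the weak solution of $-\Delta u=\sum_{l=1}^N g_l\delta_{\gamma_l}$ in $\Omega$, $u=0$ on $\partial\Omega$. Let $\mathcal T$ be a shape-regular triangulation of $\Omega$ conforming to the segments (each $\gamma_l$ is a union of interior edges of $\mathcal T$), $k\ge1$, $S(\mathcal T)=\{v\in\mathcal C^0(\Omega)\cap H^1_0(\Omega):v|_T\in P_k(T)\ \forall T\in\mathcal T\}$, and let $u_h\in S(\mathcal T)$ satisfy $\int_\Omega\nabla u_h\cdot\nabla v_h\,dx=\sum_l\int_{\gamma_l}g_lv_h\,ds$ for all $v_h\in S(\mathcal T)$. Then $$\|\nabla(u-u_h)\|_{L^2(\Omega)}\le C\,\eta(u_h),\qquad \eta(u_h)=\Big(\sum_{T\in\mathcal T}\eta_T(u_h)^2\Big)^{1/2},$$ where $$\eta_T(u_h)^2=h_T^2\|\Delta u_h\|_{L^2(T)}^2+\frac12\sum_{e\subset\partial T,\ e\in\mathcal E_I}h_T\|f-[\partial_{\mathbf n}u_h]\|_{L^2(e)}^2,$$ and $C$ is independent of the mesh size.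
   Context: $\mathcal E_I$ is the set of interior edges of $\mathcal T$, $h_T$ the diameter of $T$, $P_k(T)$ the polynomials of degree $\le k$ on $T$. The function $f$ on interior edges is defined by $f=g_l$ on edges $e\subset\gamma_l$ and $f=0$ on edges $e\in\mathcal E_I$ not contained in $\cup_l\gamma_l$. For an interior edge $e=\partial T_+\cap\partial T_-$, with $\mathbf n^\pm$ the outward unit normals of $T_\pm$, $[\partial_{\mathbf n}v]=\mathbf n^+\cdot\nabla v^++\mathbf n^-\cdot\nabla v^-$ where $v^\pm=v|_{T_\pm}$. *)

theory Defs
  imports "HOL-Analysis.Analysis"
begin

text \<open>Points of the plane are of type real^2. All functions are total on the plane;
  only their values on the relevant sets matter.\<close>

definition polyk :: "nat \<Rightarrow> (real^2 \<Rightarrow> real) \<Rightarrow> bool" where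
  "polyk k p \<longleftrightarrow> (\<exists>c :: nat \<Rightarrow> nat \<Rightarrow> real.
      \<forall>x. p x = (\<Sum>i\<le>k. \<Sum>j\<le>k - i. c i j * (x$1)^i * (x$2)^j))"

definition tri :: "(real^2) set \<Rightarrow> bool" where
  "tri T \<longleftrightarrow> (\<exists>a b c. \<not> collinear {a, b, c} \<and> T = convex hull {a, b, c})"

definition verts :: "(real^2) set \<Rightarrow> (real^2) set" where
  "verts T = {x. x extreme_point_of T}"

definition edges :: "(real^2) set \<Rightarrow> (real^2) set set" where
  "edges T = {closed_segment v w | v w. v \<in> verts T \<and> w \<in> verts T \<and> v \<noteq> w}"

definition polygonal_domain :: "(real^2) set \<Rightarrow> bool" where
  "polygonal_domain \<Omega> \<longleftrightarrow> open \<Omega> \<and> bounded \<Omega> \<and> connected \<Omega> \<and> \<Omega> \<noteq> {} \<and>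
     (\<exists>P. finite P \<and> (\<forall>T\<in>P. tri T) \<and> \<Omega> = interior (\<Union>P))"

definition triangulation :: "(real^2) set \<Rightarrow> (real^2) set set \<Rightarrow> bool" where
  "triangulation \<Omega> Th \<longleftrightarrow> finite Th \<and> Th \<noteq> {} \<and> (\<forall>T\<in>Th. tri T) \<and>
     \<Union>Th = closure \<Omega> \<and> \<Omega> = interior (\<Union>Th) \<and>
     (\<forall>T1\<in>Th. \<forall>T2\<in>Th. T1 \<noteq> T2 \<longrightarrow>
        T1 \<inter> T2 = {} \<or>
        (\<exists>v. v \<in> verts T1 \<and> v \<in> verts T2 \<and> T1 \<inter> T2 = {v}) \<or>
        (T1 \<inter> T2 \<in> edges T1 \<and> T1 \<inter> T2 \<in> edges T2))"

definition interior_edges :: "(real^2) set set \<Rightarrow> (real^2) set set" where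
  "interior_edges Th = {e. \<exists>T1\<in>Th. \<exists>T2\<in>Th. T1 \<noteq> T2 \<and> e \<in> edges T1 \<and> e = T1 \<inter> T2}"

definition inradius :: "(real^2) set \<Rightarrow> real" where
  "inradius T = Sup {r. \<exists>c. cball c r \<subseteq> T}"

definition shape_regular :: "real \<Rightarrow> (real^2) set set \<Rightarrow> bool" where
  "shape_regular \<sigma> Th \<longleftrightarrow> (\<forall>T\<in>Th. diameter T \<le> \<sigma> * inradius T)"

definition line_int :: "real^2 \<Rightarrow> real^2 \<Rightarrow> (real^2 \<Rightarrow> real) \<Rightarrow> real" where
  "line_int v w f = dist v w * integral\<^sup>L (lebesgue_on {0..1}) (\<lambda>t. f (v + t *\<^sub>R (w - v)))"

definition edge_int :: "(real^2) set \<Rightarrow> (real^2 \<Rightarrow> real) \<Rightarrow> real" where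
  "edge_int e f = (SOME I. \<exists>v w. v \<noteq> w \<and> e = closed_segment v w \<and> I = line_int v w f)"

definition L2_seg :: "real^2 \<Rightarrow> real^2 \<Rightarrow> (real^2 \<Rightarrow> real) \<Rightarrow> bool" where
  "L2_seg a b g \<longleftrightarrow> (\<lambda>t. g (a + t *\<^sub>R (b - a))) \<in> borel_measurable (lebesgue_on {0..1}) \<and>
     integrable (lebesgue_on {0..1}) (\<lambda>t. (g (a + t *\<^sub>R (b - a)))^2)"

definition Cc1 :: "(real^2) set \<Rightarrow> (real^2 \<Rightarrow> real) \<Rightarrow> (real^2 \<Rightarrow> real^2) \<Rightarrow> bool" where
  "Cc1 \<Omega> \<phi> d\<phi> \<longleftrightarrow> continuous_on UNIV d\<phi> \<and>
     (\<forall>x. (\<phi> has_derivative (\<lambda>h. d\<phi> x \<bullet> h)) (at x)) \<and>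
     compact (closure {x. \<phi> x \<noteq> 0}) \<and> closure {x. \<phi> x \<noteq> 0} \<subseteq> \<Omega>"

definition H10 :: "(real^2) set \<Rightarrow> (real^2 \<Rightarrow> real) \<Rightarrow> (real^2 \<Rightarrow> real^2) \<Rightarrow> bool" where
  "H10 \<Omega> u G \<longleftrightarrow>
     u \<in> borel_measurable (lebesgue_on \<Omega>) \<and> G \<in> borel_measurable (lebesgue_on \<Omega>) \<and>
     integrable (lebesgue_on \<Omega>) (\<lambda>x. (u x)^2) \<and>
     integrable (lebesgue_on \<Omega>) (\<lambda>x. (norm (G x))^2) \<and>
     (\<exists>\<phi> d\<phi>. (\<forall>n. Cc1 \<Omega> (\<phi> n) (d\<phi> n)) \<and>
        (\<lambda>n. integral\<^sup>L (lebesgue_on \<Omega>) (\<lambda>x. (\<phi> n x - u x)^2)) \<longlonglongrightarrow> 0 \<and>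
        (\<lambda>n. integral\<^sup>L (lebesgue_on \<Omega>) (\<lambda>x. (norm (d\<phi> n x - G x))^2)) \<longlonglongrightarrow> 0)"

definition weak_solution ::
  "(real^2) set \<Rightarrow> nat \<Rightarrow> (nat \<Rightarrow> real^2) \<Rightarrow> (nat \<Rightarrow> real^2) \<Rightarrow> (nat \<Rightarrow> real^2 \<Rightarrow> real)
   \<Rightarrow> (real^2 \<Rightarrow> real) \<Rightarrow> (real^2 \<Rightarrow> real^2) \<Rightarrow> bool" where
  "weak_solution \<Omega> N a b g u G \<longleftrightarrow> H10 \<Omega> u G \<and>
     (\<forall>\<phi> d\<phi>. Cc1 \<Omega> \<phi> d\<phi> \<longrightarrow>
        integral\<^sup>L (lebesgue_on \<Omega>) (\<lambda>x. G x \<bullet> d\<phi> x) =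
        (\<Sum>l<N. line_int (a l) (b l) (\<lambda>x. g l x * \<phi> x)))"

definition fe_space :: "(real^2) set \<Rightarrow> (real^2) set set \<Rightarrow> nat \<Rightarrow> (real^2 \<Rightarrow> real) set" where
  "fe_space \<Omega> Th k = {v. continuous_on \<Omega> v \<and> (\<exists>G. H10 \<Omega> v G) \<and>
      (\<forall>T\<in>Th. \<exists>p. polyk k p \<and> (\<forall>x\<in>T. v x = p x))}"

text \<open>Pointwise (classical) gradient; for piecewise polynomials it exists off the mesh skeleton.\<close>
definition grad :: "(real^2 \<Rightarrow> real) \<Rightarrow> real^2 \<Rightarrow> real^2" where
  "grad v x = (SOME d. (v has_derivative (\<lambda>h. d \<bullet> h)) (at x))"

definition grad_within :: "(real^2 \<Rightarrow> real) \<Rightarrow> (real^2) set \<Rightarrow> real^2 \<Rightarrow> real^2" where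
  "grad_within v T x = (SOME d. (v has_derivative (\<lambda>h. d \<bullet> h)) (at x within T))"

definition pdiff :: "2 \<Rightarrow> (real^2 \<Rightarrow> real) \<Rightarrow> real^2 \<Rightarrow> real" where
  "pdiff i f x = deriv (\<lambda>t. f (x + t *\<^sub>R axis i 1)) 0"

definition lap :: "(real^2 \<Rightarrow> real) \<Rightarrow> real^2 \<Rightarrow> real" where
  "lap f x = (\<Sum>i\<in>UNIV. deriv (\<lambda>t. pdiff i f (x + t *\<^sub>R axis i 1)) 0)"

definition outward_normal :: "(real^2) set \<Rightarrow> (real^2) set \<Rightarrow> real^2" where
  "outward_normal T e = (SOME n. norm n = 1 \<and> (\<forall>x\<in>e. \<forall>p\<in>T. n \<bullet> (p - x) \<le> 0))"

definition neighbor :: "(real^2) set set \<Rightarrow> (real^2) set \<Rightarrow> (real^2) set \<Rightarrow> (real^2) set" where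
  "neighbor Th T e = (THE T'. T' \<in> Th \<and> T' \<noteq> T \<and> e \<subseteq> T')"

definition jump :: "(real^2 \<Rightarrow> real) \<Rightarrow> (real^2) set \<Rightarrow> (real^2) set \<Rightarrow> (real^2) set \<Rightarrow> real^2 \<Rightarrow> real" where
  "jump v Tp Tm e x = outward_normal Tp e \<bullet> grad_within v Tp x + outward_normal Tm e \<bullet> grad_within v Tm x"

definition src_f :: "nat \<Rightarrow> (nat \<Rightarrow> real^2) \<Rightarrow> (nat \<Rightarrow> real^2) \<Rightarrow> (nat \<Rightarrow> real^2 \<Rightarrow> real)
   \<Rightarrow> (real^2) set \<Rightarrow> real^2 \<Rightarrow> real" where
  "src_f N a b g e x = (\<Sum>l | l < N \<and> e \<subseteq> closed_segment (a l) (b l). g l x)"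

definition eta_T_sq :: "(real^2) set set \<Rightarrow> nat \<Rightarrow> (nat \<Rightarrow> real^2) \<Rightarrow> (nat \<Rightarrow> real^2)
   \<Rightarrow> (nat \<Rightarrow> real^2 \<Rightarrow> real) \<Rightarrow> (real^2 \<Rightarrow> real) \<Rightarrow> (real^2) set \<Rightarrow> real" where
  "eta_T_sq Th N a b g uh T =
     (diameter T)^2 * integral\<^sup>L (lebesgue_on T) (\<lambda>x. (lap uh x)^2) +
     1/2 * (\<Sum>e\<in>edges T \<inter> interior_edges Th.
        diameter T * edge_int e (\<lambda>x. (src_f N a b g e x - jump uh T (neighbor Th T e) e x)^2))"

definition eta :: "(real^2) set set \<Rightarrow> nat \<Rightarrow> (nat \<Rightarrow> real^2) \<Rightarrow> (nat \<Rightarrow> real^2)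
   \<Rightarrow> (nat \<Rightarrow> real^2 \<Rightarrow> real) \<Rightarrow> (real^2 \<Rightarrow> real) \<Rightarrow> real" where
  "eta Th N a b g uh = sqrt (\<Sum>T\<in>Th. eta_T_sq Th N a b g uh T)"

end

theory Submission
  imports Defs
begin

text \<open>
  The error \<open>W = \<nabla>u - \<nabla>u\<^sub>h\<close> is an \<open>L\<^sup>2\<close>-limit of gradients of test functions \<open>\<theta>\<close>, because
  \<open>u\<^sub>h\<close> vanishes on the boundary (trace inequality) and can therefore itself be approximated.
  For a test function \<open>\<phi>\<close> subtract a piecewise affine interpolant \<open>v\<^sub>h\<close>, use Galerkin
  orthogonality and integrate by parts on each triangle: the residual becomes
  \<open>\<Sum>\<^sub>T \<integral>\<^sub>T \<Delta>u\<^sub>h (\<phi> - v\<^sub>h) + \<Sum>\<^sub>e \<integral>\<^sub>e (f - [\<partial>\<^sub>n u\<^sub>h]) (\<phi> - v\<^sub>h)\<close>.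
  Young's inequality with a weight equal to the interpolation constant \<open>C\<close> gives
  \<open>2 \<integral> W \<bullet> \<nabla>\<theta> - \<parallel>\<nabla>\<theta>\<parallel>\<^sup>2 \<le> C \<eta>\<^sup>2\<close>, and \<open>\<nabla>\<theta> \<rightarrow> W\<close> yields \<open>\<parallel>W\<parallel>\<^sup>2 \<le> C \<eta>\<^sup>2\<close>.

  The value of \<open>v\<^sub>h\<close> at an interior vertex is the mean of \<open>\<phi>\<close> over one adjacent edge, and \<open>0\<close> at
  boundary vertices. In two dimensions the means over two edges of a triangle \<open>T\<close> differ by at most
  a shape-dependent multiple of \<open>\<parallel>\<nabla>\<phi>\<parallel>\<close> on \<open>T\<close>, with no power of the diameter. Walking around the
  vertex from triangle to triangle hence compares any two edge means there, and on a boundary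
  vertex the walk reaches a boundary edge, where \<open>\<phi> = 0\<close>. No comparison of the sizes of
  neighbouring triangles is needed; shape regularity only bounds the number of triangles at a vertex.
\<close>

section \<open>Lebesgue measure in the plane\<close>

text \<open>All estimates are proved for C1 functions; Sobolev functions enter only as limits. This
  shapes two steps. The weak equation cannot be tested with the error itself, whence \<theta>, the
  difference of an approximant of \<open>u\<close> and one of \<open>uh\<close>. And membership in
  the finite element space supplies some L2 gradient of \<open>uh\<close>, a priori unrelated to the
  pointwise \<open>grad uh\<close>; only after the boundary values are known to vanish does the
  Lipschitz zero extension show that \<open>grad uh\<close> itself is a limit of gradients of test
  functions.

  Edge means replace point values because in the plane the gradient energy does not control point
  values. A mean over an edge is controlled, and since it is 0 on boundary edges, the value 0 at a
  boundary vertex is just another edge mean.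

  Geometry is reduced to determinants: one affine substitution gives the divergence theorem on a
  triangle, and from it follow the area, the trace identity and the edge estimates. All constants
  come from \<open>K\<close>, twice the shape parameter: at most \<open>K\<^sup>2\<close> triangles
  meet at a vertex, so a walk around it needs at most \<open>K^4\<close> steps.\<close>

text \<open>The determinant with columns \<open>u\<close> and \<open>v\<close>. For a triangle,
  \<open>cr (q - p) (r - p)\<close> is twice the signed area, and its being nonzero is the
  nondegeneracy test throughout.\<close>

definition cr :: "real^2 \<Rightarrow> real^2 \<Rightarrow> real" where
  "cr u v = u$1 * v$2 - u$2 * v$1"

abbreviation sint :: "(real^2) set \<Rightarrow> (real^2 \<Rightarrow> real) \<Rightarrow> real" where
  "sint S f \<equiv> integral\<^sup>L (lebesgue_on S) f"

lemma norm_real2: "norm (x::real^2) = sqrt ((x$1)\<^sup>2 + (x$2)\<^sup>2)"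
  by (simp add: norm_vec_def L2_set_def UNIV_2)

lemma inner_real2: "(x::real^2) \<bullet> y = x$1*y$1 + x$2*y$2"
  by (simp add: inner_vec_def UNIV_2)

lemma borel_measurable_vector2: "(\<lambda>(s,t). vector [s,t] :: real^2) \<in> borel \<rightarrow>\<^sub>M borel"
proof (rule borel_measurable_continuous_onI)
  have eq: "(\<lambda>(s::real,t::real). vector [s,t] :: real^2) = (\<lambda>x. \<chi> i. if i = 1 then fst x else snd x)"
    by (auto simp: fun_eq_iff vec_eq_iff forall_2)
  have "continuous_on UNIV (\<lambda>x::real \<times> real. if i = 1 then fst x else snd x)" for i :: 2
    by (cases "i = 1") (simp_all add: continuous_on_fst continuous_on_snd continuous_on_id)
  then show "continuous_on UNIV (\<lambda>(s::real,t::real). vector [s,t] :: real^2)"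
    unfolding eq by (rule continuous_on_vec_lambda)
qed

text \<open>Fubini is available on \<open>real \<times> real\<close>, while the statement lives on
  \<open>real^2\<close>. Agreement on boxes identifies the two Lebesgue measures.\<close>

lemma lborel_real2_eq_distr:
  "lborel = distr (lborel :: (real \<times> real) measure) borel (\<lambda>(s,t). vector [s,t] :: real^2)"
proof (rule lborel_eqI)
  note [measurable] = borel_measurable_vector2
  fix l u :: "real^2" assume le: "\<And>b. b \<in> Basis \<Longrightarrow> l \<bullet> b \<le> u \<bullet> b"
  have le12: "l$1 \<le> u$1" "l$2 \<le> u$2"
    using le[of "axis 1 1"] le[of "axis 2 1"] by (auto simp: inner_axis axis_in_Basis_iff)
  have pre: "(\<lambda>(s,t). vector [s,t] :: real^2) -` box l u = box (l$1, l$2) (u$1, u$2)"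
    by (auto simp: mem_box Basis_vec_def UNIV_2 inner_axis Basis_prod_def)
  have "emeasure (distr (lborel :: (real \<times> real) measure) borel (\<lambda>(s,t). vector [s,t] :: real^2)) (box l u)
     = emeasure lborel (box (l$1, l$2) (u$1, u$2))"
    by (subst emeasure_distr) (auto simp: pre)
  also have "\<dots> = ennreal ((u$1 - l$1) * (u$2 - l$2))"
    using le12 by (subst emeasure_lborel_box)
      (auto simp: Basis_prod_def)
  also have "(u$1 - l$1) * (u$2 - l$2) = (\<Prod>b\<in>Basis. (u - l) \<bullet> b)"
    by (simp add: Basis_vec_def UNIV_2 inner_axis axis_eq_axis)
  finally show "emeasure (distr (lborel :: (real \<times> real) measure) borel (\<lambda>(s,t). vector [s,t] :: real^2)) (box l u)
     = (\<Prod>b\<in>Basis. (u - l) \<bullet> b)" .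
qed simp

text \<open>Change of variables to coordinates along two sides of a triangle, as an identity of
  measures: it is checked on boxes, where the Jacobian comes from the behaviour of Lebesgue measure
  under linear maps, and then serves every Borel integrand.\<close>

lemma lborel_real2_affine:
  fixes p E1 E2 :: "real^2"
  assumes "cr E1 E2 \<noteq> 0"
  shows "lborel = density (distr (lborel :: (real \<times> real) measure) borel
            (\<lambda>(s,t). p + s *\<^sub>R E1 + t *\<^sub>R E2)) (\<lambda>_. ennreal \<bar>cr E1 E2\<bar>)"
    (is "_ = density (distr lborel borel ?\<Phi>) _")
proof (rule lborel_eqI)
  let ?V = "(\<lambda>(s,t). vector [s,t] :: real^2)"
  let ?L = "\<lambda>x::real^2. x$1 *\<^sub>R E1 + x$2 *\<^sub>R E2"
  have \<Phi>_meas [measurable]: "?\<Phi> \<in> borel \<rightarrow>\<^sub>M borel"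
    unfolding case_prod_beta by (intro borel_measurable_continuous_onI continuous_intros)
  note [measurable] = borel_measurable_vector2
  have lin: "linear ?L"
    by (auto intro!: linearI simp: algebra_simps)
  have det: "det (matrix ?L) = cr E1 E2"
    by (simp add: det_2 matrix_def cr_def axis_def)
  fix l u :: "real^2" assume le: "\<And>b. b \<in> Basis \<Longrightarrow> l \<bullet> b \<le> u \<bullet> b"
  define S where "S = {x. p + ?L x \<in> box l u}"
  have inj: "inj ?L"
    using det_nz_iff_inj[OF lin] det assms by simp
  have surj: "surj ?L"
    using lin inj linear_injective_imp_surjective by blast
  obtain h where h: "linear h" "\<And>x. h (?L x) = x"
    using linear_injective_left_inverse[OF lin inj] by (auto simp: fun_eq_iff)
  have h': "?L (h y) = y" for y
  proof -
    obtain x where "y = ?L x" using surj by (rule surjE)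
    then show ?thesis using h(2) by simp
  qed
  have img: "?L ` S = (\<lambda>x. x - p) ` box l u"
  proof (intro equalityI subsetI)
    fix y assume "y \<in> ?L ` S"
    then obtain x where "y = ?L x" "p + ?L x \<in> box l u" by (auto simp: S_def)
    then show "y \<in> (\<lambda>x. x - p) ` box l u" by (intro image_eqI[of _ _ "p + ?L x"]) auto
  next
    fix y assume "y \<in> (\<lambda>x. x - p) ` box l u"
    then have "p + y \<in> box l u" by auto
    then have "h y \<in> S" using h'[of y] by (simp add: S_def)
    then show "y \<in> ?L ` S" using h'[of y] by (intro image_eqI[of _ _ "h y"]) auto
  qed
  have S_eq: "S = h ` ((\<lambda>x. x - p) ` box l u)"
    unfolding img[symmetric] image_image h(2) by simp
  have lmb: "(\<lambda>x. x - p) ` box l u \<in> lmeasurable"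
    using measurable_translation[of "box l u" "-p"] by simp
  have S_lm: "S \<in> lmeasurable"
    unfolding S_eq by (rule measurable_linear_image[OF h(1) lmb])
  have S_open: "S \<in> sets borel"
  proof -
    have "open (((\<lambda>x. p + ?L x)) -` box l u)"
      by (intro open_vimage open_box continuous_intros)
    then show ?thesis unfolding S_def vimage_def by simp
  qed
  have mS: "measure lebesgue (box l u) = \<bar>cr E1 E2\<bar> * measure lebesgue S"
  proof -
    have "measure lebesgue ((\<lambda>x. x - p) ` box l u) = \<bar>cr E1 E2\<bar> * measure lebesgue S"
      using measure_linear_image[OF lin S_lm] by (simp add: img det)
    moreover have "measure lebesgue ((\<lambda>x. x - p) ` box l u) = measure lebesgue (box l u)"
      using measure_translation[of "-p" "box l u"] by simp
    ultimately show ?thesis by simp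
  qed
  have vec: "?\<Phi> -` box l u = ?V -` S"
    by (auto simp: S_def algebra_simps)
  have "emeasure lborel (?V -` S) = emeasure (distr (lborel :: (real \<times> real) measure) borel ?V) S"
    by (subst emeasure_distr) (auto simp: S_open)
  also have "\<dots> = emeasure lborel S"
    by (simp add: lborel_real2_eq_distr[symmetric])
  also have "\<dots> = emeasure lebesgue S"
    using S_open by simp
  also have "\<dots> = ennreal (measure lebesgue S)"
    using S_lm by (simp add: emeasure_eq_measure2 fmeasurableD2 emeasure_eq_ennreal_measure)
  finally have eS: "emeasure lborel (?V -` S) = ennreal (measure lebesgue S)" .
  have "emeasure (density (distr lborel borel ?\<Phi>) (\<lambda>_. ennreal \<bar>cr E1 E2\<bar>)) (box l u)
      = ennreal \<bar>cr E1 E2\<bar> * emeasure lborel (?\<Phi> -` box l u)"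
    by (simp add: emeasure_density nn_integral_cmult_indicator emeasure_distr)
  also have "\<dots> = ennreal (measure lebesgue (box l u))"
    by (simp add: vec eS mS ennreal_mult)
  also have "\<dots> = ennreal (\<Prod>b\<in>Basis. (u - l) \<bullet> b)"
    using le by (simp add: measure_lborel_box_eq)
  finally show "emeasure (density (distr lborel borel ?\<Phi>) (\<lambda>_. ennreal \<bar>cr E1 E2\<bar>)) (box l u) =
        ennreal (\<Prod>b\<in>Basis. (u - l) \<bullet> b)" .
qed simp

text \<open>The integrals of the statement are over \<open>lebesgue_on S\<close>, whereas Fubini and
  the fundamental theorem are used for \<open>lborel\<close> with an indicator. Continuity on a
  compact set allows the passage.\<close>

lemma integral_lebesgue_on_eq_lborel:
  fixes f :: "'a::euclidean_space \<Rightarrow> 'b::euclidean_space"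
  assumes "compact S" "continuous_on S f"
  shows "integral\<^sup>L (lebesgue_on S) f = (\<integral>x. indicator S x *\<^sub>R f x \<partial>lborel)"
    and "integrable (lebesgue_on S) f"
proof -
  have i: "integrable lborel (\<lambda>x. indicator S x *\<^sub>R f x)"
    by (rule borel_integrable_compact[OF assms])
  then have m: "(\<lambda>x. indicator S x *\<^sub>R f x) \<in> borel_measurable lborel"
    by (rule borel_measurable_integrable)
  have S: "S \<inter> space lebesgue \<in> sets lebesgue"
    using borel_compact[OF assms(1)] by simp
  show "integral\<^sup>L (lebesgue_on S) f = (\<integral>x. indicator S x *\<^sub>R f x \<partial>lborel)"
    by (subst integral_restrict_space[OF S]) (use m in \<open>simp add: integral_completion\<close>)
  show "integrable (lebesgue_on S) f"
    by (subst integrable_restrict_space[OF S]) (use i m in \<open>simp add: integrable_completion\<close>)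
qed

lemmas integrable_on_compact = integral_lebesgue_on_eq_lborel(2)

section \<open>The divergence theorem on a triangle\<close>

text \<open>The gradient is an explicit argument and lives on the whole plane. Test functions and
  polynomial pieces both qualify, so the integral identities on a triangle involve no one-sided
  derivatives.\<close>

definition C1grad :: "(real^2 \<Rightarrow> real) \<Rightarrow> (real^2 \<Rightarrow> real^2) \<Rightarrow> bool" where
  "C1grad f df \<longleftrightarrow> continuous_on UNIV df \<and> (\<forall>x. (f has_derivative (\<lambda>h. df x \<bullet> h)) (at x))"

definition emean :: "real^2 \<Rightarrow> real^2 \<Rightarrow> (real^2 \<Rightarrow> real) \<Rightarrow> real" where
  "emean v w f = integral\<^sup>L (lebesgue_on {0..1}) (\<lambda>t. f (v + t *\<^sub>R (w - v)))"

lemma line_int_emean: "line_int v w f = dist v w * emean v w f"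
  by (simp add: line_int_def emean_def)

lemma C1grad_cont: "C1grad f df \<Longrightarrow> continuous_on S f"
  unfolding C1grad_def
  by (meson continuous_at_imp_continuous_on has_derivative_continuous)

lemma C1grad_grad_cont: "C1grad f df \<Longrightarrow> continuous_on S df"
  unfolding C1grad_def using continuous_on_subset by blast

lemma C1grad_line:
  assumes "C1grad f df"
  shows "((\<lambda>s. f (x + s *\<^sub>R d)) has_vector_derivative (df (x + s *\<^sub>R d) \<bullet> d)) (at s within S)"
proof -
  have f: "(f has_derivative (\<lambda>h. df (x + s *\<^sub>R d) \<bullet> h)) (at (x + s *\<^sub>R d))"
    using assms by (auto simp: C1grad_def)
  have "((\<lambda>s. x + s *\<^sub>R d) has_derivative (\<lambda>h. h *\<^sub>R d)) (at s within S)"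
    by (auto intro!: derivative_eq_intros)
  from has_derivative_compose[OF this f]
  show ?thesis by (simp add: has_vector_derivative_def inner_commute)
qed

lemma integrable_segment:
  fixes f :: "real^2 \<Rightarrow> real"
  assumes "continuous_on UNIV f"
  shows "integrable (lebesgue_on {0..1}) (\<lambda>t. f (v + t *\<^sub>R (w - v)))"
  by (intro integrable_on_compact continuous_on_compose2[OF assms] continuous_intros) auto

lemma emean_commute: "emean v w f = emean w v f" 
proof -
  let ?g = "\<lambda>t. f (v + t *\<^sub>R (w - v))"
  have eq: "emean v w f = (\<integral>t. indicator {0..1} t *\<^sub>R f (v + t *\<^sub>R (w - v)) \<partial>lebesgue)" for v w
    unfolding emean_def by (subst integral_restrict_space) (auto)
  have "(\<integral>t. indicator {0..1} t *\<^sub>R ?g t \<partial>lebesgue) = \<bar>-1\<bar> *\<^sub>R (\<integral>t. indicator {0..1} (1 + (-1) * t) *\<^sub>R ?g (1 + (-1) * t) \<partial>lebesgue)"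
    by (rule lebesgue_integral_real_affine) simp
  also have "\<dots> = (\<integral>t. indicator {0..1} t *\<^sub>R f (w + t *\<^sub>R (v - w)) \<partial>lebesgue)"
  proof -
    have "v + (1 + - 1 * t) *\<^sub>R (w - v) = w + t *\<^sub>R (v - w)" for t
      by (simp add: algebra_simps)
    then show ?thesis
      by (auto intro!: Bochner_Integration.integral_cong split: split_indicator)
  qed
  finally show ?thesis by (simp add: eq[of v w] eq[of w v])
qed

lemma line_int_commute: "line_int v w f = line_int w v f"
  by (simp add: line_int_emean emean_commute dist_commute)

lemma cr_swap: "cr (r - p) (q - p) = - cr (q - p) (r - p)"
  by (simp add: cr_def)

lemma cr_rot: "cr (r - q) (p - q) = cr (q - p) (r - p)"
  by (simp add: cr_def algebra_simps)

text \<open>Cramer's rule in the basis \<open>E1\<close>, \<open>E2\<close>.\<close>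

lemma cr_basis:
  assumes "cr E1 E2 \<noteq> 0"
  shows "d = (cr d E2 / cr E1 E2) *\<^sub>R E1 + (cr E1 d / cr E1 E2) *\<^sub>R E2"
  using assms by (auto simp: vec_eq_iff forall_2 divide_simps) (auto simp: cr_def algebra_simps)

lemma cr_indep:
  assumes "cr E1 E2 \<noteq> 0" "a *\<^sub>R E1 + b *\<^sub>R E2 = a' *\<^sub>R E1 + b' *\<^sub>R E2"
  shows "a = a'" "b = b'"
proof -
  have "cr (a *\<^sub>R E1 + b *\<^sub>R E2) E2 = cr (a' *\<^sub>R E1 + b' *\<^sub>R E2) E2"
       "cr E1 (a *\<^sub>R E1 + b *\<^sub>R E2) = cr E1 (a' *\<^sub>R E1 + b' *\<^sub>R E2)"
    using assms by auto
  then have "a * cr E1 E2 = a' * cr E1 E2" "b * cr E1 E2 = b' * cr E1 E2"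
    by (auto simp: cr_def algebra_simps)
  then show "a = a'" "b = b'" using assms by auto
qed

lemma mem_triangle_iff:
  assumes "cr (q - p) (r - p) \<noteq> 0"
  shows "p + s *\<^sub>R (q - p) + t *\<^sub>R (r - p) \<in> convex hull {p,q,r} \<longleftrightarrow> 0 \<le> s \<and> 0 \<le> t \<and> s + t \<le> 1"
proof
  assume "p + s *\<^sub>R (q - p) + t *\<^sub>R (r - p) \<in> convex hull {p,q,r}"
  then obtain u v where uv: "0 \<le> u" "0 \<le> v" "u + v \<le> 1"
    and "p + s *\<^sub>R (q - p) + t *\<^sub>R (r - p) = p + u *\<^sub>R (q - p) + v *\<^sub>R (r - p)"
    unfolding convex_hull_3_alt by blast
  then have "s *\<^sub>R (q - p) + t *\<^sub>R (r - p) = u *\<^sub>R (q - p) + v *\<^sub>R (r - p)" by (simp add: add.assoc)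
  from cr_indep[OF assms this] uv show "0 \<le> s \<and> 0 \<le> t \<and> s + t \<le> 1" by simp
qed (auto simp: convex_hull_3_alt)

lemma integral_lborel_real2_affine:
  fixes h :: "real^2 \<Rightarrow> real"
  assumes cr: "cr E1 E2 \<noteq> 0" and h[measurable]: "h \<in> borel_measurable borel"
  shows "integral\<^sup>L lborel h
      = \<bar>cr E1 E2\<bar> * (\<integral>x. h (case x of (s, t) \<Rightarrow> p + s *\<^sub>R E1 + t *\<^sub>R E2) \<partial>lborel)"
proof -
  have [measurable]: "(\<lambda>(s,t). p + s *\<^sub>R E1 + t *\<^sub>R E2) \<in> borel \<rightarrow>\<^sub>M borel"
    unfolding case_prod_beta by (intro borel_measurable_continuous_onI continuous_intros)
  have "integral\<^sup>L lborel h = integral\<^sup>L (density (distr (lborel :: (real \<times> real) measure) borel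
      (\<lambda>(s,t). p + s *\<^sub>R E1 + t *\<^sub>R E2)) (\<lambda>_. ennreal \<bar>cr E1 E2\<bar>)) h"
    using lborel_real2_affine[OF cr, of p] by simp
  also have "\<dots> = \<bar>cr E1 E2\<bar> * (\<integral>x. h (case x of (s, t) \<Rightarrow> p + s *\<^sub>R E1 + t *\<^sub>R E2) \<partial>lborel)"
    by (subst integral_density) (auto simp: integral_distr)
  finally show ?thesis .
qed

text \<open>Fubini along chords parallel to \<open>q - p\<close>: on each chord the fundamental
  theorem leaves the value on the side \<open>q r\<close> minus the value on the side
  \<open>p r\<close>, both at the same parameter \<open>t\<close>. This one identity yields the
  divergence theorem as well as the comparison of edge means.\<close>

lemma triangle_integral_directional:
  assumes f: "C1grad f df" and cr: "cr (q - p) (r - p) \<noteq> 0"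
  shows "sint (convex hull {p,q,r}) (\<lambda>x. df x \<bullet> (q - p))
     = \<bar>cr (q - p) (r - p)\<bar> * (emean q r f - emean p r f)"
proof -
  let ?T = "convex hull {p,q,r}"
  let ?\<Phi> = "\<lambda>(t,s). p + t *\<^sub>R (r - p) + s *\<^sub>R (q - p)"
  let ?h = "\<lambda>x. indicator ?T x *\<^sub>R (df x \<bullet> (q - p)) :: real"
  have cT: "compact ?T"
    by (simp add: compact_convex_hull)
  have contd: "continuous_on S (\<lambda>x. df x \<bullet> (q - p))" for S
    by (intro continuous_intros C1grad_grad_cont[OF f])
  have h_meas: "?h \<in> borel_measurable borel"
    using borel_integrable_compact[OF cT contd] by (auto dest: borel_measurable_integrable)
  have \<Phi>_cont: "continuous_on S ?\<Phi>" for S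
    unfolding case_prod_beta by (intro continuous_intros)
  have \<Phi>_meas[measurable]: "?\<Phi> \<in> borel \<rightarrow>\<^sub>M borel"
    using \<Phi>_cont by (rule borel_measurable_continuous_onI)
  have cr': "cr (r - p) (q - p) \<noteq> 0" "\<bar>cr (r - p) (q - p)\<bar> = \<bar>cr (q - p) (r - p)\<bar>"
    using cr by (auto simp: cr_swap[of r p q])
  define K where "K = {x::real \<times> real. 0 \<le> fst x \<and> 0 \<le> snd x \<and> fst x + snd x \<le> 1}"
  have K: "?\<Phi> x \<in> ?T \<longleftrightarrow> x \<in> K" for x
    using mem_triangle_iff[OF cr, of "snd x" "fst x"] by (auto simp: K_def case_prod_beta algebra_simps)
  have cK: "compact K"
  proof -
    have "closed K" unfolding K_def
      by (intro closed_Collect_conj closed_Collect_le continuous_intros)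
    moreover have "K \<subseteq> cbox (0,0) (1,1)" unfolding K_def by (auto simp: cbox_Pair_eq)
    ultimately show ?thesis using bounded_cbox bounded_subset compact_eq_bounded_closed by blast
  qed
  have "sint ?T (\<lambda>x. df x \<bullet> (q - p)) = integral\<^sup>L lborel ?h"
    by (rule integral_lebesgue_on_eq_lborel[OF cT contd])
  also have "\<dots> = \<bar>cr (q - p) (r - p)\<bar> * (\<integral>x. ?h (?\<Phi> x) \<partial>lborel)"
    using integral_lborel_real2_affine[OF cr'(1) h_meas, of p] cr'(2) by simp
  also have "(\<integral>x. ?h (?\<Phi> x) \<partial>lborel) = (\<integral>x. indicator K x *\<^sub>R (df (?\<Phi> x) \<bullet> (q - p)) \<partial>(lborel \<Otimes>\<^sub>M lborel))"
    unfolding lborel_prod using K by (intro Bochner_Integration.integral_cong) (auto split: split_indicator)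
  also have "\<dots> = (\<integral>t. \<integral>s. indicator K (t,s) *\<^sub>R (df (?\<Phi> (t,s)) \<bullet> (q - p)) \<partial>lborel \<partial>lborel)"
  proof (rule lborel_pair.integral_fst'[symmetric])
    have "continuous_on K (\<lambda>x. df (?\<Phi> x) \<bullet> (q - p))"
      by (intro continuous_on_compose2[OF contd[of UNIV] \<Phi>_cont]) auto
    then show "integrable (lborel \<Otimes>\<^sub>M lborel) (\<lambda>x. indicator K x *\<^sub>R (df (?\<Phi> x) \<bullet> (q - p)))"
      unfolding lborel_prod by (rule borel_integrable_compact[OF cK])
  qed
  also have "\<dots> = (\<integral>t. indicator {0..1} t *\<^sub>R (f (q + t *\<^sub>R (r - q)) - f (p + t *\<^sub>R (r - p))) \<partial>lborel)"
  proof (rule Bochner_Integration.integral_cong[OF refl])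
    fix t :: real
    show "(\<integral>s. indicator K (t,s) *\<^sub>R (df (?\<Phi> (t,s)) \<bullet> (q - p)) \<partial>lborel)
        = indicator {0..1} t *\<^sub>R (f (q + t *\<^sub>R (r - q)) - f (p + t *\<^sub>R (r - p)))"
    proof (cases "t \<in> {0..1}")
      case False
      then have "indicator K (t,s) = (0::real)" for s by (auto simp: K_def)
      then show ?thesis using False by simp
    next
      case True
      have "indicator K (t,s) = (indicator {0..1-t} s :: real)" for s
        using True by (auto simp: K_def indicator_def)
      then have "(\<integral>s. indicator K (t,s) *\<^sub>R (df (?\<Phi> (t,s)) \<bullet> (q - p)) \<partial>lborel)
        = (\<integral>s. indicator {0..1-t} s *\<^sub>R (df (p + t *\<^sub>R (r - p) + s *\<^sub>R (q - p)) \<bullet> (q - p)) \<partial>lborel)"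
        by simp
      also have "\<dots> = f (p + t *\<^sub>R (r - p) + (1-t) *\<^sub>R (q - p)) - f (p + t *\<^sub>R (r - p) + 0 *\<^sub>R (q - p))"
        using True
        by (intro integral_FTC_Icc C1grad_line[OF f] continuous_on_compose2[OF contd[of UNIV]] continuous_intros) auto
      also have "p + t *\<^sub>R (r - p) + (1-t) *\<^sub>R (q - p) = q + t *\<^sub>R (r - q)"
        by (simp add: algebra_simps)
      finally show ?thesis using True by simp
    qed
  qed
  also have "\<dots> = integral\<^sup>L (lebesgue_on {0..1}) (\<lambda>t. f (q + t *\<^sub>R (r - q)) - f (p + t *\<^sub>R (r - p)))"
    by (rule integral_lebesgue_on_eq_lborel(1)[symmetric])
       (auto intro!: continuous_intros continuous_on_compose2[OF C1grad_cont[OF f, of UNIV]])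
  also have "\<dots> = emean q r f - emean p r f"
    unfolding emean_def using C1grad_cont[OF f]
    by (intro Bochner_Integration.integral_diff integrable_segment)
  finally show ?thesis .
qed

text \<open>The last condition states that base times height is twice the area. It makes the normal
  point outward, and in this form normals enter the divergence theorem without square roots.\<close>

definition is_normal :: "real^2 \<Rightarrow> real^2 \<Rightarrow> real^2 \<Rightarrow> real^2 \<Rightarrow> bool" where
  "is_normal n p q r \<longleftrightarrow> norm n = 1 \<and> n \<bullet> (r - q) = 0 \<and> dist q r * (n \<bullet> (q - p)) = \<bar>cr (q - p) (r - p)\<bar>"

text \<open>Both sides are linear in the direction, so it suffices to treat two edge directions.\<close>
lemma triangle_gradient_theorem:
  assumes f: "C1grad f df" and cr: "cr (q - p) (r - p) \<noteq> 0"
    and n: "is_normal n1 p q r" "is_normal n2 q r p" "is_normal n3 r p q"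
  shows "sint (convex hull {p,q,r}) (\<lambda>x. df x \<bullet> d)
    = (n1 \<bullet> d) * line_int q r f + (n2 \<bullet> d) * line_int r p f + (n3 \<bullet> d) * line_int p q f"
proof -
  let ?I = "\<lambda>d. sint (convex hull {p,q,r}) (\<lambda>x. df x \<bullet> d)"
  let ?D = "\<bar>cr (q - p) (r - p)\<bar>"
  have i: "integrable (lebesgue_on (convex hull {p,q,r})) (\<lambda>x. df x \<bullet> d)" for d
    by (intro integrable_on_compact compact_convex_hull continuous_intros C1grad_grad_cont[OF f]) auto
  have D: "\<bar>cr (r - q) (p - q)\<bar> = ?D" "\<bar>cr (p - r) (q - r)\<bar> = ?D"
    using cr_rot[of r q p] cr_rot[of p r q] by auto
  have n1: "dist q r * (n1 \<bullet> (q - p)) = ?D" "dist q r * (n1 \<bullet> (r - p)) = ?D"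
    using n(1) by (auto simp: is_normal_def inner_diff_right)
  have n2: "dist r p * (n2 \<bullet> (q - p)) = - ?D" "n2 \<bullet> (r - p) = 0"
    using n(2) D by (auto simp: is_normal_def inner_diff_right algebra_simps)
  have n3: "n3 \<bullet> (q - p) = 0" "dist p q * (n3 \<bullet> (r - p)) = - ?D"
    using n(3) D by (auto simp: is_normal_def inner_diff_right algebra_simps)
  define a where "a = cr d (r - p) / cr (q - p) (r - p)"
  define b where "b = cr (q - p) d / cr (q - p) (r - p)"
  have d: "d = a *\<^sub>R (q - p) + b *\<^sub>R (r - p)"
    unfolding a_def b_def by (rule cr_basis[OF cr])
  have Iq: "?I (q - p) = ?D * (emean q r f - emean r p f)"
    using triangle_integral_directional[OF f cr] by (simp add: emean_commute[of p r])
  have set: "{p,q,r} = {p,r,q}" by auto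
  have Ir: "?I (r - p) = ?D * (emean q r f - emean p q f)"
    using triangle_integral_directional[OF f, of r p q] cr unfolding set
    by (simp add: emean_commute[of r q] cr_swap[of r p q])
  have "?I d = sint (convex hull {p,q,r}) (\<lambda>x. a * (df x \<bullet> (q - p)) + b * (df x \<bullet> (r - p)))"
    by (subst d) (simp add: inner_add_right)
  also have "\<dots> = a * ?I (q - p) + b * ?I (r - p)"
    using i by simp
  also have "\<dots> = a * (?D * (emean q r f - emean r p f)) + b * (?D * (emean q r f - emean p q f))"
    by (simp add: Iq Ir)
  also have "\<dots> = (a * (dist q r * (n1 \<bullet> (q - p))) + b * (dist q r * (n1 \<bullet> (r - p)))) * emean q r f
      + (a * (dist r p * (n2 \<bullet> (q - p))) + b * (dist r p * (n2 \<bullet> (r - p)))) * emean r p f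
      + (a * (dist p q * (n3 \<bullet> (q - p))) + b * (dist p q * (n3 \<bullet> (r - p)))) * emean p q f"
    unfolding n1 n2 n3 by (simp add: algebra_simps)
  also have "\<dots> = (n1 \<bullet> d) * line_int q r f + (n2 \<bullet> d) * line_int r p f + (n3 \<bullet> d) * line_int p q f"
    by (subst d)+ (simp add: line_int_emean inner_add_right algebra_simps)
  finally show ?thesis .
qed

lemma line_int_add:
  assumes "continuous_on UNIV f" "continuous_on UNIV g"
  shows "line_int v w (\<lambda>x. f x + g x) = line_int v w f + line_int v w g"
  unfolding line_int_def using integrable_segment[OF assms(1)] integrable_segment[OF assms(2)]
  by (simp add: algebra_simps)

lemma line_int_cmult: "line_int v w (\<lambda>x. c * f x) = c * line_int v w f"
  unfolding line_int_def by simp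

lemma triangle_divergence_theorem:
  fixes F :: "real^2 \<Rightarrow> real^2"
  assumes F1: "C1grad (\<lambda>x. F x $ 1) dF1" and F2: "C1grad (\<lambda>x. F x $ 2) dF2" 
    and cr: "cr (q - p) (r - p) \<noteq> 0"
    and n: "is_normal n1 p q r" "is_normal n2 q r p" "is_normal n3 r p q"
  shows "sint (convex hull {p,q,r}) (\<lambda>x. dF1 x $ 1 + dF2 x $ 2)
    = line_int q r (\<lambda>x. F x \<bullet> n1) + line_int r p (\<lambda>x. F x \<bullet> n2) + line_int p q (\<lambda>x. F x \<bullet> n3)"
proof -
  let ?I = "\<lambda>f. sint (convex hull {p,q,r}) f"
  have i: "integrable (lebesgue_on (convex hull {p,q,r})) (\<lambda>x. dF1 x $ 1)"
       "integrable (lebesgue_on (convex hull {p,q,r})) (\<lambda>x. dF2 x $ 2)"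
    by (intro integrable_on_compact compact_convex_hull continuous_intros C1grad_grad_cont[OF F1] C1grad_grad_cont[OF F2]; simp)+
  have a: "x \<bullet> axis j 1 = x $ j" for x :: "real^2" and j by (simp add: inner_axis)
  have l: "line_int v w (\<lambda>x. F x \<bullet> n) = (n $ 1) * line_int v w (\<lambda>x. F x $ 1) + (n $ 2) * line_int v w (\<lambda>x. F x $ 2)" for v w n
  proof -
    have "line_int v w (\<lambda>x. F x \<bullet> n) = line_int v w (\<lambda>x. n $ 1 * F x $ 1 + n $ 2 * F x $ 2)"
      by (simp add: inner_real2 mult.commute)
    also have "\<dots> = line_int v w (\<lambda>x. n $ 1 * F x $ 1) + line_int v w (\<lambda>x. n $ 2 * F x $ 2)"
      by (intro line_int_add continuous_intros C1grad_cont[OF F1] C1grad_cont[OF F2])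
    finally show ?thesis by (simp add: line_int_cmult)
  qed
  have "?I (\<lambda>x. dF1 x $ 1 + dF2 x $ 2) = ?I (\<lambda>x. dF1 x \<bullet> axis 1 1) + ?I (\<lambda>x. dF2 x \<bullet> axis 2 1)"
    unfolding a using i by simp
  then show ?thesis
    unfolding triangle_gradient_theorem[OF F1 cr n] triangle_gradient_theorem[OF F2 cr n]
    by (simp add: l a)
qed

lemma Cauchy_Schwarz_integral:
  fixes f g :: "'a \<Rightarrow> real"
  assumes [measurable]: "f \<in> borel_measurable M" "g \<in> borel_measurable M"
    and f: "integrable M (\<lambda>x. (f x)\<^sup>2)" and g: "integrable M (\<lambda>x. (g x)\<^sup>2)"
  shows integrable_mult_L2: "integrable M (\<lambda>x. f x * g x)"
    and Cauchy_Schwarz_integral_sq: "(\<integral>x. f x * g x \<partial>M)\<^sup>2 \<le> (\<integral>x. (f x)\<^sup>2 \<partial>M) * (\<integral>x. (g x)\<^sup>2 \<partial>M)"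
    and Cauchy_Schwarz_integral_sqrt: "\<bar>\<integral>x. f x * g x \<partial>M\<bar> \<le> sqrt (\<integral>x. (f x)\<^sup>2 \<partial>M) * sqrt (\<integral>x. (g x)\<^sup>2 \<partial>M)"
proof -
  show i: "integrable M (\<lambda>x. f x * g x)"
  proof (rule Bochner_Integration.integrable_bound)
    show "integrable M (\<lambda>x. (f x)\<^sup>2 + (g x)\<^sup>2)" using f g by simp
    show "AE x in M. norm (f x * g x) \<le> norm ((f x)\<^sup>2 + (g x)\<^sup>2)"
    proof (rule AE_I2)
      fix x
      have "0 \<le> (\<bar>f x\<bar> - \<bar>g x\<bar>)\<^sup>2" by simp
      then have "2 * (\<bar>f x\<bar> * \<bar>g x\<bar>) \<le> (f x)\<^sup>2 + (g x)\<^sup>2" by (simp add: power2_diff)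
      moreover have "0 \<le> \<bar>f x\<bar> * \<bar>g x\<bar>" by simp
      ultimately have "\<bar>f x\<bar> * \<bar>g x\<bar> \<le> (f x)\<^sup>2 + (g x)\<^sup>2" by linarith
      then show "norm (f x * g x) \<le> norm ((f x)\<^sup>2 + (g x)\<^sup>2)" by (simp add: abs_mult)
    qed
  qed measurable
  define A B C where "A = (\<integral>x. (f x)\<^sup>2 \<partial>M)" and "B = (\<integral>x. f x * g x \<partial>M)" and "C = (\<integral>x. (g x)\<^sup>2 \<partial>M)"
  have q: "0 \<le> A + 2 * l * B + l\<^sup>2 * C" for l
  proof -
    have "0 \<le> (\<integral>x. (f x + l * g x)\<^sup>2 \<partial>M)" by simp
    also have "\<dots> = (\<integral>x. (f x)\<^sup>2 + (2 * l) * (f x * g x) + l\<^sup>2 * (g x)\<^sup>2 \<partial>M)"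
      by (intro Bochner_Integration.integral_cong) (auto simp: power2_eq_square algebra_simps)
    also have "\<dots> = A + 2 * l * B + l\<^sup>2 * C"
      using f g i by (simp add: A_def B_def C_def)
    finally show ?thesis .
  qed
  have C0: "0 \<le> C" unfolding C_def by simp
  have main: "B\<^sup>2 \<le> A * C"
  proof (cases "C = 0")
    case True
    have "B = 0"
    proof (rule ccontr)
      assume "B \<noteq> 0"
      moreover have "0 \<le> A" unfolding A_def by simp
      \<comment> \<open>For \<open>C = 0\<close> the quadratic is affine in \<open>l\<close>; this
        choice of \<open>l\<close> gives it the value \<open>- A - 2\<close>.\<close>
      ultimately show False using q[of "- (A + 1) / B"] True by simp
    qed
    then show ?thesis using True by simp
  next
    case False
    then have "0 \<le> (A + 2 * (- B / C) * B + (- B / C)\<^sup>2 * C) * C"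
      using q[of "- B / C"] C0 by (intro mult_nonneg_nonneg) auto
    also have "\<dots> = A * C - B\<^sup>2"
      using False by (simp add: field_simps power2_eq_square)
    finally show ?thesis by simp
  qed
  then show "(\<integral>x. f x * g x \<partial>M)\<^sup>2 \<le> (\<integral>x. (f x)\<^sup>2 \<partial>M) * (\<integral>x. (g x)\<^sup>2 \<partial>M)"
    by (simp add: A_def B_def C_def)
  show "\<bar>\<integral>x. f x * g x \<partial>M\<bar> \<le> sqrt (\<integral>x. (f x)\<^sup>2 \<partial>M) * sqrt (\<integral>x. (g x)\<^sup>2 \<partial>M)"
    using real_sqrt_le_mono[OF main] by (simp add: A_def B_def C_def real_sqrt_mult)
qed

section \<open>Rules for C1 functions with explicit gradient\<close>

lemma C1grad_const: "C1grad (\<lambda>x. c) (\<lambda>x. 0)"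
  by (auto simp: C1grad_def)

lemma C1grad_add: "C1grad f df \<Longrightarrow> C1grad g dg \<Longrightarrow> C1grad (\<lambda>x. f x + g x) (\<lambda>x. df x + dg x)"
  unfolding C1grad_def by (auto intro!: continuous_intros derivative_eq_intros simp: inner_add_left)

lemma C1grad_diff: "C1grad f df \<Longrightarrow> C1grad g dg \<Longrightarrow> C1grad (\<lambda>x. f x - g x) (\<lambda>x. df x - dg x)"
  unfolding C1grad_def by (auto intro!: continuous_intros derivative_eq_intros simp: inner_diff_left)

lemma C1grad_mult:
  assumes "C1grad f df" "C1grad g dg"
  shows "C1grad (\<lambda>x. f x * g x) (\<lambda>x. f x *\<^sub>R dg x + g x *\<^sub>R df x)"
  unfolding C1grad_def
proof (intro conjI allI)
  show "continuous_on UNIV (\<lambda>x. f x *\<^sub>R dg x + g x *\<^sub>R df x)"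
    by (intro continuous_intros C1grad_cont[OF assms(1)] C1grad_cont[OF assms(2)]
        C1grad_grad_cont[OF assms(1)] C1grad_grad_cont[OF assms(2)])
  fix x
  have "(f has_derivative (\<lambda>h. df x \<bullet> h)) (at x)" "(g has_derivative (\<lambda>h. dg x \<bullet> h)) (at x)"
    using assms by (auto simp: C1grad_def)
  from has_derivative_mult[OF this]
  show "((\<lambda>x. f x * g x) has_derivative (\<lambda>h. (f x *\<^sub>R dg x + g x *\<^sub>R df x) \<bullet> h)) (at x)"
    by (simp add: inner_add_left mult.commute)
qed

lemma C1grad_coord: "C1grad (\<lambda>x. x $ i - c) (\<lambda>x. axis i 1)"
proof -
  have "((\<lambda>x::real^2. x $ i - c) has_derivative (\<lambda>h. axis i 1 \<bullet> h)) (at x)" for x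
    by (auto intro!: derivative_eq_intros bounded_linear_imp_has_derivative bounded_linear_vec_nth simp: inner_axis')
  then show ?thesis by (simp add: C1grad_def)
qed

lemma C1grad_affine: "C1grad (\<lambda>x. c + d \<bullet> x) (\<lambda>x. d)"
  unfolding C1grad_def by (auto intro!: derivative_eq_intros)

lemma line_int_cong:
  assumes "\<And>x. x \<in> closed_segment v w \<Longrightarrow> f x = g x"
  shows "line_int v w f = line_int v w g"
proof -
  have "v + t *\<^sub>R (w - v) \<in> closed_segment v w" if "t \<in> {0..1}" for t
    unfolding in_segment using that by (intro exI[of _ t]) (auto simp: algebra_simps)
  then show ?thesis
    unfolding line_int_def using assms by (intro arg_cong2[of _ _ _ _ "(*)"] Bochner_Integration.integral_cong) auto
qed

section \<open>Determinants and outward unit normals of a triangle\<close>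

lemma collinear_iff_cr: "collinear {a,b,c} \<longleftrightarrow> cr (b - a) (c - a) = 0"
proof -
  have "collinear {a,b,c} \<longleftrightarrow> collinear {b,a,c}" by (simp add: insert_commute)
  also have "\<dots> \<longleftrightarrow> collinear {0, b - a, c - a}" by (rule collinear_3) (simp only: NO_MATCH_def)
  also have "\<dots> \<longleftrightarrow> cr (b - a) (c - a) = 0"
  proof
    assume "collinear {0, b - a, c - a}"
    then consider "b - a = 0" | "c - a = 0" | k where "c - a = k *\<^sub>R (b - a)"
      by (auto simp: collinear_lemma)
    then show "cr (b - a) (c - a) = 0"
    proof cases
      case (3 k)
      show ?thesis unfolding 3 by (simp add: cr_def)
    qed (simp_all add: cr_def)
  next
    assume 0: "cr (b - a) (c - a) = 0"
    show "collinear {0, b - a, c - a}"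
    proof (cases "b - a = 0")
      case False
      let ?u = "b - a" and ?v = "c - a"
      have nz: "(?u$1)\<^sup>2 + (?u$2)\<^sup>2 \<noteq> 0"
        using False by (metis norm_real2 norm_eq_zero real_sqrt_zero)
      have e: "?u$1 * ?v$2 = ?u$2 * ?v$1" using 0 by (simp add: cr_def)
      \<comment> \<open>The projection of \<open>?v\<close> onto \<open>?u\<close>; it returns
        \<open>?v\<close> because the determinant vanishes.\<close>
      have "?v = ((?u \<bullet> ?v) / ((?u$1)\<^sup>2 + (?u$2)\<^sup>2)) *\<^sub>R ?u"
      proof -
        have "(?u$1)\<^sup>2 * ?v$1 + (?u$2)\<^sup>2 * ?v$1 = (?u$1 * ?v$1 + ?u$2 * ?v$2) * ?u$1"
          using e by (simp add: power2_eq_square) algebra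
        moreover have "(?u$1)\<^sup>2 * ?v$2 + (?u$2)\<^sup>2 * ?v$2 = (?u$1 * ?v$1 + ?u$2 * ?v$2) * ?u$2"
          using e by (simp add: power2_eq_square) algebra
        ultimately show ?thesis using nz
          by (simp add: vec_eq_iff forall_2 inner_real2 eq_divide_eq) (simp add: algebra_simps)
      qed
      then show ?thesis unfolding collinear_lemma by blast
    qed (simp add: collinear_lemma)
  qed
  finally show ?thesis .
qed

lemma is_normalI:
  assumes n: "norm n = 1" "n \<bullet> (r - q) = 0" "n \<bullet> (q - p) \<ge> 0"
  shows "is_normal n p q r"
proof -
  \<comment> \<open>In the plane a vector orthogonal to the unit vector \<open>n\<close> is a
    multiple of its quarter turn; \<open>l\<close> is that multiple for \<open>r - q\<close>, so its
    absolute value is the edge length.\<close>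
  define l where "l = n$1 * (r - q)$2 - n$2 * (r - q)$1"
  have n2: "(n$1)\<^sup>2 + (n$2)\<^sup>2 = 1" using n(1) by (simp add: norm_real2)
  have o: "n$1 * (r-q)$1 + n$2 * (r-q)$2 = 0" using n(2) by (simp add: inner_real2)
  have d1: "(r - q)$1 = - l * n$2" and d2: "(r - q)$2 = l * n$1"
    unfolding l_def using n2 o by (simp_all add: power2_eq_square) algebra+
  have dist: "dist q r = \<bar>l\<bar>"
  proof -
    have "dist q r = sqrt (((r-q)$1)\<^sup>2 + ((r-q)$2)\<^sup>2)" by (simp add: dist_norm norm_real2 power2_commute)
    also have "((r-q)$1)\<^sup>2 + ((r-q)$2)\<^sup>2 = l\<^sup>2" unfolding d1 d2 using n2 by algebra
    finally show ?thesis by simp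
  qed
  have "cr (q - p) (r - p) = cr (q - p) (r - q)" by (simp add: cr_def algebra_simps)
  also have "\<dots> = l * (n \<bullet> (q - p))" unfolding cr_def d1 d2 by (simp add: inner_real2 algebra_simps)
  finally have "\<bar>cr (q - p) (r - p)\<bar> = \<bar>l\<bar> * (n \<bullet> (q - p))" using n(3) by (simp add: abs_mult)
  then show ?thesis using n dist by (simp add: is_normal_def)
qed

text \<open>The quarter turn of the edge direction, normalised and signed so as to point away from
  \<open>p\<close>. Existence is what makes the choice in \<open>outward_normal\<close>
  meaningful.\<close>

lemma outward_normal_exists:
  assumes "cr (q - p) (r - p) \<noteq> 0"
  shows "\<exists>n. norm n = 1 \<and> (\<forall>x\<in>closed_segment q r. \<forall>y\<in>convex hull {p,q,r}. n \<bullet> (y - x) \<le> 0)"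
proof -
  have qr: "q \<noteq> r" using assms by (auto simp: cr_def)
  define m :: "real^2" where "m = (1 / norm (r - q)) *\<^sub>R vector [- (r - q)$2, (r - q)$1]"
  have m1: "norm m = 1" 
  proof -
    have "norm (vector [- (r - q)$2, (r - q)$1] :: real^2) = norm (r - q)"
      by (simp add: norm_real2 add.commute power2_commute)
    then show ?thesis using qr by (simp add: m_def)
  qed
  have m2: "m \<bullet> (r - q) = 0"
    unfolding m_def inner_scaleR_left by (simp add: inner_real2 algebra_simps)
  define n where "n = (if m \<bullet> (q - p) \<ge> 0 then m else - m)"
  have n: "norm n = 1" "n \<bullet> (r - q) = 0" "n \<bullet> (q - p) \<ge> 0"
    using m1 m2 by (auto simp: n_def)
  have "n \<bullet> (y - x) \<le> 0" if x: "x \<in> closed_segment q r" and y: "y \<in> convex hull {p,q,r}" for x y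
  proof -
    obtain s where "x = (1 - s) *\<^sub>R q + s *\<^sub>R r" using x by (auto simp: in_segment)
    then have "x = q + s *\<^sub>R (r - q)" by (simp add: algebra_simps)
    then have nx: "n \<bullet> x = n \<bullet> q" using n(2) by (simp add: inner_add_right)
    obtain u v where uv: "u \<ge> 0" "v \<ge> 0" "u + v \<le> 1" "y = p + u *\<^sub>R (q - p) + v *\<^sub>R (r - p)"
      using y by (auto simp: convex_hull_3_alt)
    have "r - p = (r - q) + (q - p)" by simp
    then have rp: "n \<bullet> (r - p) = n \<bullet> (q - p)" using n(2) by (metis add_0 inner_add_right)
    have "n \<bullet> (y - x) = n \<bullet> (y - p) - n \<bullet> (q - p)" using nx by (simp add: inner_diff_right)
    also have "\<dots> = (u + v - 1) * (n \<bullet> (q - p))"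
      unfolding uv using rp by (simp add: inner_add_right algebra_simps)
    also have "\<dots> \<le> 0" using uv n(3) by (simp add: mult_nonpos_nonneg)
    finally show ?thesis .
  qed
  then show ?thesis using n(1) by blast
qed

text \<open>Whatever vector the choice picks, its inequality tested with \<open>q\<close> and
  \<open>r\<close> against each other forces orthogonality to the edge, and tested with
  \<open>p\<close> it fixes the sign.\<close>

lemma outward_normal_is_normal:
  assumes "cr (q - p) (r - p) \<noteq> 0"
  shows "is_normal (outward_normal (convex hull {p,q,r}) (closed_segment q r)) p q r"
proof -
  let ?n = "outward_normal (convex hull {p,q,r}) (closed_segment q r)"
  have n: "norm ?n = 1" "\<And>x y. x\<in>closed_segment q r \<Longrightarrow> y\<in>convex hull {p,q,r} \<Longrightarrow> ?n \<bullet> (y - x) \<le> 0"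
    using someI_ex[OF outward_normal_exists[OF assms]] unfolding outward_normal_def[symmetric] by auto
  have h: "p \<in> convex hull {p,q,r}" "q \<in> convex hull {p,q,r}" "r \<in> convex hull {p,q,r}"
    by (auto intro: hull_inc)
  have "?n \<bullet> (r - q) \<le> 0" "?n \<bullet> (q - r) \<le> 0" "?n \<bullet> (p - q) \<le> 0"
    by (intro n h; simp)+
  then show ?thesis using n(1) by (intro is_normalI) (auto simp: inner_diff_right)
qed

text \<open>The divergence theorem for the field \<open>w x *\<^sub>R G x\<close>; with
  \<open>G\<close> a gradient this is integration by parts against the Laplacian.\<close>

lemma triangle_green:
  assumes w: "C1grad w dw" and G: "C1grad (\<lambda>x. G x $ 1) dG1" "C1grad (\<lambda>x. G x $ 2) dG2"
    and cr: "cr (q - p) (r - p) \<noteq> 0"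
    and n: "is_normal n1 p q r" "is_normal n2 q r p" "is_normal n3 r p q"
  shows "sint (convex hull {p,q,r}) (\<lambda>x. G x \<bullet> dw x)
    = line_int q r (\<lambda>x. (n1 \<bullet> G x) * w x) + line_int r p (\<lambda>x. (n2 \<bullet> G x) * w x) + line_int p q (\<lambda>x. (n3 \<bullet> G x) * w x)
     - sint (convex hull {p,q,r}) (\<lambda>x. (dG1 x $ 1 + dG2 x $ 2) * w x)"
proof -
  let ?F = "\<lambda>x. w x *\<^sub>R G x"
  let ?dF1 = "\<lambda>x. w x *\<^sub>R dG1 x + G x $ 1 *\<^sub>R dw x"
  let ?dF2 = "\<lambda>x. w x *\<^sub>R dG2 x + G x $ 2 *\<^sub>R dw x"
  have F: "C1grad (\<lambda>x. ?F x $ 1) ?dF1" "C1grad (\<lambda>x. ?F x $ 2) ?dF2"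
    using C1grad_mult[OF w G(1)] C1grad_mult[OF w G(2)] by simp_all
  have Gc: "continuous_on UNIV G"
  proof -
    have "G = (\<lambda>x. \<chi> i. G x $ i)" by simp
    moreover have "continuous_on UNIV (\<lambda>x. \<chi> i. G x $ i)"
    proof (rule continuous_on_vec_lambda)
      fix i :: 2 show "continuous_on UNIV (\<lambda>x. G x $ i)"
        using C1grad_cont[OF G(1)] C1grad_cont[OF G(2)] exhaust_2[of i] by auto
    qed
    ultimately show ?thesis by simp
  qed
  note [continuous_intros] = continuous_on_subset[OF Gc subset_UNIV] C1grad_cont[OF w] C1grad_grad_cont[OF w] C1grad_grad_cont[OF G(1)] C1grad_grad_cont[OF G(2)]
  have i: "integrable (lebesgue_on (convex hull {p,q,r})) (\<lambda>x. (dG1 x $ 1 + dG2 x $ 2) * w x)"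
     "integrable (lebesgue_on (convex hull {p,q,r})) (\<lambda>x. G x \<bullet> dw x)"
    by (intro integrable_on_compact compact_convex_hull continuous_intros; simp)+
  have "sint (convex hull {p,q,r}) (\<lambda>x. ?dF1 x $ 1 + ?dF2 x $ 2)
     = sint (convex hull {p,q,r}) (\<lambda>x. (dG1 x $ 1 + dG2 x $ 2) * w x + G x \<bullet> dw x)"
    by (intro Bochner_Integration.integral_cong) (auto simp: inner_real2 algebra_simps)
  also have "\<dots> = sint (convex hull {p,q,r}) (\<lambda>x. (dG1 x $ 1 + dG2 x $ 2) * w x)
      + sint (convex hull {p,q,r}) (\<lambda>x. G x \<bullet> dw x)"
    using i by (rule Bochner_Integration.integral_add)
  finally show ?thesis
    using triangle_divergence_theorem[OF F cr n]
    by (simp add: inner_commute[of _ n1] inner_commute[of _ n2] inner_commute[of _ n3] mult.commute)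
qed

text \<open>The field \<open>W x (x - p)\<close> is tangential on the two edges through \<open>p\<close>, so only the opposite edge contributes.\<close>
lemma triangle_trace_identity:
  assumes W: "C1grad W dW" and cr: "cr (q - p) (r - p) \<noteq> 0"
  shows "sint (convex hull {p,q,r}) (\<lambda>x. 2 * W x + dW x \<bullet> (x - p))
     = \<bar>cr (q - p) (r - p)\<bar> * emean q r W"
proof -
  have cr2: "cr (r - q) (p - q) \<noteq> 0" "cr (p - r) (q - r) \<noteq> 0"
    using cr cr_rot[of r q p] cr_rot[of p r q] by auto
  obtain n1 n2 n3 where n: "is_normal n1 p q r" "is_normal n2 q r p" "is_normal n3 r p q"
    using outward_normal_is_normal[OF cr] outward_normal_is_normal[OF cr2(1)] outward_normal_is_normal[OF cr2(2)] by blast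
  let ?F = "\<lambda>x. W x *\<^sub>R (x - p)"
  let ?dF = "\<lambda>i x. W x *\<^sub>R axis i 1 + (x $ i - p $ i) *\<^sub>R dW x"
  have F: "C1grad (\<lambda>x. ?F x $ i) (?dF i)" for i
    using C1grad_mult[OF W C1grad_coord[of i "p$i"]] by simp
  have l1: "line_int q r (\<lambda>x. ?F x \<bullet> n1) = line_int q r (\<lambda>x. (n1 \<bullet> (q - p)) * W x)"
  proof (rule line_int_cong)
    fix x assume "x \<in> closed_segment q r"
    then obtain s where "x = (1 - s) *\<^sub>R q + s *\<^sub>R r" by (auto simp: in_segment)
    then have xp: "x - p = (q - p) + s *\<^sub>R (r - q)" by (simp add: algebra_simps)
    have "n1 \<bullet> (x - p) = n1 \<bullet> (q - p)"
      unfolding xp using n(1) by (simp add: is_normal_def inner_add_right)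
    then show "?F x \<bullet> n1 = (n1 \<bullet> (q - p)) * W x"
      by (simp add: inner_commute)
  qed
  have l2: "line_int r p (\<lambda>x. ?F x \<bullet> n2) = line_int r p (\<lambda>x. 0 * W x)"
  proof (rule line_int_cong)
    fix x assume "x \<in> closed_segment r p"
    then obtain s where "x = (1 - s) *\<^sub>R r + s *\<^sub>R p" by (auto simp: in_segment)
    then have "x - p = (s - 1) *\<^sub>R (p - r)" by (simp add: algebra_simps)
    then show "?F x \<bullet> n2 = 0 * W x"
      using n(2) by (simp add: is_normal_def inner_commute)
  qed
  have l3: "line_int p q (\<lambda>x. ?F x \<bullet> n3) = line_int p q (\<lambda>x. 0 * W x)"
  proof (rule line_int_cong)
    fix x assume "x \<in> closed_segment p q"
    then obtain s where "x = (1 - s) *\<^sub>R p + s *\<^sub>R q" by (auto simp: in_segment)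
    then have "x - p = s *\<^sub>R (q - p)" by (simp add: algebra_simps)
    then show "?F x \<bullet> n3 = 0 * W x"
      using n(3) by (simp add: is_normal_def inner_commute)
  qed
  have "sint (convex hull {p,q,r}) (\<lambda>x. 2 * W x + dW x \<bullet> (x - p))
    = sint (convex hull {p,q,r}) (\<lambda>x. ?dF 1 x $ 1 + ?dF 2 x $ 2)"
    by (intro Bochner_Integration.integral_cong) (auto simp: inner_real2 algebra_simps)
  also have "\<dots> = dist q r * (n1 \<bullet> (q - p)) * emean q r W"
    unfolding triangle_divergence_theorem[OF F[of 1] F[of 2] cr n] l1 l2 l3 line_int_cmult
    by (simp add: line_int_emean)
  also have "\<dots> = \<bar>cr (q - p) (r - p)\<bar> * emean q r W"
    using n(1) by (simp add: is_normal_def)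
  finally show ?thesis .
qed

text \<open>For the constant function 1 the trace identity says that twice the area is the absolute
  determinant.\<close>

lemma measure_triangle:
  assumes "cr (q - p) (r - p) \<noteq> 0"
  shows "measure lebesgue (convex hull {p,q,r}) = \<bar>cr (q - p) (r - p)\<bar> / 2"
proof -
  have "convex hull {p,q,r} \<in> sets lebesgue"
    using lmeasurable_compact[OF compact_convex_hull, of "{p,q,r}"] by auto
  then have "measure (lebesgue_on (convex hull {p,q,r})) (convex hull {p,q,r}) = measure lebesgue (convex hull {p,q,r})"
    by (simp add: measure_restrict_space)
  moreover have "measure (lebesgue_on {0..1::real}) {0..1} = 1"
    by (simp add: measure_restrict_space)
  ultimately show ?thesis
    using triangle_trace_identity[OF C1grad_const[of 1] assms] by (simp add: emean_def)
qed

section \<open>Poincare inequality on convex sets\<close>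

text \<open>In \<open>x\<close> this is the dilation about \<open>y\<close> with factor
  \<open>1 - t\<close>, at least 1/2; its Jacobian \<open>(1 - t)^2\<close> is at least 1/4, which
  explains the 4.\<close>

lemma nn_integral_convex_combination_le:
  fixes g :: "real^2 \<Rightarrow> ennreal"
  assumes [measurable]: "g \<in> borel_measurable borel" and t: "0 \<le> t" "t \<le> 1/2"
  shows "(\<integral>\<^sup>+x. g (x + t *\<^sub>R (y - x)) \<partial>lborel) \<le> 4 * (\<integral>\<^sup>+x. g x \<partial>lborel)"
proof -
  have "(\<integral>\<^sup>+x. g x \<partial>lborel) = (\<integral>\<^sup>+x. g x \<partial>(density (distr lborel borel (\<lambda>x. t *\<^sub>R y + (1 - t) *\<^sub>R x)) (\<lambda>_. \<bar>1 - t\<bar>^DIM(real^2))))"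
    using lborel_affine[of "1 - t" "t *\<^sub>R y"] t by simp
  also have "\<dots> = ennreal ((1 - t)^2) * (\<integral>\<^sup>+x. g (t *\<^sub>R y + (1 - t) *\<^sub>R x) \<partial>lborel)"
    using t by (simp add: nn_integral_density nn_integral_distr nn_integral_cmult)
  finally have eq: "(\<integral>\<^sup>+x. g x \<partial>lborel) = ennreal ((1 - t)^2) * (\<integral>\<^sup>+x. g (x + t *\<^sub>R (y - x)) \<partial>lborel)"
    by (simp add: algebra_simps)
  have "(1/2)^2 \<le> (1 - t)^2" using t by (intro power_mono) auto
  then have "1 \<le> 4 * (1 - t)^2" by (simp add: power2_eq_square)
  then have "1 * (\<integral>\<^sup>+x. g (x + t *\<^sub>R (y - x)) \<partial>lborel) \<le> ennreal (4 * (1 - t)^2) * (\<integral>\<^sup>+x. g (x + t *\<^sub>R (y - x)) \<partial>lborel)"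
    by (intro mult_right_mono) auto
  also have "\<dots> = 4 * (\<integral>\<^sup>+x. g x \<partial>lborel)"
    unfolding eq by (simp add: ennreal_mult mult.assoc)
  finally show ?thesis by simp
qed

text \<open>Going only up to the midpoint keeps \<open>t \<le> 1/2\<close>, where the substitution above has bounded Jacobian.\<close>
lemma half_segment_estimate:
  assumes f: "C1grad f df" and h: "norm (y - x) \<le> h"
  shows "(f (x + (1/2) *\<^sub>R (y - x)) - f x)\<^sup>2
     \<le> h\<^sup>2 / 2 * (\<integral>t. indicator {0..1/2} t *\<^sub>R (norm (df (x + t *\<^sub>R (y - x))))\<^sup>2 \<partial>lborel)"
proof -
  let ?M = "lebesgue_on {0..1/2::real}"
  let ?\<phi> = "\<lambda>t. df (x + t *\<^sub>R (y - x)) \<bullet> (y - x)"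
  have dfc: "continuous_on S (\<lambda>t. df (x + t *\<^sub>R (y - x)))" for S
    by (intro continuous_on_compose2[OF C1grad_grad_cont[OF f, of UNIV]] continuous_intros) auto
  have c: "continuous_on S ?\<phi>" "continuous_on S (\<lambda>t. (?\<phi> t)\<^sup>2)" "continuous_on S (\<lambda>t. (norm (df (x + t *\<^sub>R (y - x))))\<^sup>2)" for S
    by (intro continuous_intros dfc)+
  have "integral\<^sup>L ?M ?\<phi> = (\<integral>t. indicator {0..1/2} t *\<^sub>R ?\<phi> t \<partial>lborel)"
    by (rule integral_lebesgue_on_eq_lborel) (auto intro: c)
  also have "\<dots> = f (x + (1/2) *\<^sub>R (y - x)) - f (x + 0 *\<^sub>R (y - x))"
    by (intro integral_FTC_Icc C1grad_line[OF f] c) auto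
  finally have FTC: "f (x + (1/2) *\<^sub>R (y - x)) - f x = integral\<^sup>L ?M (\<lambda>t. ?\<phi> t * 1)" by simp
  have i: "integrable ?M ?\<phi>" "integrable ?M (\<lambda>t. (?\<phi> t)\<^sup>2)" "integrable ?M (\<lambda>t. (norm (df (x + t *\<^sub>R (y - x))))\<^sup>2)"
    by (intro integrable_on_compact c; simp)+
  have "(integral\<^sup>L ?M (\<lambda>t. ?\<phi> t * 1))\<^sup>2 \<le> (integral\<^sup>L ?M (\<lambda>t. (?\<phi> t)\<^sup>2)) * (integral\<^sup>L ?M (\<lambda>t. (1::real)\<^sup>2))"
    using i by (intro Cauchy_Schwarz_integral_sq) auto
  also have "integral\<^sup>L ?M (\<lambda>t. (1::real)\<^sup>2) = 1/2"
    by (simp add: measure_restrict_space)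
  also have "integral\<^sup>L ?M (\<lambda>t. (?\<phi> t)\<^sup>2) \<le> integral\<^sup>L ?M (\<lambda>t. h\<^sup>2 * (norm (df (x + t *\<^sub>R (y - x))))\<^sup>2)"
  proof (rule integral_mono)
    fix t
    have "\<bar>?\<phi> t\<bar> \<le> norm (df (x + t *\<^sub>R (y - x))) * norm (y - x)" by (rule Cauchy_Schwarz_ineq2)
    also have "\<dots> \<le> norm (df (x + t *\<^sub>R (y - x))) * h" using h by (intro mult_left_mono) auto
    finally have "\<bar>?\<phi> t\<bar>\<^sup>2 \<le> (norm (df (x + t *\<^sub>R (y - x))) * h)\<^sup>2" by (intro power_mono) auto
    then show "(?\<phi> t)\<^sup>2 \<le> h\<^sup>2 * (norm (df (x + t *\<^sub>R (y - x))))\<^sup>2" by (simp add: power_mult_distrib mult.commute)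
  qed (use i in auto)
  also have "\<dots> = h\<^sup>2 * integral\<^sup>L ?M (\<lambda>t. (norm (df (x + t *\<^sub>R (y - x))))\<^sup>2)" by simp
  also have "integral\<^sup>L ?M (\<lambda>t. (norm (df (x + t *\<^sub>R (y - x))))\<^sup>2) = (\<integral>t. indicator {0..1/2} t *\<^sub>R (norm (df (x + t *\<^sub>R (y - x))))\<^sup>2 \<partial>lborel)"
    by (rule integral_lebesgue_on_eq_lborel) (auto intro: c)
  finally show ?thesis unfolding FTC by simp
qed

text \<open>Two points of \<open>S\<close> are joined through their common midpoint, and each half
  is estimated by the energy along it. Fubini moves the segment parameter outermost, where the
  dilation bound gives the factor 4 on an interval of length 1/2. Nonnegative extended integrals
  spare all integrability questions.\<close>

lemma poincare_convex_double:
  assumes S: "compact S" "convex S" and f: "C1grad f df"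
    and h: "\<And>x y. x \<in> S \<Longrightarrow> y \<in> S \<Longrightarrow> norm (y - x) \<le> h"
  shows "(\<integral>\<^sup>+y. indicator S y * (\<integral>\<^sup>+x. indicator S x * ennreal ((f x - f y)\<^sup>2) \<partial>lborel) \<partial>lborel)
     \<le> ennreal (h\<^sup>2) * (4 * (emeasure lborel S * (\<integral>\<^sup>+x. indicator S x * ennreal ((norm (df x))\<^sup>2) \<partial>lborel)))"
proof -
  have Sm[measurable]: "S \<in> sets borel" using S(1) by (rule borel_compact)
  have [measurable]: "f \<in> borel_measurable borel" "df \<in> borel_measurable borel"
    using C1grad_cont[OF f, of UNIV] C1grad_grad_cont[OF f, of UNIV] by (auto intro: borel_measurable_continuous_onI)
  define g where "g x = indicator S x * ennreal ((norm (df x))\<^sup>2)" for x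
  have gm[measurable]: "g \<in> borel_measurable borel" unfolding g_def by measurable
  \<comment> \<open>The energy on the half of the segment next to \<open>x\<close>. Since
    \<open>g\<close> is cut off outside \<open>S\<close>, the integral over \<open>x\<close> may
    later be enlarged from \<open>S\<close> to the whole plane.\<close>
  define P where "P x y = (\<integral>\<^sup>+t. indicator {0..1/2} t * g (x + t *\<^sub>R (y - x)) \<partial>lborel)" for x y
  have Pm: "(\<lambda>z. P (fst z) (snd z)) \<in> borel_measurable (borel \<Otimes>\<^sub>M borel)"
    unfolding P_def by measurable
  have Pm1[measurable]: "(\<lambda>x. P x y) \<in> borel_measurable borel" for y
    unfolding P_def by measurable
  have Pm2[measurable]: "(\<lambda>x. P y x) \<in> borel_measurable borel" for y
    unfolding P_def by measurable
  let ?G = "\<integral>\<^sup>+x. g x \<partial>lborel"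
  have half: "ennreal ((f (x + (1/2) *\<^sub>R (y - x)) - f x)\<^sup>2) \<le> ennreal (h\<^sup>2 / 2) * P x y"
    if xy: "x \<in> S" "y \<in> S" for x y
  proof -
    have dfc: "continuous_on T (\<lambda>t. (norm (df (x + t *\<^sub>R (y - x))))\<^sup>2)" for T
      by (intro continuous_intros continuous_on_compose2[OF C1grad_grad_cont[OF f, of UNIV]]) auto
    have inS: "x + t *\<^sub>R (y - x) \<in> S" if "t \<in> {0..1/2}" for t
    proof -
      have "(1 - t) *\<^sub>R x + t *\<^sub>R y \<in> S" using S(2) xy that by (auto simp: convex_def)
      then show ?thesis by (simp add: algebra_simps)
    qed
    have "P x y = (\<integral>\<^sup>+t. ennreal (indicator {0..1/2} t *\<^sub>R (norm (df (x + t *\<^sub>R (y - x))))\<^sup>2) \<partial>lborel)"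
      unfolding P_def g_def using inS by (intro nn_integral_cong) (auto split: split_indicator)
    also have "\<dots> = ennreal (\<integral>t. indicator {0..1/2} t *\<^sub>R (norm (df (x + t *\<^sub>R (y - x))))\<^sup>2 \<partial>lborel)"
      by (intro nn_integral_eq_integral borel_integrable_compact dfc) auto
    finally have PJ: "P x y = ennreal (\<integral>t. indicator {0..1/2} t *\<^sub>R (norm (df (x + t *\<^sub>R (y - x))))\<^sup>2 \<partial>lborel)" .
    have "ennreal (h\<^sup>2 / 2) * P x y = ennreal (h\<^sup>2 / 2 * (\<integral>t. indicator {0..1/2} t *\<^sub>R (norm (df (x + t *\<^sub>R (y - x))))\<^sup>2 \<partial>lborel))"
      unfolding PJ by (rule ennreal_mult'[symmetric]) simp
    then show ?thesis using half_segment_estimate[OF f h[OF xy]] by (simp add: ennreal_leI)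
  qed
  have pw: "ennreal ((f x - f y)\<^sup>2) \<le> ennreal (h\<^sup>2) * (P x y + P y x)" if xy: "x \<in> S" "y \<in> S" for x y
  proof -
    let ?m = "x + (1/2) *\<^sub>R (y - x)"
    have m: "y + (1/2) *\<^sub>R (x - y) = ?m" by (simp add: vec_eq_iff field_simps)
    have "(f x - f y)\<^sup>2 \<le> 2 * (f ?m - f x)\<^sup>2 + 2 * (f ?m - f y)\<^sup>2"
    proof -
      have "0 \<le> ((f ?m - f x) + (f ?m - f y))\<^sup>2" by simp
      then show ?thesis by (simp add: power2_eq_square algebra_simps)
    qed
    then have "ennreal ((f x - f y)\<^sup>2) \<le> 2 * ennreal ((f ?m - f x)\<^sup>2) + 2 * ennreal ((f ?m - f y)\<^sup>2)"
      by (simp add: ennreal_leI ennreal_mult[symmetric] ennreal_plus[symmetric] ennreal_numeral[symmetric] del: ennreal_plus ennreal_numeral)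
    also have "\<dots> \<le> 2 * (ennreal (h\<^sup>2/2) * P x y) + 2 * (ennreal (h\<^sup>2/2) * P y x)"
      using half[OF xy] half[OF xy(2,1)] unfolding m by (intro add_mono mult_left_mono) auto
    also have "\<dots> = ennreal (h\<^sup>2) * (P x y + P y x)"
    proof -
      have "2 * ennreal (h\<^sup>2/2) = ennreal (h\<^sup>2)"
        by (simp add: ennreal_mult[symmetric] ennreal_numeral[symmetric] del: ennreal_numeral)
      then show ?thesis by (simp add: mult.assoc[symmetric] distrib_left)
    qed
    finally show ?thesis .
  qed
  have bnd: "(\<integral>\<^sup>+x. indicator S x * P x y \<partial>lborel) \<le> 2 * ?G" for y
  proof -
    have "(\<integral>\<^sup>+x. indicator S x * P x y \<partial>lborel) \<le> (\<integral>\<^sup>+x. P x y \<partial>lborel)"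
      by (intro nn_integral_mono) (auto split: split_indicator)
    also have "\<dots> = (\<integral>\<^sup>+t. (\<integral>\<^sup>+x. indicator {0..1/2} t * g (x + t *\<^sub>R (y - x)) \<partial>lborel) \<partial>lborel)"
      unfolding P_def by (rule lborel_pair.Fubini') measurable
    also have "\<dots> \<le> (\<integral>\<^sup>+t. (4 * ?G) * indicator {0..1/2::real} t \<partial>lborel)"
    proof (rule nn_integral_mono)
      fix t :: real
      show "(\<integral>\<^sup>+x. indicator {0..1/2} t * g (x + t *\<^sub>R (y - x)) \<partial>lborel) \<le> (4 * ?G) * indicator {0..1/2} t"
        using nn_integral_convex_combination_le[OF gm, of t y] by (auto split: split_indicator)
    qed
    also have "\<dots> = 4 * ?G * ennreal (1/2)"
      by (simp add: nn_integral_cmult_indicator)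
    also have "\<dots> = 2 * ?G"
    proof -
      have "ennreal (4 * (1/2)) = ennreal 4 * ennreal (1/2)" by (rule ennreal_mult) auto
      moreover have "(4::real) * (1/2) = 2" by simp
      ultimately have "4 * ennreal (1/2) = 2" by (simp only: ennreal_numeral)
      then show ?thesis by (metis mult.assoc mult.commute)
    qed
    finally show ?thesis .
  qed
  have b1: "(\<integral>\<^sup>+y. indicator S y * (\<integral>\<^sup>+x. indicator S x * P x y \<partial>lborel) \<partial>lborel) \<le> 2 * ?G * emeasure lborel S"
  proof -
    have "(\<integral>\<^sup>+y. indicator S y * (\<integral>\<^sup>+x. indicator S x * P x y \<partial>lborel) \<partial>lborel) \<le> (\<integral>\<^sup>+y. (2 * ?G) * indicator S y \<partial>lborel)"
      using bnd by (intro nn_integral_mono) (auto split: split_indicator)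
    also have "\<dots> = 2 * ?G * emeasure lborel S" by (simp add: nn_integral_cmult_indicator)
    finally show ?thesis .
  qed
  have Pswap: "(\<lambda>z. P (snd z) (fst z)) \<in> borel_measurable (borel \<Otimes>\<^sub>M borel)"
    unfolding P_def by measurable
  have b2: "(\<integral>\<^sup>+y. indicator S y * (\<integral>\<^sup>+x. indicator S x * P y x \<partial>lborel) \<partial>lborel) \<le> 2 * ?G * emeasure lborel S"
  proof -
    have "(\<integral>\<^sup>+y. indicator S y * (\<integral>\<^sup>+x. indicator S x * P y x \<partial>lborel) \<partial>lborel) 
        = (\<integral>\<^sup>+y. (\<integral>\<^sup>+x. indicator S y * (indicator S x * P y x) \<partial>lborel) \<partial>lborel)"
      by (intro nn_integral_cong nn_integral_cmult[symmetric]) simp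
    also have "\<dots> = (\<integral>\<^sup>+x. (\<integral>\<^sup>+y. indicator S y * (indicator S x * P y x) \<partial>lborel) \<partial>lborel)"
      unfolding P_def by (rule lborel_pair.Fubini') measurable
    also have "\<dots> = (\<integral>\<^sup>+x. indicator S x * (\<integral>\<^sup>+y. indicator S y * P y x \<partial>lborel) \<partial>lborel)"
      by (subst nn_integral_cmult[symmetric]) (auto intro!: nn_integral_cong simp: mult.left_commute)
    finally show ?thesis using b1 by simp
  qed
  have "(\<integral>\<^sup>+y. indicator S y * (\<integral>\<^sup>+x. indicator S x * ennreal ((f x - f y)\<^sup>2) \<partial>lborel) \<partial>lborel)
     \<le> (\<integral>\<^sup>+y. indicator S y * (\<integral>\<^sup>+x. ennreal (h\<^sup>2) * (indicator S x * P x y + indicator S x * P y x) \<partial>lborel) \<partial>lborel)"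
  proof (rule nn_integral_mono)
    fix y
    show "indicator S y * (\<integral>\<^sup>+x. indicator S x * ennreal ((f x - f y)\<^sup>2) \<partial>lborel)
      \<le> indicator S y * (\<integral>\<^sup>+x. ennreal (h\<^sup>2) * (indicator S x * P x y + indicator S x * P y x) \<partial>lborel)"
    proof (cases "y \<in> S")
      case True
      then show ?thesis using pw[of _ y]
        by (intro mult_left_mono nn_integral_mono) (auto split: split_indicator)
    qed simp
  qed
  also have "\<dots> = (\<integral>\<^sup>+y. ennreal (h\<^sup>2) * (indicator S y * (\<integral>\<^sup>+x. indicator S x * P x y \<partial>lborel)
       + indicator S y * (\<integral>\<^sup>+x. indicator S x * P y x \<partial>lborel)) \<partial>lborel)"
  proof (rule nn_integral_cong)
    fix y
    have "(\<integral>\<^sup>+x. ennreal (h\<^sup>2) * (indicator S x * P x y + indicator S x * P y x) \<partial>lborel)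
      = ennreal (h\<^sup>2) * ((\<integral>\<^sup>+x. indicator S x * P x y \<partial>lborel) + (\<integral>\<^sup>+x. indicator S x * P y x \<partial>lborel))"
      by (subst nn_integral_cmult) (auto simp: nn_integral_add)
    then show "indicator S y * (\<integral>\<^sup>+x. ennreal (h\<^sup>2) * (indicator S x * P x y + indicator S x * P y x) \<partial>lborel)
      = ennreal (h\<^sup>2) * (indicator S y * (\<integral>\<^sup>+x. indicator S x * P x y \<partial>lborel)
       + indicator S y * (\<integral>\<^sup>+x. indicator S x * P y x \<partial>lborel))"
      by (simp only: distrib_left mult.left_commute)
  qed
  also have "\<dots> = ennreal (h\<^sup>2) * ((\<integral>\<^sup>+y. indicator S y * (\<integral>\<^sup>+x. indicator S x * P x y \<partial>lborel) \<partial>lborel)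
       + (\<integral>\<^sup>+y. indicator S y * (\<integral>\<^sup>+x. indicator S x * P y x \<partial>lborel) \<partial>lborel))"
  proof -
    have m: "(\<lambda>y. indicator S y * (\<integral>\<^sup>+x. indicator S x * P x y \<partial>lborel)) \<in> borel_measurable lborel"
         "(\<lambda>y. indicator S y * (\<integral>\<^sup>+x. indicator S x * P y x \<partial>lborel)) \<in> borel_measurable lborel"
      unfolding P_def by measurable
    show ?thesis
      by (subst nn_integral_cmult) (use m in \<open>auto simp: nn_integral_add\<close>)
  qed
  also have "\<dots> \<le> ennreal (h\<^sup>2) * (2 * ?G * emeasure lborel S + 2 * ?G * emeasure lborel S)"
    using b1 b2 by (intro mult_left_mono add_mono) auto
  also have "\<dots> = ennreal (h\<^sup>2) * (4 * (emeasure lborel S * ?G))"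
  proof -
    have a: "2 * ?G * emeasure lborel S = 2 * (emeasure lborel S * ?G)" by (simp add: ac_simps)
    have "2 * ?G * emeasure lborel S + 2 * ?G * emeasure lborel S = (2 + 2) * (emeasure lborel S * ?G)"
      unfolding a by (rule distrib_right[symmetric])
    then show ?thesis by simp
  qed
  finally show ?thesis unfolding g_def .
qed

text \<open>Expanding the square, the double integral of \<open>(f x - f y)\<^sup>2\<close> equals
  twice the measure of \<open>S\<close> times the integral of \<open>(f x - m)\<^sup>2\<close>.
  Dividing by the measure turns the 4 of the double estimate into 2.\<close>

lemma poincare_convex:
  assumes S: "compact S" "convex S" "measure lebesgue S > 0" and f: "C1grad f df"
    and h: "\<And>x y. x \<in> S \<Longrightarrow> y \<in> S \<Longrightarrow> norm (y - x) \<le> h"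
    and m: "m = sint S f / measure lebesgue S"
  shows "sint S (\<lambda>x. (f x - m)\<^sup>2) \<le> 2 * h\<^sup>2 * sint S (\<lambda>x. (norm (df x))\<^sup>2)"
proof -
  let ?L = "\<lambda>\<phi>. \<integral>x. indicator S x *\<^sub>R \<phi> x \<partial>lborel"
  let ?s = "measure lebesgue S"
  have fc: "continuous_on S f" "continuous_on S df" by (auto intro: C1grad_cont[OF f] C1grad_grad_cont[OF f])
  have conv: "sint S \<phi> = ?L \<phi>" if "continuous_on S \<phi>" for \<phi> :: "real^2 \<Rightarrow> real"
    using integral_lebesgue_on_eq_lborel(1)[OF S(1) that] .
  have i: "integrable (lebesgue_on S) \<phi>" if "continuous_on S \<phi>" for \<phi> :: "real^2 \<Rightarrow> real"
    using integral_lebesgue_on_eq_lborel(2)[OF S(1) that] .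
  have ss: "S \<in> sets lebesgue" using lmeasurable_compact[OF S(1)] by auto
  have c1: "sint S (\<lambda>x. c) = c * ?s" for c :: real
    using ss by (simp add: measure_restrict_space)
  define A where "A = sint S (\<lambda>x. (f x)\<^sup>2)"
  define B where "B = sint S f"
  define \<Gamma> where "\<Gamma> = sint S (\<lambda>x. (norm (df x))\<^sup>2)"
  have Q: "sint S (\<lambda>x. (f x - c)\<^sup>2) = A - 2 * c * B + c\<^sup>2 * ?s" for c
  proof -
    have "sint S (\<lambda>x. (f x - c)\<^sup>2) = sint S (\<lambda>x. (f x)\<^sup>2 - 2 * c * f x + c\<^sup>2)"
      by (intro Bochner_Integration.integral_cong) (auto simp: power2_diff algebra_simps)
    also have "\<dots> = sint S (\<lambda>x. (f x)\<^sup>2 - 2 * c * f x) + sint S (\<lambda>x. c\<^sup>2)"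
      by (intro Bochner_Integration.integral_add i continuous_intros fc)
    also have "sint S (\<lambda>x. (f x)\<^sup>2 - 2 * c * f x) = A - sint S (\<lambda>x. 2 * c * f x)"
      unfolding A_def by (intro Bochner_Integration.integral_diff i continuous_intros fc)
    also have "sint S (\<lambda>x. 2 * c * f x) = 2 * c * B"
      unfolding B_def by simp
    finally show ?thesis unfolding c1 by simp
  qed
  have nn: "(\<integral>\<^sup>+x. indicator S x * ennreal (\<phi> x) \<partial>lborel) = ennreal (sint S \<phi>)"
    if "continuous_on S \<phi>" "\<And>x. \<phi> x \<ge> 0" for \<phi> :: "real^2 \<Rightarrow> real"
  proof -
    have "(\<integral>\<^sup>+x. indicator S x * ennreal (\<phi> x) \<partial>lborel) = (\<integral>\<^sup>+x. ennreal (indicator S x *\<^sub>R \<phi> x) \<partial>lborel)"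
      by (intro nn_integral_cong) (auto split: split_indicator)
    also have "\<dots> = ennreal (?L \<phi>)"
      by (intro nn_integral_eq_integral borel_integrable_compact S that) (auto simp: that)
    finally show ?thesis using conv[OF that(1)] by simp
  qed
  have Q0: "0 \<le> A - 2 * c * B + c\<^sup>2 * ?s" for c unfolding Q[symmetric] by simp
  have "(\<integral>\<^sup>+y. indicator S y * (\<integral>\<^sup>+x. indicator S x * ennreal ((f x - f y)\<^sup>2) \<partial>lborel) \<partial>lborel)
     = (\<integral>\<^sup>+y. indicator S y * ennreal (A - 2 * f y * B + (f y)\<^sup>2 * ?s) \<partial>lborel)"
    by (intro nn_integral_cong arg_cong2[of _ _ _ _ "(*)"] refl, subst nn) (auto intro!: continuous_intros fc simp: Q)
  also have "\<dots> = ennreal (sint S (\<lambda>y. A - 2 * f y * B + (f y)\<^sup>2 * ?s))"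
    using Q0 by (intro nn continuous_intros fc)
  also have "sint S (\<lambda>y. A - 2 * f y * B + (f y)\<^sup>2 * ?s) = 2 * (?s * A - B\<^sup>2)"
  proof -
    have "sint S (\<lambda>y. A - 2 * f y * B + (f y)\<^sup>2 * ?s)
       = sint S (\<lambda>y. A - (2 * B) * f y) + sint S (\<lambda>y. ?s * (f y)\<^sup>2)"
      by (subst Bochner_Integration.integral_add[symmetric]) (auto intro!: i continuous_intros fc Bochner_Integration.integral_cong simp: algebra_simps)
    also have "sint S (\<lambda>y. A - (2 * B) * f y) = sint S (\<lambda>y. A) - sint S (\<lambda>y. (2 * B) * f y)"
      by (intro Bochner_Integration.integral_diff i continuous_intros fc)
    also have "sint S (\<lambda>y. (2 * B) * f y) = 2 * B * B" by (simp add: B_def)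
    also have "sint S (\<lambda>y. ?s * (f y)\<^sup>2) = ?s * A" by (simp add: A_def)
    also have "sint S (\<lambda>y. A) - 2 * B * B + ?s * A = 2 * (?s * A - B\<^sup>2)"
      unfolding c1 by (simp add: power2_eq_square algebra_simps)
    finally show ?thesis .
  qed
  finally have "ennreal (2 * (?s * A - B\<^sup>2)) \<le> ennreal (h\<^sup>2) * (4 * (emeasure lborel S * (\<integral>\<^sup>+x. indicator S x * ennreal ((norm (df x))\<^sup>2) \<partial>lborel)))"
    using poincare_convex_double[OF S(1,2) f h] by simp
  also have "(\<integral>\<^sup>+x. indicator S x * ennreal ((norm (df x))\<^sup>2) \<partial>lborel) = ennreal \<Gamma>"
    unfolding \<Gamma>_def by (intro nn continuous_intros fc) auto
  also have "emeasure lborel S = ennreal ?s"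
  proof -
    have "emeasure lborel S = emeasure lebesgue S" using borel_compact[OF S(1)] by simp
    then show ?thesis using emeasure_eq_ennreal_measure[OF fmeasurableD2[OF lmeasurable_compact[OF S(1)]]] by simp
  qed
  also have "ennreal (h\<^sup>2) * (4 * (ennreal ?s * ennreal \<Gamma>)) = ennreal (h\<^sup>2 * (4 * (?s * \<Gamma>)))"
    by (simp add: ennreal_mult \<Gamma>_def)
  finally have "2 * (?s * A - B\<^sup>2) \<le> h\<^sup>2 * (4 * (?s * \<Gamma>))"
    by (subst (asm) ennreal_le_iff) (auto simp: \<Gamma>_def)
  also have "h\<^sup>2 * (4 * (?s * \<Gamma>)) = 2 * (?s * (2 * h\<^sup>2 * \<Gamma>))" by simp
  finally have "?s * A - B\<^sup>2 \<le> ?s * (2 * h\<^sup>2 * \<Gamma>)" by (rule mult_left_le_imp_le) simp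
  moreover have "?s * (A - B\<^sup>2 / ?s) = ?s * A - B\<^sup>2" using S(3) by (simp add: right_diff_distrib)
  ultimately have "?s * (A - B\<^sup>2 / ?s) \<le> ?s * (2 * h\<^sup>2 * \<Gamma>)" by simp
  then have "A - B\<^sup>2 / ?s \<le> 2 * h\<^sup>2 * \<Gamma>" using S(3) by simp
  moreover have "A - 2 * m * B + m\<^sup>2 * ?s = A - B\<^sup>2 / ?s"
    unfolding m B_def[symmetric] using S(3) by (simp add: field_simps power2_eq_square)
  ultimately show ?thesis unfolding Q \<Gamma>_def by simp
qed

section \<open>Trace and interpolation estimates on one triangle\<close>

lemma continuous_Cauchy_Schwarz:
  assumes "compact S" "continuous_on S f" "continuous_on S g"
  shows "(sint S (\<lambda>x. f x * g x))\<^sup>2 \<le> sint S (\<lambda>x. (f x)\<^sup>2) * sint S (\<lambda>x. (g x)\<^sup>2)"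
proof (rule Cauchy_Schwarz_integral_sq)
  have i: "integrable (lebesgue_on S) \<phi>" if "continuous_on S \<phi>" for \<phi> :: "real^2 \<Rightarrow> real"
    by (rule integrable_on_compact[OF assms(1) that])
  show "f \<in> borel_measurable (lebesgue_on S)" "g \<in> borel_measurable (lebesgue_on S)"
    using i[OF assms(2)] i[OF assms(3)] by auto
  show "integrable (lebesgue_on S) (\<lambda>x. (f x)\<^sup>2)" "integrable (lebesgue_on S) (\<lambda>x. (g x)\<^sup>2)"
    by (intro i continuous_intros assms)+
qed

lemma sint_const: "compact S \<Longrightarrow> sint S (\<lambda>x. c) = c * measure lebesgue S"
  using lmeasurable_compact[of S] by (simp add: measure_restrict_space fmeasurableD)

lemma sint_mono:
  assumes "compact S" "continuous_on S f" "continuous_on S g" "\<And>x. x \<in> S \<Longrightarrow> f x \<le> g x"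
  shows "sint S f \<le> sint S g"
  by (intro integral_mono integrable_on_compact assms) (use assms in auto)

text \<open>\<open>D\<close> is twice the area and \<open>h\<close> any bound for the diameter. The
  side \<open>q r\<close> is the distinguished edge and \<open>p\<close> the vertex opposite to it;
  the other edges are reached by renaming the vertices.\<close>

locale triangle =
  fixes p q r :: "real^2" and T :: "(real^2) set" and D :: real and h :: real
  assumes cr: "cr (q - p) (r - p) \<noteq> 0"
    and T_def: "T = convex hull {p,q,r}" and D_def: "D = \<bar>cr (q - p) (r - p)\<bar>"
    and h: "\<And>x y. x \<in> T \<Longrightarrow> y \<in> T \<Longrightarrow> norm (y - x) \<le> h"
begin

lemma compact_T: "compact T" and convex_T: "convex T"
  by (auto simp: T_def compact_convex_hull)

lemma D_pos: "D > 0" using cr by (simp add: D_def)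

lemma verts_in: "p \<in> T" "q \<in> T" "r \<in> T"
  by (auto simp: T_def intro: hull_inc)

lemma h_pos: "h > 0"
proof -
  have "q \<noteq> p" using cr by (auto simp: cr_def)
  then have "norm (q - p) > 0" by simp
  then show ?thesis using h[OF verts_in(1,2)] by linarith
qed

lemma measure_T: "measure lebesgue T = D / 2"
  using measure_triangle[OF cr] by (simp add: T_def D_def)

lemma D_le: "D \<le> h\<^sup>2"
proof -
  have e: "(cr u v)\<^sup>2 \<le> (norm u)\<^sup>2 * (norm v)\<^sup>2" for u v
  proof -
    have "(cr u v)\<^sup>2 + (u \<bullet> v)\<^sup>2 = (norm u)\<^sup>2 * (norm v)\<^sup>2"
      by (simp add: cr_def inner_real2 norm_real2) algebra
    then show ?thesis using zero_le_power2[of "u \<bullet> v"] by linarith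
  qed
  have "D\<^sup>2 \<le> (norm (q - p))\<^sup>2 * (norm (r - p))\<^sup>2" using e[of "q - p" "r - p"] by (simp add: D_def)
  also have "\<dots> \<le> h\<^sup>2 * h\<^sup>2" by (intro mult_mono power_mono h verts_in) auto
  finally have "D\<^sup>2 \<le> (h\<^sup>2)\<^sup>2" by (simp add: power2_eq_square)
  then show ?thesis by (rule power2_le_imp_le) simp
qed

lemma sint_inner_bound:
  assumes df: "continuous_on T df" and v: "continuous_on T v" "\<And>x. x \<in> T \<Longrightarrow> norm (v x) \<le> h"
  shows "(sint T (\<lambda>x. df x \<bullet> v x))\<^sup>2 \<le> D / 2 * (h\<^sup>2 * sint T (\<lambda>x. (norm (df x))\<^sup>2))"
proof -
  have "(sint T (\<lambda>x. 1 * (df x \<bullet> v x)))\<^sup>2 \<le> sint T (\<lambda>x. 1\<^sup>2) * sint T (\<lambda>x. (df x \<bullet> v x)\<^sup>2)"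
    by (intro continuous_Cauchy_Schwarz compact_T continuous_intros df v)
  also have "sint T (\<lambda>x. 1\<^sup>2) = D / 2" using sint_const[OF compact_T, of 1] measure_T by simp
  also have "sint T (\<lambda>x. (df x \<bullet> v x)\<^sup>2) \<le> sint T (\<lambda>x. h\<^sup>2 * (norm (df x))\<^sup>2)"
  proof (intro sint_mono compact_T continuous_intros df v)
    fix x assume "x \<in> T"
    have "\<bar>df x \<bullet> v x\<bar> \<le> norm (df x) * norm (v x)" by (rule Cauchy_Schwarz_ineq2)
    also have "\<dots> \<le> norm (df x) * h" using v(2)[OF \<open>x \<in> T\<close>] by (intro mult_left_mono) auto
    finally have "\<bar>df x \<bullet> v x\<bar>\<^sup>2 \<le> (norm (df x) * h)\<^sup>2" by (intro power_mono) auto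
    then show "(df x \<bullet> v x)\<^sup>2 \<le> h\<^sup>2 * (norm (df x))\<^sup>2" by (simp add: power_mult_distrib mult.commute)
  qed
  finally show ?thesis using D_pos by (simp add: mult_left_mono)
qed

text \<open>The chord identity and Cauchy-Schwarz, divided by \<open>D\<^sup>2\<close>. The factor
  \<open>h\<^sup>2 / (2 * D)\<close> is invariant under scaling.\<close>

lemma edge_mean_diff:
  assumes f: "C1grad f df"
  shows "(emean q r f - emean p r f)\<^sup>2 \<le> h\<^sup>2 / (2 * D) * sint T (\<lambda>x. (norm (df x))\<^sup>2)"
proof -
  have "(D * (emean q r f - emean p r f))\<^sup>2 \<le> D / 2 * (h\<^sup>2 * sint T (\<lambda>x. (norm (df x))\<^sup>2))"
    using triangle_integral_directional[OF f cr] sint_inner_bound[OF C1grad_grad_cont[OF f], of "\<lambda>x. q - p"]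
      h[OF verts_in(1,2)] by (simp add: T_def D_def)
  moreover have "D / 2 * (h\<^sup>2 * c) = D\<^sup>2 * (h\<^sup>2 / (2 * D) * c)" for c
    using D_pos by (simp add: power2_eq_square)
  ultimately have "D\<^sup>2 * (emean q r f - emean p r f)\<^sup>2 \<le> D\<^sup>2 * (h\<^sup>2 / (2 * D) * sint T (\<lambda>x. (norm (df x))\<^sup>2))"
    by (simp only: power_mult_distrib)
  then show ?thesis by (rule mult_left_le_imp_le) (use D_pos in simp)
qed

text \<open>The edge mean is compared with the mean \<open>m\<close> over the triangle: by the trace
  identity \<open>D\<close> times their difference is the integral of
  \<open>df x \<bullet> (x - p)\<close>. The 5 rounds up 2 * 2 + 1/2, from doubling the Poincare
  constant and adding the difference of the means.\<close>

lemma poincare_edge: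
  assumes f: "C1grad f df"
  shows "sint T (\<lambda>x. (f x - emean q r f)\<^sup>2) \<le> 5 * h\<^sup>2 * sint T (\<lambda>x. (norm (df x))\<^sup>2)"
proof -
  let ?\<Gamma> = "sint T (\<lambda>x. (norm (df x))\<^sup>2)"
  let ?\<mu> = "emean q r f"
  define m where "m = sint T f / measure lebesgue T"
  note [continuous_intros] = C1grad_cont[OF f] C1grad_grad_cont[OF f]
  have i: "integrable (lebesgue_on T) \<phi>" if "continuous_on T \<phi>" for \<phi> :: "real^2 \<Rightarrow> real"
    by (rule integrable_on_compact[OF compact_T that])
  have P: "sint T (\<lambda>x. (f x - m)\<^sup>2) \<le> 2 * h\<^sup>2 * ?\<Gamma>"
    by (rule poincare_convex[OF compact_T convex_T _ f h m_def]) (use D_pos in \<open>auto simp: measure_T\<close>)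
  have "sint T (\<lambda>x. 2 * f x + df x \<bullet> (x - p)) = sint T (\<lambda>x. 2 * f x) + sint T (\<lambda>x. df x \<bullet> (x - p))"
    by (intro Bochner_Integration.integral_add i continuous_intros)
  then have "D * ?\<mu> = 2 * sint T f + sint T (\<lambda>x. df x \<bullet> (x - p))"
    using triangle_trace_identity[OF f cr] by (simp add: T_def D_def)
  moreover have "2 * sint T f = D * m" using D_pos by (simp add: m_def measure_T)
  ultimately have "D * (?\<mu> - m) = sint T (\<lambda>x. df x \<bullet> (x - p))" by (simp add: algebra_simps)
  then have "(D * (?\<mu> - m))\<^sup>2 \<le> D / 2 * (h\<^sup>2 * ?\<Gamma>)"
    using sint_inner_bound[OF C1grad_grad_cont[OF f], of "\<lambda>x. x - p"] h[OF verts_in(1)]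
    by (simp add: continuous_intros)
  moreover have "(D * (?\<mu> - m))\<^sup>2 = D * (D * (?\<mu> - m)\<^sup>2)" by (simp add: power2_eq_square)
  moreover have "D / 2 * (h\<^sup>2 * ?\<Gamma>) = D * (h\<^sup>2 * ?\<Gamma> / 2)" by simp
  ultimately have "D * (D * (?\<mu> - m)\<^sup>2) \<le> D * (h\<^sup>2 * ?\<Gamma> / 2)" by simp
  then have M: "D * (m - ?\<mu>)\<^sup>2 \<le> h\<^sup>2 * ?\<Gamma> / 2" using D_pos by (simp add: power2_commute)
  have "sint T (\<lambda>x. (f x - ?\<mu>)\<^sup>2) \<le> sint T (\<lambda>x. 2 * (f x - m)\<^sup>2 + 2 * (m - ?\<mu>)\<^sup>2)"
  proof (intro sint_mono compact_T continuous_intros)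
    fix x
    have "0 \<le> ((f x - m) - (m - ?\<mu>))\<^sup>2" by simp
    then show "(f x - ?\<mu>)\<^sup>2 \<le> 2 * (f x - m)\<^sup>2 + 2 * (m - ?\<mu>)\<^sup>2"
      by (simp add: power2_eq_square algebra_simps)
  qed
  also have "\<dots> = sint T (\<lambda>x. 2 * (f x - m)\<^sup>2) + sint T (\<lambda>x. 2 * (m - ?\<mu>)\<^sup>2)"
    by (intro Bochner_Integration.integral_add i continuous_intros)
  also have "sint T (\<lambda>x. 2 * (f x - m)\<^sup>2) = 2 * sint T (\<lambda>x. (f x - m)\<^sup>2)" by simp
  also have "sint T (\<lambda>x. 2 * (m - ?\<mu>)\<^sup>2) = D * (m - ?\<mu>)\<^sup>2"
    using sint_const[OF compact_T, of "2 * (m - ?\<mu>)\<^sup>2"] measure_T by simp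
  finally have "sint T (\<lambda>x. (f x - ?\<mu>)\<^sup>2) \<le> 2 * (2 * h\<^sup>2 * ?\<Gamma>) + h\<^sup>2 * ?\<Gamma> / 2" using P M by linarith
  moreover have "0 \<le> h\<^sup>2 * ?\<Gamma>" by simp
  ultimately show ?thesis by linarith
qed

text \<open>The trace identity applied to the square of \<open>w\<close>.\<close>

lemma trace_equality:
  assumes w: "C1grad w dw"
  shows "D * emean q r (\<lambda>x. (w x)\<^sup>2) = 2 * sint T (\<lambda>x. (w x)\<^sup>2) + 2 * sint T (\<lambda>x. w x * (dw x \<bullet> (x - p)))"
proof -
  note [continuous_intros] = C1grad_cont[OF w] C1grad_grad_cont[OF w]
  have i: "integrable (lebesgue_on T) \<phi>" if "continuous_on T \<phi>" for \<phi> :: "real^2 \<Rightarrow> real"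
    by (rule integrable_on_compact[OF compact_T that])
  have "(\<lambda>x. w x *\<^sub>R dw x + w x *\<^sub>R dw x) = (\<lambda>x. (2 * w x) *\<^sub>R dw x)" by (auto simp: fun_eq_iff vec_eq_iff)
  then have "C1grad (\<lambda>x. (w x)\<^sup>2) (\<lambda>x. (2 * w x) *\<^sub>R dw x)" using C1grad_mult[OF w w] by (simp add: power2_eq_square)
  from triangle_trace_identity[OF this cr]
  have "D * emean q r (\<lambda>x. (w x)\<^sup>2) = sint T (\<lambda>x. 2 * (w x)\<^sup>2 + 2 * (w x * (dw x \<bullet> (x - p))))"
    by (simp add: T_def D_def mult.assoc)
  also have "\<dots> = sint T (\<lambda>x. 2 * (w x)\<^sup>2) + sint T (\<lambda>x. 2 * (w x * (dw x \<bullet> (x - p))))"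
    by (intro Bochner_Integration.integral_add i continuous_intros)
  finally show ?thesis by simp
qed

lemma trace_inequality:
  assumes w: "C1grad w dw"
  shows "D * emean q r (\<lambda>x. (w x)\<^sup>2) \<le> 3 * sint T (\<lambda>x. (w x)\<^sup>2) + h\<^sup>2 * sint T (\<lambda>x. (norm (dw x))\<^sup>2)"
proof -
  note [continuous_intros] = C1grad_cont[OF w] C1grad_grad_cont[OF w]
  have i: "integrable (lebesgue_on T) \<phi>" if "continuous_on T \<phi>" for \<phi> :: "real^2 \<Rightarrow> real"
    by (rule integrable_on_compact[OF compact_T that])
  have "sint T (\<lambda>x. 2 * (w x * (dw x \<bullet> (x - p)))) \<le> sint T (\<lambda>x. (w x)\<^sup>2 + h\<^sup>2 * (norm (dw x))\<^sup>2)"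
  proof (intro sint_mono compact_T continuous_intros)
    fix x assume x: "x \<in> T"
    let ?b = "dw x \<bullet> (x - p)"
    have "\<bar>?b\<bar> \<le> norm (dw x) * norm (x - p)" by (rule Cauchy_Schwarz_ineq2)
    also have "\<dots> \<le> norm (dw x) * h" using h[OF verts_in(1) x] by (intro mult_left_mono) auto
    finally have "\<bar>?b\<bar>\<^sup>2 \<le> (norm (dw x) * h)\<^sup>2" by (intro power_mono) auto
    then have "?b\<^sup>2 \<le> h\<^sup>2 * (norm (dw x))\<^sup>2" by (simp add: power_mult_distrib mult.commute)
    moreover have "0 \<le> (w x - ?b)\<^sup>2" by simp
    then have "2 * (w x * ?b) \<le> (w x)\<^sup>2 + ?b\<^sup>2" by (simp add: power2_diff)
    ultimately show "2 * (w x * ?b) \<le> (w x)\<^sup>2 + h\<^sup>2 * (norm (dw x))\<^sup>2" by linarith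
  qed
  also have "\<dots> = sint T (\<lambda>x. (w x)\<^sup>2) + sint T (\<lambda>x. h\<^sup>2 * (norm (dw x))\<^sup>2)"
    by (intro Bochner_Integration.integral_add i continuous_intros)
  finally show ?thesis using trace_equality[OF w] by simp
qed

text \<open>In contrast to the additive form, the right side tends to 0 when \<open>w\<close> tends
  to 0 in L2 while its gradients merely stay bounded.\<close>

lemma trace_inequality_product:
  assumes w: "C1grad w dw"
  shows "D * emean q r (\<lambda>x. (w x)\<^sup>2) \<le> 2 * sint T (\<lambda>x. (w x)\<^sup>2)
     + 2 * h * (sqrt (sint T (\<lambda>x. (w x)\<^sup>2)) * sqrt (sint T (\<lambda>x. (norm (dw x))\<^sup>2)))"
proof -
  note [continuous_intros] = C1grad_cont[OF w] C1grad_grad_cont[OF w]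
  have "(sint T (\<lambda>x. w x * (dw x \<bullet> (x - p))))\<^sup>2 \<le> sint T (\<lambda>x. (w x)\<^sup>2) * sint T (\<lambda>x. (dw x \<bullet> (x - p))\<^sup>2)"
    by (intro continuous_Cauchy_Schwarz compact_T continuous_intros)
  also have "\<dots> \<le> sint T (\<lambda>x. (w x)\<^sup>2) * sint T (\<lambda>x. h\<^sup>2 * (norm (dw x))\<^sup>2)"
  proof (intro mult_left_mono sint_mono compact_T continuous_intros)
    fix x assume x: "x \<in> T"
    let ?b = "dw x \<bullet> (x - p)"
    have "\<bar>?b\<bar> \<le> norm (dw x) * norm (x - p)" by (rule Cauchy_Schwarz_ineq2)
    also have "\<dots> \<le> norm (dw x) * h" using h[OF verts_in(1) x] by (intro mult_left_mono) auto
    finally have "\<bar>?b\<bar>\<^sup>2 \<le> (norm (dw x) * h)\<^sup>2" by (intro power_mono) auto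
    then show "?b\<^sup>2 \<le> h\<^sup>2 * (norm (dw x))\<^sup>2" by (simp add: power_mult_distrib mult.commute)
  qed simp
  finally have "sqrt ((sint T (\<lambda>x. w x * (dw x \<bullet> (x - p))))\<^sup>2)
     \<le> sqrt (h\<^sup>2 * (sint T (\<lambda>x. (w x)\<^sup>2) * sint T (\<lambda>x. (norm (dw x))\<^sup>2)))"
    by (intro real_sqrt_le_mono) (simp add: mult_ac)
  then have "\<bar>sint T (\<lambda>x. w x * (dw x \<bullet> (x - p)))\<bar>
     \<le> h * (sqrt (sint T (\<lambda>x. (w x)\<^sup>2)) * sqrt (sint T (\<lambda>x. (norm (dw x))\<^sup>2)))"
    using h_pos by (simp add: real_sqrt_mult)
  then show ?thesis using trace_equality[OF w] by linarith
qed

lemma affine_bound: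
  assumes "\<bar>c + d \<bullet> p - \<mu>\<bar> \<le> X" "\<bar>c + d \<bullet> q - \<mu>\<bar> \<le> X" "\<bar>c + d \<bullet> r - \<mu>\<bar> \<le> X" "x \<in> T"
  shows "\<bar>c + d \<bullet> x - \<mu>\<bar> \<le> X"
proof -
  obtain a b e where abe: "0 \<le> a" "0 \<le> b" "0 \<le> e" "a + b + e = 1" "x = a *\<^sub>R p + b *\<^sub>R q + e *\<^sub>R r"
    using assms(4) unfolding T_def convex_hull_3 by blast
  have "c + d \<bullet> x - \<mu> = (a + b + e) * (c - \<mu>) + d \<bullet> x" using abe(4) by simp
  also have "\<dots> = a * (c + d \<bullet> p - \<mu>) + b * (c + d \<bullet> q - \<mu>) + e * (c + d \<bullet> r - \<mu>)"
    unfolding abe(5) by (simp add: inner_add_right algebra_simps)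
  finally have "\<bar>c + d \<bullet> x - \<mu>\<bar> \<le> \<bar>a * (c + d \<bullet> p - \<mu>)\<bar> + \<bar>b * (c + d \<bullet> q - \<mu>)\<bar> + \<bar>e * (c + d \<bullet> r - \<mu>)\<bar>" by linarith
  also have "\<dots> \<le> a * X + b * X + e * X"
    using abe assms by (simp add: abs_mult add_mono mult_left_mono)
  also have "\<dots> = X" using abe(4) by (metis distrib_right mult_1)
  finally show ?thesis .
qed

text \<open>An inscribed ball has area at least \<open>\<rho>\<^sup>2\<close>. In this form shape
  regularity turns the scaling invariant factors of the edge estimates into powers of
  \<open>K\<close>.\<close>

lemma D_ge:
  assumes "cball c0 \<rho> \<subseteq> T" "h \<le> K * \<rho>" "\<rho> > 0"
  shows "h\<^sup>2 \<le> K\<^sup>2 * D"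
proof -
  have K: "K \<ge> 0" using assms h_pos by (metis less_le_trans linorder_not_le mult_neg_pos order_less_imp_le)
  have "measure lebesgue (cball c0 \<rho>) \<le> measure lebesgue T"
    by (intro measure_mono_fmeasurable assms lmeasurable_compact compact_T) auto
  then have "pi * \<rho>\<^sup>2 \<le> D / 2"
    using content_cball[of \<rho> c0] assms(3) unit_ball_vol_2 by (simp add: measure_T)
  moreover have "\<rho>\<^sup>2 \<le> pi * \<rho>\<^sup>2" using pi_ge_two mult_right_mono[of 1 pi "\<rho>\<^sup>2"] by simp
  ultimately have "\<rho>\<^sup>2 \<le> D" using D_pos by linarith
  moreover have "h\<^sup>2 \<le> K\<^sup>2 * \<rho>\<^sup>2" using power_mono[OF assms(2), of 2] h_pos by (simp add: power_mult_distrib)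
  ultimately show ?thesis by (meson mult_left_mono order_trans zero_le_power2)
qed

text \<open>\<open>X\<close> measures how far the vertex values are from the edge mean. For the L2
  bound, \<open>f\<close> and the affine function are both compared with that constant; for the
  gradient bound, an inverse estimate converts the oscillation of the affine function into its
  slope.\<close>

lemma local_interpolation:
  assumes f: "C1grad f df" and ball: "cball c0 \<rho> \<subseteq> T" "h \<le> K * \<rho>" "\<rho> > 0"
    and X: "\<bar>c + d \<bullet> p - emean q r f\<bar> \<le> X" "\<bar>c + d \<bullet> q - emean q r f\<bar> \<le> X" "\<bar>c + d \<bullet> r - emean q r f\<bar> \<le> X"
  shows "sint T (\<lambda>x. (f x - (c + d \<bullet> x))\<^sup>2) \<le> h\<^sup>2 * (10 * sint T (\<lambda>x. (norm (df x))\<^sup>2) + X\<^sup>2)"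
    and "sint T (\<lambda>x. (norm (df x - d))\<^sup>2) \<le> 2 * sint T (\<lambda>x. (norm (df x))\<^sup>2) + K\<^sup>2 * X\<^sup>2"
proof -
  let ?\<Gamma> = "sint T (\<lambda>x. (norm (df x))\<^sup>2)"
  let ?\<mu> = "emean q r f"
  note [continuous_intros] = C1grad_cont[OF f] C1grad_grad_cont[OF f]
  have i: "integrable (lebesgue_on T) \<phi>" if "continuous_on T \<phi>" for \<phi> :: "real^2 \<Rightarrow> real"
    by (rule integrable_on_compact[OF compact_T that])
  have K: "K > 0" using ball h_pos by (metis less_le_trans linorder_not_le mult_nonpos_nonneg order_less_imp_le)
  have X0: "X \<ge> 0" using X(1) by linarith
  have ab: "\<bar>c + d \<bullet> x - ?\<mu>\<bar> \<le> X" if "x \<in> T" for x using affine_bound[OF X that] .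
  have "sint T (\<lambda>x. (f x - (c + d \<bullet> x))\<^sup>2) \<le> sint T (\<lambda>x. 2 * (f x - ?\<mu>)\<^sup>2 + 2 * X\<^sup>2)"
  proof (intro sint_mono compact_T continuous_intros)
    fix x assume "x \<in> T"
    from power_mono[OF ab[OF this], of 2] have "(c + d \<bullet> x - ?\<mu>)\<^sup>2 \<le> X\<^sup>2" by simp
    moreover have "0 \<le> ((f x - ?\<mu>) + (c + d \<bullet> x - ?\<mu>))\<^sup>2" by simp
    then have "(f x - (c + d \<bullet> x))\<^sup>2 \<le> 2 * (f x - ?\<mu>)\<^sup>2 + 2 * (c + d \<bullet> x - ?\<mu>)\<^sup>2"
      by (simp add: power2_eq_square algebra_simps)
    ultimately show "(f x - (c + d \<bullet> x))\<^sup>2 \<le> 2 * (f x - ?\<mu>)\<^sup>2 + 2 * X\<^sup>2" by linarith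
  qed
  also have "\<dots> = sint T (\<lambda>x. 2 * (f x - ?\<mu>)\<^sup>2) + sint T (\<lambda>x. 2 * X\<^sup>2)"
    by (intro Bochner_Integration.integral_add i continuous_intros)
  also have "sint T (\<lambda>x. 2 * X\<^sup>2) = D * X\<^sup>2" using sint_const[OF compact_T, of "2 * X\<^sup>2"] measure_T by simp
  also have "\<dots> \<le> h\<^sup>2 * X\<^sup>2" using D_le by (intro mult_right_mono) auto
  also have "sint T (\<lambda>x. 2 * (f x - ?\<mu>)\<^sup>2) \<le> 2 * (5 * h\<^sup>2 * ?\<Gamma>)"
    using poincare_edge[OF f] by simp
  finally show "sint T (\<lambda>x. (f x - (c + d \<bullet> x))\<^sup>2) \<le> h\<^sup>2 * (10 * ?\<Gamma> + X\<^sup>2)"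
    by (simp add: algebra_simps)
  \<comment> \<open>Along \<open>d\<close> the affine function varies by
    \<open>2 * norm d * \<rho>\<close> across the inscribed ball, but on \<open>T\<close> its values
    lie within \<open>X\<close> of the edge mean.\<close>
  have dle: "norm d * \<rho> \<le> X"
  proof (cases "d = 0")
    case False
    let ?e = "(\<rho> / norm d) *\<^sub>R d"
    have "c0 + ?e \<in> cball c0 \<rho>" "c0 - ?e \<in> cball c0 \<rho>" using ball(3) False by (auto simp: dist_norm)
    then have "\<bar>c + d \<bullet> (c0 + ?e) - ?\<mu>\<bar> \<le> X" "\<bar>c + d \<bullet> (c0 - ?e) - ?\<mu>\<bar> \<le> X" using ab ball(1) by blast+
    then have "2 * (d \<bullet> ?e) \<le> 2 * X" unfolding inner_add_right inner_diff_right by linarith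
    moreover have "d \<bullet> ?e = norm d * \<rho>"
      using False by (simp add: dot_square_norm power2_eq_square)
    ultimately show ?thesis by simp
  qed (use X0 in simp)
  have "norm d * h \<le> norm d * (K * \<rho>)" using ball(2) by (intro mult_left_mono) auto
  also have "\<dots> = K * (norm d * \<rho>)" by simp
  also have "\<dots> \<le> K * X" using dle K by (intro mult_left_mono) auto
  finally have "(norm d * h)\<^sup>2 \<le> (K * X)\<^sup>2" using h_pos by (intro power_mono) auto
  then have dh: "(norm d)\<^sup>2 * h\<^sup>2 \<le> K\<^sup>2 * X\<^sup>2" by (simp add: power_mult_distrib)
  have "sint T (\<lambda>x. (norm (df x - d))\<^sup>2) \<le> sint T (\<lambda>x. 2 * (norm (df x))\<^sup>2 + 2 * (norm d)\<^sup>2)"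
  proof (intro sint_mono compact_T continuous_intros)
    fix x
    have "norm (df x - d) \<le> norm (df x) + norm d" by (rule norm_triangle_ineq4)
    then have "(norm (df x - d))\<^sup>2 \<le> (norm (df x) + norm d)\<^sup>2" by (intro power_mono) auto
    also have "\<dots> \<le> 2 * (norm (df x))\<^sup>2 + 2 * (norm d)\<^sup>2"
      using zero_le_power2[of "norm (df x) - norm d"] by (simp add: power2_eq_square algebra_simps)
    finally show "(norm (df x - d))\<^sup>2 \<le> 2 * (norm (df x))\<^sup>2 + 2 * (norm d)\<^sup>2" .
  qed
  also have "\<dots> = sint T (\<lambda>x. 2 * (norm (df x))\<^sup>2) + sint T (\<lambda>x. 2 * (norm d)\<^sup>2)"
    by (intro Bochner_Integration.integral_add i continuous_intros)
  also have "sint T (\<lambda>x. 2 * (norm d)\<^sup>2) = (norm d)\<^sup>2 * D" using sint_const[OF compact_T, of "2 * (norm d)\<^sup>2"] measure_T by simp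
  also have "\<dots> \<le> (norm d)\<^sup>2 * h\<^sup>2" using D_le by (intro mult_left_mono) auto
  also have "\<dots> \<le> K\<^sup>2 * X\<^sup>2" by (rule dh)
  finally show "sint T (\<lambda>x. (norm (df x - d))\<^sup>2) \<le> 2 * ?\<Gamma> + K\<^sup>2 * X\<^sup>2" by simp
qed

end

section \<open>Approximation of Lipschitz functions by compactly supported C1 functions\<close>

text \<open>The Steklov average along one coordinate axis.\<close>

definition axis_avg :: "2 \<Rightarrow> real \<Rightarrow> (real^2 \<Rightarrow> real) \<Rightarrow> real^2 \<Rightarrow> real" where
  "axis_avg i \<delta> g x = integral {-\<delta>..\<delta>} (\<lambda>s. g (x + s *\<^sub>R axis i 1)) / (2 * \<delta>)"

lemma continuous_axis_avg:
  assumes g: "continuous_on UNIV g" and "\<delta> > 0"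
  shows "continuous_on UNIV (axis_avg i \<delta> g)"
proof -
  have "continuous_on UNIV (\<lambda>x. integral (cbox (-\<delta>) \<delta>) (\<lambda>s. g (x + s *\<^sub>R axis i 1)))"
    by (rule integral_continuous_on_param)
      (auto simp: case_prod_beta intro!: continuous_on_compose2[OF g] continuous_intros)
  then show ?thesis
    unfolding axis_avg_def[abs_def] using assms(2) by (intro continuous_intros) auto
qed

text \<open>A sliding integral changes only at its two ends, so a merely continuous \<open>g\<close>
  acquires a derivative, and this derivative is again continuous.\<close>

lemma axis_avg_has_derivative:
  assumes g: "continuous_on UNIV g" and \<delta>: "\<delta> > 0"
  shows "((\<lambda>u. axis_avg i \<delta> g (x + u *\<^sub>R axis i 1)) has_real_derivative
     (g (x + (u + \<delta>) *\<^sub>R axis i 1) - g (x + (u - \<delta>) *\<^sub>R axis i 1)) / (2 * \<delta>)) (at u)"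
proof -
  let ?\<gamma> = "\<lambda>s. g (x + s *\<^sub>R axis i 1)"
  \<comment> \<open>The margin of 2 keeps \<open>u' - \<delta>\<close> and
    \<open>u' + \<delta>\<close> in the open interval for all \<open>u'\<close> within distance 1 of
    \<open>u\<close>, where the antiderivative has a two-sided derivative.\<close>
  let ?a = "u - \<delta> - 2" and ?b = "u + \<delta> + 2"
  have "continuous_on {?a..?b} ?\<gamma>"
    by (intro continuous_on_compose2[OF g] continuous_intros) auto
  then obtain G where G: "\<And>s. s \<in> {?a..?b} \<Longrightarrow> (G has_vector_derivative ?\<gamma> s) (at s within {?a..?b})"
    using antiderivative_continuous[of ?a ?b ?\<gamma>] by blast
  have G': "(G has_real_derivative ?\<gamma> s) (at s)" if "s \<in> {?a<..<?b}" for s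
  proof -
    have "(G has_vector_derivative ?\<gamma> s) (at s within {?a..?b})" using that by (intro G) auto
    moreover have "at s within {?a..?b} = at s" using that by (intro at_within_interior) auto
    ultimately show ?thesis by (simp add: has_real_derivative_iff_has_vector_derivative)
  qed
  have eq: "axis_avg i \<delta> g (x + u' *\<^sub>R axis i 1) = (G (u' + \<delta>) - G (u' - \<delta>)) / (2 * \<delta>)" if u': "u' \<in> {u - 1<..<u + 1}" for u'
  proof -
    have "((\<lambda>s. ?\<gamma> (u' + s)) has_integral (G (u' + \<delta>) - G (u' + - \<delta>))) {-\<delta>..\<delta>}"
    proof (rule fundamental_theorem_of_calculus)
      fix s assume s: "s \<in> {-\<delta>..\<delta>}"
      have "((\<lambda>s. G (u' + s)) has_real_derivative ?\<gamma> (u' + s) * 1) (at s)"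
        using u' s by (intro DERIV_chain2[OF G']) (auto intro!: derivative_eq_intros)
      then show "((\<lambda>s. G (u' + s)) has_vector_derivative ?\<gamma> (u' + s)) (at s within {-\<delta>..\<delta>})"
        by (simp add: has_real_derivative_iff_has_vector_derivative has_vector_derivative_at_within)
    qed (use \<delta> in auto)
    then have "integral {-\<delta>..\<delta>} (\<lambda>s. ?\<gamma> (u' + s)) = G (u' + \<delta>) - G (u' - \<delta>)" by (simp add: integral_unique)
    moreover have "?\<gamma> (u' + s) = g (x + u' *\<^sub>R axis i 1 + s *\<^sub>R axis i 1)" for s
      by (simp add: scaleR_add_left add.assoc)
    ultimately show ?thesis by (simp add: axis_avg_def)
  qed
  have d: "((\<lambda>u'. (G (u' + \<delta>) - G (u' - \<delta>)) / (2 * \<delta>)) has_real_derivative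
     (?\<gamma> (u + \<delta>) * 1 - ?\<gamma> (u - \<delta>) * 1) / (2 * \<delta>)) (at u)"
    using \<delta> by (intro DERIV_cdivide DERIV_diff DERIV_chain2[OF G']) (auto intro!: derivative_eq_intros)
  show ?thesis
    by (rule has_field_derivative_transform_within_open[where S = "{u - 1<..<u + 1}"])
      (use d eq in auto)
qed

text \<open>Continuity of the partial derivatives gives total differentiability; the result for
  functions on a product is transported to \<open>real^2\<close>.\<close>

lemma C1grad_of_partials:
  fixes f :: "real^2 \<Rightarrow> real"
  assumes d: "\<And>i x. ((\<lambda>u. f (x + u *\<^sub>R axis i 1)) has_real_derivative g i x) (at 0)"
    and c: "\<And>i. continuous_on UNIV (g i)"
  shows "C1grad f (\<lambda>x. vector [g 1 x, g 2 x])"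
  unfolding C1grad_def
proof (intro conjI allI)
  have eq: "(\<lambda>x. vector [g 1 x, g 2 x] :: real^2) = (\<lambda>x. \<chi> i. g i x)"
    by (auto simp: fun_eq_iff vec_eq_iff forall_2)
  show "continuous_on UNIV (\<lambda>x. vector [g 1 x, g 2 x] :: real^2)"
    unfolding eq by (intro continuous_on_vec_lambda c)
  fix x :: "real^2"
  define F where "F a b = f (a *\<^sub>R axis 1 1 + b *\<^sub>R axis 2 1)" for a b
  have F: "f z = F (z$1) (z$2)" for z
  proof -
    have "z = z$1 *\<^sub>R axis 1 1 + z$2 *\<^sub>R axis 2 1" by (simp add: vec_eq_iff forall_2 axis_def)
    then show ?thesis by (simp add: F_def)
  qed
  define G where "G i a b = g i (a *\<^sub>R axis 1 1 + b *\<^sub>R axis 2 1)" for i a b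
  have d1: "((\<lambda>a. F a b) has_real_derivative G 1 a b) (at a)" for a b
  proof -
    have "((\<lambda>u. F (a + u) b) has_real_derivative G 1 a b) (at 0)"
      using d[of "a *\<^sub>R axis 1 1 + b *\<^sub>R axis 2 1" 1] by (simp add: F_def G_def algebra_simps)
    then show ?thesis using DERIV_shift[of "\<lambda>a. F a b" "G 1 a b" 0 a] by (simp add: add.commute)
  qed
  have d2: "((\<lambda>b. F a b) has_real_derivative G 2 a b) (at b)" for a b
  proof -
    have "((\<lambda>u. F a (b + u)) has_real_derivative G 2 a b) (at 0)"
      using d[of "a *\<^sub>R axis 1 1 + b *\<^sub>R axis 2 1" 2] by (simp add: F_def G_def algebra_simps)
    then show ?thesis using DERIV_shift[of "\<lambda>b. F a b" "G 2 a b" 0 b] by (simp add: add.commute)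
  qed
  have Gc: "continuous_on UNIV (\<lambda>z. G 2 (fst z) (snd z))"
    unfolding G_def by (intro continuous_on_compose2[OF c] continuous_intros) auto
  have "((\<lambda>(a,b). F a b) has_derivative (\<lambda>(ta,tb). G 1 (x$1) (x$2) * ta
      + blinfun_apply (blinfun_scaleR_left (G 2 (x$1) (x$2))) tb)) (at (x$1, x$2) within UNIV \<times> UNIV)"
  proof (rule has_derivative_partialsI)
    show "((\<lambda>a. F a (x$2)) has_derivative (*) (G 1 (x$1) (x$2))) (at (x$1) within UNIV)"
      using d1 by (simp add: has_field_derivative_def)
    show "((\<lambda>b. F a b) has_derivative blinfun_apply (blinfun_scaleR_left (G 2 a b))) (at b within UNIV)" for a b
    proof -
      have "blinfun_apply (blinfun_scaleR_left (G 2 a b)) = (*) (G 2 a b)" by (auto simp: fun_eq_iff)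
      then show ?thesis using d2[of a b] by (simp add: has_field_derivative_def)
    qed
    have "continuous_on UNIV (\<lambda>z. blinfun_scaleR_left (G 2 (fst z) (snd z)))"
      by (intro bounded_linear.continuous_on[OF bounded_linear_blinfun_scaleR_left] Gc)
    then show "continuous (at (x$1, x$2) within UNIV \<times> UNIV) (\<lambda>(a,b). blinfun_scaleR_left (G 2 a b))"
      unfolding case_prod_beta UNIV_Times_UNIV by (simp add: continuous_on_eq_continuous_within)
  qed auto
  then have F': "((\<lambda>z. F (fst z) (snd z)) has_derivative (\<lambda>z. G 1 (x$1) (x$2) * fst z + G 2 (x$1) (x$2) * snd z)) (at (x$1, x$2))"
    unfolding case_prod_beta UNIV_Times_UNIV by (simp add: mult.commute)
  have proj: "((\<lambda>z::real^2. (z$1, z$2)) has_derivative (\<lambda>z. (z$1, z$2))) (at x)"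
    by (intro has_derivative_Pair bounded_linear_imp_has_derivative bounded_linear_vec_nth)
  from has_derivative_compose[OF proj F']
  have "((\<lambda>z. F (z$1) (z$2)) has_derivative (\<lambda>z. G 1 (x$1) (x$2) * z$1 + G 2 (x$1) (x$2) * z$2)) (at x)" by simp
  moreover have "G i (x$1) (x$2) = g i x" for i
  proof -
    have "x = x$1 *\<^sub>R axis 1 1 + x$2 *\<^sub>R axis 2 1" by (simp add: vec_eq_iff forall_2 axis_def)
    then show ?thesis by (simp add: G_def)
  qed
  ultimately show "(f has_derivative (\<lambda>h. vector [g 1 x, g 2 x] \<bullet> h)) (at x)"
    by (simp add: F[abs_def] inner_real2)
qed

text \<open>To differentiate in direction \<open>i\<close>, the average along \<open>i\<close> must
  be the outer one; both orders are therefore needed.\<close>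

lemma axis_avg_swap:
  assumes w: "continuous_on UNIV w" and \<delta>: "\<delta> > 0"
  shows "axis_avg i \<delta> (axis_avg j \<delta> w) = axis_avg j \<delta> (axis_avg i \<delta> w)"
proof
  fix x
  have "integral (cbox (-\<delta>) \<delta>) (\<lambda>s. integral (cbox (-\<delta>) \<delta>) (\<lambda>t. w (x + s *\<^sub>R axis i 1 + t *\<^sub>R axis j 1)))
      = integral (cbox (-\<delta>) \<delta>) (\<lambda>t. integral (cbox (-\<delta>) \<delta>) (\<lambda>s. w (x + s *\<^sub>R axis i 1 + t *\<^sub>R axis j 1)))"
    by (rule integral_swap_continuous)
      (auto simp: case_prod_beta intro!: continuous_on_compose2[OF w] continuous_intros)
  then show "axis_avg i \<delta> (axis_avg j \<delta> w) x = axis_avg j \<delta> (axis_avg i \<delta> w) x"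
    by (simp add: axis_avg_def add_ac)
qed

definition box_avg :: "real \<Rightarrow> (real^2 \<Rightarrow> real) \<Rightarrow> real^2 \<Rightarrow> real" where
  "box_avg \<delta> w = axis_avg 1 \<delta> (axis_avg 2 \<delta> w)"

text \<open>The index \<open>3 - i\<close> denotes the other axis.\<close>

definition box_avg_partial :: "real \<Rightarrow> (real^2 \<Rightarrow> real) \<Rightarrow> 2 \<Rightarrow> real^2 \<Rightarrow> real" where
  "box_avg_partial \<delta> w i x = (axis_avg (3 - i) \<delta> w (x + \<delta> *\<^sub>R axis i 1) - axis_avg (3 - i) \<delta> w (x - \<delta> *\<^sub>R axis i 1)) / (2 * \<delta>)"

lemma box_avg_C1:
  assumes w: "continuous_on UNIV w" and \<delta>: "\<delta> > 0"
  shows "C1grad (box_avg \<delta> w) (\<lambda>x. vector [box_avg_partial \<delta> w 1 x, box_avg_partial \<delta> w 2 x])"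
proof (rule C1grad_of_partials)
  fix i :: 2 and x
  have "box_avg \<delta> w = axis_avg i \<delta> (axis_avg (3 - i) \<delta> w)"
    using exhaust_2[of i] axis_avg_swap[OF w \<delta>, of 1 2] by (auto simp: box_avg_def)
  then show "((\<lambda>u. box_avg \<delta> w (x + u *\<^sub>R axis i 1)) has_real_derivative box_avg_partial \<delta> w i x) (at 0)"
    using axis_avg_has_derivative[OF continuous_axis_avg[OF w \<delta>] \<delta>, of i "3 - i" x 0] by (simp add: box_avg_partial_def)
next
  fix i :: 2
  note c = continuous_on_compose2[OF continuous_axis_avg[OF w \<delta>]]
  show "continuous_on UNIV (box_avg_partial \<delta> w i)"
    unfolding box_avg_partial_def[abs_def] using \<delta> by (intro continuous_intros c) auto
qed

lemma axis_avg_approx: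
  assumes g: "continuous_on UNIV g" and \<delta>: "\<delta> > 0"
    and b: "\<And>s. \<bar>s\<bar> \<le> \<delta> \<Longrightarrow> \<bar>g (x + s *\<^sub>R axis i 1) - c\<bar> \<le> B"
  shows "\<bar>axis_avg i \<delta> g x - c\<bar> \<le> B"
proof -
  have co: "continuous_on {-\<delta>..\<delta>} (\<lambda>s. g (x + s *\<^sub>R axis i 1))"
    by (intro continuous_on_compose2[OF g] continuous_intros) auto
  have "integral {-\<delta>..\<delta>} (\<lambda>s. g (x + s *\<^sub>R axis i 1) - c) = integral {-\<delta>..\<delta>} (\<lambda>s. g (x + s *\<^sub>R axis i 1)) - c * (2 * \<delta>)"
    using \<delta> by (subst integral_diff) (auto intro!: integrable_continuous_interval co)
  moreover have "norm (integral {-\<delta>..\<delta>} (\<lambda>s. g (x + s *\<^sub>R axis i 1) - c)) \<le> B * (\<delta> - - \<delta>)"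
    using \<delta> b by (intro integral_bound continuous_intros co) auto
  ultimately have "\<bar>integral {-\<delta>..\<delta>} (\<lambda>s. g (x + s *\<^sub>R axis i 1)) - c * (2 * \<delta>)\<bar> \<le> B * (2 * \<delta>)" by simp
  moreover have "axis_avg i \<delta> g x - c = (integral {-\<delta>..\<delta>} (\<lambda>s. g (x + s *\<^sub>R axis i 1)) - c * (2 * \<delta>)) / (2 * \<delta>)"
    using \<delta> by (simp add: axis_avg_def field_simps)
  ultimately show ?thesis using \<delta> by (simp add: abs_mult pos_divide_le_eq)
qed

lemma box_avg_approx:
  assumes w: "continuous_on UNIV w" and \<delta>: "\<delta> > 0"
    and b: "\<And>y. norm (y - x) \<le> 2 * \<delta> \<Longrightarrow> \<bar>w y - c\<bar> \<le> B"
  shows "\<bar>box_avg \<delta> w x - c\<bar> \<le> B"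
  unfolding box_avg_def
proof (intro axis_avg_approx continuous_axis_avg w \<delta>)
  fix s t :: real assume st: "\<bar>s\<bar> \<le> \<delta>" "\<bar>t\<bar> \<le> \<delta>"
  have "norm (s *\<^sub>R axis 1 1 + t *\<^sub>R axis 2 1 :: real^2) \<le> \<bar>s\<bar> + \<bar>t\<bar>"
    by (rule norm_triangle_le) simp
  then show "\<bar>w (x + s *\<^sub>R axis 1 1 + t *\<^sub>R axis 2 1) - c\<bar> \<le> B"
    using st by (intro b) (simp add: algebra_simps)
qed

text \<open>The partial derivative of the box average is the average, along the other axis, of
  central difference quotients of \<open>w\<close>. Bounds for these quotients pass to it: with
  \<open>c = 0\<close> a Lipschitz bound, with \<open>c\<close> a derivative of the limit the
  convergence.\<close>

lemma box_avg_partial_approx: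
  assumes w: "continuous_on UNIV w" and \<delta>: "\<delta> > 0"
    and b: "\<And>t. \<bar>t\<bar> \<le> \<delta> \<Longrightarrow> \<bar>(w (x + t *\<^sub>R axis (3 - i) 1 + \<delta> *\<^sub>R axis i 1) - w (x + t *\<^sub>R axis (3 - i) 1 - \<delta> *\<^sub>R axis i 1)) / (2 * \<delta>) - c\<bar> \<le> B"
  shows "\<bar>box_avg_partial \<delta> w i x - c\<bar> \<le> B"
proof -
  let ?g = "\<lambda>y. (w (y + \<delta> *\<^sub>R axis i 1) - w (y - \<delta> *\<^sub>R axis i 1)) / (2 * \<delta>)"
  have gc: "continuous_on UNIV ?g"
    using \<delta> by (intro continuous_intros continuous_on_compose2[OF w]) auto
  have int: "(\<lambda>s. w (y + s *\<^sub>R axis (3 - i) 1)) integrable_on {-\<delta>..\<delta>}" for y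
    by (intro integrable_continuous_interval continuous_on_compose2[OF w] continuous_intros) auto
  have "axis_avg (3 - i) \<delta> ?g x = box_avg_partial \<delta> w i x"
  proof -
    have "integral {-\<delta>..\<delta>} (\<lambda>s. ?g (x + s *\<^sub>R axis (3 - i) 1))
      = integral {-\<delta>..\<delta>} (\<lambda>s. w (x + \<delta> *\<^sub>R axis i 1 + s *\<^sub>R axis (3 - i) 1) - w (x - \<delta> *\<^sub>R axis i 1 + s *\<^sub>R axis (3 - i) 1)) / (2 * \<delta>)"
      by (subst integral_divide[symmetric]) (simp add: algebra_simps)
    also have "\<dots> = (integral {-\<delta>..\<delta>} (\<lambda>s. w (x + \<delta> *\<^sub>R axis i 1 + s *\<^sub>R axis (3 - i) 1)) - integral {-\<delta>..\<delta>} (\<lambda>s. w (x - \<delta> *\<^sub>R axis i 1 + s *\<^sub>R axis (3 - i) 1))) / (2 * \<delta>)"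
      by (subst integral_diff[OF int int]) simp
    finally show ?thesis
      unfolding axis_avg_def box_avg_partial_def by (simp add: diff_divide_distrib)
  qed
  moreover have "\<bar>axis_avg (3 - i) \<delta> ?g x - c\<bar> \<le> B"
    by (rule axis_avg_approx[OF gc \<delta>]) (rule b)
  ultimately show ?thesis by simp
qed

lemma AE_lebesgue_on_negligible:
  assumes "negligible N" "S \<in> sets lebesgue"
  shows "AE x in lebesgue_on S. x \<in> S - N"
proof -
  have "AE x in lebesgue. x \<notin> N"
    using assms(1) by (simp add: negligible_iff_null_sets AE_not_in)
  then show ?thesis
    using assms(2) by (subst AE_restrict_space_iff) auto
qed

text \<open>
  Since \<open>\<bar>v\<bar> \<le> L d\<close> for the distance \<open>d\<close> to the complement of \<open>\<Omega>\<close>, clamping \<open>v\<close> to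
  \<open>\<plusminus>2 L (d - \<epsilon>)\<^sup>+\<close> changes \<open>v\<close> only where \<open>d < 2 \<epsilon>\<close>, keeps the Lipschitz constant bounded and
  gives compact support; a box average of a continuous function is already continuously differentiable.
\<close>
lemma lipschitz_Cc1_approx:
  fixes v :: "real^2 \<Rightarrow> real" and dv :: "real^2 \<Rightarrow> real^2"
  assumes \<Omega>: "open \<Omega>" "bounded \<Omega>" and L: "L > 0"
    and lip: "\<And>x y. \<bar>v x - v y\<bar> \<le> L * dist x y" and v0: "\<And>x. x \<notin> \<Omega> \<Longrightarrow> v x = 0"
    and N: "negligible N"
    and loc: "\<And>x. x \<in> \<Omega> - N \<Longrightarrow> \<exists>U. open U \<and> x \<in> U \<and> continuous_on U dv \<and> (\<forall>y\<in>U. (v has_derivative (\<lambda>h. dv y \<bullet> h)) (at y))"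
  shows "\<exists>\<phi> d\<phi>. (\<forall>n. Cc1 \<Omega> (\<phi> n) (d\<phi> n)) \<and>
        (\<lambda>n. sint \<Omega> (\<lambda>x. (\<phi> n x - v x)\<^sup>2)) \<longlonglongrightarrow> 0 \<and>
        (\<lambda>n. sint \<Omega> (\<lambda>x. (norm (d\<phi> n x - dv x))\<^sup>2)) \<longlonglongrightarrow> 0"
    and "dv \<in> borel_measurable (lebesgue_on \<Omega>)" "integrable (lebesgue_on \<Omega>) (\<lambda>x. (norm (dv x))\<^sup>2)"
    and "v \<in> borel_measurable (lebesgue_on \<Omega>)" "integrable (lebesgue_on \<Omega>) (\<lambda>x. (v x)\<^sup>2)"
proof -
  define d where "d x = infdist x (- \<Omega>)" for x
  have cl: "closed (- \<Omega>)" using \<Omega>(1) by auto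
  have ne: "- \<Omega> \<noteq> {}" using \<Omega>(2) not_bounded_UNIV[where 'a="real^2"] by (metis Compl_empty_eq double_complement)
  have dlip: "\<bar>d x - d y\<bar> \<le> dist x y" for x y unfolding d_def by (rule infdist_triangle_abs)
  have d0: "d x \<ge> 0" for x unfolding d_def by (rule infdist_nonneg)
  have dpos: "d x > 0 \<longleftrightarrow> x \<in> \<Omega>" for x
    using in_closed_iff_infdist_zero[OF cl ne, of x] d0[of x] unfolding d_def by auto
  have vd: "\<bar>v x\<bar> \<le> L * d x" for x
  proof -
    obtain y where "y \<in> - \<Omega>" "infdist x (- \<Omega>) = dist x y" using infdist_attains_inf[OF cl ne] by blast
    then show ?thesis using lip[of x y] v0[of y] by (simp add: d_def)
  qed
  have vc: "continuous_on S v" for S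
  proof -
    have "L-lipschitz_on S v" using lip L by (auto simp: lipschitz_on_def dist_real_def)
    then show ?thesis by (rule lipschitz_on_continuous_on)
  qed
  obtain B0 where B0: "\<And>x. \<bar>v x\<bar> \<le> B0"
  proof -
    obtain R where R: "\<And>x. x \<in> \<Omega> \<Longrightarrow> norm x \<le> R" using \<Omega>(2) by (auto simp: bounded_iff)
    obtain a0 where a0: "a0 \<notin> \<Omega>" using ne by auto
    have "\<bar>v x\<bar> \<le> L * (\<bar>R\<bar> + norm a0)" for x
    proof (cases "x \<in> \<Omega>")
      case True
      have "\<bar>v x\<bar> \<le> L * dist x a0" using lip[of x a0] v0[OF a0] by simp
      also have "\<dots> \<le> L * (\<bar>R\<bar> + norm a0)"
      proof (rule mult_left_mono)
        have "dist x a0 \<le> norm x + norm a0" by (simp add: dist_norm norm_triangle_ineq4)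
        then show "dist x a0 \<le> \<bar>R\<bar> + norm a0" using R[OF True] by linarith
      qed (use L in simp)
      finally show ?thesis .
    qed (use L v0 in simp)
    then show ?thesis by (rule that)
  qed
  define \<epsilon> where "\<epsilon> n = 1 / real (Suc n)" for n
  \<comment> \<open>The average at a point uses values at distance at most
    \<open>2 * \<delta> n\<close>, half of \<open>\<epsilon> n\<close>. As \<open>w n\<close> is
    zero where \<open>d\<close> is at most \<open>\<epsilon> n\<close>, its average is zero where
    \<open>d\<close> is below half of that.\<close>
  define \<delta> where "\<delta> n = \<epsilon> n / 4" for n
  have \<epsilon>: "\<epsilon> n > 0" for n by (simp add: \<epsilon>_def)
  have \<delta>: "\<delta> n > 0" for n using \<epsilon> by (simp add: \<delta>_def)
  have \<epsilon>0: "\<epsilon> \<longlonglongrightarrow> 0" unfolding \<epsilon>_def[abs_def] by (rule lim_1_over_n[THEN LIMSEQ_Suc])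
  define M where "M n x = 2 * L * max 0 (d x - \<epsilon> n)" for n x
  define w where "w n x = max (- M n x) (min (M n x) (v x))" for n x
  have M0: "M n x \<ge> 0" for n x using L by (simp add: M_def)
  have Mlip: "\<bar>M n x - M n y\<bar> \<le> 2 * L * dist x y" for n x y
  proof -
    have "\<bar>max 0 (d x - \<epsilon> n) - max 0 (d y - \<epsilon> n)\<bar> \<le> dist x y" using dlip[of x y] zero_le_dist[of x y] by (auto simp: max_def)
    then have "2 * L * \<bar>max 0 (d x - \<epsilon> n) - max 0 (d y - \<epsilon> n)\<bar> \<le> 2 * L * dist x y" using L by (intro mult_left_mono) auto
    moreover have "\<bar>M n x - M n y\<bar> = 2 * L * \<bar>max 0 (d x - \<epsilon> n) - max 0 (d y - \<epsilon> n)\<bar>"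
      unfolding M_def right_diff_distrib[symmetric] abs_mult using L by simp
    ultimately show ?thesis by simp
  qed
  have clamp: "\<bar>max (- a) (min a b) - max (- a') (min a' b')\<bar> \<le> c"
    if "\<bar>a - a'\<bar> \<le> c" "\<bar>b - b'\<bar> \<le> c" for a a' b b' c :: real
    using that by (auto simp: max_def min_def abs_le_iff)
  have wlip: "\<bar>w n x - w n y\<bar> \<le> 2 * L * dist x y" for n x y
    unfolding w_def
  proof (rule clamp[OF Mlip])
    have "0 \<le> L * dist x y" using L by simp
    then show "\<bar>v x - v y\<bar> \<le> 2 * L * dist x y" using lip[of x y] by linarith
  qed
  have wc: "continuous_on S (w n)" for S n
  proof -
    have "(2*L)-lipschitz_on S (w n)" using wlip L by (auto simp: lipschitz_on_def dist_real_def)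
    then show ?thesis by (rule lipschitz_on_continuous_on)
  qed
  have w0: "w n x = 0" if "d x \<le> \<epsilon> n" for n x
    using that by (simp add: w_def M_def)
  have wv: "w n x = v x" if "2 * \<epsilon> n \<le> d x" for n x
  proof -
    have "L * d x \<le> M n x"
    proof -
      have "d x \<le> 2 * max 0 (d x - \<epsilon> n)" using that by (auto simp: max_def)
      then have "L * d x \<le> L * (2 * max 0 (d x - \<epsilon> n))" using L by (intro mult_left_mono) auto
      then show ?thesis by (simp add: M_def)
    qed
    then have "\<bar>v x\<bar> \<le> M n x" using vd[of x] by linarith
    then show ?thesis by (auto simp: w_def max_def min_def)
  qed
  have wB: "\<bar>w n x\<bar> \<le> B0" for n x
    using B0[of x] M0[of n x] by (auto simp: w_def max_def min_def)
  define \<phi> where "\<phi> n = box_avg (\<delta> n) (w n)" for n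
  define d\<phi> where "d\<phi> n x = (vector [box_avg_partial (\<delta> n) (w n) 1 x, box_avg_partial (\<delta> n) (w n) 2 x] :: real^2)" for n x
  have C1: "C1grad (\<phi> n) (d\<phi> n)" for n
    unfolding \<phi>_def d\<phi>_def[abs_def] by (rule box_avg_C1[OF wc \<delta>])
  have dphi_i: "d\<phi> n x $ i = box_avg_partial (\<delta> n) (w n) i x" for n x i
    using exhaust_2[of i] by (auto simp: d\<phi>_def)
  have \<phi>B: "\<bar>\<phi> n x\<bar> \<le> B0" for n x
    using box_avg_approx[OF wc \<delta>, where c = 0 and B = B0] wB by (simp add: \<phi>_def)
  have supp: "\<epsilon> n / 2 \<le> d x" if "\<phi> n x \<noteq> 0" for n x
  proof (rule ccontr)
    assume "\<not> \<epsilon> n / 2 \<le> d x"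
    then have "\<bar>w n y - 0\<bar> \<le> 0" if "norm (y - x) \<le> 2 * \<delta> n" for y
      using w0[of y n] dlip[of y x] that by (auto simp: \<delta>_def dist_norm)
    then have "\<bar>\<phi> n x - 0\<bar> \<le> 0" unfolding \<phi>_def by (intro box_avg_approx[OF wc \<delta>]) auto
    then show False using that by simp
  qed
  have Cc: "Cc1 \<Omega> (\<phi> n) (d\<phi> n)" for n
  proof -
    have clo: "closed {x. \<epsilon> n / 2 \<le> d x}"
      unfolding d_def by (intro closed_Collect_le continuous_intros)
    then have sub: "closure {x. \<phi> n x \<noteq> 0} \<subseteq> {x. \<epsilon> n / 2 \<le> d x}"
      using supp by (intro closure_minimal) auto
    also have "\<dots> \<subseteq> \<Omega>"
    proof
      fix x assume "x \<in> {x. \<epsilon> n / 2 \<le> d x}"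
      then have "d x > 0" using \<epsilon>[of n] by auto
      then show "x \<in> \<Omega>" by (simp add: dpos)
    qed
    finally have subO: "closure {x. \<phi> n x \<noteq> 0} \<subseteq> \<Omega>" .
    then have "bounded (closure {x. \<phi> n x \<noteq> 0})" using \<Omega>(2) bounded_subset by blast
    then have "compact (closure {x. \<phi> n x \<noteq> 0})" by (simp add: compact_eq_bounded_closed)
    then show ?thesis using C1[of n] subO by (auto simp: Cc1_def C1grad_def)
  qed
  have part_bound: "\<bar>d\<phi> n x $ i\<bar> \<le> 2 * L" for n x i
  proof -
    have "\<bar>box_avg_partial (\<delta> n) (w n) i x - 0\<bar> \<le> 2 * L"
    proof (rule box_avg_partial_approx[OF wc \<delta>])
      fix t :: real
      let ?y = "x + t *\<^sub>R axis (3 - i) 1" and ?e = "\<delta> n *\<^sub>R axis i 1 :: real^2"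
      have "(?y + ?e) - (?y - ?e) = (2 * \<delta> n) *\<^sub>R axis i 1" by (simp add: vec_eq_iff)
      then have "dist (?y + ?e) (?y - ?e) = 2 * \<delta> n" using \<delta>[of n] by (simp add: dist_norm)
      then have "\<bar>w n (?y + ?e) - w n (?y - ?e)\<bar> \<le> 2 * L * (2 * \<delta> n)" using wlip[of n "?y + ?e" "?y - ?e"] by simp
      then show "\<bar>(w n (?y + ?e) - w n (?y - ?e)) / (2 * \<delta> n) - 0\<bar> \<le> 2 * L"
        using \<delta>[of n] by (simp add: abs_divide pos_divide_le_eq)
    qed
    then show ?thesis by (simp add: dphi_i)
  qed
  have ev: "eventually (\<lambda>n. \<epsilon> n < c) sequentially" if "c > 0" for c
    using order_tendstoD(2)[OF \<epsilon>0 that] .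
  \<comment> \<open>Near \<open>x\<close> the clamped \<open>w n\<close> equals \<open>v\<close>
    once \<open>\<epsilon> n\<close> is small against \<open>d x\<close>. A central difference
    quotient is then a value of \<open>dv\<close> at distance at most \<open>2 * \<delta> n\<close>
    from \<open>x\<close>, and \<open>dv\<close> is continuous there.\<close>
  have lim_i: "(\<lambda>n. d\<phi> n x $ i) \<longlonglongrightarrow> dv x $ i" if x: "x \<in> \<Omega> - N" for x i
  proof (rule LIMSEQ_I)
    fix e :: real assume "e > 0"
    obtain U where U: "open U" "x \<in> U" "continuous_on U dv" "\<And>y. y \<in> U \<Longrightarrow> (v has_derivative (\<lambda>h. dv y \<bullet> h)) (at y)"
      using loc[OF x] by blast
    have dx: "d x > 0" using x dpos by auto
    have "isCont dv x" using U by (simp add: continuous_on_eq_continuous_at)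
    then obtain \<rho>1 where r1: "\<rho>1 > 0" "\<And>y. dist y x < \<rho>1 \<Longrightarrow> dist (dv y) (dv x) < e/2"
      using \<open>e > 0\<close> unfolding continuous_at_eps_delta by (metis half_gt_zero)
    obtain \<rho>2 where r2: "\<rho>2 > 0" "ball x \<rho>2 \<subseteq> U" using U(1,2) open_contains_ball by blast
    define \<rho> where "\<rho> = min (min \<rho>1 \<rho>2) (d x / 4)"
    have \<rho>: "\<rho> > 0" using r1 r2 dx by (simp add: \<rho>_def)
    obtain n0 where n0: "\<And>n. n \<ge> n0 \<Longrightarrow> \<epsilon> n < \<rho>" using ev[OF \<rho>] by (auto simp: eventually_sequentially)
    have "norm (d\<phi> n x $ i - dv x $ i) < e" if n: "n \<ge> n0" for n
    proof -
      have en: "\<epsilon> n < \<rho>" using n0[OF n] .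
      have near: "y \<in> U \<and> w n y = v y \<and> norm (dv y - dv x) < e/2" if y: "dist y x \<le> 2 * \<delta> n" for y
      proof -
        have "dist y x < \<rho>" using y en \<epsilon>[of n] by (simp add: \<delta>_def)
        moreover have "2 * \<epsilon> n \<le> d y" using dlip[of y x] \<open>dist y x < \<rho>\<close> en by (auto simp: \<rho>_def)
        ultimately show ?thesis using r1(2)[of y] r2(2) wv[of n y] by (auto simp: \<rho>_def dist_commute dist_norm norm_minus_commute)
      qed
      have "\<bar>box_avg_partial (\<delta> n) (w n) i x - dv x $ i\<bar> \<le> e/2"
      proof (rule box_avg_partial_approx[OF wc \<delta>])
        fix t :: real assume t: "\<bar>t\<bar> \<le> \<delta> n"
        let ?y = "x + t *\<^sub>R axis (3 - i) 1" and ?e = "axis i 1 :: real^2"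
        have nr: "dist (?y + s *\<^sub>R ?e) x \<le> 2 * \<delta> n" if "\<bar>s\<bar> \<le> \<delta> n" for s
        proof -
          have "dist (?y + s *\<^sub>R ?e) x = norm (t *\<^sub>R axis (3 - i) 1 + s *\<^sub>R ?e)" by (simp add: dist_norm algebra_simps)
          also have "\<dots> \<le> \<bar>t\<bar> + \<bar>s\<bar>" by (rule norm_triangle_le) simp
          finally show ?thesis using t that by linarith
        qed
        have der: "((\<lambda>s. v (?y + s *\<^sub>R ?e)) has_real_derivative dv (?y + s *\<^sub>R ?e) $ i) (at s)" if "\<bar>s\<bar> \<le> \<delta> n" for s
        proof -
          have "(v has_derivative (\<lambda>h. dv (?y + s *\<^sub>R ?e) \<bullet> h)) (at (?y + s *\<^sub>R ?e))"
            using near[OF nr[OF that]] U(4) by blast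
          moreover have "((\<lambda>s. ?y + s *\<^sub>R ?e) has_derivative (\<lambda>h. h *\<^sub>R ?e)) (at s)"
            by (auto intro!: derivative_eq_intros)
          ultimately have "((\<lambda>s. v (?y + s *\<^sub>R ?e)) has_derivative (\<lambda>h. dv (?y + s *\<^sub>R ?e) \<bullet> (h *\<^sub>R ?e))) (at s)"
            by (rule has_derivative_compose[rotated])
          moreover have "(\<lambda>h. dv (?y + s *\<^sub>R ?e) \<bullet> (h *\<^sub>R ?e)) = (*) (dv (?y + s *\<^sub>R ?e) $ i)"
            by (auto simp: fun_eq_iff inner_axis)
          ultimately show ?thesis by (simp add: has_field_derivative_def)
        qed
        have "\<exists>z>- \<delta> n. z < \<delta> n \<and> v (?y + \<delta> n *\<^sub>R ?e) - v (?y + (- \<delta> n) *\<^sub>R ?e) = (\<delta> n - - \<delta> n) * (dv (?y + z *\<^sub>R ?e) $ i)"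
          using \<delta>[of n] by (intro MVT2 der) auto
        then obtain z where z: "\<bar>z\<bar> \<le> \<delta> n" "v (?y + \<delta> n *\<^sub>R ?e) - v (?y + (- \<delta> n) *\<^sub>R ?e) = (\<delta> n - - \<delta> n) * (dv (?y + z *\<^sub>R ?e) $ i)"
          by (metis abs_le_iff less_imp_le minus_less_iff)
        have wv1: "w n (?y + \<delta> n *\<^sub>R ?e) = v (?y + \<delta> n *\<^sub>R ?e)" "w n (?y + (- \<delta> n) *\<^sub>R ?e) = v (?y + (- \<delta> n) *\<^sub>R ?e)"
          using near[OF nr[of "\<delta> n"]] near[OF nr[of "- \<delta> n"]] \<delta>[of n] by simp_all
        have "(w n (?y + \<delta> n *\<^sub>R ?e) - w n (?y - \<delta> n *\<^sub>R ?e)) / (2 * \<delta> n) = dv (?y + z *\<^sub>R ?e) $ i"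
          using wv1 z(2) \<delta>[of n] by (simp add: field_simps)
        moreover have "\<bar>dv (?y + z *\<^sub>R ?e) $ i - dv x $ i\<bar> \<le> norm (dv (?y + z *\<^sub>R ?e) - dv x)"
          using component_le_norm_cart[of "dv (?y + z *\<^sub>R ?e) - dv x" i] by simp
        ultimately show "\<bar>(w n (?y + \<delta> n *\<^sub>R ?e) - w n (?y - \<delta> n *\<^sub>R ?e)) / (2 * \<delta> n) - dv x $ i\<bar> \<le> e/2"
          using near[OF nr[OF z(1)]] by linarith
      qed
      then show ?thesis using \<open>e > 0\<close> by (simp add: dphi_i)
    qed
    then show "\<exists>n0. \<forall>n\<ge>n0. norm (d\<phi> n x $ i - dv x $ i) < e" by blast
  qed
  have lim: "(\<lambda>n. d\<phi> n x) \<longlonglongrightarrow> dv x" if "x \<in> \<Omega> - N" for x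
    by (intro vec_tendstoI lim_i[OF that])
  have norm2: "norm (y::real^2) \<le> \<bar>y$1\<bar> + \<bar>y$2\<bar>" for y
    using norm_le_l1_cart[of y] by (simp add: UNIV_2)
  have dphiB: "norm (d\<phi> n x) \<le> 4 * L" for n x
    using norm2[of "d\<phi> n x"] part_bound[of n x 1] part_bound[of n x 2] by linarith
  \<comment> \<open>The bound for \<open>dv\<close> is inherited from the approximating gradients as
    their pointwise limit.\<close>
  have dvB: "norm (dv x) \<le> 4 * L" if "x \<in> \<Omega> - N" for x
    by (rule LIMSEQ_le_const2[OF tendsto_norm[OF lim[OF that]]]) (use dphiB in auto)
  have Om: "\<Omega> \<in> sets lebesgue" "\<Omega> \<in> lmeasurable"
    using \<Omega> by (auto intro: lmeasurable_open)
  have AEN: "AE x in lebesgue_on \<Omega>. x \<in> \<Omega> - N" by (rule AE_lebesgue_on_negligible[OF N Om(1)])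
  have dvc: "continuous_on (\<Omega> - N) dv"
  proof (rule continuous_at_imp_continuous_on, rule ballI)
    fix x assume "x \<in> \<Omega> - N"
    then obtain U where "open U" "x \<in> U" "continuous_on U dv" using loc by blast
    then show "isCont dv x" by (simp add: continuous_on_eq_continuous_at)
  qed
  have N': "N \<inter> \<Omega> \<in> null_sets (lebesgue_on \<Omega>)"
    using negligible_subset[OF N, of "N \<inter> \<Omega>"] Om(1)
    by (subst null_sets_restrict_space) (simp_all add: negligible_iff_null_sets)
  have "dv \<in> borel_measurable (lebesgue_on (\<Omega> - (N \<inter> \<Omega>)))"
  proof (rule continuous_imp_measurable_on_sets_lebesgue)
    show "continuous_on (\<Omega> - (N \<inter> \<Omega>)) dv" using dvc by (rule continuous_on_subset) auto
    show "\<Omega> - (N \<inter> \<Omega>) \<in> sets lebesgue" using N Om by (auto simp: negligible_iff_null_sets null_setsD2)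
  qed
  then show dvm: "dv \<in> borel_measurable (lebesgue_on \<Omega>)"
    using borel_measurable_diff_null[OF N' Om(1), of dv] by blast
  have fin: "integrable (lebesgue_on \<Omega>) (\<lambda>x. c)" for c :: real
    using finite_measure_lebesgue_on[OF Om(2)] by (simp add: finite_measure.integrable_const)
  have bint: "integrable (lebesgue_on \<Omega>) g" if "g \<in> borel_measurable (lebesgue_on \<Omega>)" "AE x in lebesgue_on \<Omega>. norm (g x) \<le> c" for g :: "real^2 \<Rightarrow> real" and c
    by (rule Bochner_Integration.integrable_bound[OF fin[of c] that(1)]) (use that(2) in \<open>auto elim!: AE_mp\<close>)
  show "integrable (lebesgue_on \<Omega>) (\<lambda>x. (norm (dv x))\<^sup>2)"
  proof (rule bint[where c = "(4 * L)\<^sup>2"])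
    show "AE x in lebesgue_on \<Omega>. norm ((norm (dv x))\<^sup>2) \<le> (4 * L)\<^sup>2"
    proof (rule AE_mp[OF AEN], rule AE_I2, rule impI)
      fix x assume "x \<in> \<Omega> - N"
      from power_mono[OF dvB[OF this], of 2] show "norm ((norm (dv x))\<^sup>2) \<le> (4 * L)\<^sup>2" by simp
    qed
  qed (use dvm in measurable)
  show vm: "v \<in> borel_measurable (lebesgue_on \<Omega>)"
    by (intro continuous_imp_measurable_on_sets_lebesgue vc Om)
  show "integrable (lebesgue_on \<Omega>) (\<lambda>x. (v x)\<^sup>2)"
  proof (rule bint[where c = "B0\<^sup>2"])
    show "AE x in lebesgue_on \<Omega>. norm ((v x)\<^sup>2) \<le> B0\<^sup>2"
    proof (rule AE_I2)
      fix x show "norm ((v x)\<^sup>2) \<le> B0\<^sup>2" using power_mono[OF B0[of x], of 2] by simp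
    qed
  qed (use vm in measurable)
  have \<phi>m: "\<phi> n \<in> borel_measurable (lebesgue_on \<Omega>)" "d\<phi> n \<in> borel_measurable (lebesgue_on \<Omega>)" for n
    by (intro continuous_imp_measurable_on_sets_lebesgue Om C1grad_cont[OF C1] C1grad_grad_cont[OF C1])+
  have \<phi>lim: "(\<lambda>n. \<phi> n x) \<longlonglongrightarrow> v x" if "x \<in> \<Omega>" for x
  proof (rule LIM_zero_cancel, rule Lim_null_comparison)
    have "eventually (\<lambda>n. \<epsilon> n < d x / 2) sequentially" using that dpos by (intro ev) auto
    then show "\<forall>\<^sub>F n in sequentially. norm (\<phi> n x - v x) \<le> L * \<epsilon> n"
    proof eventually_elim
      case (elim n)
      then have "w n x = v x" by (intro wv) auto
      have "\<bar>w n y - v x\<bar> \<le> L * \<epsilon> n" if "norm (y - x) \<le> 2 * \<delta> n" for y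
      proof -
        have "\<bar>w n y - w n x\<bar> \<le> 2 * L * dist y x" by (rule wlip)
        also have "\<dots> \<le> 2 * L * (2 * \<delta> n)" using that L by (intro mult_left_mono) (auto simp: dist_norm)
        finally show ?thesis using \<open>w n x = v x\<close> by (simp add: \<delta>_def)
      qed
      then show ?case unfolding \<phi>_def real_norm_def by (intro box_avg_approx[OF wc \<delta>]) auto
    qed
    show "(\<lambda>n. L * \<epsilon> n) \<longlonglongrightarrow> 0" using tendsto_mult_right_zero[OF \<epsilon>0, of L] by simp
  qed
  have l1: "(\<lambda>n. sint \<Omega> (\<lambda>x. (\<phi> n x - v x)\<^sup>2)) \<longlonglongrightarrow> sint \<Omega> (\<lambda>x. 0)"
  proof (rule integral_dominated_convergence[where w = "\<lambda>x. (2 * B0)\<^sup>2"])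
    show "AE x in lebesgue_on \<Omega>. (\<lambda>n. (\<phi> n x - v x)\<^sup>2) \<longlonglongrightarrow> 0"
    proof (rule AE_I2)
      fix x assume "x \<in> space (lebesgue_on \<Omega>)"
      then have "(\<lambda>n. \<phi> n x - v x) \<longlonglongrightarrow> 0" using \<phi>lim[of x] LIM_zero by auto
      from tendsto_power[OF this, of 2] show "(\<lambda>n. (\<phi> n x - v x)\<^sup>2) \<longlonglongrightarrow> 0" by simp
    qed
    show "AE x in lebesgue_on \<Omega>. norm ((\<phi> n x - v x)\<^sup>2) \<le> (2 * B0)\<^sup>2" for n
    proof (rule AE_I2)
      fix x
      have "\<bar>\<phi> n x - v x\<bar> \<le> 2 * B0" using \<phi>B[of n x] B0[of x] by linarith
      from power_mono[OF this, of 2] show "norm ((\<phi> n x - v x)\<^sup>2) \<le> (2 * B0)\<^sup>2" by simp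
    qed
    show "(\<lambda>x. (\<phi> n x - v x)\<^sup>2) \<in> borel_measurable (lebesgue_on \<Omega>)" for n
      using \<phi>m[of n] vm by measurable
  qed (use fin in auto)
  have l2: "(\<lambda>n. sint \<Omega> (\<lambda>x. (norm (d\<phi> n x - dv x))\<^sup>2)) \<longlonglongrightarrow> sint \<Omega> (\<lambda>x. 0)"
  proof (rule integral_dominated_convergence[where w = "\<lambda>x. (8 * L)\<^sup>2"])
    show "AE x in lebesgue_on \<Omega>. (\<lambda>n. (norm (d\<phi> n x - dv x))\<^sup>2) \<longlonglongrightarrow> 0"
    proof (rule AE_mp[OF AEN], rule AE_I2, rule impI)
      fix x assume "x \<in> \<Omega> - N"
      then have "(\<lambda>n. norm (d\<phi> n x - dv x)) \<longlonglongrightarrow> 0" using lim[of x] tendsto_norm_zero LIM_zero by blast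
      from tendsto_power[OF this, of 2] show "(\<lambda>n. (norm (d\<phi> n x - dv x))\<^sup>2) \<longlonglongrightarrow> 0" by simp
    qed
    show "AE x in lebesgue_on \<Omega>. norm ((norm (d\<phi> n x - dv x))\<^sup>2) \<le> (8 * L)\<^sup>2" for n
    proof (rule AE_mp[OF AEN], rule AE_I2, rule impI)
      fix x assume x: "x \<in> \<Omega> - N"
      have "norm (d\<phi> n x - dv x) \<le> 8 * L"
        using norm_triangle_ineq4[of "d\<phi> n x" "dv x"] dphiB[of n x] dvB[OF x] by linarith
      from power_mono[OF this, of 2] show "norm ((norm (d\<phi> n x - dv x))\<^sup>2) \<le> (8 * L)\<^sup>2" by simp
    qed
    show "(\<lambda>x. (norm (d\<phi> n x - dv x))\<^sup>2) \<in> borel_measurable (lebesgue_on \<Omega>)" for n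
      using \<phi>m[of n] dvm by measurable
  qed (use fin in auto)
  show "\<exists>\<phi> d\<phi>. (\<forall>n. Cc1 \<Omega> (\<phi> n) (d\<phi> n)) \<and>
        (\<lambda>n. sint \<Omega> (\<lambda>x. (\<phi> n x - v x)\<^sup>2)) \<longlonglongrightarrow> 0 \<and>
        (\<lambda>n. sint \<Omega> (\<lambda>x. (norm (d\<phi> n x - dv x))\<^sup>2)) \<longlonglongrightarrow> 0"
    using Cc l1 l2 by (intro exI[of _ \<phi>] exI[of _ d\<phi>]) auto
qed

section \<open>Geometry of triangulations\<close>

text \<open>The barycentric coordinate belonging to \<open>p\<close>, as a quotient of signed areas
  over the opposite side. Cyclic permutation of \<open>p q r\<close> gives the other two.\<close>

definition bary :: "real^2 \<Rightarrow> real^2 \<Rightarrow> real^2 \<Rightarrow> real^2 \<Rightarrow> real" where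
  "bary p q r x = cr (r - q) (x - q) / cr (r - q) (p - q)"

lemma bary_combination:
  assumes cr: "cr (q - p) (r - p) \<noteq> 0"
  shows "bary p q r x + bary q r p x + bary r p q x = 1"
    and "x = bary p q r x *\<^sub>R p + bary q r p x *\<^sub>R q + bary r p q x *\<^sub>R r"
proof -
  have c: "cr (r - q) (p - q) = cr (q - p) (r - p)" "cr (p - r) (q - r) = cr (q - p) (r - p)"
    by (auto simp: cr_def algebra_simps)
  have nz: "(q - p) $ 1 * (r - p) $ 2 - (q - p) $ 2 * (r - p) $ 1 \<noteq> 0" using cr by (simp add: cr_def)
  show s: "bary p q r x + bary q r p x + bary r p q x = 1"
  proof -
    have "cr (r - q) (x - q) + cr (p - r) (x - r) + cr (q - p) (x - p) = cr (q - p) (r - p)"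
      by (simp add: cr_def algebra_simps)
    then show ?thesis
      using cr unfolding bary_def c by (simp add: add_divide_distrib[symmetric])
  qed
  have b: "bary q r p x = cr (x - p) (r - p) / cr (q - p) (r - p)" "bary r p q x = cr (q - p) (x - p) / cr (q - p) (r - p)"
    unfolding bary_def c by (simp_all add: cr_def algebra_simps)
  have "x - p = bary q r p x *\<^sub>R (q - p) + bary r p q x *\<^sub>R (r - p)"
    unfolding b by (rule cr_basis[OF cr])
  then have "x = (1 - bary q r p x - bary r p q x) *\<^sub>R p + bary q r p x *\<^sub>R q + bary r p q x *\<^sub>R r"
    by (simp add: algebra_simps)
  moreover have "1 - bary q r p x - bary r p q x = bary p q r x" using s by simp
  ultimately show "x = bary p q r x *\<^sub>R p + bary q r p x *\<^sub>R q + bary r p q x *\<^sub>R r" by simp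
qed

lemma bary_of_combination:
  assumes cr: "cr (q - p) (r - p) \<noteq> 0" and "a + b + c = 1"
  shows "bary p q r (a *\<^sub>R p + b *\<^sub>R q + c *\<^sub>R r) = a"
proof -
  have "cr (r - q) (p - q) \<noteq> 0" using cr by (simp add: cr_rot)
  moreover have "cr (r - q) ((a *\<^sub>R p + b *\<^sub>R q + c *\<^sub>R r) - q) = a * cr (r - q) (p - q)"
  proof -
    have b: "b = 1 - a - c" using assms(2) by simp
    show ?thesis unfolding b by (simp add: cr_def algebra_simps)
  qed
  ultimately show ?thesis by (simp add: bary_def)
qed

lemma cr_cyclic_nz:
  assumes "cr (q - p) (r - p) \<noteq> 0"
  shows "cr (r - q) (p - q) \<noteq> 0" "cr (p - r) (q - r) \<noteq> 0" "cr (r - p) (q - p) \<noteq> 0"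
  using assms by (auto simp: cr_def algebra_simps)

lemma continuous_bary: "continuous_on S (bary p q r)"
  unfolding bary_def[abs_def] cr_def divide_inverse by (intro continuous_intros)

lemma mem_triangle_bary:
  assumes cr: "cr (q - p) (r - p) \<noteq> 0"
  shows "x \<in> convex hull {p,q,r} \<longleftrightarrow> bary p q r x \<ge> 0 \<and> bary q r p x \<ge> 0 \<and> bary r p q x \<ge> 0"
proof
  assume "x \<in> convex hull {p,q,r}"
  then obtain a b c where abc: "0 \<le> a" "0 \<le> b" "0 \<le> c" "a + b + c = 1" "x = a *\<^sub>R p + b *\<^sub>R q + c *\<^sub>R r"
    by (auto simp: convex_hull_3)
  have "bary p q r x = a" using bary_of_combination[OF cr, of a b c] abc by simp
  moreover have "bary q r p x = b" using bary_of_combination[OF cr_cyclic_nz(1)[OF cr], of b c a] abc by (simp add: add_ac)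
  moreover have "bary r p q x = c" using bary_of_combination[OF cr_cyclic_nz(2)[OF cr], of c a b] abc by (simp add: add_ac)
  ultimately show "bary p q r x \<ge> 0 \<and> bary q r p x \<ge> 0 \<and> bary r p q x \<ge> 0" using abc by simp
next
  assume "bary p q r x \<ge> 0 \<and> bary q r p x \<ge> 0 \<and> bary r p q x \<ge> 0"
  then show "x \<in> convex hull {p,q,r}"
    unfolding convex_hull_3 using bary_combination[OF cr, of x] by blast
qed

lemma open_bary_pos: "open {x. bary p q r x > 0}"
  by (intro open_Collect_less continuous_bary continuous_intros)

lemma interior_triangle_bary:
  assumes cr: "cr (q - p) (r - p) \<noteq> 0" and "bary p q r x > 0" "bary q r p x > 0" "bary r p q x > 0"
  shows "x \<in> interior (convex hull {p,q,r})"
proof (rule interiorI)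
  show "open ({x. bary p q r x > 0} \<inter> {x. bary q r p x > 0} \<inter> {x. bary r p q x > 0})"
    by (intro open_Int open_bary_pos)
qed (use assms in \<open>auto simp: mem_triangle_bary\<close>)

lemma bary_closed_segment:
  assumes cr: "cr (q - p) (r - p) \<noteq> 0"
  shows "x \<in> closed_segment q r \<longleftrightarrow> x \<in> convex hull {p,q,r} \<and> bary p q r x = 0"
proof
  assume "x \<in> closed_segment q r"
  then obtain s where s: "0 \<le> s" "s \<le> 1" "x = 0 *\<^sub>R p + (1 - s) *\<^sub>R q + s *\<^sub>R r" by (auto simp: in_segment)
  then have "bary p q r x = 0" using bary_of_combination[OF cr, of 0 "1 - s" s] by simp
  moreover have "x \<in> convex hull {p,q,r}" unfolding convex_hull_3 using s by (intro CollectI exI[of _ 0] exI[of _ "1 - s"] exI[of _ s]) auto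
  ultimately show "x \<in> convex hull {p,q,r} \<and> bary p q r x = 0" by simp
next
  assume a: "x \<in> convex hull {p,q,r} \<and> bary p q r x = 0"
  then have f: "bary q r p x = 1 - bary r p q x" "x = bary q r p x *\<^sub>R q + bary r p q x *\<^sub>R r" "0 \<le> bary r p q x" "0 \<le> bary q r p x"
    using bary_combination[OF cr, of x] mem_triangle_bary[OF cr, of x] by auto
  have "x = (1 - bary r p q x) *\<^sub>R q + bary r p q x *\<^sub>R r" using f(2) unfolding f(1) .
  then show "x \<in> closed_segment q r"
    unfolding in_segment using f by (intro exI[of _ "bary r p q x"]) simp
qed

lemma bary_open_segment:
  assumes cr: "cr (q - p) (r - p) \<noteq> 0" and "x \<in> open_segment q r"
  shows "bary p q r x = 0" "bary q r p x > 0" "bary r p q x > 0"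
proof -
  obtain s where s: "0 < s" "s < 1" "x = 0 *\<^sub>R p + (1 - s) *\<^sub>R q + s *\<^sub>R r" using assms(2) by (auto simp: in_segment)
  show "bary p q r x = 0" using bary_of_combination[OF cr, of 0 "1 - s" s] s by simp
  have "bary q r p x = 1 - s" using bary_of_combination[OF cr_cyclic_nz(1)[OF cr], of "1 - s" s 0] s by simp
  then show "bary q r p x > 0" using s by simp
  have "bary r p q x = s" using bary_of_combination[OF cr_cyclic_nz(2)[OF cr], of s 0 "1 - s"] s by (simp add: add_ac)
  then show "bary r p q x > 0" using s by simp
qed

lemma open_segment_of_bary:
  assumes cr: "cr (q - p) (r - p) \<noteq> 0" and "bary p q r x = 0" "bary q r p x > 0" "bary r p q x > 0"
  shows "x \<in> open_segment q r"
proof -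
  have "q \<noteq> r" using cr by (auto simp: cr_def)
  moreover have f: "bary q r p x = 1 - bary r p q x" "x = bary q r p x *\<^sub>R q + bary r p q x *\<^sub>R r"
    using bary_combination[OF cr, of x] assms by auto
  moreover have "x = (1 - bary r p q x) *\<^sub>R q + bary r p q x *\<^sub>R r" using f(2) unfolding f(1) .
  ultimately show ?thesis
    unfolding in_segment using assms by (intro conjI exI[of _ "bary r p q x"]) simp_all
qed

section \<open>Vertices, edges and interior of a triangle\<close>

lemma verts_triangle:
  assumes "cr (q - p) (r - p) \<noteq> 0"
  shows "verts (convex hull {p,q,r}) = {p,q,r}"
proof -
  have "\<not> affine_dependent {p,q,r}"
    using assms affine_dependent_imp_collinear_3[of p q r] by (auto simp: collinear_iff_cr)
  then show ?thesis
    unfolding verts_def by (auto simp: extreme_point_of_convex_hull_affine_independent)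
qed

lemma edges_triangle:
  assumes "cr (q - p) (r - p) \<noteq> 0"
  shows "edges (convex hull {p,q,r}) = {closed_segment q r, closed_segment r p, closed_segment p q}"
proof -
  have "p \<noteq> q" "q \<noteq> r" "p \<noteq> r" using assms by (auto simp: cr_def)
  then show ?thesis
    unfolding edges_def verts_triangle[OF assms]
    by (auto simp: closed_segment_commute)
qed

text \<open>The end points are recovered from the point set as its extreme points.\<close>

lemma closed_segment_endpoints:
  assumes "closed_segment a b = closed_segment c d"
  shows "{a,b} = {c,d :: 'a::euclidean_space}"
proof -
  have "{a,b} = {x. x extreme_point_of closed_segment a b}" for a b :: 'a
    by (auto simp: extreme_point_of_segment)
  then show ?thesis using assms by metis
qed

lemma tri_cr: "tri T \<longleftrightarrow> (\<exists>p q r. cr (q - p) (r - p) \<noteq> 0 \<and> T = convex hull {p,q,r})"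
  by (simp add: tri_def collinear_iff_cr)

lemma tri_vertex_obtain:
  assumes "tri T" "z \<in> verts T"
  obtains q r where "cr (q - z) (r - z) \<noteq> 0" "T = convex hull {z,q,r}"
proof -
  obtain a b c where abc: "cr (b - a) (c - a) \<noteq> 0" "T = convex hull {a,b,c}" using assms(1) by (auto simp: tri_cr)
  then have "z = a \<or> z = b \<or> z = c" using assms(2) verts_triangle by auto
  moreover have "{a,b,c} = {b,c,a}" "{a,b,c} = {c,a,b}" by auto
  ultimately show ?thesis using that abc cr_cyclic_nz[OF abc(1)] by metis
qed

lemma tri_edge_obtain:
  assumes "tri T" "e \<in> edges T"
  obtains p q r where "cr (q - p) (r - p) \<noteq> 0" "T = convex hull {p,q,r}" "e = closed_segment q r"
proof -
  obtain a b c where abc: "cr (b - a) (c - a) \<noteq> 0" "T = convex hull {a,b,c}" using assms(1) by (auto simp: tri_cr)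
  then have "e = closed_segment b c \<or> e = closed_segment c a \<or> e = closed_segment a b" using assms(2) edges_triangle by auto
  moreover have "{a,b,c} = {b,c,a}" "{a,b,c} = {c,a,b}" by auto
  ultimately show ?thesis using that abc cr_cyclic_nz[OF abc(1)] by metis
qed

lemma tri_edge_obtain2:
  assumes "tri T" "closed_segment q r \<in> edges T"
  obtains p where "cr (q - p) (r - p) \<noteq> 0" "T = convex hull {p,q,r}"
proof -
  obtain p a b where abc: "cr (a - p) (b - p) \<noteq> 0" "T = convex hull {p,a,b}" "closed_segment q r = closed_segment a b"
    using tri_edge_obtain[OF assms] by metis
  from closed_segment_endpoints[OF abc(3)] consider "a = q" "b = r" | "a = r" "b = q" by (auto simp: doubleton_eq_iff)
  then show ?thesis
  proof cases
    case 1 then show ?thesis using that abc by blast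
  next
    case 2
    then have "cr (q - p) (r - p) \<noteq> 0" using abc(1) by (simp add: cr_def algebra_simps)
    moreover have "T = convex hull {p,q,r}" using abc(2) 2 by (simp add: insert_commute)
    ultimately show ?thesis using that by blast
  qed
qed

lemma edge_endpoints_verts:
  assumes "tri T" "closed_segment v w \<in> edges T"
  shows "v \<in> verts T" "w \<in> verts T" "v \<noteq> w"
proof -
  obtain p where p: "cr (v - p) (w - p) \<noteq> 0" "T = convex hull {p,v,w}" using tri_edge_obtain2[OF assms] .
  show "v \<in> verts T" "w \<in> verts T" unfolding p(2) verts_triangle[OF p(1)] by auto
  show "v \<noteq> w" using p(1) by (auto simp: cr_def)
qed

lemma tri_compact: "tri T \<Longrightarrow> compact T" and tri_convex: "tri T \<Longrightarrow> convex T"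
  by (auto simp: tri_def compact_convex_hull)

lemma tri_closed: "tri T \<Longrightarrow> closed T" by (simp add: tri_compact compact_imp_closed)

lemma tri_closure_interior:
  assumes "tri T" shows "closure (interior T) = T" "interior T \<noteq> {}"
proof -
  obtain p q r where c: "cr (q - p) (r - p) \<noteq> 0" "T = convex hull {p,q,r}" using assms by (auto simp: tri_cr)
  let ?x = "(1/3) *\<^sub>R p + (1/3) *\<^sub>R q + (1/3) *\<^sub>R r"
  have "bary p q r ?x = 1/3" using bary_of_combination[OF c(1), of "1/3" "1/3" "1/3"] by simp
  moreover have "bary q r p ?x = 1/3" using bary_of_combination[OF cr_cyclic_nz(1)[OF c(1)], of "1/3" "1/3" "1/3"] by (simp add: add_ac)
  moreover have "bary r p q ?x = 1/3" using bary_of_combination[OF cr_cyclic_nz(2)[OF c(1)], of "1/3" "1/3" "1/3"] by (simp add: add_ac)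
  ultimately have "?x \<in> interior T" unfolding c(2) by (intro interior_triangle_bary[OF c(1)]) auto
  then show ne: "interior T \<noteq> {}" by auto
  show "closure (interior T) = T"
    using convex_closure_interior[OF tri_convex[OF assms] ne] closure_closed[OF tri_closed[OF assms]] by simp
qed

text \<open>A triangle is the closure of its interior. Together with disjointness of interiors this
  is how two mesh triangles are shown to coincide.\<close>

lemma tri_interior_near:
  assumes "tri T" "x \<in> T" "open U" "x \<in> U"
  obtains y where "y \<in> interior T" "y \<in> U"
proof -
  have "x \<in> closure (interior T)" using tri_closure_interior(1)[OF assms(1)] assms(2) by simp
  then have "U \<inter> closure (interior T) \<noteq> {}" using assms(4) by auto
  then have "U \<inter> interior T \<noteq> {}" using open_Int_closure_eq_empty[OF assms(3)] by blast
  then show ?thesis using that by auto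
qed

text \<open>At an inner point of the edge the two other barycentric coordinates are positive, and
  they remain so nearby; there the sign of the first one alone decides membership.\<close>

lemma half_disc:
  assumes cr: "cr (q - p) (r - p) \<noteq> 0" and x: "x \<in> open_segment q r"
  obtains \<epsilon> where "\<epsilon> > 0" "\<And>y. dist x y < \<epsilon> \<Longrightarrow> bary p q r y \<ge> 0 \<Longrightarrow> y \<in> convex hull {p,q,r}"
proof -
  have "open ({x. bary q r p x > 0} \<inter> {x. bary r p q x > 0})" by (intro open_Int open_bary_pos)
  moreover have "x \<in> {x. bary q r p x > 0} \<inter> {x. bary r p q x > 0}" using bary_open_segment[OF cr x] by auto
  ultimately obtain \<epsilon> where "\<epsilon> > 0" "ball x \<epsilon> \<subseteq> {x. bary q r p x > 0} \<inter> {x. bary r p q x > 0}"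
    using open_contains_ball by blast
  then show ?thesis using that mem_triangle_bary[OF cr] by (force simp: ball_def)
qed

text \<open>If both opposite vertices lay on the same side of the edge, the two half discs would
  overlap beyond it. On opposite sides they make up a full disc.\<close>

lemma adjacent_triangles_nbhd:
  assumes c: "cr (q - p) (r - p) \<noteq> 0" "cr (q - p') (r - p') \<noteq> 0"
    and int: "convex hull {p,q,r} \<inter> convex hull {p',q,r} = closed_segment q r"
    and x: "x \<in> open_segment q r"
  shows "x \<in> interior (convex hull {p,q,r} \<union> convex hull {p',q,r})"
proof -
  let ?T = "convex hull {p,q,r}" and ?T' = "convex hull {p',q,r}"
  obtain \<epsilon> where e: "\<epsilon> > 0" "\<And>y. dist x y < \<epsilon> \<Longrightarrow> bary p q r y \<ge> 0 \<Longrightarrow> y \<in> ?T" using half_disc[OF c(1) x] by blast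
  obtain \<epsilon>' where e': "\<epsilon>' > 0" "\<And>y. dist x y < \<epsilon>' \<Longrightarrow> bary p' q r y \<ge> 0 \<Longrightarrow> y \<in> ?T'" using half_disc[OF c(2) x] by blast
  let ?a = "cr (r - q) (p - q)" and ?a' = "cr (r - q) (p' - q)"
  have nz: "?a \<noteq> 0" "?a' \<noteq> 0" using cr_cyclic_nz(1)[OF c(1)] cr_cyclic_nz(1)[OF c(2)] by auto
  have opp: "?a * ?a' < 0"
  proof (rule ccontr)
    assume "\<not> ?thesis"
    then have pos: "?a * ?a' > 0" using nz by (simp add: not_less less_le)
    \<comment> \<open>A step from \<open>x\<close> towards \<open>p\<close>, short enough to stay in
      both discs. With vertices on the same side it ends in both triangles but off the edge.\<close>
    define s where "s = min 1 (min \<epsilon> \<epsilon>' / (2 * (norm (p - x) + 1)))"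
    have s: "s > 0" using e e' by (auto simp: s_def intro!: divide_pos_pos add_nonneg_pos)
    define y where "y = x + s *\<^sub>R (p - x)"
    have "s * norm (p - x) \<le> min \<epsilon> \<epsilon>' / (2 * (norm (p - x) + 1)) * norm (p - x)" by (intro mult_right_mono) (auto simp: s_def)
    also have "\<dots> < min \<epsilon> \<epsilon>'"
    proof -
      have "0 < norm (p - x) + 1" by (simp add: add_nonneg_pos)
      then have "min \<epsilon> \<epsilon>' / (2 * (norm (p - x) + 1)) * norm (p - x) = min \<epsilon> \<epsilon>' * (norm (p - x) / (2 * (norm (p - x) + 1)))" by simp
      also have "\<dots> < min \<epsilon> \<epsilon>' * 1"
        using e e' \<open>0 < norm (p - x) + 1\<close> by (intro mult_strict_left_mono) auto
      finally show ?thesis by simp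
    qed
    finally have dy: "dist x y < \<epsilon>" "dist x y < \<epsilon>'" using s by (auto simp: y_def dist_norm)
    have b0: "cr (r - q) (x - q) = 0" using bary_open_segment(1)[OF c(1) x] nz by (simp add: bary_def)
    have "cr (r - q) (y - q) = s * ?a"
    proof -
      have "cr (r - q) (y - q) = cr (r - q) (x - q) + s * (?a - cr (r - q) (x - q))"
        by (simp add: y_def cr_def algebra_simps)
      then show ?thesis using b0 by simp
    qed
    then have "bary p q r y = s" "bary p' q r y = s * ?a / ?a'" using nz by (auto simp: bary_def)
    moreover have "?a / ?a' > 0" using pos by (simp add: zero_less_divide_iff zero_less_mult_iff)
    ultimately have "bary p q r y > 0" "bary p' q r y \<ge> 0" using s by (auto simp: times_divide_eq_right[symmetric] simp del: times_divide_eq_right)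
    then have "y \<in> ?T \<inter> ?T'" using e(2) e'(2) dy by auto
    then have "y \<in> closed_segment q r" using int by simp
    then show False using bary_closed_segment[OF c(1)] \<open>bary p q r y > 0\<close> by auto
  qed
  show ?thesis
  proof (rule interiorI)
    show "open (ball x (min \<epsilon> \<epsilon>'))" "x \<in> ball x (min \<epsilon> \<epsilon>')" using e e' by auto
    show "ball x (min \<epsilon> \<epsilon>') \<subseteq> ?T \<union> ?T'"
    proof
      fix y assume y: "y \<in> ball x (min \<epsilon> \<epsilon>')"
      let ?b = "cr (r - q) (y - q)"
      have "?b / ?a \<ge> 0 \<or> ?b / ?a' \<ge> 0"
        using opp by (auto simp: zero_le_divide_iff mult_less_0_iff)
      then show "y \<in> ?T \<union> ?T'" using y e(2) e'(2) by (auto simp: bary_def)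
    qed
  qed
qed

lemma segment_interior_empty: "interior (closed_segment a (b::real^2)) = {}"
  by (rule interior_closed_segment_ge2) simp

section \<open>Conforming meshes: disjointness, boundary edges, neighbours\<close>

locale mesh =
  fixes \<Omega> :: "(real^2) set" and Th :: "(real^2) set set"
  assumes triangulation: "triangulation \<Omega> Th"
begin

lemma fin: "finite Th"
  using triangulation unfolding triangulation_def by (elim conjE)

lemma tri: "T \<in> Th \<Longrightarrow> tri T"
  using triangulation unfolding triangulation_def by (elim conjE) blast

lemma union: "\<Union>Th = closure \<Omega>"
  using triangulation unfolding triangulation_def by (elim conjE)

lemma Om: "\<Omega> = interior (\<Union>Th)"
  using triangulation unfolding triangulation_def by (elim conjE)

lemma conform: "T1 \<in> Th \<Longrightarrow> T2 \<in> Th \<Longrightarrow> T1 \<noteq> T2 \<Longrightarrow> T1 \<inter> T2 = {} \<or>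
        (\<exists>v. v \<in> verts T1 \<and> v \<in> verts T2 \<and> T1 \<inter> T2 = {v}) \<or>
        (T1 \<inter> T2 \<in> edges T1 \<and> T1 \<inter> T2 \<in> edges T2)"
  using triangulation unfolding triangulation_def by (elim conjE) blast

lemma open_Om: "open \<Omega>" by (subst Om) simp

lemma bounded_Om: "bounded \<Omega>"
proof -
  have "bounded (\<Union>Th)" using fin tri tri_compact compact_imp_bounded by blast
  then show ?thesis using Om interior_subset bounded_subset by metis
qed

lemma inter_segment: 
  assumes "T1 \<in> Th" "T2 \<in> Th" "T1 \<noteq> T2"
  obtains a b where "T1 \<inter> T2 \<subseteq> closed_segment a b"
proof -
  consider "T1 \<inter> T2 = {}" | v where "T1 \<inter> T2 = {v}" | "T1 \<inter> T2 \<in> edges T1" using conform[OF assms] by blast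
  then show ?thesis
  proof cases
    case 3 then show ?thesis using that by (auto simp: edges_def)
  qed (use that in auto)
qed

text \<open>A point of \<open>T2\<close> in the open set \<open>interior T1\<close> produces an open
  overlap of the two interiors, but by conformity the intersection lies in a segment.\<close>

lemma interior_disjoint:
  assumes "T1 \<in> Th" "T2 \<in> Th" "T1 \<noteq> T2" shows "interior T1 \<inter> T2 = {}"
proof (rule ccontr)
  assume "interior T1 \<inter> T2 \<noteq> {}"
  then obtain x where x: "x \<in> interior T1" "x \<in> T2" by auto
  obtain y where y: "y \<in> interior T2" "y \<in> interior T1" using tri_interior_near[OF tri[OF assms(2)] x(2) open_interior x(1)] .
  obtain a b where ab: "T1 \<inter> T2 \<subseteq> closed_segment a b" using inter_segment[OF assms] .
  have "interior T1 \<inter> interior T2 \<subseteq> closed_segment a b" using ab interior_subset by blast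
  then have "interior T1 \<inter> interior T2 \<subseteq> interior (closed_segment a b)" by (intro interior_maximal) auto
  then show False using y segment_interior_empty by auto
qed

lemma inter_negligible:
  assumes "T1 \<in> Th" "T2 \<in> Th" "T1 \<noteq> T2" shows "negligible (T1 \<inter> T2)"
proof -
  obtain a b where ab: "T1 \<inter> T2 \<subseteq> closed_segment a b" using inter_segment[OF assms] .
  have "negligible (closed_segment a b)" using segment_interior_empty by (subst negligible_convex_interior) auto
  then show ?thesis using ab negligible_subset by blast
qed

text \<open>An inner point of \<open>e\<close> lying in \<Omega> would be a limit of points just
  beyond \<open>e\<close>, which belong to the finitely many other triangles. Their union is closed,
  so one of them contains the point, and conformity makes \<open>e\<close> the edge shared with
  it.\<close>

lemma boundary_edge_disjoint:
  assumes T: "T \<in> Th" and e: "e \<in> edges T" "e \<notin> interior_edges Th"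
  shows "e \<inter> \<Omega> = {}"
proof -
  obtain p q r where c: "cr (q - p) (r - p) \<noteq> 0" and Tq: "T = convex hull {p,q,r}" and eq: "e = closed_segment q r"
    using tri_edge_obtain[OF tri[OF T] e(1)] .
  have "x \<notin> \<Omega>" if x: "x \<in> open_segment q r" for x
  proof
    assume "x \<in> \<Omega>"
    let ?S = "\<Union>(Th - {T})"
    have b0: "cr (r - q) (x - q) = 0" "cr (r - q) (p - q) \<noteq> 0"
      using bary_open_segment(1)[OF c x] cr_cyclic_nz[OF c] by (simp_all add: bary_def)
    have "x \<in> closure ?S"
      unfolding closure_approachable
    proof (intro allI impI)
      fix \<epsilon> :: real assume "\<epsilon> > 0"
      obtain \<rho> where \<rho>: "\<rho> > 0" "ball x \<rho> \<subseteq> \<Omega>" using \<open>x \<in> \<Omega>\<close> open_Om open_contains_ball by blast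
      define s where "s = min \<epsilon> \<rho> / (2 * (norm (p - x) + 1))"
      have npos: "0 < norm (p - x) + 1" by (simp add: add_nonneg_pos)
      have s: "s > 0" using \<open>\<epsilon> > 0\<close> \<rho> npos by (auto simp: s_def)
      \<comment> \<open>Away from \<open>p\<close>, across the edge: the first barycentric
        coordinate becomes \<open>- s\<close>. The radius \<rho> keeps \<open>y\<close> in \<Omega>,
        hence in some triangle.\<close>
      define y where "y = x - s *\<^sub>R (p - x)"
      have "s * norm (p - x) = min \<epsilon> \<rho> * (norm (p - x) / (2 * (norm (p - x) + 1)))" by (simp add: s_def)
      also have "\<dots> < min \<epsilon> \<rho> * 1" using \<open>\<epsilon> > 0\<close> \<rho> npos by (intro mult_strict_left_mono) auto
      finally have dy: "dist y x < \<epsilon>" "dist x y < \<rho>" using s by (auto simp: y_def dist_norm)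
      have "cr (r - q) (y - q) = cr (r - q) (x - q) - s * (cr (r - q) (p - q) - cr (r - q) (x - q))"
        by (simp add: y_def cr_def algebra_simps)
      then have "bary p q r y = - s" using b0 by (simp add: bary_def)
      then have "y \<notin> T" using s mem_triangle_bary[OF c] Tq by auto
      moreover have "y \<in> \<Union>Th" using dy(2) \<rho>(2) Om interior_subset by (metis mem_ball subsetD)
      ultimately show "\<exists>y\<in>?S. dist y x < \<epsilon>" using dy by blast
    qed
    moreover have "closed ?S" using fin tri tri_closed by (intro closed_Union) auto
    ultimately obtain T' where T': "T' \<in> Th" "T' \<noteq> T" "x \<in> T'" by (auto simp: closure_closed)
    have xT: "x \<in> T" using bary_open_segment[OF c x] mem_triangle_bary[OF c] Tq by auto
    have xv: "x \<notin> verts T"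
    proof -
      have "bary p q r p = 1" using bary_of_combination[OF c, of 1 0 0] by simp
      then have "x \<noteq> p" using bary_open_segment(1)[OF c x] by auto
      then show ?thesis using x verts_triangle[OF c] Tq by (auto simp: open_segment_def)
    qed
    have xi: "x \<in> T \<inter> T'" using xT T'(3) by simp
    have "T \<inter> T' \<in> edges T" using conform[OF T T'(1) T'(2)[symmetric]] xi xv by (metis empty_iff singletonD)
    then have "T \<inter> T' = closed_segment q r \<or> T \<inter> T' = closed_segment r p \<or> T \<inter> T' = closed_segment p q"
      using edges_triangle[OF c] Tq by auto
    moreover have "x \<notin> closed_segment r p"
      using bary_closed_segment[OF cr_cyclic_nz(1)[OF c]] bary_open_segment(2)[OF c x] by auto
    moreover have "x \<notin> closed_segment p q"
      using bary_closed_segment[OF cr_cyclic_nz(2)[OF c]] bary_open_segment(3)[OF c x] by auto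
    ultimately have "T \<inter> T' = e" using xT T'(3) eq by auto
    then have "e \<in> interior_edges Th" unfolding interior_edges_def using T T' e by auto
    then show False using e by simp
  qed
  then have "\<Omega> \<inter> open_segment q r = {}" by auto
  \<comment> \<open>An open set missing the open segment misses its closure; this settles the end
    points of \<open>e\<close>.\<close>
  then have "\<Omega> \<inter> closure (open_segment q r) = {}" using open_Int_closure_eq_empty[OF open_Om] by blast
  moreover have "q \<noteq> r" using c by (auto simp: cr_def)
  ultimately show ?thesis using eq by auto
qed

lemma interior_edge_adjacent:
  assumes "T \<in> Th" "T' \<in> Th" "T \<noteq> T'" "closed_segment q r \<in> edges T" "T \<inter> T' = closed_segment q r"
  obtains p p' where "cr (q - p) (r - p) \<noteq> 0" "T = convex hull {p,q,r}" "cr (q - p') (r - p') \<noteq> 0" "T' = convex hull {p',q,r}"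
    "\<And>x. x \<in> open_segment q r \<Longrightarrow> x \<in> interior (T \<union> T')"
proof -
  have qr: "q \<noteq> r" using edge_endpoints_verts(3)[OF tri[OF assms(1)] assms(4)] .
  then have "infinite (T \<inter> T')" unfolding assms(5) by simp
  then have "T \<inter> T' \<in> edges T'" using conform[OF assms(1-3)] by (metis finite.emptyI finite.insertI)
  then have e': "closed_segment q r \<in> edges T'" using assms by simp
  obtain p where p: "cr (q - p) (r - p) \<noteq> 0" "T = convex hull {p,q,r}" using tri_edge_obtain2[OF tri[OF assms(1)] assms(4)] .
  obtain p' where p': "cr (q - p') (r - p') \<noteq> 0" "T' = convex hull {p',q,r}" using tri_edge_obtain2[OF tri[OF assms(2)] e'] .
  have "x \<in> interior (T \<union> T')" if "x \<in> open_segment q r" for x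
    using adjacent_triangles_nbhd[OF p(1) p'(1) _ that] assms(5) p p' by auto
  then show ?thesis using that p p' by blast
qed

text \<open>The two triangles form a neighbourhood of the midpoint of \<open>e\<close>, so a further
  triangle through it would share interior points with one of them.\<close>

lemma third_triangle:
  assumes "T \<in> Th" "T' \<in> Th" "T \<noteq> T'" "e \<in> edges T" "T \<inter> T' = e" "T'' \<in> Th" "e \<subseteq> T''"
  shows "T'' = T \<or> T'' = T'"
proof -
  obtain p q r where c: "cr (q - p) (r - p) \<noteq> 0" "e = closed_segment q r"
    using tri_edge_obtain[OF tri[OF assms(1)] assms(4)] by metis
  have "q \<noteq> r" using c by (auto simp: cr_def)
  then have m: "midpoint q r \<in> open_segment q r" by simp
  then have mi: "midpoint q r \<in> interior (T \<union> T')"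
    using interior_edge_adjacent[OF assms(1-3)] assms(4,5) c by metis
  have "midpoint q r \<in> T''" using assms(7) c m by (auto simp: open_segment_def)
  then obtain y where y: "y \<in> interior T''" "y \<in> interior (T \<union> T')"
    using tri_interior_near[OF tri[OF assms(6)] _ open_interior mi] by blast
  then have "y \<in> T \<or> y \<in> T'" using interior_subset by blast
  then show ?thesis using y(1) interior_disjoint[OF assms(6,1)] interior_disjoint[OF assms(6,2)] by blast
qed

text \<open>Exactly two triangles contain an interior edge, so the definite description in
  \<open>neighbor\<close> is meaningful. That \<open>e\<close> is an edge of the neighbour as well
  follows from conformity, since a segment is more than one point.\<close>

lemma interior_edge_neighbor:
  assumes "e \<in> interior_edges Th" "T \<in> Th" "e \<in> edges T"
  shows "neighbor Th T e \<in> Th" "neighbor Th T e \<noteq> T" "T \<inter> neighbor Th T e = e" "e \<in> edges (neighbor Th T e)"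
    and "\<And>T''. T'' \<in> Th \<Longrightarrow> e \<subseteq> T'' \<Longrightarrow> T'' = T \<or> T'' = neighbor Th T e"
proof -
  have eT: "e \<subseteq> T"
  proof -
    obtain p q r where "cr (q - p) (r - p) \<noteq> 0" "T = convex hull {p,q,r}" "e = closed_segment q r"
      using tri_edge_obtain[OF tri[OF assms(2)] assms(3)] .
    then show ?thesis using bary_closed_segment by blast
  qed
  obtain T1 T2 where T12: "T1 \<in> Th" "T2 \<in> Th" "T1 \<noteq> T2" "e \<in> edges T1" "e = T1 \<inter> T2"
    using assms(1) by (auto simp: interior_edges_def)
  have "T = T1 \<or> T = T2" using third_triangle[OF T12(1-4) T12(5)[symmetric] assms(2) eT] .
  then obtain T' where T': "T' \<in> Th" "T' \<noteq> T" "T \<inter> T' = e" using T12 by blast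
  have third: "T'' = T \<or> T'' = T'" if "T'' \<in> Th" "e \<subseteq> T''" for T''
    using third_triangle[OF assms(2) T'(1) T'(2)[symmetric] assms(3) T'(3) that] .
  have "neighbor Th T e = T'"
    unfolding neighbor_def using T' third by (intro the_equality) auto
  moreover have "e \<in> edges T'"
  proof -
    obtain v w where vw: "e = closed_segment v w" "v \<noteq> w" using assms(3) by (auto simp: edges_def)
    then have "infinite (T \<inter> T')" unfolding T'(3) by simp
    then show ?thesis using conform[OF assms(2) T'(1) T'(2)[symmetric]] T'(3) by (metis finite.emptyI finite.insertI)
  qed
  ultimately show "neighbor Th T e \<in> Th" "neighbor Th T e \<noteq> T" "T \<inter> neighbor Th T e = e" "e \<in> edges (neighbor Th T e)"
    "\<And>T''. T'' \<in> Th \<Longrightarrow> e \<subseteq> T'' \<Longrightarrow> T'' = T \<or> T'' = neighbor Th T e"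
    using T' third by auto
qed

lemma open_edge_in_interior:
  assumes "closed_segment q r \<in> interior_edges Th" "T \<in> Th" "closed_segment q r \<in> edges T" "x \<in> open_segment q r"
  shows "x \<in> interior (T \<union> neighbor Th T (closed_segment q r))"
proof -
  note n = interior_edge_neighbor[OF assms(1-3)]
  show ?thesis using interior_edge_adjacent[OF assms(2) n(1) n(2)[symmetric] assms(3) n(3)] assms(4) by metis
qed

text \<open>Conformity excludes hanging nodes: a vertex of \<open>T\<close> in the open part of a
  shared edge would not be an extreme point of \<open>T\<close>.\<close>

lemma vertex_shared:
  assumes "T \<in> Th" "T' \<in> Th" "z \<in> verts T" "z \<in> T'"
  shows "z \<in> verts T'"
proof (cases "T = T'")
  case False
  have zT: "z \<in> T" using assms(3) by (auto simp: verts_def extreme_point_of_def)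
  then have ne: "T \<inter> T' \<noteq> {}" using assms(4) by auto
  consider v where "v \<in> verts T" "v \<in> verts T'" "T \<inter> T' = {v}" | "T \<inter> T' \<in> edges T" "T \<inter> T' \<in> edges T'"
    using conform[OF assms(1,2) False] ne by blast
  then show ?thesis
  proof cases
    case 1 then show ?thesis using assms zT by auto
  next
    case 2
    then obtain v w where vw: "T \<inter> T' = closed_segment v w" by (auto simp: edges_def)
    have "z \<in> closed_segment v w" using vw assms zT by auto
    moreover have "z \<notin> open_segment v w"
    proof
      assume "z \<in> open_segment v w"
      moreover have "v \<in> T" "w \<in> T" using vw by (metis IntE ends_in_segment(1)) (metis IntE ends_in_segment(2) vw)
      ultimately show False using assms(3) by (auto simp: verts_def extreme_point_of_def)
    qed
    ultimately have "z = v \<or> z = w" by (auto simp: open_segment_def)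
    then show ?thesis using edge_endpoints_verts[OF tri[OF assms(2)]] 2 vw by metis
  qed
qed (use assms in simp)

section \<open>Fans of triangles around a vertex\<close>

definition adj :: "real^2 \<Rightarrow> ((real^2) set \<times> (real^2) set) set" where
  "adj z = {(T,T'). T \<in> Th \<and> T' \<in> Th \<and> T \<noteq> T' \<and> z \<in> T \<inter> T' \<and> T \<inter> T' \<in> edges T \<and> T \<inter> T' \<in> edges T'}"

text \<open>The component of \<open>T0\<close> under walking across edges through \<open>z\<close>.
  Where parts of the mesh touch only in \<open>z\<close>, there are several fans at
  \<open>z\<close>.\<close>

definition fan :: "real^2 \<Rightarrow> (real^2) set \<Rightarrow> (real^2) set set" where
  "fan z T0 = (adj z)\<^sup>* `` {T0}"

lemma fan_subset: 
  assumes "T0 \<in> Th" "z \<in> T0" shows "fan z T0 \<subseteq> {T \<in> Th. z \<in> T}"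
proof
  fix T assume "T \<in> fan z T0"
  then have "(T0, T) \<in> (adj z)\<^sup>*" by (simp add: fan_def)
  then show "T \<in> {T \<in> Th. z \<in> T}" by (cases rule: rtranclE) (use assms in \<open>auto simp: adj_def\<close>)
qed

text \<open>
  If all edges at \<open>z\<close> in the fan are interior, the union of the fan is relatively open and closed in a
  punctured disc around \<open>z\<close>, which is connected.
\<close>
lemma fan_dichotomy:
  assumes T0: "T0 \<in> Th" "z \<in> verts T0"
    and int: "\<And>T e. T \<in> fan z T0 \<Longrightarrow> e \<in> edges T \<Longrightarrow> z \<in> e \<Longrightarrow> e \<in> interior_edges Th"
  shows "z \<in> \<Omega>" "fan z T0 = {T \<in> Th. z \<in> T}"
proof -
  let ?F = "fan z T0"
  have zT0: "z \<in> T0" using T0(2) by (auto simp: verts_def extreme_point_of_def)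
  have F: "T \<in> Th" "z \<in> T" "z \<in> verts T" if "T \<in> ?F" for T
    using fan_subset[OF T0(1) zT0] that vertex_shared[OF T0(1) _ T0(2)] by auto
  have finF: "finite ?F" using F(1) by (intro finite_subset[OF _ fin]) auto
  \<comment> \<open>In a ball smaller than the distance from \<open>z\<close> to the opposite sides,
    the fan consists of sectors. The quantifier over \<open>q r\<close> covers both ways of naming
    the other two vertices.\<close>
  have "\<exists>\<epsilon>>0. \<forall>q r y. T = convex hull {z,q,r} \<longrightarrow> cr (q - z) (r - z) \<noteq> 0 \<longrightarrow> y \<in> closed_segment q r \<longrightarrow> \<epsilon> \<le> dist z y" if TF: "T \<in> ?F" for T
  proof -
    obtain q r where qr: "cr (q - z) (r - z) \<noteq> 0" "T = convex hull {z,q,r}" using tri_vertex_obtain[OF tri[OF F(1)[OF TF]] F(3)[OF TF]] .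
    have "bary z q r z = 1" using bary_of_combination[OF qr(1), of 1 0 0] by simp
    then have "z \<notin> closed_segment q r" using bary_closed_segment[OF qr(1)] by auto
    then obtain \<epsilon> where e: "\<epsilon> > 0" "\<And>y. y \<in> closed_segment q r \<Longrightarrow> \<epsilon> \<le> dist z y"
      using separate_point_closed[OF closed_segment, of z q r] by (metis dist_commute)
    have "closed_segment q' r' = closed_segment q r" if "T = convex hull {z,q',r'}" "cr (q' - z) (r' - z) \<noteq> 0" for q' r'
    proof -
      have "{z,q',r'} = {z,q,r}" using verts_triangle[OF that(2)] verts_triangle[OF qr(1)] that(1) qr(2) by simp
      moreover have "q \<noteq> z" "r \<noteq> z" "q' \<noteq> z" "r' \<noteq> z" using qr that by (auto simp: cr_def)
      ultimately have "{q',r'} = {q,r}" by auto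
      then show ?thesis by (auto simp: doubleton_eq_iff closed_segment_commute)
    qed
    then show ?thesis using e by (intro exI[of _ \<epsilon>]) metis
  qed
  then obtain \<epsilon>f where ef: "\<And>T. T \<in> ?F \<Longrightarrow> \<epsilon>f T > 0"
    "\<And>T q r y. T \<in> ?F \<Longrightarrow> T = convex hull {z,q,r} \<Longrightarrow> cr (q - z) (r - z) \<noteq> 0 \<Longrightarrow> y \<in> closed_segment q r \<Longrightarrow> \<epsilon>f T \<le> dist z y"
    by metis
  define \<epsilon> where "\<epsilon> = Min (insert 1 (\<epsilon>f ` ?F))"
  have \<epsilon>: "\<epsilon> > 0" "\<And>T. T \<in> ?F \<Longrightarrow> \<epsilon> \<le> \<epsilon>f T" using finF ef(1) by (auto simp: \<epsilon>_def)
  let ?U = "ball z \<epsilon> - {z}"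
  let ?S = "\<Union>?F \<inter> ?U"
  have T0F: "T0 \<in> ?F" by (simp add: fan_def)
  \<comment> \<open>Away from \<open>z\<close> and from the opposite sides, a point of a fan
    triangle is interior to it or lies inside one of its two edges at \<open>z\<close>; the triangle
    across that edge belongs to the fan too.\<close>
  have key: "y \<in> interior (\<Union>?F)" if y: "y \<in> ?S" for y
  proof -
    obtain T where T: "T \<in> ?F" "y \<in> T" using y by auto
    obtain q r where c: "cr (q - z) (r - z) \<noteq> 0" and Tq: "T = convex hull {z,q,r}" using tri_vertex_obtain[OF tri[OF F(1)[OF T(1)]] F(3)[OF T(1)]] .
    have "y \<notin> closed_segment q r" using ef(2)[OF T(1) Tq c] \<epsilon>(2)[OF T(1)] y by fastforce
    then have bz: "bary z q r y > 0" using bary_closed_segment[OF c] mem_triangle_bary[OF c] T(2) Tq by (metis less_le)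
    have b: "bary q r z y \<ge> 0" "bary r z q y \<ge> 0" using mem_triangle_bary[OF c] T(2) Tq by auto
    have side: "y \<in> interior (\<Union>?F)" if s: "y \<in> open_segment z v" "closed_segment z v \<in> edges T" for v
    proof -
      have ie: "closed_segment z v \<in> interior_edges Th" using int[OF T(1) s(2)] by simp
      note n = interior_edge_neighbor[OF ie F(1)[OF T(1)] s(2)]
      let ?T' = "neighbor Th T (closed_segment z v)"
      have "y \<in> interior (T \<union> ?T')" by (rule open_edge_in_interior[OF ie F(1)[OF T(1)] s(2,1)])
      moreover have "(T, ?T') \<in> adj z" unfolding adj_def using n s F[OF T(1)] by auto
      then have "?T' \<in> ?F" using T(1) unfolding fan_def by (auto intro: rtrancl_into_rtrancl)
      then have "interior (T \<union> ?T') \<subseteq> interior (\<Union>?F)" using T(1) by (intro interior_mono) auto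
      ultimately show ?thesis by auto
    qed
    consider "bary q r z y > 0" "bary r z q y > 0" | "bary q r z y = 0" "bary r z q y > 0" | "bary q r z y > 0" "bary r z q y = 0"
      | "bary q r z y = 0" "bary r z q y = 0" using b by linarith
    then show ?thesis
    proof cases
      case 1
      then have "y \<in> interior T" unfolding Tq by (intro interior_triangle_bary[OF c bz]) auto
      then show ?thesis using interior_mono[of T "\<Union>?F"] T(1) by auto
    next
      case 2
      then have "y \<in> open_segment r z" using bz by (intro open_segment_of_bary[OF cr_cyclic_nz(1)[OF c]]) auto
      then show ?thesis using edges_triangle[OF c] Tq by (intro side[of r]) (auto simp: open_segment_commute closed_segment_commute)
    next
      case 3
      then have "y \<in> open_segment z q" using bz by (intro open_segment_of_bary[OF cr_cyclic_nz(2)[OF c]]) auto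
      then show ?thesis using edges_triangle[OF c] Tq by (intro side[of q]) auto
    next
      case 4
      then have "y = z" using bary_combination[OF c, of y] by auto
      then show ?thesis using y by auto
    qed
  qed
  have clF: "closed (\<Union>?F)" using finF F tri tri_closed by (intro closed_Union) auto
  have "?S = ?U \<inter> interior (\<Union>?F)" using key interior_subset by blast
  then have "openin (top_of_set ?U) ?S" by (metis openin_open_Int open_interior)
  moreover have "closedin (top_of_set ?U) ?S" using closedin_closed_Int[OF clF, of ?U] by (simp add: Int_commute)
  moreover have "connected ?U" by (rule connected_punctured_ball) simp
  moreover have "?S \<noteq> {}"
  proof -
    have "z \<notin> interior T0"
    proof
      assume "z \<in> interior T0"
      then have "z \<notin> verts T0" using extreme_point_not_in_interior[of z T0] by (auto simp: verts_def)
      then show False using T0 by simp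
    qed
    moreover obtain y where "y \<in> interior T0" "y \<in> ball z \<epsilon>" 
      using tri_interior_near[OF tri[OF T0(1)] zT0 open_ball, of z \<epsilon>] \<epsilon> by auto
    ultimately have "y \<in> ?S" using T0F interior_subset[of T0] by auto
    then show ?thesis by blast
  qed
  ultimately have "?S = ?U" unfolding connected_clopen by blast
  then have sub: "ball z \<epsilon> \<subseteq> \<Union>?F" using T0F zT0 by auto
  have FTh: "\<Union>?F \<subseteq> \<Union>Th" using F by auto
  show "z \<in> \<Omega>" unfolding Om by (rule interiorI[of "ball z \<epsilon>"]) (use \<epsilon> sub FTh in auto)
  show "?F = {T \<in> Th. z \<in> T}"
  proof (intro equalityI fan_subset[OF T0(1) zT0] subsetI)
    \<comment> \<open>\<open>T\<close> has interior points near \<open>z\<close>. The fan covers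
      them, and disjointness of interiors puts \<open>T\<close> into the fan.\<close>
    fix T assume T: "T \<in> {T \<in> Th. z \<in> T}"
    then obtain y where y: "y \<in> interior T" "y \<in> ball z \<epsilon>"
      using tri_interior_near[OF tri, of T z "ball z \<epsilon>"] \<epsilon> by auto
    then obtain T'' where "T'' \<in> ?F" "y \<in> T''" using sub by auto
    then show "T \<in> ?F" using interior_disjoint[of T T''] F T y by auto
  qed
qed

end

section \<open>Piecewise smooth functions on a triangulation\<close>

text \<open>The choice in \<open>edge_int\<close> ranges over the two orientations of the edge, and
  both give the same integral.\<close>

lemma edge_int_segment:
  assumes "v \<noteq> w"
  shows "edge_int (closed_segment v w) f = line_int v w f"
proof -
  have "\<exists>I v' w'. v' \<noteq> w' \<and> closed_segment v w = closed_segment v' w' \<and> I = line_int v' w' f" using assms by blast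
  then have "\<exists>v' w'. v' \<noteq> w' \<and> closed_segment v w = closed_segment v' w' \<and> edge_int (closed_segment v w) f = line_int v' w' f"
    unfolding edge_int_def by (rule someI_ex)
  then obtain v' w' where vw: "closed_segment v w = closed_segment v' w'" "edge_int (closed_segment v w) f = line_int v' w' f" by blast
  from closed_segment_endpoints[OF vw(1)] show ?thesis
    unfolding vw(2) by (auto simp: doubleton_eq_iff line_int_commute)
qed

lemma grad_eqI:
  assumes "(v has_derivative (\<lambda>h. d \<bullet> h)) (at x)"
  shows "grad v x = d"
  unfolding grad_def
proof (rule some_equality[where P = "\<lambda>d. (v has_derivative (\<lambda>h. d \<bullet> h)) (at x)"])
  fix d' assume "(v has_derivative (\<lambda>h. d' \<bullet> h)) (at x)"
  from has_derivative_unique[OF this assms] have "d' \<bullet> h = d \<bullet> h" for h by (rule fun_cong)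
  then show "d' = d" using vector_eq_rdot by blast
qed (rule assms)

lemma C1grad_lipschitz_on:
  assumes f: "C1grad f df" and S: "compact S" "convex S"
  obtains L where "L \<ge> 0" "L-lipschitz_on S f"
proof -
  have "bounded (df ` S)" by (intro compact_imp_bounded compact_continuous_image C1grad_grad_cont[OF f] S)
  then obtain B where B: "\<And>x. x \<in> S \<Longrightarrow> norm (df x) \<le> B" "B \<ge> 0"
    by (metis bounded_pos imageI less_imp_le)
  have "B-lipschitz_on S f"
  proof (rule bounded_derivative_imp_lipschitz)
    show "(f has_derivative (\<lambda>h. df x \<bullet> h)) (at x within S)" for x
      by (rule has_derivative_at_withinI) (use f in \<open>simp add: C1grad_def\<close>)
    show "onorm (\<lambda>h. df x \<bullet> h) \<le> B" if "x \<in> S" for x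
    proof (rule onorm_le)
      fix h
      have "\<bar>df x \<bullet> h\<bar> \<le> norm (df x) * norm h" by (rule Cauchy_Schwarz_ineq2)
      also have "\<dots> \<le> B * norm h" using B(1)[OF that] by (intro mult_right_mono) auto
      finally show "norm (df x \<bullet> h) \<le> B * norm h" by simp
    qed
  qed (use S B in auto)
  then show ?thesis using that B by blast
qed

context mesh
begin

lemma T_sets: "T \<in> Th \<Longrightarrow> T \<in> sets lebesgue" "T \<in> Th \<Longrightarrow> compact T"
  using tri_compact[OF tri] lmeasurable_compact by auto

lemma skeleton_negligible: "negligible (\<Union>T\<in>Th. frontier T)"
  using fin tri tri_convex negligible_convex_frontier by (intro negligible_Union) auto

lemma closure_minus: "closure \<Omega> - \<Omega> \<subseteq> (\<Union>T\<in>Th. frontier T)"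
proof
  fix x assume x: "x \<in> closure \<Omega> - \<Omega>"
  then obtain T where T: "T \<in> Th" "x \<in> T" using union by blast
  then have "x \<notin> interior T" using x Om interior_mono[of T "\<Union>Th"] by auto
  then have "x \<in> frontier T" using T closure_subset by (auto simp: frontier_def)
  then show "x \<in> (\<Union>T\<in>Th. frontier T)" using T by blast
qed

text \<open>Passing from \<Omega> to the union of the triangles adds only points of their frontiers,
  and distinct triangles meet at most in segments: null sets in both cases.\<close>

lemma sint_mesh:
  assumes i: "\<And>T. T \<in> Th \<Longrightarrow> integrable (lebesgue_on T) f"
  shows "integrable (lebesgue_on \<Omega>) (f :: real^2 \<Rightarrow> real)" "sint \<Omega> f = (\<Sum>T\<in>Th. sint T f)"
proof -
  have si: "set_integrable lebesgue T f" if "T \<in> Th" for T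
    using i[OF that] T_sets[OF that] unfolding set_integrable_def by (subst (asm) integrable_restrict_space) auto
  have conv: "sint S f = (LINT x:S|lebesgue. f x)" if "S \<in> sets lebesgue" for S
    unfolding set_lebesgue_integral_def using that by (subst integral_restrict_space) auto
  have Om_m: "\<Omega> \<in> sets lebesgue" "closure \<Omega> \<in> sets lebesgue" using open_Om by auto
  have neg: "negligible (closure \<Omega> - \<Omega>)" using negligible_subset[OF skeleton_negligible closure_minus] .
  have AE: "AE x in lebesgue. x \<notin> closure \<Omega> - \<Omega>" using neg AE_not_in[of "closure \<Omega> - \<Omega>" lebesgue] unfolding negligible_iff_null_sets by blast
  have U: "set_integrable lebesgue (\<Union>T\<in>Th. T) f" using si T_sets fin by (intro set_integrable_UN) auto
  then have U': "set_integrable lebesgue (closure \<Omega>) f" using union by simp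
  have siO: "set_integrable lebesgue \<Omega> f"
    by (rule set_integrable_subset[OF U']) (use Om_m closure_subset in auto)
  then show "integrable (lebesgue_on \<Omega>) f"
    unfolding set_integrable_def using Om_m by (subst integrable_restrict_space) auto
  have "sint \<Omega> f = (LINT x:closure \<Omega>|lebesgue. f x)"
    unfolding conv[OF Om_m(1)] set_lebesgue_integral_def
  proof (rule integral_cong_AE)
    show "AE x in lebesgue. indicat_real \<Omega> x *\<^sub>R f x = indicat_real (closure \<Omega>) x *\<^sub>R f x"
      using AE closure_subset[of \<Omega>] by (auto elim!: AE_mp split: split_indicator)
    show "(\<lambda>x. indicat_real \<Omega> x *\<^sub>R f x) \<in> borel_measurable lebesgue" "(\<lambda>x. indicat_real (closure \<Omega>) x *\<^sub>R f x) \<in> borel_measurable lebesgue"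
      using siO U' unfolding set_integrable_def by auto
  qed
  also have "\<dots> = (LINT x:(\<Union>T\<in>Th. T)|lebesgue. f x)" using union by simp
  also have "\<dots> = (\<Sum>T\<in>Th. LINT x:T|lebesgue. f x)"
  proof (rule set_integral_finite_UN_AE[OF fin])
    fix T T' assume "T \<in> Th" "T' \<in> Th"
    show "AE x in lebesgue. x \<in> T \<and> x \<in> T' \<longrightarrow> T = T'"
    proof (cases "T = T'")
      case False
      then have "T \<inter> T' \<in> null_sets lebesgue" using inter_negligible[OF \<open>T \<in> Th\<close> \<open>T' \<in> Th\<close>] by (simp add: negligible_iff_null_sets)
      from AE_not_in[OF this] show ?thesis by (rule AE_mp) (rule AE_I2, blast)
    qed simp
  qed (use si T_sets in auto)
  also have "\<dots> = (\<Sum>T\<in>Th. sint T f)" by (intro sum.cong refl conv[symmetric] T_sets)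
  finally show "sint \<Omega> f = (\<Sum>T\<in>Th. sint T f)" .
qed

section \<open>Zero values on the frontier and the zero extension\<close>

lemma frontier_point_cases:
  assumes x: "x \<in> closure \<Omega> - \<Omega>" and nv: "x \<notin> (\<Union>T\<in>Th. verts T)"
  obtains T e where "T \<in> Th" "e \<in> edges T" "e \<notin> interior_edges Th" "x \<in> e"
proof -
  obtain T where T: "T \<in> Th" "x \<in> T" using x union by blast
  obtain p q r where c: "cr (q - p) (r - p) \<noteq> 0" and Tq: "T = convex hull {p,q,r}" using tri[OF T(1)] by (auto simp: tri_cr)
  have ni: "x \<notin> interior T" using x Om interior_mono[of T "\<Union>Th"] T by auto
  have b: "bary p q r x \<ge> 0" "bary q r p x \<ge> 0" "bary r p q x \<ge> 0" using mem_triangle_bary[OF c] T Tq by auto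
  have "bary p q r x = 0 \<or> bary q r p x = 0 \<or> bary r p q x = 0"
    using ni interior_triangle_bary[OF c] b Tq by (metis less_le)
  then have "x \<in> closed_segment q r \<or> x \<in> closed_segment r p \<or> x \<in> closed_segment p q"
    using bary_closed_segment[OF c] bary_closed_segment[OF cr_cyclic_nz(1)[OF c]] bary_closed_segment[OF cr_cyclic_nz(2)[OF c]] T Tq
    by (auto simp: insert_commute)
  then obtain v w where vw: "closed_segment v w \<in> edges T" "x \<in> closed_segment v w"
    using edges_triangle[OF c] Tq by blast
  have "v \<in> verts T" "w \<in> verts T" using edge_endpoints_verts[OF tri[OF T(1)] vw(1)] by auto
  then have "x \<noteq> v" "x \<noteq> w" using nv T by auto
  then have xo: "x \<in> open_segment v w" using vw by (simp add: open_segment_def)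
  have "closed_segment v w \<notin> interior_edges Th"
  proof
    assume ie: "closed_segment v w \<in> interior_edges Th"
    have "T \<union> neighbor Th T (closed_segment v w) \<subseteq> \<Union>Th" using interior_edge_neighbor(1)[OF ie T(1) vw(1)] T by auto
    then have "x \<in> \<Omega>" using open_edge_in_interior[OF ie T(1) vw(1) xo] interior_mono Om by blast
    then show False using x by simp
  qed
  then show ?thesis using that T vw by blast
qed

lemma finite_verts: "finite (\<Union>T\<in>Th. verts T)"
proof (intro finite_UN_I fin)
  fix T assume "T \<in> Th"
  then obtain p q r where "cr (q - p) (r - p) \<noteq> 0" "T = convex hull {p,q,r}" using tri[OF \<open>T \<in> Th\<close>] by (auto simp: tri_cr)
  then show "finite (verts T)" using verts_triangle by simp
qed

text \<open>Otherwise a small punctured disc around \<open>x\<close>, being connected, would lie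
  inside \<Omega> or outside it. The latter contradicts \<open>x\<close> being in the closure, the
  former puts \<open>x\<close> in the interior of the union, which is \<Omega>.\<close>

lemma frontier_accumulates:
  assumes x: "x \<in> closure \<Omega> - \<Omega>" and "\<epsilon> > 0"
  obtains y where "y \<in> closure \<Omega> - \<Omega>" "y \<notin> (\<Union>T\<in>Th. verts T)" "dist x y < \<epsilon>"
proof (rule ccontr)
  assume "\<not> thesis"
  then have no: "\<And>y. y \<in> closure \<Omega> - \<Omega> \<Longrightarrow> dist x y < \<epsilon> \<Longrightarrow> y \<in> (\<Union>T\<in>Th. verts T)" using that by blast
  obtain \<delta> where d: "\<delta> > 0" "\<And>y. y \<in> (\<Union>T\<in>Th. verts T) \<Longrightarrow> y \<noteq> x \<Longrightarrow> \<delta> \<le> dist x y"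
    using finite_set_avoid[OF finite_verts, of x] by blast
  let ?B = "ball x (min \<epsilon> \<delta>)"
  let ?U = "?B - {x}"
  have "y \<notin> closure \<Omega> - \<Omega>" if "y \<in> ?U" for y using no[of y] d(2)[of y] that by auto
  then have eq: "?U \<inter> \<Omega> = ?U \<inter> closure \<Omega>" using closure_subset by blast
  have "openin (top_of_set ?U) (?U \<inter> \<Omega>)" using open_Om by (rule openin_open_Int)
  moreover have "closedin (top_of_set ?U) (?U \<inter> \<Omega>)" unfolding eq by (rule closedin_closed_Int) simp
  moreover have "connected ?U" by (rule connected_punctured_ball) simp
  ultimately consider "?U \<inter> \<Omega> = {}" | "?U \<inter> \<Omega> = ?U" unfolding connected_clopen by blast
  then show False
  proof cases
    case 1
    then have "?B \<inter> \<Omega> = {}" using x by auto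
    then have "?B \<inter> closure \<Omega> = {}" using open_Int_closure_eq_empty[OF open_ball] by blast
    moreover have "x \<in> ?B" using assms(2) d by auto
    ultimately show False using x by blast
  next
    case 2
    have "?B \<subseteq> closure \<Omega>"
    proof
      fix y assume "y \<in> ?B"
      then show "y \<in> closure \<Omega>" using 2 x closure_subset[of \<Omega>] by (cases "y = x") auto
    qed
    then have "x \<in> interior (\<Union>Th)" unfolding union using assms(2) d by (intro interiorI[of ?B]) auto
    then show False using x Om by auto
  qed
qed

lemma piecewise_continuous:
  assumes "\<And>T. T \<in> Th \<Longrightarrow> continuous_on T v"
  shows "continuous_on (closure \<Omega>) v"
  unfolding union[symmetric]
proof -
  have "continuous_on (\<Union>T\<in>Th. T) v"
    using assms fin tri tri_closed by (intro continuous_on_closed_Union) auto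
  then show "continuous_on (\<Union>Th) v" by simp
qed

text \<open>At a frontier vertex the value is a limit of values at nearby frontier points that are
  not vertices, and those lie on boundary edges.\<close>

lemma zero_on_frontier:
  assumes c: "\<And>T. T \<in> Th \<Longrightarrow> continuous_on T (v :: real^2 \<Rightarrow> real)"
    and z: "\<And>T e x. T \<in> Th \<Longrightarrow> e \<in> edges T \<Longrightarrow> e \<notin> interior_edges Th \<Longrightarrow> x \<in> e \<Longrightarrow> v x = 0"
    and x: "x \<in> closure \<Omega> - \<Omega>"
  shows "v x = 0"
proof (rule ccontr)
  assume "v x \<noteq> 0"
  have "continuous_on (closure \<Omega>) v" by (rule piecewise_continuous[OF c])
  then obtain \<delta> where d: "\<delta> > 0" "\<And>y. y \<in> closure \<Omega> \<Longrightarrow> dist y x < \<delta> \<Longrightarrow> dist (v y) (v x) < \<bar>v x\<bar>"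
    using x \<open>v x \<noteq> 0\<close> unfolding continuous_on_iff by (metis DiffD1 zero_less_abs_iff)
  obtain y where y: "y \<in> closure \<Omega> - \<Omega>" "y \<notin> (\<Union>T\<in>Th. verts T)" "dist x y < \<delta>"
    using frontier_accumulates[OF x d(1)] .
  then have "v y = 0" using frontier_point_cases[OF y(1,2)] z by metis
  then show False using d(2)[of y] y by (auto simp: dist_commute dist_real_def)
qed

text \<open>Along the segment from \<open>x\<close> to \<open>y\<close> the zero extension is
  Lipschitz on finitely many closed pieces, the preimages of the triangles and of the complement of
  \<Omega>; such pieces glue along an interval. In this way \<Omega> need not be convex.\<close>

lemma zero_extension_lipschitz:
  assumes P: "\<And>T. T \<in> Th \<Longrightarrow> C1grad (P T) (dP T)" "\<And>T x. T \<in> Th \<Longrightarrow> x \<in> T \<Longrightarrow> v x = P T x"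
    and z: "\<And>x. x \<in> closure \<Omega> - \<Omega> \<Longrightarrow> v x = 0"
  obtains L where "L > 0" "\<And>x y. \<bar>(if x \<in> \<Omega> then v x else 0) - (if y \<in> \<Omega> then v y else 0)\<bar> \<le> L * dist x y"
proof -
  let ?v = "\<lambda>x. if x \<in> \<Omega> then v x else 0"
  have "\<exists>L\<ge>0. L-lipschitz_on T (P T)" if "T \<in> Th" for T
    using C1grad_lipschitz_on[OF P(1)[OF that] tri_compact[OF tri[OF that]] tri_convex[OF tri[OF that]]] by blast
  then obtain Lf where Lf: "\<And>T. T \<in> Th \<Longrightarrow> Lf T \<ge> 0" "\<And>T. T \<in> Th \<Longrightarrow> (Lf T)-lipschitz_on T (P T)" by metis
  \<comment> \<open>The sum dominates every local constant, and the 1 makes it positive.\<close>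
  define L where "L = 1 + (\<Sum>T\<in>Th. Lf T)"
  have L: "L > 0" using Lf(1) by (simp add: L_def add_pos_nonneg sum_nonneg)
  have LT: "Lf T \<le> L" if "T \<in> Th" for T
    using member_le_sum[OF that, of Lf] Lf(1) fin by (auto simp: L_def)
  have vT: "?v x = P T x" if "T \<in> Th" "x \<in> T" for T x
    using P(2)[OF that] z[of x] that union by auto
  have "\<bar>?v x - ?v y\<bar> \<le> L * dist x y" for x y
  proof -
    let ?\<gamma> = "\<lambda>t. x + t *\<^sub>R (y - x)"
    have \<gamma>: "continuous_on UNIV ?\<gamma>" by (intro continuous_intros)
    have "(L * dist x y)-lipschitz_on {0..1} (\<lambda>t. ?v (?\<gamma> t))"
    proof (rule lipschitz_on_closed_Union[where I = "insert (- \<Omega>) Th" and U = "\<lambda>S. ?\<gamma> -` S"])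
      fix S assume S: "S \<in> insert (- \<Omega>) Th"
      have "closed S" using S open_Om tri tri_closed by auto
      then show "closed (?\<gamma> -` S)" by (intro closed_vimage \<gamma>)
      show "(L * dist x y)-lipschitz_on (?\<gamma> -` S) (\<lambda>t. ?v (?\<gamma> t))"
      proof (rule lipschitz_onI)
        fix s t assume st: "s \<in> ?\<gamma> -` S" "t \<in> ?\<gamma> -` S"
        show "dist (?v (?\<gamma> s)) (?v (?\<gamma> t)) \<le> L * dist x y * dist s t"
        proof (cases "S = - \<Omega>")
          case True
          then have "?v (?\<gamma> s) = 0" "?v (?\<gamma> t) = 0" using st by auto
          then show ?thesis using L by simp
        next
          case False
          then have S: "S \<in> Th" using S by auto
          have "dist (P S (?\<gamma> s)) (P S (?\<gamma> t)) \<le> Lf S * dist (?\<gamma> s) (?\<gamma> t)" by (rule lipschitz_onD[OF Lf(2)[OF S]]) (use st in auto)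
          also have "dist (?\<gamma> s) (?\<gamma> t) = dist s t * dist x y"
          proof -
            have "?\<gamma> s - ?\<gamma> t = (s - t) *\<^sub>R (y - x)" by (simp add: algebra_simps)
            then show ?thesis by (simp add: dist_norm norm_minus_commute)
          qed
          also have "Lf S * (dist s t * dist x y) \<le> L * (dist s t * dist x y)" using LT[OF S] by (intro mult_right_mono) auto
          finally show ?thesis using vT[OF S] st by (simp add: mult_ac)
        qed
      qed (use L in auto)
    next
      have "\<Omega> \<subseteq> \<Union>Th" using union closure_subset by metis
      then show "{0..1} \<subseteq> (\<Union>S\<in>insert (- \<Omega>) Th. ?\<gamma> -` S)" by auto
    qed (use fin L in auto)
    then have "dist (?v (?\<gamma> 0)) (?v (?\<gamma> 1)) \<le> L * dist x y * dist 0 (1::real)" by (rule lipschitz_onD) auto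
    moreover have "?\<gamma> 0 = x" "?\<gamma> 1 = y" by auto
    ultimately have "dist (?v x) (?v y) \<le> L * dist x y * dist 0 (1::real)" by metis
    then show ?thesis by (simp only: dist_real_def) simp
  qed
  then show ?thesis using that L by blast
qed

lemma piecewise_grad:
  assumes P: "C1grad (P T) (dP T)" "\<And>x. x \<in> T \<Longrightarrow> v x = P T x" and y: "y \<in> interior T"
  shows "(v has_derivative (\<lambda>h. dP T y \<bullet> h)) (at y)" "grad v y = dP T y"
proof -
  have "(P T has_derivative (\<lambda>h. dP T y \<bullet> h)) (at y)" using P(1) by (auto simp: C1grad_def)
  then show d: "(v has_derivative (\<lambda>h. dP T y \<bullet> h)) (at y)"
    by (rule has_derivative_transform_within_open[OF _ open_interior y]) (metis P(2) interior_subset subsetD)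
  show "grad v y = dP T y" by (rule grad_eqI[OF d])
qed

text \<open>The zero extension is Lipschitz and smooth off the skeleton, a null set, so
  \<open>lipschitz_Cc1_approx\<close> applies with the pointwise gradient. This identifies
  \<open>grad v\<close> as a Sobolev gradient of \<open>v\<close>.\<close>

lemma piecewise_H10:
  assumes P: "\<And>T. T \<in> Th \<Longrightarrow> C1grad (P T) (dP T)" "\<And>T x. T \<in> Th \<Longrightarrow> x \<in> T \<Longrightarrow> v x = P T x"
    and z: "\<And>x. x \<in> closure \<Omega> - \<Omega> \<Longrightarrow> v x = 0"
  shows "H10 \<Omega> v (grad v)"
proof -
  let ?v = "\<lambda>x. if x \<in> \<Omega> then v x else 0"
  obtain L where L: "L > 0" "\<And>x y. \<bar>?v x - ?v y\<bar> \<le> L * dist x y" using zero_extension_lipschitz[where P = P and dP = dP and v = v, OF P z] by blast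
  let ?N = "\<Union>T\<in>Th. frontier T"
  have loc: "\<exists>U. open U \<and> x \<in> U \<and> continuous_on U (grad v) \<and> (\<forall>y\<in>U. (?v has_derivative (\<lambda>h. grad v y \<bullet> h)) (at y))"
    if x: "x \<in> \<Omega> - ?N" for x
  proof -
    obtain T where T: "T \<in> Th" "x \<in> T" using x union closure_subset by blast
    then have xi: "x \<in> interior T" using x closure_subset by (auto simp: frontier_def)
    have sub: "interior T \<subseteq> \<Omega>" using Om interior_mono[of T "\<Union>Th"] T by auto
    have pg: "(v has_derivative (\<lambda>h. dP T y \<bullet> h)) (at y)" "grad v y = dP T y" if "y \<in> interior T" for y
      using piecewise_grad[where P = P and dP = dP and v = v, OF P(1)[OF T(1)] _ that] P(2)[OF T(1)] by blast+
    have "continuous_on (interior T) (grad v)"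
      using C1grad_grad_cont[OF P(1)[OF T(1)]] by (rule continuous_on_eq) (use pg(2) in auto)
    moreover have "(?v has_derivative (\<lambda>h. grad v y \<bullet> h)) (at y)" if y: "y \<in> interior T" for y
    proof -
      have "(v has_derivative (\<lambda>h. grad v y \<bullet> h)) (at y)" using pg[OF y] by simp
      then show ?thesis
        by (rule has_derivative_transform_within_open[OF _ open_interior y]) (use sub in auto)
    qed
    ultimately show ?thesis using xi by blast
  qed
  have v0: "?v x = 0" if "x \<notin> \<Omega>" for x using that by simp
  note app = lipschitz_Cc1_approx[OF open_Om bounded_Om L(1) L(2) v0 skeleton_negligible loc]
  have cong: "sint \<Omega> (\<lambda>x. (\<phi> n x - ?v x)\<^sup>2) = sint \<Omega> (\<lambda>x. (\<phi> n x - v x)\<^sup>2)" for \<phi> :: "nat \<Rightarrow> real^2 \<Rightarrow> real" and n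
    by (intro Bochner_Integration.integral_cong) auto
  have "v \<in> borel_measurable (lebesgue_on \<Omega>)"
    using app(4) by (rule measurable_cong[THEN iffD1, rotated]) auto
  moreover have "integrable (lebesgue_on \<Omega>) (\<lambda>x. (v x)\<^sup>2)"
    using app(5) by (rule Bochner_Integration.integrable_cong[THEN iffD1, rotated 2]) auto
  ultimately show ?thesis
    unfolding H10_def using app(1-3) unfolding cong by blast
qed

end

section \<open>Piecewise polynomials and line integrals\<close>

text \<open>\<open>dG1\<close> and \<open>dG2\<close> are the gradients of the two components of
  \<open>G\<close>, so the Laplacian of \<open>p\<close> is
  \<open>dG1 x $ 1 + dG2 x $ 2\<close>.\<close>

definition C2grad :: "(real^2 \<Rightarrow> real) \<Rightarrow> (real^2 \<Rightarrow> real^2) \<Rightarrow> (real^2 \<Rightarrow> real^2) \<Rightarrow> (real^2 \<Rightarrow> real^2) \<Rightarrow> bool" where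
  "C2grad p G dG1 dG2 \<longleftrightarrow> C1grad p G \<and> C1grad (\<lambda>x. G x $ 1) dG1 \<and> C1grad (\<lambda>x. G x $ 2) dG2"

lemma C2grad_const: "C2grad (\<lambda>x. c) (\<lambda>x. 0) (\<lambda>x. 0) (\<lambda>x. 0)"
  by (auto simp: C2grad_def C1grad_const)

lemma C2grad_coord: "C2grad (\<lambda>x. x $ i) (\<lambda>x. axis i 1) (\<lambda>x. 0) (\<lambda>x. 0)"
  using C1grad_coord[of i 0] by (auto simp: C2grad_def C1grad_const)

lemma C2grad_add: "C2grad p G a b \<Longrightarrow> C2grad q H c d \<Longrightarrow> C2grad (\<lambda>x. p x + q x) (\<lambda>x. G x + H x) (\<lambda>x. a x + c x) (\<lambda>x. b x + d x)"
  by (auto simp: C2grad_def intro!: C1grad_add)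

lemma C2grad_mult:
  assumes "C2grad p G a b" "C2grad q H c d"
  shows "\<exists>K e f. C2grad (\<lambda>x. p x * q x) K e f"
proof -
  have p: "C1grad p G" "C1grad (\<lambda>x. G x $ 1) a" "C1grad (\<lambda>x. G x $ 2) b"
   and q: "C1grad q H" "C1grad (\<lambda>x. H x $ 1) c" "C1grad (\<lambda>x. H x $ 2) d" using assms by (auto simp: C2grad_def)
  show ?thesis
    using C1grad_mult[OF p(1) q(1)] C1grad_add[OF C1grad_mult[OF p(1) q(2)] C1grad_mult[OF q(1) p(2)]]
      C1grad_add[OF C1grad_mult[OF p(1) q(3)] C1grad_mult[OF q(1) p(3)]]
    unfolding C2grad_def by (intro exI conjI) auto
qed

text \<open>The functions with two continuous derivatives contain constants and coordinates and are
  closed under sums and products.\<close>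

lemma polyk_C2grad:
  assumes "polyk k p" shows "\<exists>G a b. C2grad p G a b"
proof -
  define S where "S = {p. \<exists>G a b. C2grad p G a b}"
  have const: "(\<lambda>x. c) \<in> S" for c using C2grad_const by (auto simp: S_def)
  have coord: "(\<lambda>x. x $ i) \<in> S" for i using C2grad_coord[of i] by (auto simp: S_def)
  have add: "(\<lambda>x. p x + q x) \<in> S" if "p \<in> S" "q \<in> S" for p q using C2grad_add that unfolding S_def by blast
  have mult: "(\<lambda>x. p x * q x) \<in> S" if "p \<in> S" "q \<in> S" for p q using C2grad_mult that unfolding S_def by blast
  have pow: "(\<lambda>x. p x ^ n) \<in> S" if "p \<in> S" for p n
    by (induction n) (use const[of 1] mult that in auto)
  have sum: "(\<lambda>x. \<Sum>i\<in>A. f i x) \<in> S" if "finite A" "\<And>i. i \<in> A \<Longrightarrow> f i \<in> S" for A :: "nat set" and f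
    using that by (induction A rule: finite_induct) (use const[of 0] add in auto)
  obtain c where "p = (\<lambda>x. \<Sum>i\<le>k. \<Sum>j\<le>k - i. c i j * (x$1)^i * (x$2)^j)" using assms by (auto simp: polyk_def fun_eq_iff)
  then have "p \<in> S" by (simp only:) (intro sum mult pow coord const finite_atMost)
  then show ?thesis by (simp add: S_def)
qed

lemma polyk_affine:
  assumes "k \<ge> 1" shows "polyk k (\<lambda>x. c + d \<bullet> x)"
proof -
  define C :: "nat \<Rightarrow> nat \<Rightarrow> real" where "C i j = (if i = 0 \<and> j = 0 then c else if i = 1 \<and> j = 0 then d$1 else if i = 0 \<and> j = 1 then d$2 else 0)" for i j
  have "c + d \<bullet> x = (\<Sum>i\<le>k. \<Sum>j\<le>k - i. C i j * (x$1)^i * (x$2)^j)" for x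
  proof -
    have "(\<Sum>i\<le>k. \<Sum>j\<le>k - i. C i j * (x$1)^i * (x$2)^j) = (\<Sum>i\<in>{0,1}. \<Sum>j\<le>k - i. C i j * (x$1)^i * (x$2)^j)"
      using assms by (intro sum.mono_neutral_right) (auto simp: C_def)
    also have "\<dots> = (\<Sum>j\<le>k. C 0 j * (x$2)^j) + (\<Sum>j\<le>k - 1. C 1 j * x$1 * (x$2)^j)" by simp
    also have "(\<Sum>j\<le>k. C 0 j * (x$2)^j) = (\<Sum>j\<in>{0,1}. C 0 j * (x$2)^j)"
      using assms by (intro sum.mono_neutral_right) (auto simp: C_def)
    also have "(\<Sum>j\<le>k - 1. C 1 j * x$1 * (x$2)^j) = (\<Sum>j\<in>{0}. C 1 j * x$1 * (x$2)^j)"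
      by (intro sum.mono_neutral_right) (auto simp: C_def)
    finally show ?thesis by (simp add: C_def inner_real2)
  qed
  then show ?thesis unfolding polyk_def by blast
qed

lemma C1grad_axis_derivative:
  assumes "C1grad f df"
  shows "((\<lambda>t. f (x + t *\<^sub>R axis i 1)) has_real_derivative df (x + t *\<^sub>R axis i 1) $ i) (at t)"
  using C1grad_line[OF assms, of x "axis i 1" t UNIV]
  by (simp add: has_real_derivative_iff_has_vector_derivative inner_axis)

lemma open_axis_line: "open U \<Longrightarrow> open {t. x + t *\<^sub>R axis i 1 \<in> (U :: (real^2) set)}"
proof -
  assume "open U"
  then have "open ((\<lambda>t. x + t *\<^sub>R axis i 1) -` U)" by (intro open_vimage continuous_intros)
  then show ?thesis by (simp add: vimage_def)
qed

lemma pdiff_interior: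
  assumes P: "C1grad P G" "\<And>x. x \<in> U \<Longrightarrow> v x = P x" and U: "open U" "y \<in> U"
  shows "pdiff i v y = G y $ i"
proof -
  have "((\<lambda>t. v (y + t *\<^sub>R axis i 1)) has_real_derivative G (y + 0 *\<^sub>R axis i 1) $ i) (at 0)"
    by (rule has_field_derivative_transform_within_open[OF C1grad_axis_derivative[OF P(1)] open_axis_line[OF U(1), of y i]])
      (use P(2) U in auto)
  then show ?thesis unfolding pdiff_def by (simp add: DERIV_imp_deriv)
qed

lemma lap_interior:
  assumes P: "C2grad P G a b" "\<And>x. x \<in> U \<Longrightarrow> v x = P x" and U: "open U" "y \<in> U"
  shows "lap v y = a y $ 1 + b y $ 2"
proof -
  have C1: "C1grad P G" and C: "C1grad (\<lambda>x. G x $ 1) a" "C1grad (\<lambda>x. G x $ 2) b" using P(1) by (auto simp: C2grad_def)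
  have d: "deriv (\<lambda>t. pdiff i v (y + t *\<^sub>R axis i 1)) 0 = c y $ i" if c: "C1grad (\<lambda>x. G x $ i) c" for i c
  proof -
    have "((\<lambda>t. pdiff i v (y + t *\<^sub>R axis i 1)) has_real_derivative c (y + 0 *\<^sub>R axis i 1) $ i) (at 0)"
      by (rule has_field_derivative_transform_within_open[OF C1grad_axis_derivative[OF c] open_axis_line[OF U(1), of y i]])
        (use pdiff_interior[OF C1 P(2) U(1)] U in auto)
    then show ?thesis by (simp add: DERIV_imp_deriv)
  qed
  show ?thesis unfolding lap_def UNIV_2 using d[OF C(1)] d[OF C(2)] by simp
qed

text \<open>At a boundary point, uniqueness of the derivative within \<open>T\<close> rests on the
  triangle spanning the plane; it is what allows the choice in \<open>grad_within\<close> to be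
  evaluated.\<close>

lemma grad_within_triangle:
  assumes T: "tri T" and P: "C1grad P G" "\<And>y. y \<in> T \<Longrightarrow> v y = P y" and x: "x \<in> T"
  shows "grad_within v T x = G x"
proof -
  have der: "(v has_derivative (\<lambda>h. G x \<bullet> h)) (at x within T)"
  proof (rule has_derivative_transform[OF x])
    show "(P has_derivative (\<lambda>h. G x \<bullet> h)) (at x within T)"
      by (rule has_derivative_at_withinI) (use P(1) in \<open>simp add: C1grad_def\<close>)
  qed (rule P(2))
  have "d = d'" if dd: "(v has_derivative (\<lambda>h. d \<bullet> h)) (at x within T)" "(v has_derivative (\<lambda>h. d' \<bullet> h)) (at x within T)" for d d'
  proof -
    \<comment> \<open>The segment from \<open>x\<close> to any \<open>y\<close> in \<open>T\<close>
      stays in \<open>T\<close>, and the one-sided derivative along it determines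
      \<open>d \<bullet> (y - x)\<close>. The three vertices then provide two independent
      directions.\<close>
    have eq: "d \<bullet> (y - x) = d' \<bullet> (y - x)" if y: "y \<in> T" for y
    proof -
      let ?\<gamma> = "\<lambda>t. x + t *\<^sub>R (y - x)"
      have \<gamma>T: "?\<gamma> ` {0..1} \<subseteq> T"
      proof
        fix z assume "z \<in> ?\<gamma> ` {0..1}"
        then obtain t where t: "0 \<le> t" "t \<le> 1" "z = x + t *\<^sub>R (y - x)" by auto
        have "(1 - t) *\<^sub>R x + t *\<^sub>R y \<in> T" using tri_convex[OF T] x y t by (auto simp: convex_def)
        moreover have "z = (1 - t) *\<^sub>R x + t *\<^sub>R y" unfolding t(3) by (simp add: algebra_simps)
        ultimately show "z \<in> T" by simp
      qed
      have \<gamma>d: "(?\<gamma> has_derivative (\<lambda>h. h *\<^sub>R (y - x))) (at 0 within {0..1})"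
        by (auto intro!: derivative_eq_intros)
      have dv: "((\<lambda>t. v (?\<gamma> t)) has_vector_derivative d \<bullet> (y - x)) (at 0 within {0..1})"
        if "(v has_derivative (\<lambda>h. d \<bullet> h)) (at x within T)" for d
      proof -
        have "(v has_derivative (\<lambda>h. d \<bullet> h)) (at (?\<gamma> 0) within ?\<gamma> ` {0..1})" using has_derivative_subset[OF that \<gamma>T] by simp
        from has_derivative_in_compose[OF \<gamma>d this] show ?thesis by (simp add: has_vector_derivative_def)
      qed
      have "at (0::real) within {0..1} \<noteq> bot" by (simp add: at_within_Icc_at_right trivial_limit_at_right_real)
      then show ?thesis using vector_derivative_unique_within[OF _ dv[OF dd(1)] dv[OF dd(2)]] by blast
    qed
    obtain p q r where c: "cr (q - p) (r - p) \<noteq> 0" "T = convex hull {p,q,r}" using T by (auto simp: tri_cr)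
    have "p \<in> T" "q \<in> T" "r \<in> T" unfolding c(2) by (auto intro: hull_inc)
    from eq[OF this(1)] eq[OF this(2)] eq[OF this(3)]
    have e: "(d - d') \<bullet> (q - p) = 0" "(d - d') \<bullet> (r - p) = 0" by (simp_all add: inner_diff_left inner_diff_right)
    have "d - d' = (cr (d - d') (r - p) / cr (q - p) (r - p)) *\<^sub>R (q - p) + (cr (q - p) (d - d') / cr (q - p) (r - p)) *\<^sub>R (r - p)"
      by (rule cr_basis[OF c(1)])
    then have "(d - d') \<bullet> (d - d') = (d - d') \<bullet> ((cr (d - d') (r - p) / cr (q - p) (r - p)) *\<^sub>R (q - p) + (cr (q - p) (d - d') / cr (q - p) (r - p)) *\<^sub>R (r - p))" by simp
    also have "\<dots> = 0" unfolding inner_add_right inner_scaleR_right e by simp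
    finally show ?thesis by simp
  qed
  then show ?thesis unfolding grad_within_def using der
    by (intro some_equality[where P = "\<lambda>d. (v has_derivative (\<lambda>h. d \<bullet> h)) (at x within T)"]) auto
qed

section \<open>Line integrals over subsegments and edges\<close>

text \<open>An edge inside a segment is an interval of its parameter. The end points are renamed in
  parameter order, since the edge may run against the segment.\<close>

lemma subsegment_param:
  assumes ab: "a \<noteq> (b::real^2)" and vw: "v \<noteq> w" "closed_segment v w \<subseteq> closed_segment a b"
  obtains v' w' \<alpha> \<beta> where "0 \<le> \<alpha>" "\<alpha> < \<beta>" "\<beta> \<le> 1" "closed_segment v w = closed_segment v' w'"
    "v' = a + \<alpha> *\<^sub>R (b - a)" "w' = a + \<beta> *\<^sub>R (b - a)" "{v,w} = {v',w'}"
    "{t \<in> {0..1}. a + t *\<^sub>R (b - a) \<in> closed_segment v w} = {\<alpha>..\<beta>}"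
proof -
  have par: "\<exists>t. 0 \<le> t \<and> t \<le> 1 \<and> z = a + t *\<^sub>R (b - a)" if "z \<in> closed_segment a b" for z
    using that by (auto simp: in_segment algebra_simps)
  obtain s where s: "0 \<le> s" "s \<le> 1" "v = a + s *\<^sub>R (b - a)" using par[of v] vw by auto
  obtain t where t: "0 \<le> t" "t \<le> 1" "w = a + t *\<^sub>R (b - a)" using par[of w] vw by auto
  have st: "s \<noteq> t" using s t vw by auto
  define \<alpha> \<beta> where "\<alpha> = min s t" and "\<beta> = max s t"
  define v' w' where "v' = a + \<alpha> *\<^sub>R (b - a)" and "w' = a + \<beta> *\<^sub>R (b - a)"
  have e: "{v,w} = {v',w'}" using s t by (auto simp: v'_def w'_def \<alpha>_def \<beta>_def min_def max_def)
  then have seg: "closed_segment v w = closed_segment v' w'" by (auto simp: doubleton_eq_iff closed_segment_commute)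
  have \<alpha>\<beta>: "0 \<le> \<alpha>" "\<alpha> < \<beta>" "\<beta> \<le> 1" using s t st by (auto simp: \<alpha>_def \<beta>_def)
  have "{t \<in> {0..1}. a + t *\<^sub>R (b - a) \<in> closed_segment v w} = {\<alpha>..\<beta>}"
  proof (intro equalityI subsetI)
    fix t assume "t \<in> {t \<in> {0..1}. a + t *\<^sub>R (b - a) \<in> closed_segment v w}"
    then obtain u where u: "0 \<le> u" "u \<le> 1" "a + t *\<^sub>R (b - a) = (1 - u) *\<^sub>R v' + u *\<^sub>R w'" unfolding seg by (auto simp: in_segment)
    then have "t *\<^sub>R (b - a) = (\<alpha> + u * (\<beta> - \<alpha>)) *\<^sub>R (b - a)" by (simp add: v'_def w'_def algebra_simps)
    then have teq: "t = \<alpha> + u * (\<beta> - \<alpha>)" using ab by simp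
    have "0 \<le> u * (\<beta> - \<alpha>)" "u * (\<beta> - \<alpha>) \<le> 1 * (\<beta> - \<alpha>)" using u \<alpha>\<beta> by (auto intro!: mult_right_mono)
    then show "t \<in> {\<alpha>..\<beta>}" using teq by auto
  next
    fix t assume t: "t \<in> {\<alpha>..\<beta>}"
    define u where "u = (t - \<alpha>) / (\<beta> - \<alpha>)"
    have u: "0 \<le> u" "u \<le> 1" "t = \<alpha> + u * (\<beta> - \<alpha>)" using t \<alpha>\<beta> by (auto simp: u_def field_simps)
    have "a + t *\<^sub>R (b - a) = (1 - u) *\<^sub>R v' + u *\<^sub>R w'" unfolding u(3) by (simp add: v'_def w'_def algebra_simps)
    then show "t \<in> {t \<in> {0..1}. a + t *\<^sub>R (b - a) \<in> closed_segment v w}"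
      unfolding seg in_segment using u t \<alpha>\<beta> by auto
  qed
  then show ?thesis using that[of \<alpha> \<beta> v' w'] \<alpha>\<beta> seg e v'_def w'_def by blast
qed

lemma integral_subinterval:
  fixes H :: "real \<Rightarrow> real"
  assumes ab: "\<alpha> < \<beta>"
  shows "integral\<^sup>L (lebesgue_on {\<alpha>..\<beta>}) H = (\<beta> - \<alpha>) * integral\<^sup>L (lebesgue_on {0..1}) (\<lambda>t. H (\<alpha> + t * (\<beta> - \<alpha>)))"
    and "integrable (lebesgue_on {\<alpha>..\<beta>}) H \<Longrightarrow> integrable (lebesgue_on {0..1}) (\<lambda>t. H (\<alpha> + t * (\<beta> - \<alpha>)))"
    and "H \<in> borel_measurable (lebesgue_on {\<alpha>..\<beta>}) \<Longrightarrow> (\<lambda>t. H (\<alpha> + t * (\<beta> - \<alpha>))) \<in> borel_measurable (lebesgue_on {0..1})"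
proof -
  let ?f = "\<lambda>s. indicator {\<alpha>..\<beta>} s *\<^sub>R H s"
  have ind: "?f (\<alpha> + (\<beta> - \<alpha>) * t) = indicator {0..1} t *\<^sub>R H (\<alpha> + t * (\<beta> - \<alpha>))" for t
  proof -
    have "\<alpha> + (\<beta> - \<alpha>) * t \<in> {\<alpha>..\<beta>} \<longleftrightarrow> t \<in> {0..1}"
    proof -
      have "\<alpha> \<le> \<alpha> + (\<beta> - \<alpha>) * t \<longleftrightarrow> 0 \<le> t" using ab by (simp add: zero_le_mult_iff)
      moreover have "\<alpha> + (\<beta> - \<alpha>) * t \<le> \<beta> \<longleftrightarrow> (\<beta> - \<alpha>) * t \<le> (\<beta> - \<alpha>) * 1" by auto
      then have "\<alpha> + (\<beta> - \<alpha>) * t \<le> \<beta> \<longleftrightarrow> t \<le> 1" using ab by (simp only: mult_le_cancel_left_pos)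
      ultimately show ?thesis by auto
    qed
    then show ?thesis by (auto simp: mult.commute split: split_indicator)
  qed
  have "integral\<^sup>L lebesgue ?f = \<bar>\<beta> - \<alpha>\<bar> *\<^sub>R (\<integral>t. ?f (\<alpha> + (\<beta> - \<alpha>) * t) \<partial>lebesgue)"
    by (rule lebesgue_integral_real_affine) (use ab in simp)
  then show "integral\<^sup>L (lebesgue_on {\<alpha>..\<beta>}) H = (\<beta> - \<alpha>) * integral\<^sup>L (lebesgue_on {0..1}) (\<lambda>t. H (\<alpha> + t * (\<beta> - \<alpha>)))"
    unfolding ind using ab by (simp add: integral_restrict_space)
  have aff: "(\<lambda>t. \<alpha> + (\<beta> - \<alpha>) * t) \<in> lebesgue \<rightarrow>\<^sub>M lebesgue"
    using lebesgue_affine_measurable[where c = "\<lambda>_::real. \<beta> - \<alpha>" and t = \<alpha>] ab by simp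
  show m: "(\<lambda>t. H (\<alpha> + t * (\<beta> - \<alpha>))) \<in> borel_measurable (lebesgue_on {0..1})" if "H \<in> borel_measurable (lebesgue_on {\<alpha>..\<beta>})" for H :: "real \<Rightarrow> real"
  proof -
    have "(\<lambda>s. indicator {\<alpha>..\<beta>} s *\<^sub>R H s) \<in> borel_measurable lebesgue" using that by (subst (asm) borel_measurable_restrict_space_iff) auto
    from measurable_compose[OF aff this]
    have "(\<lambda>t. indicator {\<alpha>..\<beta>} (\<alpha> + (\<beta> - \<alpha>) * t) *\<^sub>R H (\<alpha> + (\<beta> - \<alpha>) * t)) \<in> borel_measurable lebesgue" .
    moreover have "indicator {\<alpha>..\<beta>} (\<alpha> + (\<beta> - \<alpha>) * t) = (indicator {0..1} t :: real)" for t
    proof -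
      have "\<alpha> + (\<beta> - \<alpha>) * t \<in> {\<alpha>..\<beta>} \<longleftrightarrow> t \<in> {0..1}"
      proof -
        have "\<alpha> \<le> \<alpha> + (\<beta> - \<alpha>) * t \<longleftrightarrow> 0 \<le> t" using ab by (simp add: zero_le_mult_iff)
        moreover have "\<alpha> + (\<beta> - \<alpha>) * t \<le> \<beta> \<longleftrightarrow> (\<beta> - \<alpha>) * t \<le> (\<beta> - \<alpha>) * 1" by auto
        then have "\<alpha> + (\<beta> - \<alpha>) * t \<le> \<beta> \<longleftrightarrow> t \<le> 1" using ab by (simp only: mult_le_cancel_left_pos)
        ultimately show ?thesis by auto
      qed
      then show ?thesis by (auto split: split_indicator)
    qed
    ultimately show ?thesis by (subst borel_measurable_restrict_space_iff) (auto simp: mult.commute)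
  qed
  show "integrable (lebesgue_on {0..1}) (\<lambda>t. H (\<alpha> + t * (\<beta> - \<alpha>)))" if i: "integrable (lebesgue_on {\<alpha>..\<beta>}) H"
  proof -
    have "integrable lebesgue ?f" using i by (subst (asm) integrable_restrict_space) auto
    then have "integrable lebesgue (\<lambda>t. ?f (\<alpha> + (\<beta> - \<alpha>) * t))"
      using ab lebesgue_integrable_real_affine[of ?f "\<beta> - \<alpha>" \<alpha>] by simp
    then show ?thesis unfolding ind by (subst integrable_restrict_space) auto
  qed
qed

lemma L2_seg_commute:
  assumes "L2_seg v w g" shows "L2_seg w v g"
proof -
  let ?K = "\<lambda>t. g (v + t *\<^sub>R (w - v))"
  have K: "?K (1 + (-1) * t) = g (w + t *\<^sub>R (v - w))" for t
  proof -
    have "v + (1 + (-1) * t) *\<^sub>R (w - v) = w + t *\<^sub>R (v - w)" by (simp add: algebra_simps)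
    then show ?thesis by simp
  qed
  have ind: "indicator {0..1} (1 + (-1) * t) = (indicator {0..1} t :: real)" for t :: real by (auto split: split_indicator)
  have m: "?K \<in> borel_measurable (lebesgue_on {0..1})" and i: "integrable (lebesgue_on {0..1}) (\<lambda>t. (?K t)\<^sup>2)"
    using assms by (auto simp: L2_seg_def)
  have aff: "(\<lambda>t::real. 1 + (-1) * t) \<in> lebesgue \<rightarrow>\<^sub>M lebesgue"
    using lebesgue_affine_measurable[where c = "\<lambda>_::real. -1" and t = 1] by simp
  have "(\<lambda>s. indicator {0..1} s *\<^sub>R ?K s) \<in> borel_measurable lebesgue" using m by (subst (asm) borel_measurable_restrict_space_iff) auto
  from measurable_compose[OF aff this]
  have "(\<lambda>t. indicator {0..1} t *\<^sub>R g (w + t *\<^sub>R (v - w))) \<in> borel_measurable lebesgue" unfolding K ind .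
  moreover have "integrable lebesgue (\<lambda>s. indicator {0..1} s *\<^sub>R (?K s)\<^sup>2)" using i by (subst (asm) integrable_restrict_space) auto
  from lebesgue_integrable_real_affine[OF this, of "-1" 1]
  have "integrable lebesgue (\<lambda>t. indicator {0..1} t *\<^sub>R (g (w + t *\<^sub>R (v - w)))\<^sup>2)" unfolding K ind by simp
  ultimately show ?thesis
    unfolding L2_seg_def by (subst borel_measurable_restrict_space_iff, simp, subst integrable_restrict_space) auto
qed

lemma integrable_lebesgue_on_subset:
  fixes f :: "'a::euclidean_space \<Rightarrow> real"
  assumes "integrable (lebesgue_on S) f" "S \<in> sets lebesgue" "T \<in> sets lebesgue" "T \<subseteq> S"
  shows "integrable (lebesgue_on T) f"
proof -
  have "set_integrable lebesgue S f" using assms unfolding set_integrable_def by (subst (asm) integrable_restrict_space) auto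
  then have "set_integrable lebesgue T f" using assms by (intro set_integrable_subset[where A = S and B = T]) auto
  then show ?thesis using assms unfolding set_integrable_def by (subst integrable_restrict_space) auto
qed

lemma L2_subsegment:
  assumes L2: "L2_seg a b g" and ab: "a \<noteq> b" and vw: "v \<noteq> w" "closed_segment v w \<subseteq> closed_segment a b"
  shows "L2_seg v w g"
proof -
  obtain v' w' \<alpha> \<beta> where p: "0 \<le> \<alpha>" "\<alpha> < \<beta>" "\<beta> \<le> 1" "closed_segment v w = closed_segment v' w'" "v' = a + \<alpha> *\<^sub>R (b - a)" "w' = a + \<beta> *\<^sub>R (b - a)" "{v,w} = {v',w'}"
      "{t \<in> {0..1}. a + t *\<^sub>R (b - a) \<in> closed_segment v w} = {\<alpha>..\<beta>}"
    by (rule subsegment_param[OF ab vw])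
  let ?H = "\<lambda>t. g (a + t *\<^sub>R (b - a))"
  have H: "?H (\<alpha> + t * (\<beta> - \<alpha>)) = g (v' + t *\<^sub>R (w' - v'))" for t
    unfolding p(5,6) by (simp add: algebra_simps)
  have sub: "{\<alpha>..\<beta>} \<subseteq> {0..1}" using p by auto
  have "?H \<in> borel_measurable (lebesgue_on {\<alpha>..\<beta>})"
  proof (rule measurable_restrict_mono[OF _ sub])
    show "?H \<in> borel_measurable (lebesgue_on {0..1})" using L2 by (simp add: L2_seg_def)
  qed
  from integral_subinterval(3)[OF p(2) this] have "(\<lambda>t. g (v' + t *\<^sub>R (w' - v'))) \<in> borel_measurable (lebesgue_on {0..1})" unfolding H .
  moreover have "integrable (lebesgue_on {\<alpha>..\<beta>}) (\<lambda>t. (?H t)\<^sup>2)"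
  proof (rule integrable_lebesgue_on_subset[OF _ _ _ sub])
    show "integrable (lebesgue_on {0..1}) (\<lambda>t. (?H t)\<^sup>2)" using L2 by (simp add: L2_seg_def)
  qed auto
  from integral_subinterval(2)[OF p(2) this] have "integrable (lebesgue_on {0..1}) (\<lambda>t. (g (v' + t *\<^sub>R (w' - v')))\<^sup>2)" unfolding H .
  ultimately have L: "L2_seg v' w' g" by (simp add: L2_seg_def)
  then show ?thesis using p(7) L2_seg_commute[OF L] by (auto simp: doubleton_eq_iff)
qed

context mesh
begin

lemma edge_subset: "T \<in> Th \<Longrightarrow> e \<in> edges T \<Longrightarrow> e \<subseteq> T"
  using tri_edge_obtain[OF tri] bary_closed_segment by (metis subsetI)

lemma edges_finite: "T \<in> Th \<Longrightarrow> finite (edges T)"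
proof -
  assume "T \<in> Th"
  then obtain p q r where "cr (q - p) (r - p) \<noteq> 0" "T = convex hull {p,q,r}" using tri[OF \<open>T \<in> Th\<close>] by (auto simp: tri_cr)
  then show ?thesis using edges_triangle by simp
qed

lemma interior_edges_subset: "interior_edges Th \<subseteq> (\<Union>T\<in>Th. edges T)"
  by (auto simp: interior_edges_def)

lemma interior_edges_finite: "finite (interior_edges Th)"
  using finite_subset[OF interior_edges_subset] fin edges_finite by blast

lemma triangle_edges_inter:
  assumes T: "T \<in> Th" and e: "e \<in> edges T" "e' \<in> edges T" "e \<noteq> e'" shows "finite (e \<inter> e')"
proof -
  obtain p q r where c: "cr (q - p) (r - p) \<noteq> 0" "T = convex hull {p,q,r}" "e = closed_segment q r" using tri_edge_obtain[OF tri[OF T] e(1)] .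
  have "e' = closed_segment r p \<or> e' = closed_segment p q" using edges_triangle[OF c(1)] c e by auto
  then show ?thesis
  proof
    assume e': "e' = closed_segment r p"
    have "e \<inter> e' \<subseteq> {r}"
    proof
      fix x assume "x \<in> e \<inter> e'"
      then have "bary p q r x = 0" "bary q r p x = 0"
        using bary_closed_segment[OF c(1)] bary_closed_segment[OF cr_cyclic_nz(1)[OF c(1)]] c e' by auto
      then show "x \<in> {r}" using bary_combination[OF c(1), of x] by auto
    qed
    then show ?thesis using finite_subset by blast
  next
    assume e': "e' = closed_segment p q"
    have "e \<inter> e' \<subseteq> {q}"
    proof
      fix x assume "x \<in> e \<inter> e'"
      then have "bary p q r x = 0" "bary r p q x = 0"
        using bary_closed_segment[OF c(1)] bary_closed_segment[OF cr_cyclic_nz(2)[OF c(1)]] c e' by auto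
      then show "x \<in> {q}" using bary_combination[OF c(1), of x] by auto
    qed
    then show ?thesis using finite_subset by blast
  qed
qed

lemma edges_inter_finite:
  assumes "T \<in> Th" "e \<in> edges T" "T' \<in> Th" "e' \<in> edges T'" "e \<noteq> e'" shows "finite (e \<inter> e')"
proof (cases "T = T'")
  case True then show ?thesis using triangle_edges_inter assms by blast
next
  case False
  have sub: "e \<inter> e' \<subseteq> T \<inter> T'" using edge_subset assms by blast
  consider "finite (T \<inter> T')" | "T \<inter> T' \<in> edges T" "T \<inter> T' \<in> edges T'"
    using conform[OF assms(1,3) False] by (metis finite.emptyI finite.insertI)
  then show ?thesis
  proof cases
    case 1 then show ?thesis using sub finite_subset by blast
  next
    case 2
    have "e \<noteq> T \<inter> T' \<or> e' \<noteq> T \<inter> T'" using assms(5) by auto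
    then show ?thesis
    proof
      assume "e \<noteq> T \<inter> T'"
      from triangle_edges_inter[OF assms(1,2) 2(1) this] show ?thesis by (rule finite_subset[rotated]) (use sub in blast)
    next
      assume "e' \<noteq> T \<inter> T'"
      from triangle_edges_inter[OF assms(3,4) 2(2) this] show ?thesis by (rule finite_subset[rotated]) (use sub in blast)
    qed
  qed
qed

lemma interior_edge_segment:
  assumes "e \<in> interior_edges Th" obtains v w where "e = closed_segment v w" "v \<noteq> w"
  using assms interior_edges_subset by (auto simp: edges_def)

text \<open>The edges inside the segment are pulled back to parameter intervals; distinct edges
  share finitely many points, so these intervals overlap in null sets.\<close>

lemma line_int_split:
  assumes ab: "a \<noteq> b" and E: "E \<subseteq> interior_edges Th" "closed_segment a b = \<Union>E"
    and i: "integrable (lebesgue_on {0..1}) (\<lambda>t. F (a + t *\<^sub>R (b - a)))"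
  shows "line_int a b F = (\<Sum>e | e \<in> interior_edges Th \<and> e \<subseteq> closed_segment a b. edge_int e F)"
proof -
  let ?H = "\<lambda>t. F (a + t *\<^sub>R (b - a))"
  let ?I = "{e. e \<in> interior_edges Th \<and> e \<subseteq> closed_segment a b}"
  define A where "A e = {t \<in> {0..1}. a + t *\<^sub>R (b - a) \<in> e}" for e
  have finI: "finite ?I" using interior_edges_finite by auto
  have "a + t *\<^sub>R (b - a) \<in> closed_segment a b" if "t \<in> {0..1}" for t
    unfolding in_segment using that by (intro exI[of _ t]) (auto simp: algebra_simps)
  \<comment> \<open>The sum runs over all interior edges inside the segment, as in
    \<open>src_f\<close>; the role of \<open>E\<close> is to show that they cover it.\<close>
  then have cover: "(\<Union>e\<in>?I. A e) = {0..1}"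
    using E unfolding A_def by (auto; blast)
  have edge: "A e \<in> sets lebesgue \<and> set_integrable lebesgue (A e) ?H \<and> dist a b * (LINT t:A e|lebesgue. ?H t) = edge_int e F"
    if e: "e \<in> ?I" for e
  proof -
    obtain v w where vw: "e = closed_segment v w" "v \<noteq> w" using interior_edge_segment e by blast
    have sub0: "closed_segment v w \<subseteq> closed_segment a b" using e vw by auto
    obtain v' w' \<alpha> \<beta> where p: "0 \<le> \<alpha>" "\<alpha> < \<beta>" "\<beta> \<le> 1" "closed_segment v w = closed_segment v' w'" "v' = a + \<alpha> *\<^sub>R (b - a)" "w' = a + \<beta> *\<^sub>R (b - a)" "{v,w} = {v',w'}"
      "{t \<in> {0..1}. a + t *\<^sub>R (b - a) \<in> closed_segment v w} = {\<alpha>..\<beta>}"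
      by (rule subsegment_param[OF ab vw(2) sub0])
    have Ae: "A e = {\<alpha>..\<beta>}" using p(8) by (simp add: A_def vw)
    have sub: "{\<alpha>..\<beta>} \<subseteq> {0..1}" using p by auto
    have i': "integrable (lebesgue_on {\<alpha>..\<beta>}) ?H" by (rule integrable_lebesgue_on_subset[OF i _ _ sub]) auto
    then have si: "set_integrable lebesgue {\<alpha>..\<beta>} ?H" unfolding set_integrable_def by (subst (asm) integrable_restrict_space) auto
    have vw': "v' \<noteq> w'" using p ab by auto
    have H: "?H (\<alpha> + t * (\<beta> - \<alpha>)) = F (v' + t *\<^sub>R (w' - v'))" for t
      unfolding p(5,6) by (simp add: algebra_simps)
    have "w' - v' = (\<beta> - \<alpha>) *\<^sub>R (b - a)" unfolding p(5,6) by (simp add: algebra_simps)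
    then have "norm (w' - v') = norm (b - a) * (\<beta> - \<alpha>)" using p(2) by simp
    then have dist: "dist v' w' = dist a b * (\<beta> - \<alpha>)" by (simp add: dist_norm norm_minus_commute)
    have "(LINT t:{\<alpha>..\<beta>}|lebesgue. ?H t) = integral\<^sup>L (lebesgue_on {\<alpha>..\<beta>}) ?H"
      unfolding set_lebesgue_integral_def by (subst integral_restrict_space) auto
    also have "\<dots> = (\<beta> - \<alpha>) * integral\<^sup>L (lebesgue_on {0..1}) (\<lambda>t. F (v' + t *\<^sub>R (w' - v')))"
      unfolding integral_subinterval(1)[OF p(2)] H ..
    finally have "dist a b * (LINT t:A e|lebesgue. ?H t) = line_int v' w' F" unfolding Ae by (simp add: line_int_def dist)
    also have "\<dots> = edge_int e F" unfolding vw(1) p(4) using edge_int_segment[OF vw'] by simp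
    finally show ?thesis using si Ae by simp
  qed
  have "line_int a b F = dist a b * (LINT t:{0..1}|lebesgue. ?H t)"
    unfolding line_int_def set_lebesgue_integral_def by (subst integral_restrict_space) auto
  also have "(LINT t:{0..1}|lebesgue. ?H t) = (\<Sum>e\<in>?I. LINT t:A e|lebesgue. ?H t)"
    unfolding cover[symmetric]
  proof (rule set_integral_finite_UN_AE[OF finI])
    fix e e' assume e: "e \<in> ?I" "e' \<in> ?I"
    show "AE t in lebesgue. t \<in> A e \<and> t \<in> A e' \<longrightarrow> e = e'"
    proof (cases "e = e'")
      case False
      obtain T T' where "T \<in> Th" "e \<in> edges T" "T' \<in> Th" "e' \<in> edges T'"
        using subsetD[OF interior_edges_subset, of e] subsetD[OF interior_edges_subset, of e'] e by auto
      then have fe: "finite (e \<inter> e')" using False by (rule edges_inter_finite)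
      have inj: "inj (\<lambda>t. a + t *\<^sub>R (b - a))" using ab by (auto simp: inj_def)
      have "A e \<inter> A e' \<subseteq> (\<lambda>t. a + t *\<^sub>R (b - a)) -` (e \<inter> e')" by (auto simp: A_def)
      then have "finite (A e \<inter> A e')" using finite_vimageI[OF fe inj] finite_subset by blast
      then have "A e \<inter> A e' \<in> null_sets lebesgue" using negligible_finite by (simp add: negligible_iff_null_sets[symmetric])
      from AE_not_in[OF this] show ?thesis by (rule AE_mp) (rule AE_I2, blast)
    qed simp
  qed (use edge in auto)
  also have "dist a b * \<dots> = (\<Sum>e\<in>?I. edge_int e F)"
    unfolding sum_distrib_left using edge by (intro sum.cong) auto
  finally show ?thesis .
qed

section \<open>Counting: sums over edges, and triangles at a vertex\<close>

lemma neighbor_involution: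
  assumes "T \<in> Th" "e \<in> edges T" "e \<in> interior_edges Th"
  shows "neighbor Th (neighbor Th T e) e = T"
proof -
  note n = interior_edge_neighbor[OF assms(3,1,2)]
  note n2 = interior_edge_neighbor[OF assms(3) n(1) n(4)]
  show ?thesis using n2(5)[OF assms(1) edge_subset[OF assms(1,2)]] n(2) by auto
qed

text \<open>Passing to the neighbour is an involution on the pairs of a triangle and one of its
  interior edges.\<close>

lemma sum_pairs_swap:
  fixes A :: "(real^2) set \<Rightarrow> (real^2) set \<Rightarrow> real"
  shows "(\<Sum>T\<in>Th. \<Sum>e\<in>edges T \<inter> interior_edges Th. A (neighbor Th T e) e) = (\<Sum>T\<in>Th. \<Sum>e\<in>edges T \<inter> interior_edges Th. A T e)"
proof -
  let ?P = "SIGMA T:Th. edges T \<inter> interior_edges Th"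
  have f: "\<forall>T\<in>Th. finite (edges T \<inter> interior_edges Th)" using edges_finite by auto
  have "(\<Sum>(T,e)\<in>?P. A (neighbor Th T e) e) = (\<Sum>(T,e)\<in>?P. A T e)"
    by (rule sum.reindex_bij_witness[where i = "\<lambda>(T,e). (neighbor Th T e, e)" and j = "\<lambda>(T,e). (neighbor Th T e, e)"])
      (auto simp: neighbor_involution interior_edge_neighbor)
  then show ?thesis by (simp add: sum.Sigma[OF fin f])
qed

text \<open>Every interior edge belongs to exactly two triangles; this is the origin of the weight
  1/2 of the jump terms in the estimator.\<close>

lemma sum_interior_edges:
  fixes Y :: "(real^2) set \<Rightarrow> real"
  shows "(\<Sum>T\<in>Th. \<Sum>e\<in>edges T \<inter> interior_edges Th. Y e) = 2 * (\<Sum>e\<in>interior_edges Th. Y e)"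
proof -
  have "(\<Sum>T\<in>Th. \<Sum>e\<in>edges T \<inter> interior_edges Th. Y e) = (\<Sum>T\<in>Th. \<Sum>e | e \<in> interior_edges Th \<and> e \<in> edges T. Y e)"
    by (intro sum.cong refl) auto
  also have "\<dots> = (\<Sum>e\<in>interior_edges Th. \<Sum>T | T \<in> Th \<and> e \<in> edges T. Y e)"
    by (rule sum.swap_restrict[OF fin interior_edges_finite])
  also have "\<dots> = (\<Sum>e\<in>interior_edges Th. 2 * Y e)"
  proof (rule sum.cong[OF refl])
    fix e assume e: "e \<in> interior_edges Th"
    then obtain T where T: "T \<in> Th" "e \<in> edges T" using interior_edges_subset by blast
    note n = interior_edge_neighbor[OF e T]
    have "{T'. T' \<in> Th \<and> e \<in> edges T'} = {T, neighbor Th T e}"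
      using n T edge_subset by blast
    then show "(\<Sum>T | T \<in> Th \<and> e \<in> edges T. Y e) = 2 * Y e" using n(2) by simp
  qed
  finally show ?thesis by (simp add: sum_distrib_left)
qed

text \<open>Each triangle at \<open>z\<close> is shrunk towards \<open>z\<close> to a common
  diameter \<epsilon>. The shrunk copy contains a ball of radius at least
  \<open>\<epsilon> / K\<close> and lies in the disc of radius \<epsilon> around \<open>z\<close>.
  The copies overlap in null sets, so comparing areas bounds their number, whatever the true
  sizes.\<close>

lemma vertex_degree:
  assumes K: "K > 0" and reg: "\<And>T. T \<in> Th \<Longrightarrow> \<exists>c \<rho>. \<rho> > 0 \<and> cball c \<rho> \<subseteq> T \<and> diameter T \<le> K * \<rho>"
  shows "real (card {T \<in> Th. z \<in> T}) \<le> K\<^sup>2"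
proof -
  let ?V = "{T \<in> Th. z \<in> T}"
  have finV: "finite ?V" using fin by auto
  have dpos: "diameter T > 0" if T: "T \<in> Th" for T
  proof -
    obtain c \<rho> where r: "\<rho> > 0" "cball c \<rho> \<subseteq> T" using reg[OF T] by blast
    have "diameter (cball c \<rho>) \<le> diameter T" using r T_sets[OF T] by (intro diameter_subset compact_imp_bounded) auto
    then show ?thesis using r by simp
  qed
  \<comment> \<open>The minimum keeps every scaling factor \<open>\<epsilon> / diameter T\<close> at
    most 1, so that the shrunk ball stays in \<open>T\<close>; the 1 covers the case of no triangle
    at \<open>z\<close>.\<close>
  define \<epsilon> where "\<epsilon> = Min (insert 1 (diameter ` ?V))"
  have \<epsilon>: "\<epsilon> > 0" "\<And>T. T \<in> ?V \<Longrightarrow> \<epsilon> \<le> diameter T" using finV dpos by (auto simp: \<epsilon>_def)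
  have big: "pi * (\<epsilon> / K)\<^sup>2 \<le> measure lebesgue (T \<inter> cball z \<epsilon>)" if T: "T \<in> ?V" for T
  proof -
    obtain c \<rho> where r: "\<rho> > 0" "cball c \<rho> \<subseteq> T" "diameter T \<le> K * \<rho>" using reg T by blast
    have h: "diameter T > 0" using dpos T by auto
    define t where "t = \<epsilon> / diameter T"
    have t: "0 < t" "t \<le> 1" using \<epsilon> T h by (auto simp: t_def)
    have "cball (z + t *\<^sub>R (c - z)) (t * \<rho>) \<subseteq> T \<inter> cball z \<epsilon>"
    proof
      fix y assume y: "y \<in> cball (z + t *\<^sub>R (c - z)) (t * \<rho>)"
      define y' where "y' = z + (1 / t) *\<^sub>R (y - z)"
      have yy: "y = (1 - t) *\<^sub>R z + t *\<^sub>R y'" using t by (simp add: y'_def algebra_simps)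
      have "c - y' = (1 / t) *\<^sub>R (z + t *\<^sub>R (c - z) - y)" using t by (simp add: y'_def algebra_simps)
      then have "dist c y' = (1 / t) * dist (z + t *\<^sub>R (c - z)) y" using t by (simp add: dist_norm)
      also have "\<dots> \<le> (1 / t) * (t * \<rho>)" using y t by (intro mult_left_mono) auto
      finally have "y' \<in> cball c \<rho>" using t by simp
      then have y'T: "y' \<in> T" using r by blast
      then have "y \<in> T" unfolding yy using tri_convex[OF tri, of T] T t by (auto simp: convex_def)
      moreover have "dist z y \<le> \<epsilon>"
      proof -
        have "z - y = t *\<^sub>R (z - y')" unfolding yy by (simp add: algebra_simps)
        then have "dist z y = t * dist z y'" using t by (simp add: dist_norm)
        also have "\<dots> \<le> t * diameter T" using y'T T t T_sets by (intro mult_left_mono diameter_bounded_bound compact_imp_bounded) auto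
        also have "\<dots> = \<epsilon>" using h by (simp add: t_def)
        finally show ?thesis .
      qed
      ultimately show "y \<in> T \<inter> cball z \<epsilon>" by simp
    qed
    then have "measure lebesgue (cball (z + t *\<^sub>R (c - z)) (t * \<rho>)) \<le> measure lebesgue (T \<inter> cball z \<epsilon>)"
      using T T_sets by (intro measure_mono_fmeasurable) (auto intro!: lmeasurable_compact compact_Int)
    moreover have "measure lebesgue (cball (z + t *\<^sub>R (c - z)) (t * \<rho>)) = pi * (t * \<rho>)\<^sup>2"
      using content_cball[of "t * \<rho>" "z + t *\<^sub>R (c - z)"] t r(1) unit_ball_vol_2 by simp
    moreover have "\<epsilon> / K \<le> t * \<rho>"
    proof -
      have "\<epsilon> * diameter T \<le> \<epsilon> * (K * \<rho>)" using r(3) \<epsilon> by (intro mult_left_mono) auto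
      then show ?thesis using h K by (simp add: t_def field_simps)
    qed
    then have "pi * (\<epsilon> / K)\<^sup>2 \<le> pi * (t * \<rho>)\<^sup>2" using \<epsilon>(1) K by (intro mult_left_mono power_mono) auto
    ultimately show ?thesis by linarith
  qed
  have "real (card ?V) * (pi * (\<epsilon> / K)\<^sup>2) \<le> (\<Sum>T\<in>?V. measure lebesgue (T \<inter> cball z \<epsilon>))"
    using sum_mono[of ?V "\<lambda>_. pi * (\<epsilon> / K)\<^sup>2", OF big] by simp
  also have "\<dots> = measure lebesgue (\<Union>((\<lambda>T. T \<inter> cball z \<epsilon>) ` ?V))"
  proof (rule measure_negligible_finite_Union_image[symmetric, OF finV])
    show "T \<inter> cball z \<epsilon> \<in> lmeasurable" if "T \<in> ?V" for T using that T_sets by (auto intro!: lmeasurable_compact compact_Int)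
    show "pairwise (\<lambda>x y. negligible (x \<inter> cball z \<epsilon> \<inter> (y \<inter> cball z \<epsilon>))) ?V"
    proof (rule pairwiseI)
      fix x y assume "x \<in> ?V" "y \<in> ?V" "x \<noteq> y"
      then have "negligible (x \<inter> y)" by (intro inter_negligible) auto
      then show "negligible (x \<inter> cball z \<epsilon> \<inter> (y \<inter> cball z \<epsilon>))" by (rule negligible_subset) auto
    qed
  qed
  also have "\<dots> \<le> measure lebesgue (cball z \<epsilon>)"
  proof (rule measure_mono_fmeasurable)
    show "\<Union>((\<lambda>T. T \<inter> cball z \<epsilon>) ` ?V) \<in> sets lebesgue"
      using T_sets(1) by (intro sets.finite_UN[OF finV] sets.Int) auto
  qed auto
  also have "\<dots> = pi * \<epsilon>\<^sup>2" using content_cball[of \<epsilon> z] \<epsilon>(1) unit_ball_vol_2 by simp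
  finally have "real (card ?V) * (pi * (\<epsilon> / K)\<^sup>2) \<le> K\<^sup>2 * (pi * (\<epsilon> / K)\<^sup>2)" using K by (simp add: power_divide)
  moreover have "pi * (\<epsilon> / K)\<^sup>2 > 0" using \<epsilon>(1) K by simp
  ultimately show ?thesis by (rule mult_right_le_imp_le)
qed

end

section \<open>Quasi-interpolation by edge means\<close>

definition edge_mean :: "(real^2) set \<Rightarrow> (real^2 \<Rightarrow> real) \<Rightarrow> real" where
  "edge_mean e f = edge_int e f / edge_int e (\<lambda>_. 1)"

lemma edge_mean_segment: "v \<noteq> w \<Longrightarrow> edge_mean (closed_segment v w) f = emean v w f"
  by (simp add: edge_mean_def edge_int_segment line_int_emean) (simp add: emean_def measure_restrict_space)

text \<open>A ball with explicit radius stands in for \<open>inradius\<close>, which is a supremum.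
  All later constants are functions of \<open>K\<close> alone.\<close>

locale regular_mesh = mesh +
  fixes K :: real
  assumes K_pos: "K > 0"
    and regular: "\<And>T. T \<in> Th \<Longrightarrow> \<exists>c \<rho>. \<rho> > 0 \<and> cball c \<rho> \<subseteq> T \<and> diameter T \<le> K * \<rho>"
begin

lemma triangle_of:
  assumes "T \<in> Th" "cr (q - p) (r - p) \<noteq> 0" "T = convex hull {p,q,r}"
  shows "triangle p q r T \<bar>cr (q - p) (r - p)\<bar> (diameter T)"
proof
  show "norm (y - x) \<le> diameter T" if "x \<in> T" "y \<in> T" for x y
    using diameter_bounded_bound[OF compact_imp_bounded[OF T_sets(2)[OF assms(1)]] that(2,1)] by (simp add: dist_norm)
qed (use assms in auto)

lemma diameter_sq_le:
  assumes "T \<in> Th" "cr (q - p) (r - p) \<noteq> 0" "T = convex hull {p,q,r}"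
  shows "(diameter T)\<^sup>2 \<le> K\<^sup>2 * \<bar>cr (q - p) (r - p)\<bar>"
  using triangle.D_ge[OF triangle_of[OF assms]] regular[OF assms(1)] by blast

lemma diameter_pos: "T \<in> Th \<Longrightarrow> diameter T > 0"
  using triangle.h_pos[OF triangle_of] tri by (metis tri_cr)

lemma emean_diff_bound:
  assumes f: "C1grad f df" and T: "T \<in> Th" "cr (q - p) (r - p) \<noteq> 0" "T = convex hull {p,q,r}"
  shows "\<bar>emean q r f - emean p r f\<bar> \<le> K * sqrt (sint T (\<lambda>x. (norm (df x))\<^sup>2))"
proof -
  let ?\<Gamma> = "sint T (\<lambda>x. (norm (df x))\<^sup>2)" and ?D = "\<bar>cr (q - p) (r - p)\<bar>"
  have G0: "0 \<le> ?\<Gamma>" by simp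
  have D: "?D > 0" using T by simp
  have "(emean q r f - emean p r f)\<^sup>2 \<le> (diameter T)\<^sup>2 / (2 * ?D) * ?\<Gamma>"
    by (rule triangle.edge_mean_diff[OF triangle_of[OF T] f])
  also have "\<dots> \<le> K\<^sup>2 * ?\<Gamma>"
  proof (rule mult_right_mono[OF _ G0])
    have "(diameter T)\<^sup>2 \<le> K\<^sup>2 * ?D" by (rule diameter_sq_le[OF T])
    also have "\<dots> \<le> K\<^sup>2 * (2 * ?D)" using D by (intro mult_left_mono) auto
    finally show "(diameter T)\<^sup>2 / (2 * ?D) \<le> K\<^sup>2" using D by (simp add: pos_divide_le_eq)
  qed
  finally have "sqrt ((emean q r f - emean p r f)\<^sup>2) \<le> sqrt (K\<^sup>2 * ?\<Gamma>)" by (rule real_sqrt_le_mono)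
  then show ?thesis using K_pos by (simp add: real_sqrt_mult)
qed

lemma edge_mean_diff_bound:
  assumes f: "C1grad f df" and T: "T \<in> Th" and e: "e \<in> edges T" "e' \<in> edges T"
  shows "\<bar>edge_mean e f - edge_mean e' f\<bar> \<le> K * sqrt (sint T (\<lambda>x. (norm (df x))\<^sup>2))"
proof (cases "e = e'")
  case True
  then show ?thesis using K_pos by simp
next
  case False
  obtain p q r where c: "cr (q - p) (r - p) \<noteq> 0" "T = convex hull {p,q,r}" "e = closed_segment q r"
    using tri_edge_obtain[OF tri[OF T] e(1)] .
  have ne: "p \<noteq> q" "q \<noteq> r" "p \<noteq> r" using c(1) by (auto simp: cr_def)
  have "e' = closed_segment r p \<or> e' = closed_segment p q" using edges_triangle[OF c(1)] c e False by auto
  then show ?thesis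
  proof
    assume "e' = closed_segment r p"
    then have "edge_mean e' f = emean p r f" using ne by (simp add: edge_mean_segment emean_commute)
    moreover have "edge_mean e f = emean q r f" using c ne by (simp add: edge_mean_segment)
    ultimately show ?thesis using emean_diff_bound[OF f T c(1,2)] by simp
  next
    assume "e' = closed_segment p q"
    then have "edge_mean e' f = emean p q f" using ne by (simp add: edge_mean_segment)
    moreover have "edge_mean e f = emean r q f" using c ne by (simp add: edge_mean_segment emean_commute)
    moreover have "T = convex hull {p,r,q}" using c by (simp add: insert_commute)
    ultimately show ?thesis using emean_diff_bound[OF f T cr_cyclic_nz(3)[OF c(1)]] by simp
  qed
qed

section \<open>Comparing edge means by walking around a vertex\<close>

definition patch_energy :: "(real^2 \<Rightarrow> real^2) \<Rightarrow> real^2 \<Rightarrow> real" where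
  "patch_energy df z = (\<Sum>T | T \<in> Th \<and> z \<in> T. sint T (\<lambda>x. (norm (df x))\<^sup>2))"

lemma patch_energy_ge: "T \<in> Th \<Longrightarrow> z \<in> T \<Longrightarrow> sint T (\<lambda>x. (norm (df x))\<^sup>2) \<le> patch_energy df z"
  unfolding patch_energy_def using fin by (intro member_le_sum) auto

lemma patch_energy_nonneg: "patch_energy df z \<ge> 0"
  unfolding patch_energy_def by (intro sum_nonneg) simp

text \<open>Every triangle visited is paid for once, in passing from the edge by which the walk
  enters to the edge by which it leaves. A walk of \<open>n\<close> steps visits
  \<open>n + 1\<close> triangles.\<close>

lemma edge_mean_chain:
  assumes f: "C1grad f df" and "(T, T') \<in> adj z ^^ n" "T \<in> Th" "T' \<in> Th"
    and "e \<in> edges T" "z \<in> e" "e' \<in> edges T'" "z \<in> e'"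
  shows "\<bar>edge_mean e f - edge_mean e' f\<bar> \<le> (real n + 1) * (K * sqrt (patch_energy df z))"
  using assms(2-8)
proof (induction n arbitrary: T' e')
  case 0
  then have "T' = T" by simp
  have "z \<in> T" using 0 edge_subset by blast
  then have "K * sqrt (sint T (\<lambda>x. (norm (df x))\<^sup>2)) \<le> K * sqrt (patch_energy df z)"
    using K_pos 0 patch_energy_ge by (intro mult_left_mono) auto
  then show ?case using edge_mean_diff_bound[OF f, of T e e'] 0 \<open>T' = T\<close> by simp
next
  case (Suc n)
  then obtain T'' where T'': "(T, T'') \<in> adj z ^^ n" "(T'', T') \<in> adj z" by auto
  let ?e = "T'' \<inter> T'"
  have a: "T'' \<in> Th" "?e \<in> edges T''" "?e \<in> edges T'" "z \<in> ?e" using T''(2) by (auto simp: adj_def)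
  have IH: "\<bar>edge_mean e f - edge_mean ?e f\<bar> \<le> (real n + 1) * (K * sqrt (patch_energy df z))"
    using Suc.IH[OF T''(1)] Suc.prems a by blast
  have "z \<in> T'" using a by auto
  then have "K * sqrt (sint T' (\<lambda>x. (norm (df x))\<^sup>2)) \<le> K * sqrt (patch_energy df z)"
    using K_pos Suc.prems patch_energy_ge by (intro mult_left_mono) auto
  then have "\<bar>edge_mean ?e f - edge_mean e' f\<bar> \<le> K * sqrt (patch_energy df z)"
    using edge_mean_diff_bound[OF f Suc.prems(3) a(3) Suc.prems(6)] by linarith
  then have "\<bar>edge_mean e f - edge_mean e' f\<bar> \<le> (real n + 1) * (K * sqrt (patch_energy df z)) + K * sqrt (patch_energy df z)"
    using IH by linarith
  also have "\<dots> = (real (Suc n) + 1) * (K * sqrt (patch_energy df z))" by (simp add: algebra_simps)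
  finally show ?case .
qed

text \<open>\<open>K^4\<close> bounds the number of adjacent pairs at a vertex, being the square of
  the bound for the number of triangles there; the 1 accounts for the starting triangle and the last
  factor for a single comparison.\<close>

definition chain_const :: real where "chain_const = (K^4 + 1) * K"

text \<open>In a finite relation, reachability needs no more steps than the relation has pairs. This
  makes the length of the walk depend on \<open>K\<close> only.\<close>

lemma edge_mean_fan:
  assumes f: "C1grad f df" and T': "T' \<in> fan z T" and "T \<in> Th" "e \<in> edges T" "z \<in> e" "e' \<in> edges T'" "z \<in> e'"
  shows "\<bar>edge_mean e f - edge_mean e' f\<bar> \<le> chain_const * sqrt (patch_energy df z)"
proof -
  let ?V = "{T \<in> Th. z \<in> T}"
  have sub: "adj z \<subseteq> ?V \<times> ?V" by (auto simp: adj_def)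
  have finV: "finite ?V" using fin by auto
  then have fina: "finite (adj z)" using sub finite_subset by blast
  have zT: "z \<in> T" using assms edge_subset by blast
  have T'Th: "T' \<in> Th" using fan_subset[OF assms(3) zT] T' by auto
  have "(T, T') \<in> (adj z)\<^sup>*" using T' by (simp add: fan_def)
  then obtain n where n: "n \<le> card (adj z)" "(T, T') \<in> adj z ^^ n" unfolding rtrancl_finite_eq_relpow[OF fina] by auto
  have "card (adj z) \<le> card ?V * card ?V" using card_mono[OF finite_cartesian_product[OF finV finV] sub] by (simp add: card_cartesian_product)
  then have "n \<le> card ?V * card ?V" using n(1) by (rule order_trans[rotated])
  then have "real n \<le> real (card ?V * card ?V)" by (rule of_nat_mono)
  also have "\<dots> = real (card ?V) * real (card ?V)" by (rule of_nat_mult)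
  also have "\<dots> \<le> K\<^sup>2 * K\<^sup>2" by (intro mult_mono vertex_degree[OF K_pos regular]) simp_all
  also have "\<dots> = K^4" by (simp add: power2_eq_square power4_eq_xxxx)
  finally have nK: "real n \<le> K^4" .
  have "\<bar>edge_mean e f - edge_mean e' f\<bar> \<le> (real n + 1) * (K * sqrt (patch_energy df z))"
    by (rule edge_mean_chain[OF f n(2) assms(3) T'Th assms(4-7)])
  also have "\<dots> \<le> (K^4 + 1) * (K * sqrt (patch_energy df z))"
    using nK K_pos patch_energy_nonneg by (intro mult_right_mono) auto
  finally show ?thesis by (simp add: chain_const_def mult.assoc)
qed

text \<open>The choice is only meaningful for mesh vertices; elsewhere in \<open>\<Omega>\<close> the value is arbitrary.\<close>
definition nodal :: "(real^2 \<Rightarrow> real) \<Rightarrow> real^2 \<Rightarrow> real" where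
  "nodal f z = (if z \<in> \<Omega> then edge_mean (SOME e. \<exists>T\<in>Th. e \<in> edges T \<and> z \<in> e \<and> z \<in> verts T) f else 0)"

lemma vertex_in_T: "z \<in> verts T \<Longrightarrow> z \<in> T"
  by (auto simp: verts_def extreme_point_of_def)

text \<open>For \<open>z\<close> outside \<Omega>, the contrapositive of
  \<open>fan_dichotomy\<close> puts an edge with mean 0 into the fan of \<open>T\<close>. For
  \<open>z\<close> in \<Omega>, no boundary edge contains \<open>z\<close>, so the fan of the chosen
  triangle comprises all triangles at \<open>z\<close>, among them \<open>T\<close>.\<close>

lemma nodal_bound:
  assumes f: "C1grad f df" and f0: "\<And>x. x \<notin> \<Omega> \<Longrightarrow> f x = 0"
    and T: "T \<in> Th" "z \<in> verts T" "e \<in> edges T" "z \<in> e"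
  shows "\<bar>nodal f z - edge_mean e f\<bar> \<le> chain_const * sqrt (patch_energy df z)"
proof (cases "z \<in> \<Omega>")
  case False
  have "\<exists>T'\<in>fan z T. \<exists>e'\<in>edges T'. z \<in> e' \<and> e' \<notin> interior_edges Th"
    using fan_dichotomy(1)[OF T(1,2)] False by blast
  then obtain T' e' where e': "T' \<in> fan z T" "e' \<in> edges T'" "z \<in> e'" "e' \<notin> interior_edges Th" by blast
  have T'Th: "T' \<in> Th" using fan_subset[OF T(1) vertex_in_T[OF T(2)]] e' by auto
  have "e' \<inter> \<Omega> = {}" by (rule boundary_edge_disjoint[OF T'Th e'(2,4)])
  then have 0: "f x = 0" if "x \<in> e'" for x using that f0 by blast
  obtain v w where vw: "e' = closed_segment v w" "v \<noteq> w" using e'(2) by (auto simp: edges_def)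
  have "line_int v w f = line_int v w (\<lambda>x. 0)" by (rule line_int_cong) (use 0 vw in auto)
  then have l0: "line_int v w f = 0" by (simp add: line_int_def)
  have "edge_mean e' f = 0" unfolding edge_mean_def vw(1) edge_int_segment[OF vw(2)] l0 by simp
  then show ?thesis using edge_mean_fan[OF f e'(1) T(1,3,4) e'(2,3)] False by (simp add: nodal_def)
next
  case True
  define e0 where "e0 = (SOME e. \<exists>T\<in>Th. e \<in> edges T \<and> z \<in> e \<and> z \<in> verts T)"
  have "\<exists>T\<in>Th. e0 \<in> edges T \<and> z \<in> e0 \<and> z \<in> verts T"
    unfolding e0_def by (rule someI_ex) (use T in blast)
  then obtain T0 where T0: "T0 \<in> Th" "e0 \<in> edges T0" "z \<in> e0" "z \<in> verts T0" by blast
  have "fan z T0 = {T \<in> Th. z \<in> T}"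
  proof (rule fan_dichotomy(2)[OF T0(1,4)])
    fix T e assume "T \<in> fan z T0" "e \<in> edges T" "z \<in> e"
    moreover have "T \<in> Th" using fan_subset[OF T0(1) vertex_in_T[OF T0(4)]] \<open>T \<in> fan z T0\<close> by auto
    ultimately show "e \<in> interior_edges Th" using boundary_edge_disjoint[of T e] True by blast
  qed
  then have "T \<in> fan z T0" using T vertex_in_T by auto
  from edge_mean_fan[OF f this T0(1-3) T(3,4)] show ?thesis using True by (simp add: nodal_def e0_def)
qed

section \<open>The piecewise affine interpolant and its error\<close>

lemma affine_interpolation:
  assumes "tri T" shows "\<exists>c d. \<forall>z\<in>verts T. c + d \<bullet> z = g z"
proof -
  obtain p q r where c: "cr (q - p) (r - p) \<noteq> 0" "T = convex hull {p,q,r}" using assms by (auto simp: tri_cr)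
  have lin: "\<exists>c d. \<forall>x. bary p q r x = c + d \<bullet> x" for p q r
  proof -
    let ?k = "1 / cr (r - q) (p - q)"
    have "bary p q r x = - ?k * cr (r - q) q + (?k *\<^sub>R vector [- (r - q)$2, (r - q)$1]) \<bullet> x" for x
      unfolding inner_scaleR_left bary_def by (simp add: cr_def inner_real2 diff_divide_distrib add_divide_distrib algebra_simps)
    then show ?thesis by blast
  qed
  obtain c1 d1 where 1: "\<And>x. bary p q r x = c1 + d1 \<bullet> x" using lin by metis
  obtain c2 d2 where 2: "\<And>x. bary q r p x = c2 + d2 \<bullet> x" using lin by metis
  obtain c3 d3 where 3: "\<And>x. bary r p q x = c3 + d3 \<bullet> x" using lin by metis
  let ?l = "\<lambda>x. g p * bary p q r x + g q * bary q r p x + g r * bary r p q x"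
  have l: "(g p * c1 + g q * c2 + g r * c3) + (g p *\<^sub>R d1 + g q *\<^sub>R d2 + g r *\<^sub>R d3) \<bullet> x = ?l x" for x
    unfolding 1 2 3 by (simp add: inner_add_left algebra_simps)
  note cy = cr_cyclic_nz[OF c(1)]
  have "?l p = g p" "?l q = g q" "?l r = g r"
    using bary_of_combination[OF c(1), of 1 0 0] bary_of_combination[OF c(1), of 0 1 0] bary_of_combination[OF c(1), of 0 0 1]
      bary_of_combination[OF cy(1), of 1 0 0] bary_of_combination[OF cy(1), of 0 1 0] bary_of_combination[OF cy(1), of 0 0 1]
      bary_of_combination[OF cy(2), of 1 0 0] bary_of_combination[OF cy(2), of 0 1 0] bary_of_combination[OF cy(2), of 0 0 1]
    by auto
  then show ?thesis unfolding c(2) verts_triangle[OF c(1)] using l by (intro exI[of _ "g p * c1 + g q * c2 + g r * c3"] exI[of _ "g p *\<^sub>R d1 + g q *\<^sub>R d2 + g r *\<^sub>R d3"]) auto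
qed

lemma affine_on_segment:
  assumes "c + d \<bullet> v = c' + d' \<bullet> v" "c + d \<bullet> w = c' + d' \<bullet> w" "x \<in> closed_segment v w"
  shows "c + d \<bullet> x = c' + d' \<bullet> (x :: real^2)"
proof -
  obtain s where x: "x = (1 - s) *\<^sub>R v + s *\<^sub>R w" using assms(3) by (auto simp: in_segment)
  have "c + d \<bullet> x = (1 - s) * (c + d \<bullet> v) + s * (c + d \<bullet> w)" unfolding x by (simp add: inner_add_right algebra_simps)
  also have "\<dots> = c' + d' \<bullet> x" unfolding assms(1,2) unfolding x by (simp add: inner_add_right algebra_simps)
  finally show ?thesis .
qed

text \<open>Conformity makes the affine pieces agree on shared edges. A boundary edge misses
  \<Omega>, hence so do its end points, where \<open>g\<close> is zero; the interpolant thus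
  vanishes on the frontier and \<open>piecewise_H10\<close> makes it admissible in the Galerkin
  equation.\<close>

lemma nodal_interpolant:
  assumes k: "k \<ge> 1" and g0: "\<And>z. z \<notin> \<Omega> \<Longrightarrow> g z = 0"
  obtains vh c d where "vh \<in> fe_space \<Omega> Th k" "\<And>T x. T \<in> Th \<Longrightarrow> x \<in> T \<Longrightarrow> vh x = c T + d T \<bullet> x"
    "\<And>T z. T \<in> Th \<Longrightarrow> z \<in> verts T \<Longrightarrow> c T + d T \<bullet> z = g z"
    "\<And>T e x. T \<in> Th \<Longrightarrow> e \<in> edges T \<Longrightarrow> e \<notin> interior_edges Th \<Longrightarrow> x \<in> e \<Longrightarrow> vh x = 0"
proof -
  have "\<forall>T\<in>Th. \<exists>c d. \<forall>z\<in>verts T. c + d \<bullet> z = g z" using affine_interpolation tri by blast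
  then obtain c d where cd: "\<And>T z. T \<in> Th \<Longrightarrow> z \<in> verts T \<Longrightarrow> c T + d T \<bullet> z = g z" by metis
  \<comment> \<open>Any triangle containing \<open>x\<close> serves, because \<open>agree\<close>
    shows that the value does not depend on the choice.\<close>
  define sel where "sel x = (SOME T. T \<in> Th \<and> x \<in> T)" for x
  define vh where "vh x = c (sel x) + d (sel x) \<bullet> x" for x
  have sel: "sel x \<in> Th \<and> x \<in> sel x" if "T \<in> Th" "x \<in> T" for T x
    unfolding sel_def by (rule someI_ex) (use that in blast)
  have agree: "c T + d T \<bullet> x = c T' + d T' \<bullet> x" if TT: "T \<in> Th" "T' \<in> Th" "x \<in> T" "x \<in> T'" for T T' x
  proof (cases "T = T'")
    case False
    have ne: "T \<inter> T' \<noteq> {}" using TT by auto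
    consider v where "v \<in> verts T" "v \<in> verts T'" "T \<inter> T' = {v}" | "T \<inter> T' \<in> edges T" "T \<inter> T' \<in> edges T'"
      using conform[OF TT(1,2) False] ne by blast
    then show ?thesis
    proof cases
      case 1
      then have "x = v" using TT by auto
      then show ?thesis using cd TT 1 by simp
    next
      case 2
      then obtain v w where vw: "T \<inter> T' = closed_segment v w" by (auto simp: edges_def)
      have V: "v \<in> verts T" "w \<in> verts T" "v \<in> verts T'" "w \<in> verts T'"
        using edge_endpoints_verts[OF tri[OF TT(1)]] edge_endpoints_verts[OF tri[OF TT(2)]] 2 vw by auto
      have xs: "x \<in> closed_segment v w" using TT vw by blast
      show ?thesis
        by (rule affine_on_segment[OF _ _ xs]) (simp_all add: cd[OF TT(1) V(1)] cd[OF TT(1) V(2)] cd[OF TT(2) V(3)] cd[OF TT(2) V(4)])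
    qed
  qed simp
  have vhT: "vh x = c T + d T \<bullet> x" if "T \<in> Th" "x \<in> T" for T x
    unfolding vh_def using agree[of "sel x" T x] sel[OF that] that by blast
  have bd: "vh x = 0" if T: "T \<in> Th" "e \<in> edges T" "e \<notin> interior_edges Th" "x \<in> e" for T e x
  proof -
    have e\<Omega>: "e \<inter> \<Omega> = {}" by (rule boundary_edge_disjoint[OF T(1-3)])
    obtain v w where vw: "e = closed_segment v w" using T(2) by (auto simp: edges_def)
    then have V: "v \<in> verts T" "w \<in> verts T" using edge_endpoints_verts[OF tri[OF T(1)]] T by auto
    have "v \<in> e" "w \<in> e" using vw by auto
    then have "g v = 0" "g w = 0" using g0 e\<Omega> by blast+
    moreover have xs: "x \<in> closed_segment v w" using T(4) vw by simp
    ultimately have "c T + d T \<bullet> x = 0 + 0 \<bullet> x"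
      by (intro affine_on_segment[OF _ _ xs]) (simp_all add: cd[OF T(1) V(1)] cd[OF T(1) V(2)])
    then show ?thesis using vhT[OF T(1)] edge_subset[OF T(1,2)] T(4) by auto
  qed
  have C1: "C1grad (\<lambda>x. c T + d T \<bullet> x) (\<lambda>x. d T)" for T by (rule C1grad_affine)
  have contT: "continuous_on T vh" if "T \<in> Th" for T
    using C1grad_cont[OF C1[of T]] by (rule continuous_on_eq) (use vhT[OF that] in auto)
  have z: "vh x = 0" if "x \<in> closure \<Omega> - \<Omega>" for x
    by (rule zero_on_frontier[OF contT bd that])
  have "H10 \<Omega> vh (grad vh)"
    by (rule piecewise_H10[where P = "\<lambda>T x. c T + d T \<bullet> x" and dP = "\<lambda>T x. d T", OF C1 vhT z])
  moreover have "continuous_on \<Omega> vh" using piecewise_continuous[OF contT] closure_subset continuous_on_subset by blast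
  moreover have "\<forall>T\<in>Th. \<exists>p. polyk k p \<and> (\<forall>x\<in>T. vh x = p x)"
    using polyk_affine[OF k] vhT by (intro ballI exI[of _ "\<lambda>x. c _ + d _ \<bullet> x"] conjI) auto
  ultimately have "vh \<in> fe_space \<Omega> Th k" unfolding fe_space_def by blast
  then show ?thesis using that vhT cd bd by blast
qed

definition tri_energy :: "(real^2 \<Rightarrow> real^2) \<Rightarrow> (real^2) set \<Rightarrow> real" where
  "tri_energy df T = (\<Sum>z\<in>verts T. patch_energy df z)"

lemma verts_card: "T \<in> Th \<Longrightarrow> finite (verts T) \<and> card (verts T) \<le> 3"
proof -
  assume "T \<in> Th"
  then obtain p q r where "cr (q - p) (r - p) \<noteq> 0" "T = convex hull {p,q,r}" using tri[OF \<open>T \<in> Th\<close>] by (auto simp: tri_cr)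
  then have "verts T = {p,q,r}" using verts_triangle by simp
  then show ?thesis by (simp add: card_insert_if)
qed

text \<open>Finite overlap: at most \<open>K\<^sup>2\<close> triangles share a vertex, and at most
  three mesh vertices lie in a triangle.\<close>

lemma sum_tri_energy:
  "(\<Sum>T\<in>Th. tri_energy df T) \<le> 3 * K\<^sup>2 * (\<Sum>T\<in>Th. sint T (\<lambda>x. (norm (df x))\<^sup>2))"
proof -
  let ?Z = "\<Union>T\<in>Th. verts T"
  let ?\<Gamma> = "\<lambda>T. sint T (\<lambda>x. (norm (df x))\<^sup>2)"
  have finZ: "finite ?Z" by (rule finite_verts)
  have "(\<Sum>T\<in>Th. tri_energy df T) = (\<Sum>T\<in>Th. \<Sum>z | z \<in> ?Z \<and> z \<in> verts T. patch_energy df z)"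
    unfolding tri_energy_def by (intro sum.cong refl) auto
  also have "\<dots> = (\<Sum>z\<in>?Z. \<Sum>T | T \<in> Th \<and> z \<in> verts T. patch_energy df z)"
    by (rule sum.swap_restrict[OF fin finZ])
  also have "\<dots> \<le> (\<Sum>z\<in>?Z. K\<^sup>2 * patch_energy df z)"
  proof (rule sum_mono)
    fix z
    have "card {T. T \<in> Th \<and> z \<in> verts T} \<le> card {T \<in> Th. z \<in> T}" using fin vertex_in_T by (intro card_mono) auto
    then have "real (card {T. T \<in> Th \<and> z \<in> verts T}) \<le> K\<^sup>2" using vertex_degree[OF K_pos regular, of z] by linarith
    then show "(\<Sum>T | T \<in> Th \<and> z \<in> verts T. patch_energy df z) \<le> K\<^sup>2 * patch_energy df z"
      using patch_energy_nonneg[of df z] by (simp add: mult_right_mono)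
  qed
  also have "\<dots> = K\<^sup>2 * (\<Sum>z\<in>?Z. \<Sum>T | T \<in> Th \<and> z \<in> T. ?\<Gamma> T)"
    by (simp add: sum_distrib_left patch_energy_def)
  also have "(\<Sum>z\<in>?Z. \<Sum>T | T \<in> Th \<and> z \<in> T. ?\<Gamma> T) = (\<Sum>T\<in>Th. \<Sum>z | z \<in> ?Z \<and> z \<in> T. ?\<Gamma> T)"
    by (rule sum.swap_restrict[OF finZ fin])
  also have "\<dots> \<le> (\<Sum>T\<in>Th. 3 * ?\<Gamma> T)"
  proof (rule sum_mono)
    fix T assume T: "T \<in> Th"
    have "{z. z \<in> ?Z \<and> z \<in> T} \<subseteq> verts T" using vertex_shared[OF _ T] by blast
    then have "card {z. z \<in> ?Z \<and> z \<in> T} \<le> card (verts T)" using verts_card[OF T] by (intro card_mono) auto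
    then have "real (card {z. z \<in> ?Z \<and> z \<in> T}) \<le> 3" using verts_card[OF T] by linarith
    then show "(\<Sum>z | z \<in> ?Z \<and> z \<in> T. ?\<Gamma> T) \<le> 3 * ?\<Gamma> T" by (simp add: mult_right_mono)
  qed
  also have "(\<Sum>T\<in>Th. 3 * ?\<Gamma> T) = 3 * (\<Sum>T\<in>Th. ?\<Gamma> T)" by (simp add: sum_distrib_left)
  finally show ?thesis by (simp add: mult_left_mono)
qed

text \<open>The factors of \<open>local_interpolation\<close> once the vertex deviation is bounded
  by \<open>chain_const + K\<close> times the square root of the energy: \<open>const1\<close> for
  the function, \<open>const2\<close> for the gradient.\<close>

definition const1 :: real where "const1 = 10 + (chain_const + K)\<^sup>2"
definition const2 :: real where "const2 = 2 + K\<^sup>2 * (chain_const + K)\<^sup>2"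

text \<open>A vertex value is compared by \<open>nodal_bound\<close> with the mean over an edge of
  \<open>T\<close> at that vertex, and this mean with the one over \<open>e\<close> at the cost
  \<open>K\<close>. The sum is the deviation \<open>X\<close> of the local estimates; the trace
  inequality then carries the interpolation error to \<open>e\<close>.\<close>

lemma local_interpolation_bound:
  assumes f: "C1grad f df" and f0: "\<And>x. x \<notin> \<Omega> \<Longrightarrow> f x = 0"
    and T: "T \<in> Th" "e \<in> edges T" and cd: "\<And>z. z \<in> verts T \<Longrightarrow> c + d \<bullet> z = nodal f z"
  shows "sint T (\<lambda>x. (f x - (c + d \<bullet> x))\<^sup>2) \<le> (diameter T)\<^sup>2 * (const1 * tri_energy df T)"
    and "edge_int e (\<lambda>x. (f x - (c + d \<bullet> x))\<^sup>2) \<le> diameter T * (K\<^sup>2 * (3 * const1 + const2) * tri_energy df T)"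
proof -
  let ?h = "diameter T" and ?\<Gamma> = "sint T (\<lambda>x. (norm (df x))\<^sup>2)" and ?B = "tri_energy df T"
  obtain p q r where c: "cr (q - p) (r - p) \<noteq> 0" "T = convex hull {p,q,r}" "e = closed_segment q r"
    using tri_edge_obtain[OF tri[OF T(1)] T(2)] .
  interpret t: triangle p q r T "\<bar>cr (q - p) (r - p)\<bar>" ?h by (rule triangle_of[OF T(1) c(1,2)])
  let ?D = "\<bar>cr (q - p) (r - p)\<bar>"
  have verts: "verts T = {p,q,r}" using c verts_triangle by simp
  have ne: "p \<noteq> q" "q \<noteq> r" "p \<noteq> r" using c(1) by (auto simp: cr_def)
  have fv: "finite (verts T)" using verts by simp
  have em: "edge_mean e f = emean q r f" using c ne by (simp add: edge_mean_segment)
  have cc: "chain_const \<ge> 0" using K_pos by (simp add: chain_const_def)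
  have pB: "patch_energy df z \<le> ?B" if "z \<in> verts T" for z
    unfolding tri_energy_def by (intro member_le_sum that fv) (auto simp: patch_energy_nonneg)
  have B0: "?B \<ge> 0" unfolding tri_energy_def by (intro sum_nonneg) (simp add: patch_energy_nonneg)
  have GB: "?\<Gamma> \<le> ?B" using patch_energy_ge[OF T(1) t.verts_in(1), of df] pB[of p] verts by auto
  define X where "X = (chain_const + K) * sqrt ?B"
  have X: "\<bar>c + d \<bullet> z - emean q r f\<bar> \<le> X" if z: "z \<in> verts T" for z
  proof -
    obtain e' where e': "e' \<in> edges T" "z \<in> e'" using z verts edges_triangle[OF c(1)] c(2) by auto
    have "\<bar>nodal f z - edge_mean e' f\<bar> \<le> chain_const * sqrt (patch_energy df z)"
      by (rule nodal_bound[OF f f0 T(1) z e'])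
    also have "\<dots> \<le> chain_const * sqrt ?B" using cc pB[OF z] by (intro mult_left_mono) auto
    finally have 1: "\<bar>nodal f z - edge_mean e' f\<bar> \<le> chain_const * sqrt ?B" .
    have "\<bar>edge_mean e' f - edge_mean e f\<bar> \<le> K * sqrt ?\<Gamma>" by (rule edge_mean_diff_bound[OF f T(1) e'(1) T(2)])
    also have "\<dots> \<le> K * sqrt ?B" using GB K_pos by (intro mult_left_mono) auto
    finally have "\<bar>nodal f z - edge_mean e f\<bar> \<le> chain_const * sqrt ?B + K * sqrt ?B" using 1 by linarith
    then show ?thesis unfolding X_def cd[OF z] em by (simp add: distrib_right)
  qed
  have X2: "X\<^sup>2 = (chain_const + K)\<^sup>2 * ?B" using B0 by (simp add: X_def power_mult_distrib)
  obtain c0 \<rho> where ball: "\<rho> > 0" "cball c0 \<rho> \<subseteq> T" "?h \<le> K * \<rho>" using regular[OF T(1)] by blast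
  note loc = t.local_interpolation[OF f ball(2,3,1) X X X, unfolded verts, simplified]
  have "sint T (\<lambda>x. (f x - (c + d \<bullet> x))\<^sup>2) \<le> ?h\<^sup>2 * (10 * ?\<Gamma> + X\<^sup>2)" by (rule loc(1))
  also have "\<dots> \<le> ?h\<^sup>2 * (const1 * ?B)"
  proof (rule mult_left_mono)
    have "10 * ?\<Gamma> + X\<^sup>2 \<le> 10 * ?B + (chain_const + K)\<^sup>2 * ?B" unfolding X2 using GB by simp
    then show "10 * ?\<Gamma> + X\<^sup>2 \<le> const1 * ?B" by (simp add: const1_def distrib_right)
  qed simp
  finally show 1: "sint T (\<lambda>x. (f x - (c + d \<bullet> x))\<^sup>2) \<le> ?h\<^sup>2 * (const1 * ?B)" .
  have "sint T (\<lambda>x. (norm (df x - d))\<^sup>2) \<le> 2 * ?\<Gamma> + K\<^sup>2 * X\<^sup>2" by (rule loc(2))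
  also have "\<dots> \<le> 2 * ?B + K\<^sup>2 * ((chain_const + K)\<^sup>2 * ?B)" unfolding X2 using GB by simp
  also have "\<dots> = const2 * ?B" by (simp add: const2_def algebra_simps)
  finally have 2: "sint T (\<lambda>x. (norm (df x - d))\<^sup>2) \<le> const2 * ?B" .
  have w: "C1grad (\<lambda>x. f x - (c + d \<bullet> x)) (\<lambda>x. df x - d)" by (rule C1grad_diff[OF f C1grad_affine])
  let ?m = "emean q r (\<lambda>x. (f x - (c + d \<bullet> x))\<^sup>2)"
  have m0: "?m \<ge> 0" unfolding emean_def by simp
  have "?D * ?m \<le> 3 * sint T (\<lambda>x. (f x - (c + d \<bullet> x))\<^sup>2) + ?h\<^sup>2 * sint T (\<lambda>x. (norm (df x - d))\<^sup>2)"
    by (rule t.trace_inequality[OF w])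
  also have "\<dots> \<le> 3 * (?h\<^sup>2 * (const1 * ?B)) + ?h\<^sup>2 * (const2 * ?B)"
    using 1 2 by (intro add_mono mult_left_mono) auto
  also have "\<dots> = ?h\<^sup>2 * ((3 * const1 + const2) * ?B)" by (simp add: algebra_simps)
  also have "\<dots> \<le> (K\<^sup>2 * ?D) * ((3 * const1 + const2) * ?B)"
  proof (rule mult_right_mono)
    show "?h\<^sup>2 \<le> K\<^sup>2 * ?D" by (rule diameter_sq_le[OF T(1) c(1,2)])
    have "const1 \<ge> 0" "const2 \<ge> 0" by (auto simp: const1_def const2_def)
    then show "0 \<le> (3 * const1 + const2) * ?B" using B0 by simp
  qed
  finally have "?D * ?m \<le> ?D * (K\<^sup>2 * (3 * const1 + const2) * ?B)" by (simp add: mult_ac)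
  then have m: "?m \<le> K\<^sup>2 * (3 * const1 + const2) * ?B" using t.D_pos by (rule mult_left_le_imp_le)
  \<comment> \<open>The edge length, at most the diameter, supplies the single power of
    \<open>?h\<close> that matches the weight of the jump term.\<close>
  have "edge_int e (\<lambda>x. (f x - (c + d \<bullet> x))\<^sup>2) = dist q r * ?m" unfolding c(3) edge_int_segment[OF ne(2)] line_int_emean ..
  also have "\<dots> \<le> ?h * ?m" using t.h[OF t.verts_in(3,2)] m0 by (intro mult_right_mono) (auto simp: dist_norm)
  also have "\<dots> \<le> ?h * (K\<^sup>2 * (3 * const1 + const2) * ?B)" using m t.h_pos by (intro mult_left_mono) auto
  finally show "edge_int e (\<lambda>x. (f x - (c + d \<bullet> x))\<^sup>2) \<le> ?h * (K\<^sup>2 * (3 * const1 + const2) * ?B)" .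
qed

end

section \<open>The residual\<close>

lemma Cc1_C1grad: "Cc1 \<Omega> \<phi> d\<phi> \<Longrightarrow> C1grad \<phi> d\<phi>"
  by (auto simp: Cc1_def C1grad_def)

lemma Cc1_zero:
  assumes "Cc1 \<Omega> \<phi> d\<phi>" "x \<notin> \<Omega>" shows "\<phi> x = 0"
proof (rule ccontr)
  assume "\<phi> x \<noteq> 0"
  then have "x \<in> closure {x. \<phi> x \<noteq> 0}" using closure_subset[of "{x. \<phi> x \<noteq> 0}"] by auto
  then show False using assms by (auto simp: Cc1_def)
qed

lemma Cc1_diff:
  assumes "Cc1 \<Omega> \<phi> d\<phi>" "Cc1 \<Omega> \<psi> d\<psi>"
  shows "Cc1 \<Omega> (\<lambda>x. \<phi> x - \<psi> x) (\<lambda>x. d\<phi> x - d\<psi> x)"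
proof -
  let ?S = "{x. \<phi> x \<noteq> 0}" and ?S' = "{x. \<psi> x \<noteq> 0}"
  have C: "C1grad (\<lambda>x. \<phi> x - \<psi> x) (\<lambda>x. d\<phi> x - d\<psi> x)" by (intro C1grad_diff Cc1_C1grad[OF assms(1)] Cc1_C1grad[OF assms(2)])
  have "{x. \<phi> x - \<psi> x \<noteq> 0} \<subseteq> ?S \<union> ?S'" by auto
  then have sub: "closure {x. \<phi> x - \<psi> x \<noteq> 0} \<subseteq> closure ?S \<union> closure ?S'"
    unfolding closure_Un[symmetric] by (rule closure_mono)
  have "compact (closure ?S \<union> closure ?S')" using assms by (intro compact_Un) (auto simp: Cc1_def)
  then have "bounded (closure {x. \<phi> x - \<psi> x \<noteq> 0})" using bounded_subset[OF compact_imp_bounded sub] by blast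
  then have "compact (closure {x. \<phi> x - \<psi> x \<noteq> 0})" unfolding compact_eq_bounded_closed by simp
  moreover have "closure {x. \<phi> x - \<psi> x \<noteq> 0} \<subseteq> \<Omega>" using sub assms by (auto simp: Cc1_def)
  ultimately show ?thesis using C by (simp add: Cc1_def C1grad_def)
qed

text \<open>\<open>grad\<close> and \<open>lap\<close> are determined by the polynomial piece only
  inside a triangle and may be arbitrary on its frontier. The frontier is a null set, so the
  continuous \<open>F\<close> computes the integral.\<close>

lemma triangle_AE_integral:
  assumes T: "tri T" and F: "continuous_on T F" and eq: "\<And>x. x \<in> interior T \<Longrightarrow> f x = (F x :: real)"
  shows "integrable (lebesgue_on T) f" "sint T f = sint T F"
proof -
  have TL: "T \<in> sets lebesgue" using lmeasurable_compact[OF tri_compact[OF T]] by auto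
  have fr: "negligible (frontier T)" by (rule negligible_convex_frontier[OF tri_convex[OF T]])
  have frT: "frontier T \<subseteq> T" using tri_closed[OF T] by (simp add: frontier_subset_closed)
  have N: "frontier T \<in> null_sets (lebesgue_on T)"
    using fr frT TL by (subst null_sets_restrict_space) (simp_all add: negligible_iff_null_sets)
  have Fi: "integrable (lebesgue_on T) F" by (rule integrable_on_compact[OF tri_compact[OF T] F])
  have int: "T - frontier T = interior T"
    using tri_closed[OF T] interior_subset[of T] by (auto simp: frontier_def closure_closed)
  have "F \<in> borel_measurable (lebesgue_on (T - frontier T))"
    by (rule measurable_restrict_mono[OF borel_measurable_integrable[OF Fi]]) auto
  then have "f \<in> borel_measurable (lebesgue_on (T - frontier T))"
    by (rule measurable_cong[THEN iffD1, rotated]) (use eq int in auto)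
  then have fm: "f \<in> borel_measurable (lebesgue_on T)"
    using borel_measurable_diff_null[OF N TL, of f] by blast
  have "AE x in lebesgue_on T. x \<in> T - frontier T" by (rule AE_lebesgue_on_negligible[OF fr TL])
  then have AE: "AE x in lebesgue_on T. f x = F x" by (rule AE_mp) (use eq int in auto)
  show "integrable (lebesgue_on T) f" using integrable_cong_AE[OF fm borel_measurable_integrable[OF Fi] AE] Fi by simp
  show "sint T f = sint T F" by (rule integral_cong_AE[OF fm borel_measurable_integrable[OF Fi] AE])
qed

lemma edge_int_cong:
  assumes "e = closed_segment v w" "v \<noteq> w" "\<And>x. x \<in> e \<Longrightarrow> f x = g x"
  shows "edge_int e f = edge_int e g"
  unfolding assms(1) edge_int_segment[OF assms(2)] by (rule line_int_cong) (use assms in auto)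

section \<open>Square integrable functions on segments and Young's inequality\<close>

lemma L2_seg_cont:
  assumes "continuous_on (closed_segment v w) f" shows "L2_seg v w f"
proof -
  have "v + t *\<^sub>R (w - v) \<in> closed_segment v w" if "t \<in> {0..1}" for t
    unfolding in_segment using that by (intro exI[of _ t]) (auto simp: algebra_simps)
  then have c: "continuous_on {0..1} (\<lambda>t. f (v + t *\<^sub>R (w - v)))"
    by (intro continuous_on_compose2[OF assms] continuous_intros) auto
  have "integrable (lebesgue_on {0..1}) (\<lambda>t. f (v + t *\<^sub>R (w - v)))" by (intro integrable_on_compact c) auto
  moreover have "integrable (lebesgue_on {0..1}) (\<lambda>t. (f (v + t *\<^sub>R (w - v)))\<^sup>2)" by (intro integrable_on_compact continuous_intros c) auto
  ultimately show ?thesis by (auto simp: L2_seg_def)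
qed

lemma L2_seg_mult:
  assumes "L2_seg v w f" "L2_seg v w g"
  shows "integrable (lebesgue_on {0..1}) (\<lambda>t. f (v + t *\<^sub>R (w - v)) * g (v + t *\<^sub>R (w - v)))"
  using assms unfolding L2_seg_def by (intro integrable_mult_L2) auto

lemma L2_seg_diff:
  assumes "L2_seg v w f" "L2_seg v w g" shows "L2_seg v w (\<lambda>x. f x - g x)"
proof -
  let ?f = "\<lambda>t. f (v + t *\<^sub>R (w - v))" and ?g = "\<lambda>t. g (v + t *\<^sub>R (w - v))"
  have m: "?f \<in> borel_measurable (lebesgue_on {0..1})" "?g \<in> borel_measurable (lebesgue_on {0..1})"
    and i: "integrable (lebesgue_on {0..1}) (\<lambda>t. (?f t)\<^sup>2)" "integrable (lebesgue_on {0..1}) (\<lambda>t. (?g t)\<^sup>2)"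
    using assms by (auto simp: L2_seg_def)
  have "integrable (lebesgue_on {0..1}) (\<lambda>t. (?f t)\<^sup>2 - 2 * (?f t * ?g t) + (?g t)\<^sup>2)"
    using i L2_seg_mult[OF assms] by simp
  then have "integrable (lebesgue_on {0..1}) (\<lambda>t. (?f t - ?g t)\<^sup>2)" by (simp add: power2_diff mult.assoc add_diff_eq diff_add_eq)
  then show ?thesis using m by (simp add: L2_seg_def)
qed

lemma L2_seg_sum:
  assumes "finite I" "\<And>l. l \<in> I \<Longrightarrow> L2_seg v w (f l)" shows "L2_seg v w (\<lambda>x. \<Sum>l\<in>I. f l x)"
  using assms
proof (induction I rule: finite_induct)
  case empty
  show ?case by (simp add: L2_seg_def)
next
  case (insert l I)
  have "L2_seg v w (\<lambda>x. 0 - f l x)"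
    by (rule L2_seg_diff) (use insert in \<open>auto simp: L2_seg_def\<close>)
  from L2_seg_diff[OF insert.IH this] insert show ?case by (simp add: add.commute)
qed

text \<open>Integrates the expansion of \<open>(t * f x - g x)\<^sup>2 / (2 * t)\<close>, which is
  nonnegative. The weight \<open>t\<close> will be a constant times the diameter.\<close>

lemma line_int_young:
  assumes f: "L2_seg v w f" and g: "L2_seg v w g" and t: "t > 0"
  shows "line_int v w (\<lambda>x. f x * g x) \<le> (t * line_int v w (\<lambda>x. (f x)\<^sup>2) + line_int v w (\<lambda>x. (g x)\<^sup>2) / t) / 2"
proof -
  let ?M = "lebesgue_on {0..1::real}"
  let ?f = "\<lambda>s. f (v + s *\<^sub>R (w - v))" and ?g = "\<lambda>s. g (v + s *\<^sub>R (w - v))"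
  have i: "integrable ?M (\<lambda>s. (?f s)\<^sup>2)" "integrable ?M (\<lambda>s. (?g s)\<^sup>2)" using f g by (auto simp: L2_seg_def)
  have "integral\<^sup>L ?M (\<lambda>s. ?f s * ?g s) \<le> integral\<^sup>L ?M (\<lambda>s. (t/2) * (?f s)\<^sup>2 + (1 / (2 * t)) * (?g s)\<^sup>2)"
  proof (rule integral_mono[OF L2_seg_mult[OF f g]])
    fix s
    have "0 \<le> (t * ?f s - ?g s)\<^sup>2 / (2 * t)" using t by simp
    also have "\<dots> = (t/2) * (?f s)\<^sup>2 + (1 / (2 * t)) * (?g s)\<^sup>2 - ?f s * ?g s"
      using t by (simp add: power2_eq_square field_simps)
    finally show "?f s * ?g s \<le> (t/2) * (?f s)\<^sup>2 + (1 / (2 * t)) * (?g s)\<^sup>2" by simp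
  qed (use i in auto)
  also have "\<dots> = (t/2) * integral\<^sup>L ?M (\<lambda>s. (?f s)\<^sup>2) + (1 / (2 * t)) * integral\<^sup>L ?M (\<lambda>s. (?g s)\<^sup>2)"
    using i by simp
  finally have "dist v w * integral\<^sup>L ?M (\<lambda>s. ?f s * ?g s) \<le> dist v w * ((t/2) * integral\<^sup>L ?M (\<lambda>s. (?f s)\<^sup>2) + (1 / (2 * t)) * integral\<^sup>L ?M (\<lambda>s. (?g s)\<^sup>2))"
    by (intro mult_left_mono) auto
  then show ?thesis using t by (simp add: line_int_def field_simps)
qed

lemma sint_young:
  assumes S: "compact S" and f: "continuous_on S f" and g: "continuous_on S g" and t: "t > 0"
  shows "sint S (\<lambda>x. f x * g x) \<le> (t * sint S (\<lambda>x. (f x)\<^sup>2) + sint S (\<lambda>x. (g x)\<^sup>2) / t) / 2"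
proof -
  have "sint S (\<lambda>x. f x * g x) \<le> sint S (\<lambda>x. (t/2) * (f x)\<^sup>2 + (1 / (2 * t)) * (g x)\<^sup>2)"
  proof (intro sint_mono S continuous_intros f g)
    fix x
    have "0 \<le> (t * f x - g x)\<^sup>2 / (2 * t)" using t by simp
    also have "\<dots> = (t/2) * (f x)\<^sup>2 + (1 / (2 * t)) * (g x)\<^sup>2 - f x * g x"
      using t by (simp add: power2_eq_square field_simps)
    finally show "f x * g x \<le> (t/2) * (f x)\<^sup>2 + (1 / (2 * t)) * (g x)\<^sup>2" by simp
  qed
  also have "\<dots> = sint S (\<lambda>x. (t/2) * (f x)\<^sup>2) + sint S (\<lambda>x. (1 / (2 * t)) * (g x)\<^sup>2)"
    by (intro Bochner_Integration.integral_add integrable_on_compact S continuous_intros f g)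
  finally show ?thesis using t by (simp add: field_simps)
qed

lemma continuous_segment_zero:
  assumes f: "continuous_on UNIV f" and 0: "emean v w (\<lambda>x. (f x)\<^sup>2) = 0" and x: "x \<in> closed_segment v w"
  shows "f x = 0"
proof -
  let ?g = "\<lambda>t. (f (v + t *\<^sub>R (w - v)))\<^sup>2"
  have c: "continuous_on {0..1} ?g" by (intro continuous_intros continuous_on_compose2[OF f]) auto
  have "integral\<^sup>L (lebesgue_on {0..1}) ?g = integral {0..1} ?g"
    by (rule lebesgue_integral_eq_integral) (auto intro: integrable_on_compact c)
  then have "integral {0..1} ?g = 0" using 0 by (simp add: emean_def)
  then have z: "\<forall>t\<in>{0..1}. ?g t = 0" using integral_eq_0_iff[OF c] by simp
  obtain t where t: "0 \<le> t" "t \<le> 1" "x = (1 - t) *\<^sub>R v + t *\<^sub>R w" using x by (auto simp: in_segment)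
  have "x = v + t *\<^sub>R (w - v)" unfolding t(3) by (simp add: algebra_simps)
  then show ?thesis using z t by auto
qed

lemma norm_sum_sq: "(norm (x + y))\<^sup>2 \<le> 2 * (norm x)\<^sup>2 + 2 * (norm (y::'a::real_normed_vector))\<^sup>2"
proof -
  have "(norm (x + y))\<^sup>2 \<le> (norm x + norm y)\<^sup>2" by (intro power_mono norm_triangle_ineq) auto
  also have "\<dots> \<le> 2 * (norm x)\<^sup>2 + 2 * (norm y)\<^sup>2"
    using zero_le_power2[of "norm x - norm y"] by (simp add: power2_eq_square algebra_simps)
  finally show ?thesis .
qed

lemma L2_norm_diff_integrable:
  fixes V W :: "'a \<Rightarrow> 'b::euclidean_space"
  assumes [measurable]: "V \<in> borel_measurable M" "W \<in> borel_measurable M"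
    and i: "integrable M (\<lambda>x. (norm (V x))\<^sup>2)" "integrable M (\<lambda>x. (norm (W x))\<^sup>2)"
  shows "integrable M (\<lambda>x. (norm (V x - W x))\<^sup>2)"
    and "integral\<^sup>L M (\<lambda>x. (norm (V x - W x))\<^sup>2) \<le> 2 * integral\<^sup>L M (\<lambda>x. (norm (V x))\<^sup>2) + 2 * integral\<^sup>L M (\<lambda>x. (norm (W x))\<^sup>2)"
proof -
  have b: "(norm (V x - W x))\<^sup>2 \<le> 2 * (norm (V x))\<^sup>2 + 2 * (norm (W x))\<^sup>2" for x
    using norm_sum_sq[of "V x" "- W x"] by simp
  have i2: "integrable M (\<lambda>x. 2 * (norm (V x))\<^sup>2 + 2 * (norm (W x))\<^sup>2)" using i by simp
  show i3: "integrable M (\<lambda>x. (norm (V x - W x))\<^sup>2)"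
  proof (rule Bochner_Integration.integrable_bound[OF i2])
    show "AE x in M. norm ((norm (V x - W x))\<^sup>2) \<le> norm (2 * (norm (V x))\<^sup>2 + 2 * (norm (W x))\<^sup>2)"
      using b by (intro AE_I2) auto
  qed measurable
  have "integral\<^sup>L M (\<lambda>x. (norm (V x - W x))\<^sup>2) \<le> integral\<^sup>L M (\<lambda>x. 2 * (norm (V x))\<^sup>2 + 2 * (norm (W x))\<^sup>2)"
    by (rule integral_mono[OF i3 i2 b])
  then show "integral\<^sup>L M (\<lambda>x. (norm (V x - W x))\<^sup>2) \<le> 2 * integral\<^sup>L M (\<lambda>x. (norm (V x))\<^sup>2) + 2 * integral\<^sup>L M (\<lambda>x. (norm (W x))\<^sup>2)"
    using i by simp
qed

context regular_mesh
begin

lemma sint_T_le_Om: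
  assumes "T \<in> Th" "\<And>T. T \<in> Th \<Longrightarrow> continuous_on T f" "\<And>x. f x \<ge> 0"
  shows "sint T f \<le> sint \<Omega> f"
proof -
  have "sint \<Omega> f = (\<Sum>T\<in>Th. sint T f)"
    by (rule sint_mesh(2)) (intro integrable_on_compact T_sets assms)
  moreover have "sint T f \<le> (\<Sum>T\<in>Th. sint T f)" using fin assms by (intro member_le_sum) auto
  ultimately show ?thesis by simp
qed

text \<open>
  The approximating test functions vanish on a boundary edge, and the trace inequality transfers
  their \<open>L\<^sup>2\<close>-convergence on \<open>T\<close> to the edge as long as the gradients stay bounded.
\<close>
lemma trace_zero:
  assumes H: "H10 \<Omega> v G" and P: "\<And>T. T \<in> Th \<Longrightarrow> C1grad (P T) (dP T)" "\<And>T x. T \<in> Th \<Longrightarrow> x \<in> T \<Longrightarrow> v x = P T x"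
    and T: "T \<in> Th" "e \<in> edges T" "e \<notin> interior_edges Th" "x \<in> e"
  shows "v x = 0"
proof -
  obtain \<phi> d\<phi> where \<phi>: "\<And>n. Cc1 \<Omega> (\<phi> n) (d\<phi> n)"
    "(\<lambda>n. sint \<Omega> (\<lambda>x. (\<phi> n x - v x)\<^sup>2)) \<longlonglongrightarrow> 0"
    "(\<lambda>n. sint \<Omega> (\<lambda>x. (norm (d\<phi> n x - G x))\<^sup>2)) \<longlonglongrightarrow> 0"
    and G: "G \<in> borel_measurable (lebesgue_on \<Omega>)" "integrable (lebesgue_on \<Omega>) (\<lambda>x. (norm (G x))\<^sup>2)"
    using H unfolding H10_def by blast
  note C = Cc1_C1grad[OF \<phi>(1)]
  have vc: "continuous_on T v" if "T \<in> Th" for T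
    using C1grad_cont[OF P(1)[OF that]] by (rule continuous_on_eq) (use P(2)[OF that] in auto)
  have Oms: "\<Omega> \<in> sets lebesgue" using open_Om by auto
  obtain p q r where c: "cr (q - p) (r - p) \<noteq> 0" "T = convex hull {p,q,r}" "e = closed_segment q r"
    using tri_edge_obtain[OF tri[OF T(1)] T(2)] .
  interpret t: triangle p q r T "\<bar>cr (q - p) (r - p)\<bar>" "diameter T" by (rule triangle_of[OF T(1) c(1,2)])
  let ?D = "\<bar>cr (q - p) (r - p)\<bar>" and ?h = "diameter T"
  define A where "A n = sint T (\<lambda>x. (\<phi> n x - P T x)\<^sup>2)" for n
  have A0: "A n \<ge> 0" for n unfolding A_def by simp
  have Ale: "A n \<le> sint \<Omega> (\<lambda>x. (\<phi> n x - v x)\<^sup>2)" for n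
  proof -
    have "A n = sint T (\<lambda>x. (\<phi> n x - v x)\<^sup>2)"
      unfolding A_def using P(2)[OF T(1)] by (intro Bochner_Integration.integral_cong) auto
    also have "\<dots> \<le> sint \<Omega> (\<lambda>x. (\<phi> n x - v x)\<^sup>2)"
      by (rule sint_T_le_Om[OF T(1)]) (auto intro!: continuous_intros C1grad_cont[OF C] vc)
    finally show ?thesis .
  qed
  have Alim: "A \<longlonglongrightarrow> 0" using A0 Ale by (intro tendsto_sandwich[OF _ _ tendsto_const \<phi>(2)]) auto
  obtain B where B: "\<And>n. sint \<Omega> (\<lambda>x. (norm (d\<phi> n x - G x))\<^sup>2) \<le> B"
    using convergent_imp_Bseq[OF convergentI[OF \<phi>(3)]] by (auto simp: Bseq_def)
  define M where "M = 2 * (2 * B + 2 * sint \<Omega> (\<lambda>x. (norm (G x))\<^sup>2)) + 2 * sint T (\<lambda>x. (norm (dP T x))\<^sup>2)"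
  have dphiO: "integrable (lebesgue_on \<Omega>) (\<lambda>x. (norm (d\<phi> n x))\<^sup>2)" "d\<phi> n \<in> borel_measurable (lebesgue_on \<Omega>)" for n
  proof -
    show "integrable (lebesgue_on \<Omega>) (\<lambda>x. (norm (d\<phi> n x))\<^sup>2)"
      by (rule sint_mesh(1)) (intro integrable_on_compact T_sets continuous_intros C1grad_grad_cont[OF C])
    show "d\<phi> n \<in> borel_measurable (lebesgue_on \<Omega>)"
      by (intro continuous_imp_measurable_on_sets_lebesgue C1grad_grad_cont[OF C] Oms)
  qed
  have Mb: "sint T (\<lambda>x. (norm (d\<phi> n x - dP T x))\<^sup>2) \<le> M" for n
  proof -
    have m: "d\<phi> n \<in> borel_measurable (lebesgue_on T)" "dP T \<in> borel_measurable (lebesgue_on T)"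
      by (intro continuous_imp_measurable_on_sets_lebesgue C1grad_grad_cont[OF C] C1grad_grad_cont[OF P(1)[OF T(1)]] T_sets(1)[OF T(1)])+
    have i: "integrable (lebesgue_on T) (\<lambda>x. (norm (d\<phi> n x))\<^sup>2)" "integrable (lebesgue_on T) (\<lambda>x. (norm (dP T x))\<^sup>2)"
      by (intro integrable_on_compact T_sets(2)[OF T(1)] continuous_intros C1grad_grad_cont[OF C] C1grad_grad_cont[OF P(1)[OF T(1)]])+
    have 1: "sint T (\<lambda>x. (norm (d\<phi> n x - dP T x))\<^sup>2) \<le> 2 * sint T (\<lambda>x. (norm (d\<phi> n x))\<^sup>2) + 2 * sint T (\<lambda>x. (norm (dP T x))\<^sup>2)"
      by (rule L2_norm_diff_integrable(2)[OF m i])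
    have 2: "sint T (\<lambda>x. (norm (d\<phi> n x))\<^sup>2) \<le> sint \<Omega> (\<lambda>x. (norm (d\<phi> n x))\<^sup>2)"
      by (rule sint_T_le_Om[OF T(1)]) (auto intro!: continuous_intros C1grad_grad_cont[OF C])
    have dG: "integrable (lebesgue_on \<Omega>) (\<lambda>x. (norm (d\<phi> n x - G x))\<^sup>2)"
      by (rule L2_norm_diff_integrable(1)[OF dphiO(2) G(1) dphiO(1) G(2)])
    have nG: "(\<lambda>x. - G x) \<in> borel_measurable (lebesgue_on \<Omega>)" "(\<lambda>x. d\<phi> n x - G x) \<in> borel_measurable (lebesgue_on \<Omega>)"
      using G(1) dphiO(2)[of n] by measurable
    have 3: "sint \<Omega> (\<lambda>x. (norm (d\<phi> n x))\<^sup>2) \<le> 2 * sint \<Omega> (\<lambda>x. (norm (d\<phi> n x - G x))\<^sup>2) + 2 * sint \<Omega> (\<lambda>x. (norm (G x))\<^sup>2)"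
      using L2_norm_diff_integrable(2)[OF nG(2,1) dG] G(2) by simp
    have lin: "a \<le> 2 * (2 * B' + 2 * g) + 2 * x" if "a \<le> 2 * b + 2 * x" "b \<le> c" "c \<le> 2 * d + 2 * g" "d \<le> B'"
      for a b c d x g B' :: real using that by argo
    show ?thesis unfolding M_def by (rule lin[OF 1 2 3 B])
  qed
  have e0: "e \<inter> \<Omega> = {}" by (rule boundary_edge_disjoint[OF T(1-3)])
  have key: "?D * emean q r (\<lambda>x. (P T x)\<^sup>2) \<le> 2 * A n + 2 * ?h * (sqrt (A n) * sqrt M)" for n
  proof -
    \<comment> \<open>On a boundary edge the test function vanishes, so the edge integral of the
      square of \<open>P T\<close> is that of the difference, to which the trace inequality
      applies.\<close>
    have "line_int q r (\<lambda>x. (P T x)\<^sup>2) = line_int q r (\<lambda>x. (\<phi> n x - P T x)\<^sup>2)"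
    proof (rule line_int_cong)
      fix y assume "y \<in> closed_segment q r"
      then have "y \<notin> \<Omega>" using e0 c by auto
      then show "(P T y)\<^sup>2 = (\<phi> n y - P T y)\<^sup>2" using Cc1_zero[OF \<phi>(1)] by simp
    qed
    moreover have "q \<noteq> r" using c(1) by (auto simp: cr_def)
    ultimately have "emean q r (\<lambda>x. (P T x)\<^sup>2) = emean q r (\<lambda>x. (\<phi> n x - P T x)\<^sup>2)" by (simp add: line_int_emean)
    moreover have "?D * emean q r (\<lambda>x. (\<phi> n x - P T x)\<^sup>2) \<le> 2 * A n
       + 2 * ?h * (sqrt (A n) * sqrt (sint T (\<lambda>x. (norm (d\<phi> n x - dP T x))\<^sup>2)))"
      unfolding A_def by (rule t.trace_inequality_product[OF C1grad_diff[OF C P(1)[OF T(1)]]])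
    moreover have "2 * ?h * (sqrt (A n) * sqrt (sint T (\<lambda>x. (norm (d\<phi> n x - dP T x))\<^sup>2))) \<le> 2 * ?h * (sqrt (A n) * sqrt M)"
      using Mb[of n] A0[of n] t.h_pos by (intro mult_left_mono) auto
    ultimately show ?thesis by simp
  qed
  have "(\<lambda>n. 2 * A n + 2 * ?h * (sqrt (A n) * sqrt M)) \<longlonglongrightarrow> 2 * 0 + 2 * ?h * (sqrt 0 * sqrt M)"
    by (intro tendsto_intros Alim)
  then have "?D * emean q r (\<lambda>x. (P T x)\<^sup>2) \<le> 2 * 0 + 2 * ?h * (sqrt 0 * sqrt M)"
    by (rule LIMSEQ_le_const) (use key in auto)
  then have "emean q r (\<lambda>x. (P T x)\<^sup>2) \<le> 0" using t.D_pos by (simp add: mult_le_0_iff)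
  moreover have "emean q r (\<lambda>x. (P T x)\<^sup>2) \<ge> 0" unfolding emean_def by simp
  ultimately have "emean q r (\<lambda>x. (P T x)\<^sup>2) = 0" by simp
  then have "P T x = 0" using continuous_segment_zero[OF C1grad_cont[OF P(1)[OF T(1)]]] T(4) c(3) by blast
  then show ?thesis using P(2)[OF T(1)] edge_subset[OF T(1,2)] T(4) by auto
qed

end

lemma L2_seg_add:
  assumes "L2_seg v w f" "L2_seg v w g" shows "L2_seg v w (\<lambda>x. f x + g x)"
proof -
  have "L2_seg v w (\<lambda>x. 0 - g x)" by (rule L2_seg_diff[OF _ assms(2)]) (simp add: L2_seg_def)
  from L2_seg_diff[OF assms(1) this] show ?thesis by simp
qed

lemma line_int_mult_diff:
  assumes "L2_seg v w f" "L2_seg v w g" "L2_seg v w h"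
  shows "line_int v w (\<lambda>x. (f x - g x) * h x) = line_int v w (\<lambda>x. f x * h x) - line_int v w (\<lambda>x. g x * h x)"
  unfolding line_int_def using L2_seg_mult[OF assms(1,3)] L2_seg_mult[OF assms(2,3)]
  by (simp add: left_diff_distrib right_diff_distrib)

lemma line_int_mult_add:
  assumes "L2_seg v w f" "L2_seg v w g" "L2_seg v w h"
  shows "line_int v w (\<lambda>x. (f x + g x) * h x) = line_int v w (\<lambda>x. f x * h x) + line_int v w (\<lambda>x. g x * h x)"
  unfolding line_int_def using L2_seg_mult[OF assms(1,3)] L2_seg_mult[OF assms(2,3)]
  by (simp add: distrib_right distrib_left)

lemma line_int_mult_sum:
  assumes "finite I" "\<And>l. l \<in> I \<Longrightarrow> L2_seg v w (f l)" "L2_seg v w h"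
  shows "line_int v w (\<lambda>x. (\<Sum>l\<in>I. f l x) * h x) = (\<Sum>l\<in>I. line_int v w (\<lambda>x. f l x * h x))"
  using assms(1,2)
proof (induction I rule: finite_induct)
  case empty show ?case by (simp add: line_int_def)
next
  case (insert l I)
  have "line_int v w (\<lambda>x. (f l x + (\<Sum>l\<in>I. f l x)) * h x) = line_int v w (\<lambda>x. f l x * h x) + line_int v w (\<lambda>x. (\<Sum>l\<in>I. f l x) * h x)"
  proof (rule line_int_mult_add[OF _ _ assms(3)])
    show "L2_seg v w (f l)" "L2_seg v w (\<lambda>x. \<Sum>l\<in>I. f l x)" using insert by (auto intro!: L2_seg_sum)
  qed
  then show ?case using insert by simp
qed

context regular_mesh
begin

lemma green_edges:
  assumes T: "T \<in> Th" and w: "C1grad w dw" and P: "C2grad P G A1 A2"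
  shows "sint T (\<lambda>x. G x \<bullet> dw x) = (\<Sum>e\<in>edges T. edge_int e (\<lambda>x. (outward_normal T e \<bullet> G x) * w x))
      - sint T (\<lambda>x. (A1 x $ 1 + A2 x $ 2) * w x)"
proof -
  obtain p q r where c: "cr (q - p) (r - p) \<noteq> 0" and Tq: "T = convex hull {p,q,r}" using tri[OF T] by (auto simp: tri_cr)
  have ne: "p \<noteq> q" "q \<noteq> r" "r \<noteq> p" using c by (auto simp: cr_def)
  have T2: "T = convex hull {q,r,p}" "T = convex hull {r,p,q}" using Tq by (simp_all add: insert_commute)
  note cy = cr_cyclic_nz[OF c]
  have n: "is_normal (outward_normal T (closed_segment q r)) p q r" "is_normal (outward_normal T (closed_segment r p)) q r p"
    "is_normal (outward_normal T (closed_segment p q)) r p q"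
    using outward_normal_is_normal[OF c] outward_normal_is_normal[OF cy(1)] outward_normal_is_normal[OF cy(2)] unfolding Tq[symmetric] T2[symmetric] by auto
  have GC: "C1grad (\<lambda>x. G x $ 1) A1" "C1grad (\<lambda>x. G x $ 2) A2" using P by (auto simp: C2grad_def)
  have d: "closed_segment q r \<noteq> closed_segment r p" "closed_segment q r \<noteq> closed_segment p q" "closed_segment r p \<noteq> closed_segment p q"
    using closed_segment_endpoints ne by (metis doubleton_eq_iff)+
  have "edges T = {closed_segment q r, closed_segment r p, closed_segment p q}" using edges_triangle[OF c] Tq by simp
  then have "(\<Sum>e\<in>edges T. edge_int e (\<lambda>x. (outward_normal T e \<bullet> G x) * w x))
     = line_int q r (\<lambda>x. (outward_normal T (closed_segment q r) \<bullet> G x) * w x)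
      + line_int r p (\<lambda>x. (outward_normal T (closed_segment r p) \<bullet> G x) * w x)
      + line_int p q (\<lambda>x. (outward_normal T (closed_segment p q) \<bullet> G x) * w x)"
    using d ne by (simp add: edge_int_segment)
  then show ?thesis using triangle_green[OF w GC c n] unfolding Tq[symmetric] by simp
qed

definition edge_const :: real where "edge_const = K\<^sup>2 * (3 * const1 + const2)"
text \<open>Each triangle contributes one volume term and at most three edge terms of weight 1/2,
  and \<open>3 * K\<^sup>2\<close> is the overlap factor of \<open>sum_tri_energy\<close>. With this
  weight in Young's inequality exactly half of the gradient energy of the test function
  remains.\<close>

definition rel_const :: real where "rel_const = 3 * K\<^sup>2 * (const1 + 3 / 2 * edge_const)"

lemma rel_const_pos: "rel_const > 0" and edge_const_nonneg: "edge_const \<ge> 0" and const1_pos: "const1 > 0"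
proof -
  show c1: "const1 > 0" unfolding const1_def by (simp add: add_pos_nonneg)
  have c2: "const2 > 0" unfolding const2_def by (simp add: add_pos_nonneg)
  show e: "edge_const \<ge> 0" using c1 c2 by (simp add: edge_const_def)
  show "rel_const > 0" unfolding rel_const_def using K_pos c1 e by (intro mult_pos_pos add_pos_nonneg) auto
qed

text \<open>Regrouped by edges, every edge collects all source segments containing it, which is the
  sum \<open>src_f\<close>; overlapping segments are thereby included.\<close>

lemma line_part:
  assumes seg: "\<And>l. l < N \<Longrightarrow> a l \<noteq> b l" and L2: "\<And>l. l < N \<Longrightarrow> L2_seg (a l) (b l) (g l)"
    and conf: "\<And>l. l < N \<Longrightarrow> \<exists>E \<subseteq> interior_edges Th. closed_segment (a l) (b l) = \<Union>E"
    and \<psi>: "\<And>l. l < N \<Longrightarrow> continuous_on (closed_segment (a l) (b l)) \<psi>"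
    and \<psi>e: "\<And>e. e \<in> interior_edges Th \<Longrightarrow> continuous_on e \<psi>"
  shows "(\<Sum>l<N. line_int (a l) (b l) (\<lambda>x. g l x * \<psi> x)) = (\<Sum>e\<in>interior_edges Th. edge_int e (\<lambda>x. src_f N a b g e x * \<psi> x))"
proof -
  have "(\<Sum>l<N. line_int (a l) (b l) (\<lambda>x. g l x * \<psi> x))
     = (\<Sum>l<N. \<Sum>e | e \<in> interior_edges Th \<and> e \<subseteq> closed_segment (a l) (b l). edge_int e (\<lambda>x. g l x * \<psi> x))"
  proof (rule sum.cong[OF refl])
    fix l assume "l \<in> {..<N}"
    then have l: "l < N" by simp
    obtain E where E: "E \<subseteq> interior_edges Th" "closed_segment (a l) (b l) = \<Union>E" using conf[OF l] by blast
    show "line_int (a l) (b l) (\<lambda>x. g l x * \<psi> x) = (\<Sum>e | e \<in> interior_edges Th \<and> e \<subseteq> closed_segment (a l) (b l). edge_int e (\<lambda>x. g l x * \<psi> x))"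
      by (rule line_int_split[OF seg[OF l] E L2_seg_mult[OF L2[OF l] L2_seg_cont[OF \<psi>[OF l]]]])
  qed
  also have "\<dots> = (\<Sum>e\<in>interior_edges Th. \<Sum>l | l \<in> {..<N} \<and> e \<subseteq> closed_segment (a l) (b l). edge_int e (\<lambda>x. g l x * \<psi> x))"
    by (rule sum.swap_restrict[OF finite_lessThan interior_edges_finite])
  also have "\<dots> = (\<Sum>e\<in>interior_edges Th. edge_int e (\<lambda>x. src_f N a b g e x * \<psi> x))"
  proof (rule sum.cong[OF refl])
    fix e assume e: "e \<in> interior_edges Th"
    obtain v w where vw: "e = closed_segment v w" "v \<noteq> w" using interior_edge_segment[OF e] .
    have "L2_seg v w (g l)" if "l \<in> {l. l < N \<and> e \<subseteq> closed_segment (a l) (b l)}" for l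
      using L2_subsegment[OF L2 seg vw(2)] that vw(1) by auto
    moreover have "L2_seg v w \<psi>" using L2_seg_cont \<psi>e[OF e] vw(1) by simp
    ultimately have "line_int v w (\<lambda>x. (\<Sum>l | l < N \<and> e \<subseteq> closed_segment (a l) (b l). g l x) * \<psi> x)
      = (\<Sum>l | l < N \<and> e \<subseteq> closed_segment (a l) (b l). line_int v w (\<lambda>x. g l x * \<psi> x))"
      by (intro line_int_mult_sum) auto
    then show "(\<Sum>l | l \<in> {..<N} \<and> e \<subseteq> closed_segment (a l) (b l). edge_int e (\<lambda>x. g l x * \<psi> x)) = edge_int e (\<lambda>x. src_f N a b g e x * \<psi> x)"
      unfolding src_f_def using vw by (simp add: edge_int_segment)
  qed
  finally show ?thesis .
qed

text \<open>Half of the energy stands on the right instead of a product of norms, so every triangle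
  and every edge can be estimated with its own weight and the bounds are simply added.\<close>

lemma residual_bound:
  assumes seg: "\<And>l. l < N \<Longrightarrow> a l \<noteq> b l" and sub: "\<And>l. l < N \<Longrightarrow> closed_segment (a l) (b l) \<subseteq> \<Omega>"
    and L2: "\<And>l. l < N \<Longrightarrow> L2_seg (a l) (b l) (g l)"
    and conf: "\<And>l. l < N \<Longrightarrow> \<exists>E \<subseteq> interior_edges Th. closed_segment (a l) (b l) = \<Union>E"
    and k: "k \<ge> 1" and P: "\<And>T. T \<in> Th \<Longrightarrow> C2grad (P T) (G T) (A1 T) (A2 T)"
    and uP: "\<And>T x. T \<in> Th \<Longrightarrow> x \<in> T \<Longrightarrow> uh x = P T x"
    and gal: "\<And>vh. vh \<in> fe_space \<Omega> Th k \<Longrightarrow> sint \<Omega> (\<lambda>x. grad uh x \<bullet> grad vh x) = (\<Sum>l<N. line_int (a l) (b l) (\<lambda>x. g l x * vh x))"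
    and \<phi>: "Cc1 \<Omega> \<phi> d\<phi>"
  shows "(\<Sum>l<N. line_int (a l) (b l) (\<lambda>x. g l x * \<phi> x)) - sint \<Omega> (\<lambda>x. grad uh x \<bullet> d\<phi> x)
     \<le> (rel_const * (\<Sum>T\<in>Th. eta_T_sq Th N a b g uh T) + sint \<Omega> (\<lambda>x. (norm (d\<phi> x))\<^sup>2)) / 2"
proof -
  note \<phi>C = Cc1_C1grad[OF \<phi>] and \<phi>0 = Cc1_zero[OF \<phi>]
  have PC: "C1grad (P T) (G T)" if "T \<in> Th" for T using P[OF that] by (simp add: C2grad_def)
  have n0: "nodal \<phi> z = 0" if "z \<notin> \<Omega>" for z using that by (simp add: nodal_def)
  obtain vh c d where vh: "vh \<in> fe_space \<Omega> Th k" and vhT: "\<And>T x. T \<in> Th \<Longrightarrow> x \<in> T \<Longrightarrow> vh x = c T + d T \<bullet> x"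
    and cd: "\<And>T z. T \<in> Th \<Longrightarrow> z \<in> verts T \<Longrightarrow> c T + d T \<bullet> z = nodal \<phi> z"
    and vh0: "\<And>T e x. T \<in> Th \<Longrightarrow> e \<in> edges T \<Longrightarrow> e \<notin> interior_edges Th \<Longrightarrow> x \<in> e \<Longrightarrow> vh x = 0"
    by (rule nodal_interpolant[where k = k and g = "nodal \<phi>", OF k n0]) (assumption, rule that)
  define w where "w T x = \<phi> x - (c T + d T \<bullet> x)" for T x
  define \<psi> where "\<psi> x = \<phi> x - vh x" for x
  have wC: "C1grad (w T) (\<lambda>x. d\<phi> x - d T)" for T unfolding w_def[abs_def] by (rule C1grad_diff[OF \<phi>C C1grad_affine])
  have w\<psi>: "w T x = \<psi> x" if "T \<in> Th" "x \<in> T" for T x using vhT[OF that] by (simp add: w_def \<psi>_def)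
  let ?IE = "interior_edges Th"
  let ?n = "\<lambda>T e. outward_normal T e"
  let ?J = "\<lambda>T e x. jump uh T (neighbor Th T e) e x"
  let ?src = "src_f N a b g"
  let ?\<Delta> = "\<lambda>T x. A1 T x $ 1 + A2 T x $ 2"
  have Gcont: "continuous_on S (G T)" if "T \<in> Th" for T S by (rule C1grad_grad_cont[OF PC[OF that]])
  have \<Delta>cont: "continuous_on S (?\<Delta> T)" if "T \<in> Th" for T S
    using P[OF that] unfolding C2grad_def by (intro continuous_intros) (auto intro: C1grad_grad_cont)
  have dphic: "continuous_on S d\<phi>" for S by (rule C1grad_grad_cont[OF \<phi>C])
  have gu: "grad uh y = G T y" if "T \<in> Th" "y \<in> interior T" for T y
    by (rule piecewise_grad(2)[where P = P and dP = G, OF PC[OF that(1)] uP[OF that(1)] that(2)])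
  have gv: "grad vh y = d T" if "T \<in> Th" "y \<in> interior T" for T y
    by (rule piecewise_grad(2)[where P = "\<lambda>T x. c T + d T \<bullet> x" and dP = "\<lambda>T x. d T", OF C1grad_affine vhT[OF that(1)] that(2)])
  have I1: "sint \<Omega> (\<lambda>x. grad uh x \<bullet> d\<phi> x) = (\<Sum>T\<in>Th. sint T (\<lambda>x. G T x \<bullet> d\<phi> x))"
  proof -
    have *: "integrable (lebesgue_on T) (\<lambda>x. grad uh x \<bullet> d\<phi> x) \<and> sint T (\<lambda>x. grad uh x \<bullet> d\<phi> x) = sint T (\<lambda>x. G T x \<bullet> d\<phi> x)" if "T \<in> Th" for T
    proof -
      have c: "continuous_on T (\<lambda>x. G T x \<bullet> d\<phi> x)" by (intro continuous_intros Gcont[OF that] dphic)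
      show ?thesis
        using triangle_AE_integral[OF tri[OF that] c, of "\<lambda>x. grad uh x \<bullet> d\<phi> x"] gu[OF that] by simp
    qed
    then show ?thesis using sint_mesh(2)[of "\<lambda>x. grad uh x \<bullet> d\<phi> x"] by simp
  qed
  have I2: "sint \<Omega> (\<lambda>x. grad uh x \<bullet> grad vh x) = (\<Sum>T\<in>Th. sint T (\<lambda>x. G T x \<bullet> d T))"
  proof -
    have *: "integrable (lebesgue_on T) (\<lambda>x. grad uh x \<bullet> grad vh x) \<and> sint T (\<lambda>x. grad uh x \<bullet> grad vh x) = sint T (\<lambda>x. G T x \<bullet> d T)" if "T \<in> Th" for T
    proof -
      have c: "continuous_on T (\<lambda>x. G T x \<bullet> d T)" by (intro continuous_intros Gcont[OF that])
      show ?thesis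
        using triangle_AE_integral[OF tri[OF that] c, of "\<lambda>x. grad uh x \<bullet> grad vh x"] gu[OF that] gv[OF that] by simp
    qed
    then show ?thesis using sint_mesh(2)[of "\<lambda>x. grad uh x \<bullet> grad vh x"] by simp
  qed
  have I12: "sint \<Omega> (\<lambda>x. grad uh x \<bullet> d\<phi> x) - sint \<Omega> (\<lambda>x. grad uh x \<bullet> grad vh x) = (\<Sum>T\<in>Th. sint T (\<lambda>x. G T x \<bullet> (d\<phi> x - d T)))"
    unfolding I1 I2 sum_subtractf[symmetric]
  proof (rule sum.cong[OF refl])
    fix T assume T: "T \<in> Th"
    have "sint T (\<lambda>x. G T x \<bullet> d\<phi> x - G T x \<bullet> d T) = sint T (\<lambda>x. G T x \<bullet> d\<phi> x) - sint T (\<lambda>x. G T x \<bullet> d T)"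
      by (intro Bochner_Integration.integral_diff integrable_on_compact T_sets(2)[OF T] continuous_intros Gcont[OF T] dphic)
    then show "sint T (\<lambda>x. G T x \<bullet> d\<phi> x) - sint T (\<lambda>x. G T x \<bullet> d T) = sint T (\<lambda>x. G T x \<bullet> (d\<phi> x - d T))" by (simp add: inner_diff_right)
  qed
  have vhc: "continuous_on \<Omega> vh" using vh by (auto simp: fe_space_def)
  have \<psi>T: "continuous_on T \<psi>" if "T \<in> Th" for T
    using C1grad_cont[OF wC[of T]] by (rule continuous_on_eq) (use w\<psi>[OF that] in auto)
  have \<psi>e: "continuous_on e \<psi>" if "T \<in> Th" "e \<in> edges T" for T e
    using \<psi>T[OF that(1)] edge_subset[OF that] by (rule continuous_on_subset)
  have \<psi>IE: "continuous_on e \<psi>" if "e \<in> ?IE" for e using \<psi>e interior_edges_subset that by blast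
  have \<psi>seg: "continuous_on (closed_segment (a l) (b l)) \<psi>" if "l < N" for l
    unfolding \<psi>_def using sub[OF that] vhc by (intro continuous_intros C1grad_cont[OF \<phi>C]) (rule continuous_on_subset)
  have L1: "(\<Sum>l<N. line_int (a l) (b l) (\<lambda>x. g l x * \<phi> x)) - (\<Sum>l<N. line_int (a l) (b l) (\<lambda>x. g l x * vh x))
      = (\<Sum>e\<in>?IE. edge_int e (\<lambda>x. ?src e x * \<psi> x))"
  proof -
    have "(\<Sum>l<N. line_int (a l) (b l) (\<lambda>x. g l x * \<phi> x)) - (\<Sum>l<N. line_int (a l) (b l) (\<lambda>x. g l x * vh x))
       = (\<Sum>l<N. line_int (a l) (b l) (\<lambda>x. g l x * \<psi> x))"
      unfolding sum_subtractf[symmetric]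
    proof (rule sum.cong[OF refl])
      fix l assume "l \<in> {..<N}"
      then have l: "l < N" by simp
      have "line_int (a l) (b l) (\<lambda>x. (\<phi> x - vh x) * g l x) = line_int (a l) (b l) (\<lambda>x. \<phi> x * g l x) - line_int (a l) (b l) (\<lambda>x. vh x * g l x)"
        by (intro line_int_mult_diff L2_seg_cont C1grad_cont[OF \<phi>C] continuous_on_subset[OF vhc sub[OF l]] L2[OF l])
      then show "line_int (a l) (b l) (\<lambda>x. g l x * \<phi> x) - line_int (a l) (b l) (\<lambda>x. g l x * vh x) = line_int (a l) (b l) (\<lambda>x. g l x * \<psi> x)"
        by (simp add: \<psi>_def mult.commute)
    qed
    also have "\<dots> = (\<Sum>e\<in>?IE. edge_int e (\<lambda>x. ?src e x * \<psi> x))"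
      by (rule line_part[OF seg L2 conf \<psi>seg \<psi>IE])
    finally show ?thesis .
  qed
  \<comment> \<open>The flux of \<open>uh\<close> out of one triangle through one edge, weighted
    with \<psi>. The flux from the other side is \<open>A (neighbor Th T e) e\<close>, and the two
    together carry the jump.\<close>
  define A where "A T e = edge_int e (\<lambda>x. (?n T e \<bullet> G T x) * \<psi> x)" for T e
  have GT: "sint T (\<lambda>x. G T x \<bullet> (d\<phi> x - d T)) = (\<Sum>e\<in>edges T \<inter> ?IE. A T e) - sint T (\<lambda>x. ?\<Delta> T x * w T x)" if T: "T \<in> Th" for T
  proof -
    have "(\<Sum>e\<in>edges T. edge_int e (\<lambda>x. (?n T e \<bullet> G T x) * w T x)) = (\<Sum>e\<in>edges T. A T e)"
    proof (rule sum.cong[OF refl])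
      fix e assume e: "e \<in> edges T"
      then obtain v v' where "e = closed_segment v v'" "v \<noteq> v'" by (auto simp: edges_def)
      then show "edge_int e (\<lambda>x. (?n T e \<bullet> G T x) * w T x) = A T e"
        unfolding A_def using w\<psi>[OF T] edge_subset[OF T e] by (intro edge_int_cong) auto
    qed
    also have "\<dots> = (\<Sum>e\<in>edges T \<inter> ?IE. A T e)"
    proof (rule sum.mono_neutral_right[OF edges_finite[OF T]])
      \<comment> \<open>Boundary edges drop out because \<phi> and \<open>vh\<close> both vanish
        there.\<close>
      show "\<forall>e\<in>edges T - edges T \<inter> ?IE. A T e = 0"
      proof
        fix e assume "e \<in> edges T - edges T \<inter> ?IE"
        then have e: "e \<in> edges T" "e \<notin> ?IE" by auto
        obtain v v' where vv: "e = closed_segment v v'" "v \<noteq> v'" using e by (auto simp: edges_def)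
        have "\<psi> x = 0" if "x \<in> e" for x
        proof -
          have "x \<notin> \<Omega>" using boundary_edge_disjoint[OF T e] that by blast
          then show ?thesis using vh0[OF T e that] \<phi>0 by (simp add: \<psi>_def)
        qed
        then have "A T e = edge_int e (\<lambda>x. 0)" unfolding A_def by (intro edge_int_cong[OF vv]) auto
        then show "A T e = 0" unfolding vv(1) edge_int_segment[OF vv(2)] by (simp add: line_int_def)
      qed
    qed auto
    finally show ?thesis using green_edges[OF T wC P[OF T]] by simp
  qed
  have edgeL2: "L2_seg v v' (?src e)" "L2_seg v v' \<psi>" "L2_seg v v' (\<lambda>x. ?n T e \<bullet> G T x)" "L2_seg v v' (\<lambda>x. ?n (neighbor Th T e) e \<bullet> G (neighbor Th T e) x)"
    "\<And>x. x \<in> e \<Longrightarrow> ?J T e x = ?n T e \<bullet> G T x + ?n (neighbor Th T e) e \<bullet> G (neighbor Th T e) x"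
    if T: "T \<in> Th" and e: "e \<in> edges T" "e \<in> ?IE" and vv: "e = closed_segment v v'" "v \<noteq> v'" for T e v v'
  proof -
    note n = interior_edge_neighbor[OF e(2) T e(1)]
    show "L2_seg v v' (?src e)" unfolding src_f_def[abs_def]
    proof (rule L2_seg_sum)
      fix l assume "l \<in> {l. l < N \<and> e \<subseteq> closed_segment (a l) (b l)}"
      then show "L2_seg v v' (g l)" using L2_subsegment[OF L2 seg vv(2)] vv(1) by auto
    qed simp
    show "L2_seg v v' \<psi>" using L2_seg_cont \<psi>IE[OF e(2)] vv(1) by simp
    show "L2_seg v v' (\<lambda>x. ?n T e \<bullet> G T x)" "L2_seg v v' (\<lambda>x. ?n (neighbor Th T e) e \<bullet> G (neighbor Th T e) x)"
      by (intro L2_seg_cont continuous_intros Gcont T n(1))+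
    show "?J T e x = ?n T e \<bullet> G T x + ?n (neighbor Th T e) e \<bullet> G (neighbor Th T e) x" if x: "x \<in> e" for x
    proof -
      have "x \<in> T" "x \<in> neighbor Th T e" using x n(3) by auto
      then show ?thesis unfolding jump_def
        using grad_within_triangle[OF tri[OF T] PC[OF T] uP[OF T]] grad_within_triangle[OF tri[OF n(1)] PC[OF n(1)] uP[OF n(1)]] by simp
    qed
  qed
  define E where "E T e = edge_int e (\<lambda>x. (?src e x - ?J T e x)\<^sup>2)" for T e
  \<comment> \<open>Young's inequality with weight \<open>rel_const * diameter T\<close>: the
    diameter in the denominator cancels against the one in the interpolation error on
    \<open>e\<close>.\<close>
  have edge: "edge_int e (\<lambda>x. ?src e x * \<psi> x) - (A T e + A (neighbor Th T e) e)
      \<le> (rel_const * diameter T * E T e + edge_const * tri_energy d\<phi> T / rel_const) / 2"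
    if T: "T \<in> Th" and e: "e \<in> edges T" "e \<in> ?IE" for T e
  proof -
    obtain v v' where vv: "e = closed_segment v v'" "v \<noteq> v'" using e by (auto simp: edges_def)
    note L = edgeL2[OF T e vv]
    let ?j = "\<lambda>x. ?n T e \<bullet> G T x + ?n (neighbor Th T e) e \<bullet> G (neighbor Th T e) x"
    have jL: "L2_seg v v' ?j" by (rule L2_seg_add[OF L(3,4)])
    have "edge_int e (\<lambda>x. ?src e x * \<psi> x) - (A T e + A (neighbor Th T e) e)
       = line_int v v' (\<lambda>x. ?src e x * \<psi> x) - line_int v v' (\<lambda>x. ?j x * \<psi> x)"
      unfolding A_def using line_int_mult_add[OF L(3,4,2)] vv by (simp add: edge_int_segment)
    also have "\<dots> = line_int v v' (\<lambda>x. (?src e x - ?j x) * \<psi> x)" by (rule line_int_mult_diff[OF L(1) jL L(2), symmetric])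
    also have "\<dots> \<le> (rel_const * diameter T * line_int v v' (\<lambda>x. (?src e x - ?j x)\<^sup>2) + line_int v v' (\<lambda>x. (\<psi> x)\<^sup>2) / (rel_const * diameter T)) / 2"
      by (rule line_int_young[OF L2_seg_diff[OF L(1) jL] L(2)]) (use rel_const_pos diameter_pos[OF T] in simp)
    also have "line_int v v' (\<lambda>x. (?src e x - ?j x)\<^sup>2) = E T e"
    proof -
      have "E T e = edge_int e (\<lambda>x. (?src e x - ?j x)\<^sup>2)" unfolding E_def by (rule edge_int_cong[OF vv]) (simp add: L(5))
      then show ?thesis using vv by (simp add: edge_int_segment)
    qed
    also have "line_int v v' (\<lambda>x. (\<psi> x)\<^sup>2) = edge_int e (\<lambda>x. (\<phi> x - (c T + d T \<bullet> x))\<^sup>2)"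
    proof -
      have "edge_int e (\<lambda>x. (\<phi> x - (c T + d T \<bullet> x))\<^sup>2) = edge_int e (\<lambda>x. (\<psi> x)\<^sup>2)"
        by (rule edge_int_cong[OF vv]) (use w\<psi>[OF T] edge_subset[OF T e(1)] in \<open>auto simp: w_def\<close>)
      then show ?thesis using vv by (simp add: edge_int_segment)
    qed
    also have "(rel_const * diameter T * E T e + edge_int e (\<lambda>x. (\<phi> x - (c T + d T \<bullet> x))\<^sup>2) / (rel_const * diameter T)) / 2
       \<le> (rel_const * diameter T * E T e + edge_const * tri_energy d\<phi> T / rel_const) / 2"
    proof -
      have "edge_int e (\<lambda>x. (\<phi> x - (c T + d T \<bullet> x))\<^sup>2) \<le> diameter T * (edge_const * tri_energy d\<phi> T)"
        using local_interpolation_bound(2)[OF \<phi>C \<phi>0 T e(1) cd[OF T]] by (simp add: edge_const_def)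
      then have "edge_int e (\<lambda>x. (\<phi> x - (c T + d T \<bullet> x))\<^sup>2) / (rel_const * diameter T) \<le> diameter T * (edge_const * tri_energy d\<phi> T) / (rel_const * diameter T)"
        using rel_const_pos diameter_pos[OF T] by (intro divide_right_mono) auto
      also have "\<dots> = edge_const * tri_energy d\<phi> T / rel_const" using diameter_pos[OF T] by simp
      finally show ?thesis by (intro divide_right_mono add_left_mono) simp_all
    qed
    finally show ?thesis .
  qed
  have vol: "sint T (\<lambda>x. ?\<Delta> T x * w T x) \<le> (rel_const * (diameter T)\<^sup>2 * sint T (\<lambda>x. (lap uh x)\<^sup>2) + const1 * tri_energy d\<phi> T / rel_const) / 2"
    if T: "T \<in> Th" for T
  proof -
    have "sint T (\<lambda>x. ?\<Delta> T x * w T x) \<le> (rel_const * (diameter T)\<^sup>2 * sint T (\<lambda>x. (?\<Delta> T x)\<^sup>2) + sint T (\<lambda>x. (w T x)\<^sup>2) / (rel_const * (diameter T)\<^sup>2)) / 2"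
      by (rule sint_young[OF T_sets(2)[OF T] \<Delta>cont[OF T] C1grad_cont[OF wC]]) (use rel_const_pos diameter_pos[OF T] in simp)
    also have "sint T (\<lambda>x. (?\<Delta> T x)\<^sup>2) = sint T (\<lambda>x. (lap uh x)\<^sup>2)"
    proof (rule triangle_AE_integral(2)[OF tri[OF T], symmetric])
      show "continuous_on T (\<lambda>x. (?\<Delta> T x)\<^sup>2)" by (intro continuous_on_power \<Delta>cont[OF T])
      show "(lap uh x)\<^sup>2 = (?\<Delta> T x)\<^sup>2" if "x \<in> interior T" for x
        using lap_interior[OF P[OF T] _ open_interior that, of uh] uP[OF T] interior_subset by (metis subsetD)
    qed
    also have "(rel_const * (diameter T)\<^sup>2 * sint T (\<lambda>x. (lap uh x)\<^sup>2) + sint T (\<lambda>x. (w T x)\<^sup>2) / (rel_const * (diameter T)\<^sup>2)) / 2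
       \<le> (rel_const * (diameter T)\<^sup>2 * sint T (\<lambda>x. (lap uh x)\<^sup>2) + const1 * tri_energy d\<phi> T / rel_const) / 2"
    proof -
      obtain e where e: "e \<in> edges T"
      proof -
        obtain p q r where "cr (q - p) (r - p) \<noteq> 0" "T = convex hull {p,q,r}" using tri[OF T] by (auto simp: tri_cr)
        then show ?thesis using that edges_triangle by blast
      qed
      have "sint T (\<lambda>x. (w T x)\<^sup>2) \<le> (diameter T)\<^sup>2 * (const1 * tri_energy d\<phi> T)"
        unfolding w_def using local_interpolation_bound(1)[OF \<phi>C \<phi>0 T e cd[OF T]] by simp
      then have "sint T (\<lambda>x. (w T x)\<^sup>2) / (rel_const * (diameter T)\<^sup>2) \<le> (diameter T)\<^sup>2 * (const1 * tri_energy d\<phi> T) / (rel_const * (diameter T)\<^sup>2)"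
        using rel_const_pos diameter_pos[OF T] by (intro divide_right_mono) auto
      also have "\<dots> = const1 * tri_energy d\<phi> T / rel_const" using diameter_pos[OF T] by simp
      finally show ?thesis by (intro divide_right_mono add_left_mono) simp_all
    qed
    finally show ?thesis .
  qed
  \<comment> \<open>Each interior edge is visited from both of its triangles, and either visit
    carries the full edge residual, hence the 1/2. In this symmetric form each visit may use the
    diameter of its own triangle.\<close>
  have R: "(\<Sum>l<N. line_int (a l) (b l) (\<lambda>x. g l x * \<phi> x)) - sint \<Omega> (\<lambda>x. grad uh x \<bullet> d\<phi> x)
     = 1/2 * (\<Sum>T\<in>Th. \<Sum>e\<in>edges T \<inter> ?IE. edge_int e (\<lambda>x. ?src e x * \<psi> x) - (A T e + A (neighbor Th T e) e)) + (\<Sum>T\<in>Th. sint T (\<lambda>x. ?\<Delta> T x * w T x))"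
  proof -
    let ?SA = "\<Sum>T\<in>Th. \<Sum>e\<in>edges T \<inter> ?IE. A T e"
    have "(\<Sum>T\<in>Th. \<Sum>e\<in>edges T \<inter> ?IE. edge_int e (\<lambda>x. ?src e x * \<psi> x) - (A T e + A (neighbor Th T e) e))
      = (\<Sum>T\<in>Th. \<Sum>e\<in>edges T \<inter> ?IE. edge_int e (\<lambda>x. ?src e x * \<psi> x)) - (?SA + (\<Sum>T\<in>Th. \<Sum>e\<in>edges T \<inter> ?IE. A (neighbor Th T e) e))"
      by (simp add: sum_subtractf sum.distrib)
    also have "\<dots> = 2 * (\<Sum>e\<in>?IE. edge_int e (\<lambda>x. ?src e x * \<psi> x)) - 2 * ?SA"
      unfolding sum_interior_edges sum_pairs_swap[of A] by simp
    finally have 1: "1/2 * (\<Sum>T\<in>Th. \<Sum>e\<in>edges T \<inter> ?IE. edge_int e (\<lambda>x. ?src e x * \<psi> x) - (A T e + A (neighbor Th T e) e))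
       = (\<Sum>e\<in>?IE. edge_int e (\<lambda>x. ?src e x * \<psi> x)) - ?SA" by simp
    have 2: "(\<Sum>T\<in>Th. sint T (\<lambda>x. G T x \<bullet> (d\<phi> x - d T))) = ?SA - (\<Sum>T\<in>Th. sint T (\<lambda>x. ?\<Delta> T x * w T x))"
      using GT by (simp add: sum_subtractf)
    show ?thesis unfolding 1 using L1 I12 gal[OF vh] 2 by linarith
  qed
  have "(\<Sum>T\<in>Th. \<Sum>e\<in>edges T \<inter> ?IE. edge_int e (\<lambda>x. ?src e x * \<psi> x) - (A T e + A (neighbor Th T e) e))
     \<le> (\<Sum>T\<in>Th. (rel_const * (\<Sum>e\<in>edges T \<inter> ?IE. diameter T * E T e) + 3 * (edge_const * tri_energy d\<phi> T / rel_const)) / 2)"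
  proof (rule sum_mono)
    fix T assume T: "T \<in> Th"
    let ?\<kappa> = "edge_const * tri_energy d\<phi> T / rel_const"
    have \<kappa>0: "?\<kappa> \<ge> 0" using edge_const_nonneg rel_const_pos by (intro divide_nonneg_pos mult_nonneg_nonneg) (auto simp: tri_energy_def intro!: sum_nonneg patch_energy_nonneg)
    have card3: "card (edges T \<inter> ?IE) \<le> 3"
    proof -
      obtain p q r where "cr (q - p) (r - p) \<noteq> 0" "T = convex hull {p,q,r}" using tri[OF T] by (auto simp: tri_cr)
      then have "edges T = {closed_segment q r, closed_segment r p, closed_segment p q}" using edges_triangle by simp
      then have "card (edges T) \<le> 3" by (simp add: card_insert_if)
      moreover have "card (edges T \<inter> ?IE) \<le> card (edges T)" using edges_finite[OF T] by (intro card_mono) auto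
      ultimately show ?thesis by linarith
    qed
    have "(\<Sum>e\<in>edges T \<inter> ?IE. edge_int e (\<lambda>x. ?src e x * \<psi> x) - (A T e + A (neighbor Th T e) e))
       \<le> (\<Sum>e\<in>edges T \<inter> ?IE. (rel_const * diameter T * E T e + ?\<kappa>) / 2)"
      by (rule sum_mono) (use edge[OF T] in auto)
    also have "\<dots> = (rel_const * (\<Sum>e\<in>edges T \<inter> ?IE. diameter T * E T e) + real (card (edges T \<inter> ?IE)) * ?\<kappa>) / 2"
      by (simp add: sum_divide_distrib[symmetric] sum.distrib sum_distrib_left mult.assoc)
    also have "\<dots> \<le> (rel_const * (\<Sum>e\<in>edges T \<inter> ?IE. diameter T * E T e) + 3 * ?\<kappa>) / 2"
      using card3 \<kappa>0 by (intro divide_right_mono add_left_mono mult_right_mono) auto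
    finally show "(\<Sum>e\<in>edges T \<inter> ?IE. edge_int e (\<lambda>x. ?src e x * \<psi> x) - (A T e + A (neighbor Th T e) e))
       \<le> (rel_const * (\<Sum>e\<in>edges T \<inter> ?IE. diameter T * E T e) + 3 * ?\<kappa>) / 2" .
  qed
  moreover have "(\<Sum>T\<in>Th. sint T (\<lambda>x. ?\<Delta> T x * w T x))
     \<le> (\<Sum>T\<in>Th. (rel_const * (diameter T)\<^sup>2 * sint T (\<lambda>x. (lap uh x)\<^sup>2) + const1 * tri_energy d\<phi> T / rel_const) / 2)"
    by (rule sum_mono) (rule vol)
  ultimately have "(\<Sum>l<N. line_int (a l) (b l) (\<lambda>x. g l x * \<phi> x)) - sint \<Omega> (\<lambda>x. grad uh x \<bullet> d\<phi> x)
     \<le> 1/2 * (\<Sum>T\<in>Th. (rel_const * (\<Sum>e\<in>edges T \<inter> ?IE. diameter T * E T e) + 3 * (edge_const * tri_energy d\<phi> T / rel_const)) / 2)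
      + (\<Sum>T\<in>Th. (rel_const * (diameter T)\<^sup>2 * sint T (\<lambda>x. (lap uh x)\<^sup>2) + const1 * tri_energy d\<phi> T / rel_const) / 2)"
    unfolding R by (intro add_mono mult_left_mono) auto
  also have "\<dots> = (\<Sum>T\<in>Th. rel_const / 2 * eta_T_sq Th N a b g uh T + (const1 + 3 / 2 * edge_const) / (2 * rel_const) * tri_energy d\<phi> T)"
    unfolding sum_distrib_left[where A = Th] sum.distrib[symmetric]
  proof (rule sum.cong[OF refl])
    fix T
    \<comment> \<open>Collecting terms: the 1/2 from counting edges twice is the 1/2 of the jump
      terms in \<open>eta_T_sq\<close>, and it also turns three edge terms into the 3/2 of
      \<open>rel_const\<close>.\<close>
    have alg: "1/2 * ((r * X + 3 * (ec * B / r)) / 2) + (r * h * S + c1 * B / r) / 2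
      = r / 2 * (h * S + 1/2 * X) + (c1 + 3 / 2 * ec) / (2 * r) * B" if "r > 0" for r X ec B h S c1 :: real
      using that by (simp add: field_simps)
    show "1/2 * ((rel_const * (\<Sum>e\<in>edges T \<inter> ?IE. diameter T * E T e) + 3 * (edge_const * tri_energy d\<phi> T / rel_const)) / 2)
      + (rel_const * (diameter T)\<^sup>2 * sint T (\<lambda>x. (lap uh x)\<^sup>2) + const1 * tri_energy d\<phi> T / rel_const) / 2
      = rel_const / 2 * eta_T_sq Th N a b g uh T + (const1 + 3 / 2 * edge_const) / (2 * rel_const) * tri_energy d\<phi> T"
      unfolding eta_T_sq_def E_def by (rule alg[OF rel_const_pos])
  qed
  also have "\<dots> = rel_const / 2 * (\<Sum>T\<in>Th. eta_T_sq Th N a b g uh T) + (const1 + 3 / 2 * edge_const) / (2 * rel_const) * (\<Sum>T\<in>Th. tri_energy d\<phi> T)"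
    by (simp add: sum.distrib sum_distrib_left)
  also have "\<dots> \<le> rel_const / 2 * (\<Sum>T\<in>Th. eta_T_sq Th N a b g uh T) + (const1 + 3 / 2 * edge_const) / (2 * rel_const) * (3 * K\<^sup>2 * (\<Sum>T\<in>Th. sint T (\<lambda>x. (norm (d\<phi> x))\<^sup>2)))"
    using rel_const_pos const1_pos edge_const_nonneg by (intro add_left_mono mult_left_mono sum_tri_energy) auto
  also have "(\<Sum>T\<in>Th. sint T (\<lambda>x. (norm (d\<phi> x))\<^sup>2)) = sint \<Omega> (\<lambda>x. (norm (d\<phi> x))\<^sup>2)"
    by (rule sint_mesh(2)[symmetric]) (intro integrable_on_compact T_sets continuous_intros dphic)
  also have "(const1 + 3 / 2 * edge_const) / (2 * rel_const) * (3 * K\<^sup>2 * sint \<Omega> (\<lambda>x. (norm (d\<phi> x))\<^sup>2)) = sint \<Omega> (\<lambda>x. (norm (d\<phi> x))\<^sup>2) / 2"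
  proof -
    \<comment> \<open>Here the definition of \<open>rel_const\<close> is used: the overlap factor
      and the interpolation constants multiply to \<open>rel_const\<close>, which cancels.\<close>
    have e: "(const1 + 3 / 2 * edge_const) / (2 * rel_const) * (3 * K\<^sup>2 * s) = rel_const / (2 * rel_const) * s" for s
      unfolding rel_const_def by simp
    show ?thesis unfolding e using rel_const_pos by simp
  qed
  finally show ?thesis by simp
qed

end

section \<open>Reliability of the estimator\<close>

text \<open>\<open>inradius\<close> is a supremum, so a ball of more than half that radius is taken
  inside the triangle, which turns \<sigma> into \<open>2 * \<sigma>\<close>. Positivity of \<sigma>
  is read off from any triangle of the mesh, whose diameter is positive.\<close>

lemma shape_regular_regular_mesh:
  assumes tr: "triangulation \<Omega> Th" and sr: "shape_regular \<sigma> Th"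
  shows "regular_mesh \<Omega> Th (2 * \<sigma>)"
proof -
  interpret mesh \<Omega> Th by unfold_locales (rule tr)
  have reg: "\<sigma> > 0 \<and> (\<exists>c \<rho>. \<rho> > 0 \<and> cball c \<rho> \<subseteq> T \<and> diameter T \<le> 2 * \<sigma> * \<rho>)" if T: "T \<in> Th" for T
  proof -
    let ?S = "{r. \<exists>c. cball c r \<subseteq> T}"
    have bT: "bounded T" using T_sets(2)[OF T] by (rule compact_imp_bounded)
    obtain p q r where c: "cr (q - p) (r - p) \<noteq> 0" "T = convex hull {p,q,r}" using tri[OF T] by (auto simp: tri_cr)
    have "p \<in> T" "q \<in> T" "p \<noteq> q" using c by (auto intro: hull_inc simp: cr_def)
    then have dpos: "diameter T > 0" using diameter_bounded_bound[OF bT, of p q] by (metis less_le_trans zero_less_dist_iff)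
    \<comment> \<open>Negative radii give empty balls and therefore belong to \<open>?S\<close>;
      only the others are compared with the diameter.\<close>
    have "s \<le> diameter T" if s: "s \<in> ?S" for s
    proof (cases "s \<ge> 0")
      case True
      obtain c where "cball c s \<subseteq> T" using s by blast
      then have "diameter (cball c s) \<le> diameter T" by (intro diameter_subset bT)
      then show ?thesis using True by simp
    qed (use dpos in simp)
    then have bdd: "bdd_above ?S" by (intro bdd_aboveI)
    have "0 \<in> ?S" using \<open>p \<in> T\<close> by auto
    then have ir0: "inradius T \<ge> 0" unfolding inradius_def using bdd by (intro cSup_upper)
    have le: "diameter T \<le> \<sigma> * inradius T" using sr T by (auto simp: shape_regular_def)
    then have pos: "\<sigma> * inradius T > 0" using dpos by linarith
    then have \<sigma>: "\<sigma> > 0" and ir: "inradius T > 0" using ir0 by (auto simp: zero_less_mult_iff)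
    have neS: "?S \<noteq> {}" using \<open>0 \<in> ?S\<close> by blast
    have "inradius T / 2 < Sup ?S" using ir unfolding inradius_def by simp
    then have "\<exists>\<rho>\<in>?S. inradius T / 2 < \<rho>" using less_cSup_iff[OF neS bdd] by blast
    then obtain \<rho> c where \<rho>: "cball c \<rho> \<subseteq> T" "inradius T / 2 < \<rho>" by blast
    have "\<sigma> * inradius T \<le> \<sigma> * (2 * \<rho>)" using \<rho> \<sigma> by (intro mult_left_mono) auto
    then have "diameter T \<le> 2 * \<sigma> * \<rho>" using le by simp
    then show ?thesis using \<rho> \<sigma> ir by (intro conjI exI[of _ c] exI[of _ \<rho>]) auto
  qed
  have "Th \<noteq> {}" using tr by (auto simp: triangulation_def)
  then show ?thesis using reg by unfold_locales auto
qed

theorem theorem4p5: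
  fixes \<Omega> :: "(real^2) set" and N :: nat and a b :: "nat \<Rightarrow> real^2"
    and \<beta> :: "nat \<Rightarrow> real" and g :: "nat \<Rightarrow> real^2 \<Rightarrow> real"
    and k :: nat and \<sigma> :: real
    and u :: "real^2 \<Rightarrow> real" and Gu :: "real^2 \<Rightarrow> real^2"
  assumes "polygonal_domain \<Omega>"
    and "\<forall>l<N. a l \<noteq> b l \<and> closed_segment (a l) (b l) \<subseteq> \<Omega>"
    and "\<forall>l<N. L2_seg (a l) (b l) (g l)"
    and "weak_solution \<Omega> N a b g u Gu"
    and "k \<ge> 1"
  shows "\<exists>C. \<forall>Th uh.
     triangulation \<Omega> Th \<and> shape_regular \<sigma> Th \<and>
     (\<forall>l<N. \<exists>E \<subseteq> interior_edges Th. closed_segment (a l) (b l) = \<Union>E) \<and>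
     uh \<in> fe_space \<Omega> Th k \<and>
     (\<forall>vh\<in>fe_space \<Omega> Th k.
        integral\<^sup>L (lebesgue_on \<Omega>) (\<lambda>x. grad uh x \<bullet> grad vh x) =
        (\<Sum>l<N. line_int (a l) (b l) (\<lambda>x. g l x * vh x)))
     \<longrightarrow> sqrt (integral\<^sup>L (lebesgue_on \<Omega>) (\<lambda>x. (norm (Gu x - grad uh x))^2))
         \<le> C * eta Th N a b g uh"
proof (intro exI[of _ "sqrt (regular_mesh.rel_const (2 * \<sigma>))"] allI impI, elim conjE)
  fix Th uh
  assume tr: "triangulation \<Omega> Th" and sr: "shape_regular \<sigma> Th"
    and conf: "\<forall>l<N. \<exists>E \<subseteq> interior_edges Th. closed_segment (a l) (b l) = \<Union>E"
    and uh: "uh \<in> fe_space \<Omega> Th k"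
    and gal: "\<forall>vh\<in>fe_space \<Omega> Th k. sint \<Omega> (\<lambda>x. grad uh x \<bullet> grad vh x) = (\<Sum>l<N. line_int (a l) (b l) (\<lambda>x. g l x * vh x))"
  \<comment> \<open>The witness \<open>rel_const\<close> depends only on the parameter
    \<open>2 * \<sigma>\<close> of this interpretation, and so is the same for all meshes.\<close>
  interpret regular_mesh \<Omega> Th "2 * \<sigma>" by (rule shape_regular_regular_mesh[OF tr sr])
  have "\<forall>T\<in>Th. \<exists>p. polyk k p \<and> (\<forall>x\<in>T. uh x = p x)" using uh by (simp add: fe_space_def)
  then obtain P where P: "\<And>T. T \<in> Th \<Longrightarrow> polyk k (P T)" "\<And>T x. T \<in> Th \<Longrightarrow> x \<in> T \<Longrightarrow> uh x = P T x" by metis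
  have "\<forall>T\<in>Th. \<exists>G A1 A2. C2grad (P T) G A1 A2" using polyk_C2grad P(1) by blast
  then obtain G A1 A2 where C2: "\<And>T. T \<in> Th \<Longrightarrow> C2grad (P T) (G T) (A1 T) (A2 T)" by metis
  have C1: "C1grad (P T) (G T)" if "T \<in> Th" for T using C2[OF that] by (simp add: C2grad_def)
  \<comment> \<open>This gradient is an unspecified one. It serves to derive zero boundary values
    for \<open>uh\<close>, after which \<open>grad uh\<close> itself is shown to be
    admissible.\<close>
  obtain G' where G': "H10 \<Omega> uh G'" using uh by (auto simp: fe_space_def)
  have bd: "uh x = 0" if "T \<in> Th" "e \<in> edges T" "e \<notin> interior_edges Th" "x \<in> e" for T e x
    by (rule trace_zero[where P = P and dP = G, OF G' C1 P(2) that])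
  have uhT: "continuous_on T uh" if "T \<in> Th" for T
    using C1grad_cont[OF C1[OF that]] by (rule continuous_on_eq) (use P(2)[OF that] in auto)
  have uh0: "uh x = 0" if "x \<in> closure \<Omega> - \<Omega>" for x by (rule zero_on_frontier[OF uhT bd that])
  have Huh: "H10 \<Omega> uh (grad uh)" by (rule piecewise_H10[where P = P and dP = G, OF C1 P(2) uh0])
  have Hu: "H10 \<Omega> u Gu" and weak: "\<And>\<phi> d\<phi>. Cc1 \<Omega> \<phi> d\<phi> \<Longrightarrow> sint \<Omega> (\<lambda>x. Gu x \<bullet> d\<phi> x) = (\<Sum>l<N. line_int (a l) (b l) (\<lambda>x. g l x * \<phi> x))"
    using assms(4) by (auto simp: weak_solution_def)
  obtain \<phi> d\<phi> where \<phi>: "\<And>n. Cc1 \<Omega> (\<phi> n) (d\<phi> n)" "(\<lambda>n. sint \<Omega> (\<lambda>x. (norm (d\<phi> n x - Gu x))\<^sup>2)) \<longlonglongrightarrow> 0"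
    and Gu: "Gu \<in> borel_measurable (lebesgue_on \<Omega>)" "integrable (lebesgue_on \<Omega>) (\<lambda>x. (norm (Gu x))\<^sup>2)"
    using Hu unfolding H10_def by blast
  obtain \<psi> d\<psi> where \<psi>: "\<And>n. Cc1 \<Omega> (\<psi> n) (d\<psi> n)" "(\<lambda>n. sint \<Omega> (\<lambda>x. (norm (d\<psi> n x - grad uh x))\<^sup>2)) \<longlonglongrightarrow> 0"
    and gu: "grad uh \<in> borel_measurable (lebesgue_on \<Omega>)" "integrable (lebesgue_on \<Omega>) (\<lambda>x. (norm (grad uh x))\<^sup>2)"
    using Huh unfolding H10_def by blast
  have Oms: "\<Omega> \<in> sets lebesgue" using open_Om by auto
  define W where "W x = Gu x - grad uh x" for x
  define \<eta> where "\<eta> = (\<Sum>T\<in>Th. eta_T_sq Th N a b g uh T)"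
  have Wm: "W \<in> borel_measurable (lebesgue_on \<Omega>)" unfolding W_def[abs_def] using Gu(1) gu(1) by measurable
  have Wi: "integrable (lebesgue_on \<Omega>) (\<lambda>x. (norm (W x))\<^sup>2)" unfolding W_def by (rule L2_norm_diff_integrable(1)[OF Gu(1) gu(1) Gu(2) gu(2)])
  have Cm: "d\<theta> \<in> borel_measurable (lebesgue_on \<Omega>)" "integrable (lebesgue_on \<Omega>) (\<lambda>x. (norm (d\<theta> x))\<^sup>2)" if "Cc1 \<Omega> \<theta> d\<theta>" for \<theta> d\<theta>
  proof -
    note C = C1grad_grad_cont[OF Cc1_C1grad[OF that]]
    show "d\<theta> \<in> borel_measurable (lebesgue_on \<Omega>)" by (intro continuous_imp_measurable_on_sets_lebesgue C Oms)
    show "integrable (lebesgue_on \<Omega>) (\<lambda>x. (norm (d\<theta> x))\<^sup>2)"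
      by (rule sint_mesh(1)) (intro integrable_on_compact T_sets continuous_intros C)
  qed
  have inner_int: "integrable (lebesgue_on \<Omega>) (\<lambda>x. V x \<bullet> V' x)"
    if [measurable]: "V \<in> borel_measurable (lebesgue_on \<Omega>)" "V' \<in> borel_measurable (lebesgue_on \<Omega>)"
      and i: "integrable (lebesgue_on \<Omega>) (\<lambda>x. (norm (V x))\<^sup>2)" "integrable (lebesgue_on \<Omega>) (\<lambda>x. (norm (V' x))\<^sup>2)"
    for V V' :: "real^2 \<Rightarrow> real^2"
  proof (rule Bochner_Integration.integrable_bound)
    show "integrable (lebesgue_on \<Omega>) (\<lambda>x. norm (V x) * norm (V' x))" using i by (intro integrable_mult_L2) auto
    show "AE x in lebesgue_on \<Omega>. norm (V x \<bullet> V' x) \<le> norm (norm (V x) * norm (V' x))"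
      using Cauchy_Schwarz_ineq2 by (intro AE_I2) auto
  qed measurable
  \<comment> \<open>The square of \<open>d\<theta> - W\<close> is expanded: the residual bound
    controls twice the product with \<open>W\<close> minus the energy of \<open>d\<theta>\<close>,
    and the remaining distance tends to 0.\<close>
  have main: "sint \<Omega> (\<lambda>x. (norm (W x))\<^sup>2) \<le> rel_const * \<eta> + sint \<Omega> (\<lambda>x. (norm ((d\<phi> n x - d\<psi> n x) - W x))\<^sup>2)" for n
  proof -
    define \<theta> where "\<theta> x = \<phi> n x - \<psi> n x" for x
    define d\<theta> where "d\<theta> x = d\<phi> n x - d\<psi> n x" for x
    have th: "Cc1 \<Omega> \<theta> d\<theta>" unfolding \<theta>_def[abs_def] d\<theta>_def[abs_def] by (rule Cc1_diff[OF \<phi>(1) \<psi>(1)])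
    note m = Cm[OF th]
    have iW: "integrable (lebesgue_on \<Omega>) (\<lambda>x. W x \<bullet> d\<theta> x)" by (rule inner_int[OF Wm m(1) Wi m(2)])
    have "sint \<Omega> (\<lambda>x. W x \<bullet> d\<theta> x) = sint \<Omega> (\<lambda>x. Gu x \<bullet> d\<theta> x) - sint \<Omega> (\<lambda>x. grad uh x \<bullet> d\<theta> x)"
      unfolding W_def inner_diff_left
      by (rule Bochner_Integration.integral_diff[OF inner_int[OF Gu(1) m(1) Gu(2) m(2)] inner_int[OF gu(1) m(1) gu(2) m(2)]])
    also have "\<dots> = (\<Sum>l<N. line_int (a l) (b l) (\<lambda>x. g l x * \<theta> x)) - sint \<Omega> (\<lambda>x. grad uh x \<bullet> d\<theta> x)"
      using weak[OF th] by simp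
    also have "\<dots> \<le> (rel_const * \<eta> + sint \<Omega> (\<lambda>x. (norm (d\<theta> x))\<^sup>2)) / 2"
      unfolding \<eta>_def
      by (rule residual_bound[where P = P and G = G and ?A1.0 = A1 and ?A2.0 = A2 and k = k, OF _ _ _ _ assms(5) C2 P(2) _ th])
        (use assms(2,3) conf gal in auto)
    finally have 1: "2 * sint \<Omega> (\<lambda>x. W x \<bullet> d\<theta> x) - sint \<Omega> (\<lambda>x. (norm (d\<theta> x))\<^sup>2) \<le> rel_const * \<eta>" by simp
    have "(norm (d\<theta> x - W x))\<^sup>2 = (norm (d\<theta> x))\<^sup>2 - 2 * (W x \<bullet> d\<theta> x) + (norm (W x))\<^sup>2" for x
      by (simp add: power2_norm_eq_inner inner_diff_left inner_diff_right inner_commute)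
    then have "sint \<Omega> (\<lambda>x. (norm (d\<theta> x - W x))\<^sup>2) = sint \<Omega> (\<lambda>x. (norm (d\<theta> x))\<^sup>2 - 2 * (W x \<bullet> d\<theta> x) + (norm (W x))\<^sup>2)" by simp
    also have "\<dots> = sint \<Omega> (\<lambda>x. (norm (d\<theta> x))\<^sup>2) - 2 * sint \<Omega> (\<lambda>x. W x \<bullet> d\<theta> x) + sint \<Omega> (\<lambda>x. (norm (W x))\<^sup>2)"
      using m(2) iW Wi by simp
    finally show ?thesis using 1 unfolding d\<theta>_def by linarith
  qed
  have lim: "(\<lambda>n. sint \<Omega> (\<lambda>x. (norm ((d\<phi> n x - d\<psi> n x) - W x))\<^sup>2)) \<longlonglongrightarrow> 0"
  proof (rule tendsto_sandwich[OF _ _ tendsto_const])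
    let ?b = "\<lambda>n. 2 * sint \<Omega> (\<lambda>x. (norm (d\<phi> n x - Gu x))\<^sup>2) + 2 * sint \<Omega> (\<lambda>x. (norm (d\<psi> n x - grad uh x))\<^sup>2)"
    show "\<forall>\<^sub>F n in sequentially. sint \<Omega> (\<lambda>x. (norm ((d\<phi> n x - d\<psi> n x) - W x))\<^sup>2) \<le> ?b n"
    proof (rule always_eventually, rule allI)
      fix n
      note m1 = Cm[OF \<phi>(1)[of n]] and m2 = Cm[OF \<psi>(1)[of n]]
      have e: "(d\<phi> n x - d\<psi> n x) - W x = (d\<phi> n x - Gu x) - (d\<psi> n x - grad uh x)" for x by (simp add: W_def)
      have mm: "(\<lambda>x. d\<phi> n x - Gu x) \<in> borel_measurable (lebesgue_on \<Omega>)" "(\<lambda>x. d\<psi> n x - grad uh x) \<in> borel_measurable (lebesgue_on \<Omega>)"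
        using m1(1) m2(1) Gu(1) gu(1) by measurable
      show "sint \<Omega> (\<lambda>x. (norm ((d\<phi> n x - d\<psi> n x) - W x))\<^sup>2) \<le> ?b n"
        unfolding e by (rule L2_norm_diff_integrable(2)[OF mm L2_norm_diff_integrable(1)[OF m1(1) Gu(1) m1(2) Gu(2)] L2_norm_diff_integrable(1)[OF m2(1) gu(1) m2(2) gu(2)]])
    qed
    have "?b \<longlonglongrightarrow> 2 * 0 + 2 * 0" by (intro tendsto_intros \<phi>(2) \<psi>(2))
    then show "?b \<longlonglongrightarrow> 0" by simp
  qed auto
  have "(\<lambda>n. rel_const * \<eta> + sint \<Omega> (\<lambda>x. (norm ((d\<phi> n x - d\<psi> n x) - W x))\<^sup>2)) \<longlonglongrightarrow> rel_const * \<eta> + 0"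
    by (intro tendsto_intros lim)
  then have "sint \<Omega> (\<lambda>x. (norm (W x))\<^sup>2) \<le> rel_const * \<eta> + 0"
    by (rule LIMSEQ_le_const) (use main in auto)
  then have "sqrt (sint \<Omega> (\<lambda>x. (norm (W x))\<^sup>2)) \<le> sqrt (rel_const * \<eta>)" by (intro real_sqrt_le_mono) simp
  also have "\<dots> = sqrt rel_const * eta Th N a b g uh" by (simp add: real_sqrt_mult eta_def \<eta>_def)
  finally show "sqrt (sint \<Omega> (\<lambda>x. (norm (Gu x - grad uh x))\<^sup>2)) \<le> sqrt (regular_mesh.rel_const (2 * \<sigma>)) * eta Th N a b g uh"
    unfolding W_def .
qed

end
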